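(* Consider any one of the three settings (A), (B), (C) described in the context, with its Fourier operator $f\mapsto\widehat f$ from functions on $D$ to functions on $E$. Let $\|\cdot\|_X$ be a left-admissible functional on functions on $E$, let $\|\cdot\|_Y$ be a right-admissible functional on functions on $D$, and let $0<\beta\le 1$. Then the following are equivalent: (i) there is a finite constant $C_1$ such that $$\big\||\widehat f|^\beta\big\|_X^{1/\beta}\le C_1\|f\|_Y\qquad\text{for every } f\in L^1(D);$$ (ii) there is a finite constant $C_2$ such that $$\big\||T(f)|^\beta\big\|_X^{1/\beta}\le C_2\|f\|_Y$$ for every $f\in L^1(D)+L^2(D)$ and every sublinear operator $T$ of joint strong type $(1,\infty;2,2)$. Moreover, the optimal (smallest) constants satisfy $C_1\approx_\beta C_2$, i.e. each is bounded by the other times a constant depending only on $\beta$ and the dimension $d$.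
   Context: Settings. (A) $D=E=\mathbb R^d$ with Lebesgue measure normalized so that the unit ball has measure $1$, and $\widehat f(\xi)=\int_{\mathbb R^d}f(x)e^{-2\pi i\langle x,\xi\rangle}dx$. (B) $D=\mathbb Z$ with counting measure, $E=[-\frac12,\frac12]$ (identified with the torus) with Lebesgue measure, and $\widehat f(x)=\sum_{n\in\mathbb Z}f(n)e^{2\pi i nx}$. (C) $D=[-\frac12,\frac12]$ (identified with the torus), $E=\mathbb Z$, and $\widehat f(n)=\int_{-1/2}^{1/2}f(x)e^{-2\pi i nx}dx$. In (B), (C) take $d=1$. All functions are measurable and complex valued; on $\mathbb Z$ "function" means sequence and "integral" means sum. Rearrangements. For $h$ on a measure space with measure $\mu$ let $h^*(t)=\inf\{\lambda\ge0:\mu(|h|>\lambda)\le t\}$, $t\geq 0$. The symmetric non-increasing rearrangement $h^\circ$ is the symmetric, non-increasing (in $|x|$) function equimeasurable with $|h|$: on $\mathbb R^d$, $h^\circ(x)=h^*(|x|^d)$; on $[-\frac12,\frac12]$, $h^\circ(x)=h^*(2|x|)$; on $\mathbb Z$, $h^\circ$ takes the values $h^*(0),h^*(1),h^*(2),\dots$ at the points $0,1,-1,2,-2,\dots$ respectively. Associate functional. For a functional $\|\cdot\|_X$ with values in $[0,\infty]$, write $f\in X$ if $\|f\|_X<\infty$, and set $\|f\|_{X'}=\sup\{\int|fg|:\|g\|_X\le1\}$ (a sum in the sequence case). $X''$ is the associate of $X'$. Left-admissible: (i) $\|F\|_X=\|F\|_{X''}$ for every $F\in X''$; (ii) $\|h^\circ\|_{X'}\le\|h\|_{X'}$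 for every $h\in X'$. Right-admissible: (i) $\|mG\|_Y\le\|G\|_Y\|m\|_\infty$ for all $G\in Y$, $m\in L^\infty$; (ii) $\|G^\circ\|_Y\le\|G\|_Y$ for all $G\in Y$. An operator $T$ defined on $L^1(D)+L^2(D)$ with values in measurable functions on $E$ is sublinear if $|T(f+g)|\le|T(f)|+|T(g)|$ and $|T(\lambda f)|=|\lambda||T(f)|$. It is of joint strong type $(1,\infty;2,2)$ if $\|T(f)\|_\infty\le K\|f\|_1$ for $f\in L^1$ and $\|T(f)\|_2\le K\|f\|_2$ for $f\in L^2$, where $K\ge1$ is a fixed constant depending only on $d$. *)

theory Defs
  imports "HOL-Analysis.Analysis" "HOL-Probability.Essential_Supremum"
begin

section \<open>Lebesgue spaces\<close>

definition ennreal_powr :: "ennreal \<Rightarrow> real \<Rightarrow> ennreal" where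
  "ennreal_powr x p = (if x = \<infinity> then \<infinity> else ennreal (enn2real x powr p))"
  \<comment> \<open>only used for \<open>p > 0\<close>\<close>

definition Lp_norm :: "'a measure \<Rightarrow> real \<Rightarrow> ('a \<Rightarrow> complex) \<Rightarrow> ennreal" where
  "Lp_norm M p f = ennreal_powr (\<integral>\<^sup>+x. ennreal (cmod (f x) powr p) \<partial>M) (1 / p)"

definition Linf_norm :: "'a measure \<Rightarrow> ('a \<Rightarrow> complex) \<Rightarrow> ennreal" where
  "Linf_norm M f = esssup M (\<lambda>x. ennreal (cmod (f x)))"

definition Lp_space :: "'a measure \<Rightarrow> real \<Rightarrow> ('a \<Rightarrow> complex) set" where
  "Lp_space M p = {f \<in> borel_measurable M. Lp_norm M p f < \<infinity>}"

definition L1_plus_L2 :: "'a measure \<Rightarrow> ('a \<Rightarrow> complex) set" where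
  "L1_plus_L2 M = {\<lambda>x. g x + h x | g h. g \<in> Lp_space M 1 \<and> h \<in> Lp_space M 2}"


section \<open>Rearrangements\<close>

definition decr_rearr :: "'a measure \<Rightarrow> ('a \<Rightarrow> complex) \<Rightarrow> real \<Rightarrow> ennreal" where
  "decr_rearr M h t =
     Inf {l. emeasure M {x \<in> space M. ennreal (cmod (h x)) > l} \<le> ennreal t}"

text \<open>
  The symmetric rearrangement is \<open>h\<degree> x = h\<^sup>* (\<rho> x)\<close>, where \<open>\<rho> x\<close> is \<open>\<bar>x\<bar>\<^sup>d\<close> on
  \<open>\<real>\<^sup>d\<close>, \<open>2 \<bar>x\<bar>\<close> on \<open>[-1/2, 1/2]\<close>, and the position of \<open>x\<close> in the enumeration
  \<open>0, 1, -1, 2, -2, \<dots>\<close> on \<open>\<int>\<close> (see \<open>int_rank\<close> below).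

  It is a complex-valued function equimeasurable with \<open>\<bar>h\<bar>\<close> only if \<open>h\<^sup>* t < \<infinity>\<close> for all
  \<open>t > 0\<close> (predicate \<open>rearrangeable\<close>); otherwise \<open>h\<degree>\<close> does not exist as a complex function.
  For a rearrangeable \<open>h\<close> the only point where \<open>enn2real\<close> may meet \<open>\<infinity>\<close> is the origin of
  \<open>\<real>\<^sup>d\<close> or of the torus, which is a null set. On \<open>\<int>\<close> the value \<open>h\<^sup>* 0\<close> is
  finite too, since an unbounded sequence has \<open>h\<^sup>* t = \<infinity>\<close> for all \<open>t\<close>.
\<close>

definition rearrangeable :: "'a measure \<Rightarrow> ('a \<Rightarrow> complex) \<Rightarrow> bool" where
  "rearrangeable M h \<longleftrightarrow> (\<forall>t>0. decr_rearr M h t < \<infinity>)"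

definition sym_rearr ::
    "'a measure \<Rightarrow> ('a \<Rightarrow> real) \<Rightarrow> ('a \<Rightarrow> complex) \<Rightarrow> 'a \<Rightarrow> complex" where
  "sym_rearr M \<rho> h x = complex_of_real (enn2real (decr_rearr M h (\<rho> x)))"

definition int_rank :: "int \<Rightarrow> real" where
  "int_rank n = (if n > 0 then 2 * real_of_int n - 1 else - 2 * real_of_int n)"


section \<open>Admissible functionals\<close>

text \<open>
  A functional is an arbitrary map \<open>('a \<Rightarrow> complex) \<Rightarrow> ennreal\<close>; only its values on measurable
  functions are ever used. Functionals on classes of a.e. equal functions are the special case of
  maps that are invariant under a.e. equality.
\<close>

definition associate ::
    "'a measure \<Rightarrow> (('a \<Rightarrow> complex) \<Rightarrow> ennreal) \<Rightarrow> ('a \<Rightarrow> complex) \<Rightarrow> ennreal" where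
  "associate M X f =
     (SUP g \<in> {g \<in> borel_measurable M. X g \<le> 1}. \<integral>\<^sup>+x. ennreal (cmod (f x * g x)) \<partial>M)"

definition left_admissible ::
    "'a measure \<Rightarrow> ('a \<Rightarrow> real) \<Rightarrow> (('a \<Rightarrow> complex) \<Rightarrow> ennreal) \<Rightarrow> bool" where
  "left_admissible M \<rho> X \<longleftrightarrow>
     (\<forall>F \<in> borel_measurable M. associate M (associate M X) F < \<infinity> \<longrightarrow>
        X F = associate M (associate M X) F) \<and>
     (\<forall>h \<in> borel_measurable M. rearrangeable M h \<longrightarrow> associate M X h < \<infinity> \<longrightarrow>
        associate M X (sym_rearr M \<rho> h) \<le> associate M X h)"

definition right_admissible ::
    "'a measure \<Rightarrow> ('a \<Rightarrow> real) \<Rightarrow> (('a \<Rightarrow> complex) \<Rightarrow> ennreal) \<Rightarrow> bool" where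
  "right_admissible M \<rho> Y \<longleftrightarrow>
     (\<forall>G \<in> borel_measurable M. \<forall>m \<in> borel_measurable M.
        Y G < \<infinity> \<longrightarrow> Linf_norm M m < \<infinity> \<longrightarrow> Y (\<lambda>x. m x * G x) \<le> Y G * Linf_norm M m) \<and>
     (\<forall>G \<in> borel_measurable M. rearrangeable M G \<longrightarrow> Y G < \<infinity> \<longrightarrow> Y (sym_rearr M \<rho> G) \<le> Y G)"


section \<open>Operators\<close>

definition sublinear_operator ::
    "'a measure \<Rightarrow> 'b measure \<Rightarrow> (('a \<Rightarrow> complex) \<Rightarrow> ('b \<Rightarrow> complex)) \<Rightarrow> bool" where
  "sublinear_operator D E T \<longleftrightarrow>
     (\<forall>f \<in> L1_plus_L2 D. T f \<in> borel_measurable E) \<and>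
     (\<forall>f \<in> L1_plus_L2 D. \<forall>g \<in> L1_plus_L2 D.
        AE y in E. cmod (T (\<lambda>x. f x + g x) y) \<le> cmod (T f y) + cmod (T g y)) \<and>
     (\<forall>f \<in> L1_plus_L2 D. \<forall>c :: complex.
        AE y in E. cmod (T (\<lambda>x. c * f x) y) = cmod c * cmod (T f y))"

definition joint_strong_type ::
    "'a measure \<Rightarrow> 'b measure \<Rightarrow> real \<Rightarrow> (('a \<Rightarrow> complex) \<Rightarrow> ('b \<Rightarrow> complex)) \<Rightarrow> bool" where
  "joint_strong_type D E K T \<longleftrightarrow>
     (\<forall>f \<in> Lp_space D 1. Linf_norm E (T f) \<le> ennreal K * Lp_norm D 1 f) \<and>
     (\<forall>f \<in> Lp_space D 2. Lp_norm E 2 (T f) \<le> ennreal K * Lp_norm D 2 f)"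

text \<open>
  \<open>power_norm X \<beta> F\<close> is \<open>\<parallel> \<bar>F\<bar>\<^sup>\<beta> \<parallel>\<^bsub>X\<^esub>\<^bsup>1/\<beta>\<^esup>\<close>. In the two bounds below the product
  \<open>C * Y f\<close> with \<open>C = 0\<close> and \<open>Y f = \<infinity>\<close> is \<open>0\<close>; this affects neither the existence of
  a finite constant nor the infimum of the constants, because any \<open>C > 0\<close> makes the bound trivial for
  such \<open>f\<close>.
\<close>

definition power_norm ::
    "(('b \<Rightarrow> complex) \<Rightarrow> ennreal) \<Rightarrow> real \<Rightarrow> ('b \<Rightarrow> complex) \<Rightarrow> ennreal" where
  "power_norm X \<beta> F = ennreal_powr (X (\<lambda>y. complex_of_real (cmod (F y) powr \<beta>))) (1 / \<beta>)"

definition fourier_bound ::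
    "'a measure \<Rightarrow> (('a \<Rightarrow> complex) \<Rightarrow> ('b \<Rightarrow> complex)) \<Rightarrow> (('b \<Rightarrow> complex) \<Rightarrow> ennreal) \<Rightarrow>
     (('a \<Rightarrow> complex) \<Rightarrow> ennreal) \<Rightarrow> real \<Rightarrow> ennreal \<Rightarrow> bool" where
  "fourier_bound D \<F> X Y \<beta> C \<longleftrightarrow> (\<forall>f \<in> Lp_space D 1. power_norm X \<beta> (\<F> f) \<le> C * Y f)"

definition operator_bound ::
    "'a measure \<Rightarrow> 'b measure \<Rightarrow> real \<Rightarrow> (('b \<Rightarrow> complex) \<Rightarrow> ennreal) \<Rightarrow>
     (('a \<Rightarrow> complex) \<Rightarrow> ennreal) \<Rightarrow> real \<Rightarrow> ennreal \<Rightarrow> bool" where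
  "operator_bound D E K X Y \<beta> C \<longleftrightarrow>
     (\<forall>f \<in> L1_plus_L2 D. \<forall>T. sublinear_operator D E T \<longrightarrow> joint_strong_type D E K T \<longrightarrow>
        power_norm X \<beta> (T f) \<le> C * Y f)"


section \<open>The three settings\<close>

definition Rd_measure :: "'a::euclidean_space measure" where
  "Rd_measure = scale_measure (inverse (emeasure lebesgue (ball (0::'a) 1))) lebesgue"

definition torus_measure :: "real measure" where
  "torus_measure = lebesgue_on {-1/2..1/2}"

abbreviation int_measure :: "int measure" where
  "int_measure \<equiv> count_space UNIV"

definition Rd_radius :: "'a::euclidean_space \<Rightarrow> real" where
  "Rd_radius x = norm x ^ DIM('a)"

definition torus_radius :: "real \<Rightarrow> real" where
  "torus_radius x = 2 * \<bar>x\<bar>"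

definition Rd_fourier :: "('a::euclidean_space \<Rightarrow> complex) \<Rightarrow> 'a \<Rightarrow> complex" where
  "Rd_fourier f \<xi> = (\<integral>x. f x * cis (- 2 * pi * (x \<bullet> \<xi>)) \<partial>Rd_measure)"

definition int_fourier :: "(int \<Rightarrow> complex) \<Rightarrow> real \<Rightarrow> complex" where
  "int_fourier f x = (\<Sum>\<^sub>\<infinity>n\<in>UNIV. f n * cis (2 * pi * real_of_int n * x))"

definition torus_fourier :: "(real \<Rightarrow> complex) \<Rightarrow> int \<Rightarrow> complex" where
  "torus_fourier f n = (\<integral>x. f x * cis (- 2 * pi * real_of_int n * x) \<partial>torus_measure)"

end

theory Submission
  imports Defs "HOL-Probability.Characteristic_Functions"
begin

text \<open>
  Suppose that the Fourier transform is bounded in the sense of (i), and let \<open>g\<close> be integrable with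
  \<open>\<bar>g\<bar> \<le> f\<degree>\<close>. Right-admissibility bounds the functional at \<open>g\<close> by its
  value at \<open>f\<close>, so the transform of every such \<open>g\<close> is bounded with the same constant.
  Testing against \<open>h\<degree>\<close>, which lies in the unit ball of the associate space whenever
  \<open>h\<close> does, gives \<open>\<integral> \<bar>FT g\<bar>\<^sup>\<beta> h\<degree> \<le> N\<close> for all
  \<open>\<bar>g\<bar> \<le> f\<degree>\<close> (\<open>fourier_bound_pairing\<close>). The wanted bound for an
  operator \<open>T\<close> is, by duality, \<open>\<integral> \<bar>T f\<bar>\<^sup>\<beta> \<bar>h\<bar> \<lesssim>
  N\<close>. So (i) \<open>\<Longrightarrow>\<close> (ii) becomes a statement about one pair \<open>(f, h)\<close>,
  which is \<open>operator_power_integral\<close>.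

  For the operator, put \<open>a k = f\<^sup>* (2\<^sup>k)\<close>, and let \<open>S m\<close> be the set where
  \<open>\<bar>h\<bar>\<close> exceeds \<open>h\<^sup>* (2\<^sup>-\<^sup>m)\<close>, which has measure at most
  \<open>2\<^sup>-\<^sup>m\<close>. Splitting \<open>f\<close> at the height \<open>a m\<close>, and using the bound
  of \<open>T\<close> on \<open>L\<^sup>1\<close> for the large part and on \<open>L\<^sup>2\<close> for the small
  part, yields (\<open>operator_energy\<close>) \<open>\<integral>\<^bsub>S m\<^esub> \<bar>T f\<bar>\<^sup>2
  \<lesssim> 2\<^sup>-\<^sup>m (\<A> m)\<^sup>2 + \<Gamma> m\<close>, where \<open>\<A> m\<close> is the sum of
  \<open>(a k - a (k + 1)) 2\<^sup>k\<close> over \<open>k \<le> m\<close> and \<open>\<Gamma> m\<close> the sum of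
  \<open>F k = ((a k)\<^sup>2 - (a (k + 1))\<^sup>2) 2\<^sup>k\<close> over \<open>k \<ge> m\<close>.

  The matching lower bounds for \<open>N\<close> come from two kinds of test functions. The head sums \<open>\<A>
  m\<close> are seen by a superposition of bumps with nonnegative transforms, since no cancellation occurs among them
  (\<open>head_bound\<close>). The tail sums \<open>\<Gamma> m\<close> are a square function effect. The hypothesis on
  single functions \<open>\<bar>g\<bar> \<le> f\<degree>\<close> improves itself to families with \<open>\<Sum>
  \<bar>g\<^sub>i\<bar>\<^sup>2 \<le> (f\<degree>)\<^sup>2\<close>, for which it controls \<open>(\<Sum> \<bar>FT
  g\<^sub>i\<bar>\<^sup>2)\<^sup>\<beta>\<^sup>/\<^sup>2\<close> (\<open>square_function_bound\<close>). Indeed a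
  random signed sum of the family is bounded by a multiple of \<open>f\<degree>\<close> except for a part with small
  fourth moment, and the exceptional parts form a family of the same kind with a small constant, which is absorbed.
  Applied to modulated bumps, this shows that the energies \<open>F j\<close> may be distributed at will over the
  frequency shells \<open>i \<le> j\<close>, and each distribution gives a valid lower bound
  (\<open>tail_bound\<close>).

  The energy of \<open>T f\<close> on a layer \<open>S i - S (i + 1)\<close> is either dominated by
  \<open>2\<^sup>-\<^sup>i (\<A> i)\<^sup>2\<close>, and then the head sums suffice, or it is not. In the second case
  the inequality for \<open>S m\<close> can be absorbed: the tail sums over the layers of the second kind are at most
  a multiple of \<open>\<Gamma> m\<close>. This is exactly the condition under which their energies are a
  redistribution of the energies \<open>F j\<close> (\<open>transport_exists\<close>, \<open>tail_sums_bound\<close>).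
  Hoelder's inequality on every layer finishes the proof.

  For the converse, the Fourier integral of a function in \<open>L\<^sup>1 + L\<^sup>2\<close> need not converge, so
  the transform is approximated by operators of joint strong type (partial sums on \<open>\<int>\<close>, transforms
  of restrictions to balls with a Gaussian weight on \<open>\<real>\<^sup>d\<close>), and Fatou's lemma is applied to
  the dual bounds.

  All of this is carried out for the locale \<open>fourier_setting\<close>, which records what the three settings have
  in common; the later sections verify its assumptions. The bumps are autocorrelations of balls and of intervals of
  integers.
\<close>

section \<open>Random signs\<close>

text \<open>
  Expectations over independent signs are finite averages over the list of all sign vectors.
\<close>

fun sign_vectors :: "nat \<Rightarrow> real list list" where
  "sign_vectors 0 = [[]]"
| "sign_vectors (Suc n) = map ((#) 1) (sign_vectors n) @ map ((#) (- 1)) (sign_vectors n)"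

fun signed_sum :: "real list \<Rightarrow> complex list \<Rightarrow> complex" where
  "signed_sum (e # es) (z # zs) = complex_of_real e * z + signed_sum es zs"
| "signed_sum _ _ = 0"

definition square_sum :: "complex list \<Rightarrow> real" where
  "square_sum zs = (\<Sum>z\<leftarrow>zs. (cmod z)\<^sup>2)"

lemma square_sum_Nil [simp]: "square_sum [] = 0"
  and square_sum_Cons [simp]: "square_sum (z # zs) = (cmod z)\<^sup>2 + square_sum zs"
  by (simp_all add: square_sum_def)

lemma square_sum_nonneg: "0 \<le> square_sum zs"
  unfolding square_sum_def by (rule sum_list_nonneg) auto

lemma length_sign_vectors [simp]: "length (sign_vectors n) = 2 ^ n"
  by (induction n) simp_all

lemma cmod_add_diff_power4:
  fixes s z :: complex
  shows "cmod (s + z) ^ 4 + cmod (s - z) ^ 4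
    \<le> 2 * (cmod s ^ 4 + 6 * (cmod s)\<^sup>2 * (cmod z)\<^sup>2 + cmod z ^ 4)"
proof -
  define A where "A = (cmod s)\<^sup>2 + (cmod z)\<^sup>2"
  define r where "r = Re s * Re z + Im s * Im z"
  have p: "(cmod (s + z))\<^sup>2 = A + 2 * r" and m: "(cmod (s - z))\<^sup>2 = A - 2 * r"
    unfolding A_def r_def cmod_power2 by (simp_all add: power2_eq_square algebra_simps)
  have "r\<^sup>2 \<le> (cmod s)\<^sup>2 * (cmod z)\<^sup>2"
  proof -
    have "(cmod s)\<^sup>2 * (cmod z)\<^sup>2 - r\<^sup>2 = (Re s * Im z - Im s * Re z)\<^sup>2"
      unfolding cmod_power2 r_def by (simp add: power2_eq_square algebra_simps)
    then show ?thesis by (metis diff_ge_0_iff_ge zero_le_power2)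
  qed
  moreover have "cmod (s + z) ^ 4 + cmod (s - z) ^ 4 = 2 * A\<^sup>2 + 8 * r\<^sup>2"
  proof -
    have "cmod (s + z) ^ 4 = ((cmod (s + z))\<^sup>2)\<^sup>2" "cmod (s - z) ^ 4 = ((cmod (s - z))\<^sup>2)\<^sup>2"
      by (simp_all flip: power_mult)
    then show ?thesis unfolding p m by (simp add: power2_eq_square algebra_simps)
  qed
  moreover have "2 * A\<^sup>2 = 2 * (cmod s ^ 4 + 2 * (cmod s)\<^sup>2 * (cmod z)\<^sup>2 + cmod z ^ 4)"
    unfolding A_def by (simp add: power2_eq_square power4_eq_xxxx algebra_simps)
  ultimately show ?thesis by (simp add: algebra_simps)
qed

lemma cmod_add_diff_power2:
  fixes s z :: complex
  shows "(cmod (s + z))\<^sup>2 + (cmod (s - z))\<^sup>2 = 2 * ((cmod s)\<^sup>2 + (cmod z)\<^sup>2)"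
  unfolding cmod_power2 by (simp add: power2_eq_square algebra_simps)

lemma sum_list_sign_vectors_Suc:
  fixes \<Phi> :: "complex \<Rightarrow> real"
  shows "(\<Sum>es\<leftarrow>sign_vectors (Suc n). \<Phi> (signed_sum es (z # zs)))
   = (\<Sum>es\<leftarrow>sign_vectors n. \<Phi> (signed_sum es zs + z) + \<Phi> (signed_sum es zs - z))"
  by (simp add: comp_def sum_list_addf algebra_simps)

lemma second_moment_signs:
  "(\<Sum>es\<leftarrow>sign_vectors (length zs). (cmod (signed_sum es zs))\<^sup>2) = 2 ^ length zs * square_sum zs"
proof (induction zs)
  case Nil
  then show ?case by simp
next
  case (Cons z zs)
  show ?case
    unfolding length_Cons sum_list_sign_vectors_Suc[of "\<lambda>s. (cmod s)\<^sup>2"] cmod_add_diff_power2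
    using Cons by (simp add: sum_list_const_mult sum_list_addf sum_list_triv algebra_simps)
qed

text \<open>
  A further summand \<open>z\<close> contributes to the fourth moment of a signed sum \<open>s\<close> at most the
  mixed term \<open>6 \<bar>s\<bar>\<^sup>2 \<bar>z\<bar>\<^sup>2\<close>, whose mean is known from the second moment.
  The odd terms cancel between the two signs, and \<open>3\<close> is the fourth moment of a real Gaussian variable,
  the extremal case.
\<close>

lemma fourth_moment_signs:
  "(\<Sum>es\<leftarrow>sign_vectors (length zs). cmod (signed_sum es zs) ^ 4)
   \<le> 3 * 2 ^ length zs * (square_sum zs)\<^sup>2"
proof (induction zs)
  case Nil
  then show ?case by simp
next
  case (Cons z zs)
  let ?V = "sign_vectors (length zs)" and ?z = "(cmod z)\<^sup>2" and ?q = "square_sum zs"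
  have "(\<Sum>es\<leftarrow>sign_vectors (length (z # zs)). cmod (signed_sum es (z # zs)) ^ 4)
     = (\<Sum>es\<leftarrow>?V. cmod (signed_sum es zs + z) ^ 4 + cmod (signed_sum es zs - z) ^ 4)"
    unfolding length_Cons sum_list_sign_vectors_Suc[of "\<lambda>s. cmod s ^ 4"] ..
  also have "\<dots> \<le> (\<Sum>es\<leftarrow>?V. 2 * cmod (signed_sum es zs) ^ 4
       + 12 * ?z * (cmod (signed_sum es zs))\<^sup>2 + 2 * cmod z ^ 4)"
    by (intro sum_list_mono order.trans[OF cmod_add_diff_power4]) (simp add: algebra_simps)
  also have "\<dots> = 2 * (\<Sum>es\<leftarrow>?V. cmod (signed_sum es zs) ^ 4)
       + 12 * ?z * (2 ^ length zs * ?q) + 2 ^ length zs * (2 * cmod z ^ 4)"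
    by (simp add: sum_list_addf sum_list_const_mult sum_list_triv second_moment_signs)
  also have "\<dots> \<le> 2 * (3 * 2 ^ length zs * ?q\<^sup>2)
       + 12 * ?z * (2 ^ length zs * ?q) + 2 ^ length zs * (2 * cmod z ^ 4)"
    using Cons by (simp add: mult_ac)
  also have "\<dots> = 2 ^ length (z # zs) * (3 * ?q\<^sup>2 + 6 * ?z * ?q + cmod z ^ 4)"
    by (simp add: algebra_simps)
  also have "\<dots> \<le> 2 ^ length (z # zs) * (3 * (?z + ?q)\<^sup>2)"
    by (rule mult_left_mono) (simp_all add: power2_eq_square power4_eq_xxxx algebra_simps)
  finally show ?case by (simp add: mult_ac)
qed

text \<open>
  Below the threshold \<open>l\<close> the first summand suffices, above it the second. This additive form of
  Hoelder's inequality between moments can be summed without optimising first.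
\<close>

lemma square_le_interpolate:
  fixes x l \<beta> :: real
  assumes "0 \<le> x" "0 < l" "0 < \<beta>" "\<beta> \<le> 2"
  shows "x\<^sup>2 \<le> l powr (2 - \<beta>) * x powr \<beta> + x ^ 4 / l\<^sup>2"
proof (cases "x \<le> l")
  case True
  show ?thesis
  proof (cases "x = 0")
    case False
    then have "x\<^sup>2 = x powr (2 - \<beta>) * x powr \<beta>"
      using assms by (simp only: powr_add[symmetric]) simp
    also have "\<dots> \<le> l powr (2 - \<beta>) * x powr \<beta>"
      using True assms by (intro mult_right_mono powr_mono2) auto
    also have "\<dots> \<le> l powr (2 - \<beta>) * x powr \<beta> + x ^ 4 / l\<^sup>2" by simp
    finally show ?thesis .
  qed (use assms in auto)
next
  case False
  then have "x\<^sup>2 * l\<^sup>2 \<le> x\<^sup>2 * x\<^sup>2"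
    using assms by (intro mult_left_mono power_mono) auto
  then have "x\<^sup>2 \<le> x ^ 4 / l\<^sup>2"
    using assms by (simp add: field_simps flip: power_add)
  then show ?thesis by (simp add: add_increasing)
qed

text \<open>
  The second moment is interpolated between the moments of order \<open>\<beta>\<close> and \<open>4\<close>. With the
  threshold \<open>l\<^sup>2 = 6 q\<close>, where \<open>q\<close> is the square sum, the fourth moment accounts for
  at most half of the second, and the moment of order \<open>\<beta>\<close> must carry the other half.
\<close>

lemma khinchin_lower:
  fixes \<beta> :: real
  assumes "0 < \<beta>" "\<beta> \<le> 1"
  shows "2 ^ length zs * square_sum zs powr (\<beta> / 2)
    \<le> 12 * (\<Sum>es\<leftarrow>sign_vectors (length zs). cmod (signed_sum es zs) powr \<beta>)"
proof (cases "square_sum zs = 0")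
  case True
  then show ?thesis by (auto intro!: sum_list_nonneg)
next
  case False
  let ?V = "sign_vectors (length zs)"
  define q where "q = square_sum zs"
  define n :: real where "n = 2 ^ length zs"
  define M where "M = (\<Sum>es\<leftarrow>?V. cmod (signed_sum es zs) powr \<beta>)"
  have q: "q > 0" using False square_sum_nonneg[of zs] by (simp add: q_def)
  define l where "l = sqrt (6 * q)"
  have l: "l > 0" "l\<^sup>2 = 6 * q" using q by (auto simp: l_def)
  have "n * q = (\<Sum>es\<leftarrow>?V. (cmod (signed_sum es zs))\<^sup>2)"
    by (simp add: second_moment_signs n_def q_def)
  also have "\<dots> \<le> (\<Sum>es\<leftarrow>?V. l powr (2 - \<beta>) * cmod (signed_sum es zs) powr \<beta>
        + 1 / l\<^sup>2 * cmod (signed_sum es zs) ^ 4)"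
    using assms l by (intro sum_list_mono order.trans[OF square_le_interpolate[of _ l \<beta>]]) auto
  also have "\<dots> = l powr (2 - \<beta>) * M + 1 / l\<^sup>2 * (\<Sum>es\<leftarrow>?V. cmod (signed_sum es zs) ^ 4)"
    by (simp add: sum_list_addf sum_list_const_mult M_def divide_inverse)
  also have "\<dots> \<le> l powr (2 - \<beta>) * M + 1 / l\<^sup>2 * (3 * n * q\<^sup>2)"
    unfolding n_def q_def by (intro add_left_mono mult_left_mono fourth_moment_signs) auto
  also have "\<dots> = l powr (2 - \<beta>) * M + n * q / 2"
    using q unfolding l(2) by (simp add: power2_eq_square field_simps)
  finally have *: "n * q \<le> 2 * l powr (2 - \<beta>) * M" by simp
  have "l powr (2 - \<beta>) = (6 * q) powr (1 - \<beta> / 2)"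
    using q unfolding l_def by (simp add: powr_half_sqrt[symmetric] powr_powr diff_divide_distrib)
  also have "\<dots> = 6 powr (1 - \<beta> / 2) * q powr (1 - \<beta> / 2)"
    using q by (simp add: powr_mult)
  also have "\<dots> \<le> 6 powr 1 * q powr (1 - \<beta> / 2)"
    using assms by (intro mult_right_mono powr_mono) auto
  finally have "l powr (2 - \<beta>) \<le> 6 * q powr (1 - \<beta> / 2)" by simp
  moreover have M: "M \<ge> 0" unfolding M_def by (auto intro!: sum_list_nonneg)
  ultimately have "n * q \<le> 2 * (6 * q powr (1 - \<beta> / 2)) * M"
    by (intro order.trans[OF *] mult_right_mono) auto
  moreover have "q = q powr (\<beta> / 2) * q powr (1 - \<beta> / 2)"
    using q by (simp only: powr_add[symmetric]) simp
  ultimately have "(n * q powr (\<beta> / 2)) * q powr (1 - \<beta> / 2) \<le> (12 * M) * q powr (1 - \<beta> / 2)"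
    by (simp add: mult_ac)
  then show ?thesis using q by (simp add: n_def q_def M_def)
qed

lemma powr_add_subadditive:
  fixes a b \<beta> :: real
  assumes "0 \<le> a" "0 \<le> b" "0 < \<beta>" "\<beta> \<le> 1"
  shows "(a + b) powr \<beta> \<le> a powr \<beta> + b powr \<beta>"
proof (cases "a + b = 0")
  case False
  then have s: "a + b > 0" using assms by simp
  have *: "t * (a + b) powr \<beta> \<le> (t * (a + b)) powr \<beta>" if "0 \<le> t" "t \<le> 1" for t
  proof (cases "t = 0")
    case False
    then have "t powr 1 \<le> t powr \<beta>" using that assms by (intro powr_mono') auto
    then show ?thesis using that s by (simp add: powr_mult mult_right_mono)
  qed simp
  have "(a + b) powr \<beta> = a / (a + b) * (a + b) powr \<beta> + b / (a + b) * (a + b) powr \<beta>"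
    using s by (simp flip: distrib_right add_divide_distrib)
  also have "\<dots> \<le> (a / (a + b) * (a + b)) powr \<beta> + (b / (a + b) * (a + b)) powr \<beta>"
    using assms s by (intro add_mono *) auto
  finally show ?thesis using s by simp
qed (use assms in auto)

lemma powr_le_interpolate:
  fixes x l \<beta> :: real
  assumes "0 \<le> x" "0 < l" "0 < \<beta>" "\<beta> \<le> 2"
  shows "x powr \<beta> \<le> l powr \<beta> + l powr (\<beta> - 2) * x\<^sup>2"
proof (cases "x \<le> l")
  case True
  then have "x powr \<beta> \<le> l powr \<beta>" using assms by (intro powr_mono2) auto
  then show ?thesis by (simp add: add_increasing2)
next
  case False
  then have "x powr \<beta> = x powr (\<beta> - 2) * x powr 2"
    using assms by (simp only: powr_add[symmetric]) simp
  also have "\<dots> = x powr (\<beta> - 2) * x\<^sup>2" using False assms by simp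
  also have "\<dots> \<le> l powr (\<beta> - 2) * x\<^sup>2"
    using assms False by (intro mult_right_mono powr_mono2') auto
  finally show ?thesis by (simp add: add_increasing)
qed

text \<open>
  Jensen's inequality for the concave power \<open>\<beta> / 2\<close>, up to the factor \<open>2\<close>: interpolate
  at the height \<open>sqrt q\<close>, where \<open>q\<close> bounds the mean square.
\<close>

lemma powr_sum_list_le:
  fixes \<beta> q :: real
  assumes "0 < \<beta>" "\<beta> \<le> 2" and pos: "\<And>x. x \<in> set xs \<Longrightarrow> 0 \<le> x"
    and q: "(\<Sum>x\<leftarrow>xs. x\<^sup>2) \<le> length xs * q"
  shows "(\<Sum>x\<leftarrow>xs. x powr \<beta>) \<le> 2 * length xs * q powr (\<beta> / 2)"
proof (cases "xs = []")
  case False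
  define n where "n = real (length xs)"
  have n: "n > 0" using False by (simp add: n_def)
  have S: "0 \<le> (\<Sum>x\<leftarrow>xs. x\<^sup>2)" by (rule sum_list_nonneg) auto
  then have "0 \<le> n * q" using q unfolding n_def by (rule order.trans)
  then have q0: "q \<ge> 0" using n by (simp add: zero_le_mult_iff)
  show ?thesis
  proof (cases "q = 0")
    case True
    then have "(\<Sum>x\<leftarrow>xs. x\<^sup>2) = 0" using q S by simp
    then have "\<forall>x\<in>set xs. x\<^sup>2 = 0"
      by (subst (asm) sum_list_nonneg_eq_0_iff) auto
    then have "(\<Sum>x\<leftarrow>xs. x powr \<beta>) = (\<Sum>x\<leftarrow>xs. 0)"
      by (intro arg_cong[where f = sum_list] map_cong) auto
    then show ?thesis by simp
  next
    case False
    with q0 have q1: "q > 0" by simp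
    define l where "l = sqrt q"
    have l: "l > 0" using q1 by (simp add: l_def)
    have "(\<Sum>x\<leftarrow>xs. x powr \<beta>) \<le> (\<Sum>x\<leftarrow>xs. l powr \<beta> + l powr (\<beta> - 2) * x\<^sup>2)"
      using assms l by (intro sum_list_mono powr_le_interpolate) auto
    also have "\<dots> = n * l powr \<beta> + l powr (\<beta> - 2) * (\<Sum>x\<leftarrow>xs. x\<^sup>2)"
      by (simp add: sum_list_addf sum_list_const_mult sum_list_triv n_def)
    also have "\<dots> \<le> n * l powr \<beta> + l powr (\<beta> - 2) * (n * q)"
      using q by (intro add_left_mono mult_left_mono) (auto simp: n_def)
    also have "l powr (\<beta> - 2) * (n * q) = n * (l powr (\<beta> - 2) * l powr 2)"
      using l q1 by (simp add: l_def)
    also have "l powr (\<beta> - 2) * l powr 2 = l powr \<beta>" by (simp only: powr_add[symmetric]) simp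
    also have "l powr \<beta> = q powr (\<beta> / 2)"
      using q1 by (simp add: l_def powr_half_sqrt[symmetric] powr_powr)
    finally show ?thesis by (simp add: n_def)
  qed
qed simp

section \<open>Square functions of transforms with a unimodular kernel\<close>

lemma cmod_sum_list_mult_le:
  fixes p q :: "'c \<Rightarrow> complex"
  shows "cmod (\<Sum>t\<leftarrow>ts. p t * q t) \<le> sqrt (square_sum (map p ts)) * sqrt (square_sum (map q ts))"
proof -
  have *: "sqrt (square_sum (map r ts)) = L2_set (\<lambda>i. cmod (r (ts ! i))) {0..<length ts}"
    for r :: "'c \<Rightarrow> complex"
    by (simp add: square_sum_def L2_set_def sum_list_sum_nth comp_def)
  have "cmod (\<Sum>t\<leftarrow>ts. p t * q t) = cmod (\<Sum>i = 0..<length ts. p (ts ! i) * q (ts ! i))"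
    by (simp add: sum_list_sum_nth)
  also have "\<dots> \<le> (\<Sum>i = 0..<length ts. cmod (p (ts ! i) * q (ts ! i)))" by (rule norm_sum)
  also have "\<dots> = (\<Sum>i = 0..<length ts. \<bar>cmod (p (ts ! i))\<bar> * \<bar>cmod (q (ts ! i))\<bar>)"
    by (simp add: norm_mult)
  also have "\<dots> \<le> L2_set (\<lambda>i. cmod (p (ts ! i))) {0..<length ts} * L2_set (\<lambda>i. cmod (q (ts ! i))) {0..<length ts}"
    by (rule L2_set_mult_ineq)
  finally show ?thesis by (simp only: *)
qed

lemma square_sum_scale: "square_sum (map (\<lambda>t. complex_of_real c * p t) ts) = c\<^sup>2 * square_sum (map p ts)"
  by (induction ts) (simp_all add: norm_mult power_mult_distrib algebra_simps)

lemma nn_integral_sum_list_le: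
  assumes "\<And>t. t \<in> set ts \<Longrightarrow> (\<lambda>x. \<phi> t x) \<in> borel_measurable M"
    and "\<And>t x. t \<in> set ts \<Longrightarrow> 0 \<le> \<phi> t x"
    and "\<And>t. t \<in> set ts \<Longrightarrow> (\<integral>\<^sup>+x. ennreal (\<phi> t x) \<partial>M) \<le> B"
  shows "(\<integral>\<^sup>+x. ennreal (\<Sum>t\<leftarrow>ts. \<phi> t x) \<partial>M) \<le> of_nat (length ts) * B"
  using assms
proof (induction ts)
  case Nil
  then show ?case by simp
next
  case (Cons t ts)
  have m: "(\<lambda>x. \<Sum>t\<leftarrow>ts. \<phi> t x) \<in> borel_measurable M"
    unfolding sum_list_sum_nth using Cons.prems(1) by auto
  have nn: "0 \<le> (\<Sum>t\<leftarrow>ts. \<phi> t x)" for x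
    using Cons.prems(2) by (intro sum_list_nonneg) auto
  have "(\<integral>\<^sup>+x. ennreal (\<Sum>t\<leftarrow>t # ts. \<phi> t x) \<partial>M)
      = (\<integral>\<^sup>+x. ennreal (\<phi> t x) + ennreal (\<Sum>t\<leftarrow>ts. \<phi> t x) \<partial>M)"
    using nn Cons.prems(2) by (intro nn_integral_cong) (auto simp: ennreal_plus)
  also have "\<dots> = (\<integral>\<^sup>+x. ennreal (\<phi> t x) \<partial>M) + (\<integral>\<^sup>+x. ennreal (\<Sum>t\<leftarrow>ts. \<phi> t x) \<partial>M)"
    using Cons.prems(1) m by (intro nn_integral_add) auto
  also have "\<dots> \<le> B + of_nat (length ts) * B"
    using Cons by (intro add_mono) auto
  finally show ?case by (simp add: algebra_simps)
qed

lemma ennreal_le_linear_combination: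
  assumes "a \<le> c * x + d * y" "0 \<le> c" "0 \<le> d" "0 \<le> x" "0 \<le> y"
  shows "ennreal a \<le> ennreal c * ennreal x + ennreal d * ennreal y"
proof -
  have "ennreal a \<le> ennreal (c * x + d * y)" by (rule ennreal_leI) fact
  also have "\<dots> = ennreal c * ennreal x + ennreal d * ennreal y"
    using assms by (simp add: ennreal_plus ennreal_mult)
  finally show ?thesis .
qed

lemma integrable_sum_list:
  fixes p :: "'c \<Rightarrow> 'a \<Rightarrow> complex"
  shows "(\<And>t. t \<in> set ts \<Longrightarrow> integrable M (p t)) \<Longrightarrow> integrable M (\<lambda>x. \<Sum>t\<leftarrow>ts. p t x)"
  by (induction ts) auto

lemma square_sum_measurable [measurable]:
  "(\<And>g. g \<in> set gs \<Longrightarrow> g \<in> borel_measurable M) \<Longrightarrow> (\<lambda>x. square_sum (map (\<lambda>g. g x) gs)) \<in> borel_measurable M"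
  by (induction gs) auto

text \<open>
  The transform is assumed to be measurable because the reason for this differs: in two of the settings it is
  continuous, in the third the range of the variable is discrete.
\<close>

locale fourier_kernel =
  fixes D :: "'a measure" and E :: "'b measure" and e :: "'a \<Rightarrow> 'b \<Rightarrow> complex"
  assumes kernel_measurable [measurable]: "\<And>\<xi>. (\<lambda>x. e x \<xi>) \<in> borel_measurable D"
    and kernel_unimodular: "\<And>x \<xi>. cmod (e x \<xi>) = 1"
    and transform_measurable: "\<And>f. integrable D f \<Longrightarrow> (\<lambda>\<xi>. \<integral>x. f x * e x \<xi> \<partial>D) \<in> borel_measurable E"
begin

definition FT :: "('a \<Rightarrow> complex) \<Rightarrow> 'b \<Rightarrow> complex" where
  "FT f \<xi> = (\<integral>x. f x * e x \<xi> \<partial>D)"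

lemma FT_measurable [measurable]: "integrable D f \<Longrightarrow> FT f \<in> borel_measurable E"
  using transform_measurable[of f] by (simp add: FT_def[abs_def])

lemma integrable_mult_kernel: "integrable D f \<Longrightarrow> integrable D (\<lambda>x. f x * e x \<xi>)"
  by (rule Bochner_Integration.integrable_bound[of D f]) (auto simp: norm_mult kernel_unimodular)

lemma FT_zero [simp]: "FT (\<lambda>x. 0) \<xi> = 0"
  by (simp add: FT_def)

lemma FT_add: "integrable D f \<Longrightarrow> integrable D g \<Longrightarrow> FT (\<lambda>x. f x + g x) \<xi> = FT f \<xi> + FT g \<xi>"
  by (simp add: FT_def distrib_right integrable_mult_kernel)

lemma FT_diff: "integrable D f \<Longrightarrow> integrable D g \<Longrightarrow> FT (\<lambda>x. f x - g x) \<xi> = FT f \<xi> - FT g \<xi>"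
  by (simp add: FT_def left_diff_distrib integrable_mult_kernel)

lemma FT_scale: "FT (\<lambda>x. c * f x) \<xi> = c * FT f \<xi>"
  by (simp add: FT_def mult.assoc)

lemma FT_cong_AE:
  assumes "AE x in D. f x = g x" "f \<in> borel_measurable D" "g \<in> borel_measurable D"
  shows "FT f \<xi> = FT g \<xi>"
  unfolding FT_def using assms by (intro integral_cong_AE) auto

lemma cmod_FT_le: "cmod (FT f \<xi>) \<le> (\<integral>x. cmod (f x) \<partial>D)"
proof -
  have "cmod (FT f \<xi>) \<le> (\<integral>x. cmod (f x * e x \<xi>) \<partial>D)"
    unfolding FT_def by (rule integral_norm_bound)
  then show ?thesis by (simp add: norm_mult kernel_unimodular)
qed

lemma FT_sum_list:
  "(\<And>t. t \<in> set ts \<Longrightarrow> integrable D (p t)) \<Longrightarrow>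
    FT (\<lambda>x. \<Sum>t\<leftarrow>ts. c t * p t x) \<xi> = (\<Sum>t\<leftarrow>ts. c t * FT (p t) \<xi>)"
proof (induction ts)
  case (Cons t ts)
  have "integrable D (\<lambda>x. \<Sum>t\<leftarrow>ts. c t * p t x)"
    using Cons.prems by (intro integrable_sum_list) auto
  with Cons show ?case by (simp add: FT_add FT_scale)
qed simp

lemma FT_weighted_sum: "finite K \<Longrightarrow> (\<And>k. k \<in> K \<Longrightarrow> integrable D (p k)) \<Longrightarrow>
    FT (\<lambda>x. \<Sum>k\<in>K. complex_of_real (r k) * p k x) \<xi> = (\<Sum>k\<in>K. complex_of_real (r k) * FT (p k) \<xi>)"
  by (induction K rule: finite_induct) (simp_all add: FT_add FT_scale)

lemma integrable_signed_sum:
  "(\<And>g. g \<in> set gs \<Longrightarrow> integrable D g) \<Longrightarrow> integrable D (\<lambda>x. signed_sum es (map (\<lambda>g. g x) gs))"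
proof (induction gs arbitrary: es)
  case (Cons g gs)
  then show ?case by (cases es) auto
qed simp

lemma FT_signed_sum:
  "(\<And>g. g \<in> set gs \<Longrightarrow> integrable D g) \<Longrightarrow>
    FT (\<lambda>x. signed_sum es (map (\<lambda>g. g x) gs)) \<xi> = signed_sum es (map (\<lambda>g. FT g \<xi>) gs)"
proof (induction gs arbitrary: es)
  case (Cons g gs)
  then show ?case
    by (cases es) (auto simp: FT_add FT_scale integrable_signed_sum)
qed simp

lemma square_sum_FT_measurable:
  "(\<And>g. g \<in> set gs \<Longrightarrow> integrable D g) \<Longrightarrow> (\<lambda>x. square_sum (map (\<lambda>g. FT g x) gs)) \<in> borel_measurable E"
  by (induction gs) auto

text \<open>
  Minkowski's inequality for the \<open>\<ell>\<^sup>2\<close>-valued transform, by pairing the transforms with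
  themselves. It provides the a priori finiteness on which the absorption in the next lemma rests.
\<close>

lemma sqrt_square_sum_FT_le:
  assumes gs: "\<And>g. g \<in> set gs \<Longrightarrow> integrable D g"
    and fo: "integrable D fo" "\<And>x. x \<in> space D \<Longrightarrow> 0 \<le> fo x"
    and le: "\<And>x. x \<in> space D \<Longrightarrow> square_sum (map (\<lambda>g. g x) gs) \<le> (fo x)\<^sup>2"
  shows "sqrt (square_sum (map (\<lambda>g. FT g \<xi>) gs)) \<le> (\<integral>x. fo x \<partial>D)"
proof -
  define S where "S = square_sum (map (\<lambda>g. FT g \<xi>) gs)"
  have S: "S \<ge> 0" unfolding S_def by (rule square_sum_nonneg)
  let ?h = "\<lambda>x. \<Sum>g\<leftarrow>gs. cnj (FT g \<xi>) * g x"
  have int: "integrable D ?h" using gs by (intro integrable_sum_list) auto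
  have cnj_S: "square_sum (map (\<lambda>g. cnj (FT g \<xi>)) gs) = S"
    unfolding S_def by (simp add: square_sum_def comp_def)
  have "complex_of_real S = (\<Sum>g\<leftarrow>gs. cnj (FT g \<xi>) * FT g \<xi>)"
    unfolding S_def by (induction gs) (simp_all add: complex_norm_square[symmetric] mult.commute)
  also have "\<dots> = FT ?h \<xi>" using gs by (simp add: FT_sum_list)
  finally have "S = cmod (FT ?h \<xi>)" using S by (metis abs_of_nonneg norm_of_real)
  also have "\<dots> \<le> (\<integral>x. cmod (?h x) \<partial>D)" by (rule cmod_FT_le)
  also have "\<dots> \<le> (\<integral>x. sqrt S * fo x \<partial>D)"
  proof (rule integral_mono)
    fix x assume x: "x \<in> space D"
    have "cmod (?h x) \<le> sqrt S * sqrt (square_sum (map (\<lambda>g. g x) gs))"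
      using cmod_sum_list_mult_le[of "\<lambda>g. cnj (FT g \<xi>)" "\<lambda>g. g x" gs] by (simp only: cnj_S)
    also have "\<dots> \<le> sqrt S * fo x"
      using S fo(2)[OF x] le[OF x] by (intro mult_left_mono real_le_lsqrt) auto
    finally show "cmod (?h x) \<le> sqrt S * fo x" .
  qed (use int fo in auto)
  finally have "sqrt S * sqrt S \<le> sqrt S * (\<integral>x. fo x \<partial>D)" using S by simp
  moreover have "0 \<le> (\<integral>x. fo x \<partial>D)" using fo by (intro integral_nonneg_AE) auto
  ultimately have "sqrt S \<le> (\<integral>x. fo x \<partial>D)"
  proof (cases "S = 0")
    case False
    with S have "sqrt S > 0" by simp
    then show ?thesis using \<open>sqrt S * sqrt S \<le> _\<close> by (simp only: mult_le_cancel_left_pos)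
  qed simp
  then show ?thesis unfolding S_def .
qed

text \<open>
  An inequality of Grothendieck type. Let \<open>G\<close> be the best constant over all families with square sum at
  most \<open>fo\<^sup>2\<close>; it is finite. By Khinchin's inequality the square function of the transforms is
  controlled by an average over the signs of the transforms of signed sums \<open>R\<close>. The part \<open>T\<close>
  of \<open>R\<close> below \<open>L fo\<close> falls under the hypothesis. By the fourth moment bound, the remainders
  \<open>r\<close>, indexed by the signs and suitably scaled, form another family with square sum at most
  \<open>fo\<^sup>2\<close>, and their contribution is at most \<open>G / 2\<close> when \<open>L\<close> is large.
  Hence \<open>G \<le> 1152 N + G / 2\<close>.
\<close>

lemma square_function_bound_integrable:
  fixes \<beta> N :: real
  assumes \<beta>: "0 < \<beta>" "\<beta> \<le> 1" and N: "0 \<le> N"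
    and w [measurable]: "w \<in> borel_measurable E" and w_nn: "\<And>\<xi>. 0 \<le> w \<xi>"
    and w_fin: "(\<integral>\<^sup>+\<xi>. ennreal (w \<xi>) \<partial>E) < \<infinity>"
    and fo: "integrable D fo" "\<And>x. x \<in> space D \<Longrightarrow> 0 \<le> fo x"
    and H: "\<And>g. integrable D g \<Longrightarrow> (\<And>x. x \<in> space D \<Longrightarrow> cmod (g x) \<le> fo x) \<Longrightarrow>
        (\<integral>\<^sup>+\<xi>. ennreal (cmod (FT g \<xi>) powr \<beta> * w \<xi>) \<partial>E) \<le> ennreal N"
    and gs0: "\<And>g. g \<in> set gs0 \<Longrightarrow> integrable D g"
      "\<And>x. x \<in> space D \<Longrightarrow> square_sum (map (\<lambda>g. g x) gs0) \<le> (fo x)\<^sup>2"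
  shows "(\<integral>\<^sup>+\<xi>. ennreal (square_sum (map (\<lambda>g. FT g \<xi>) gs0) powr (\<beta> / 2) * w \<xi>) \<partial>E) \<le> ennreal (2304 * N)"
proof -
  define I where "I gs = (\<integral>\<^sup>+\<xi>. ennreal (square_sum (map (\<lambda>g. FT g \<xi>) gs) powr (\<beta> / 2) * w \<xi>) \<partial>E)" for gs
  define \<G> where "\<G> = {gs. (\<forall>g\<in>set gs. integrable D g) \<and>
      (\<forall>x\<in>space D. square_sum (map (\<lambda>g. g x) gs) \<le> (fo x)\<^sup>2)}"
  define G where "G = (SUP gs\<in>\<G>. I gs)"
  have fo_nn: "0 \<le> (\<integral>x. fo x \<partial>D)" using fo by (intro integral_nonneg_AE) auto
  have "G \<le> ennreal ((\<integral>x. fo x \<partial>D) powr \<beta>) * (\<integral>\<^sup>+\<xi>. ennreal (w \<xi>) \<partial>E)"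
    unfolding G_def
  proof (rule SUP_least)
    fix gs assume gs: "gs \<in> \<G>"
    have "square_sum (map (\<lambda>g. FT g \<xi>) gs) powr (\<beta> / 2) \<le> (\<integral>x. fo x \<partial>D) powr \<beta>" for \<xi>
    proof -
      have "sqrt (square_sum (map (\<lambda>g. FT g \<xi>) gs)) \<le> (\<integral>x. fo x \<partial>D)"
        using gs fo by (intro sqrt_square_sum_FT_le) (auto simp: \<G>_def)
      then have "sqrt (square_sum (map (\<lambda>g. FT g \<xi>) gs)) powr \<beta> \<le> (\<integral>x. fo x \<partial>D) powr \<beta>"
        using \<beta> by (intro powr_mono2) (auto simp: square_sum_nonneg)
      then show ?thesis
        by (simp add: square_sum_nonneg powr_half_sqrt[symmetric] powr_powr)
    qed
    then have "I gs \<le> (\<integral>\<^sup>+\<xi>. ennreal ((\<integral>x. fo x \<partial>D) powr \<beta>) * ennreal (w \<xi>) \<partial>E)"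
      unfolding I_def using w_nn
      by (intro nn_integral_mono) (auto simp flip: ennreal_mult intro!: ennreal_leI mult_right_mono)
    then show "I gs \<le> ennreal ((\<integral>x. fo x \<partial>D) powr \<beta>) * (\<integral>\<^sup>+\<xi>. ennreal (w \<xi>) \<partial>E)"
      by (simp add: nn_integral_cmult)
  qed
  also have "\<dots> < \<infinity>" using w_fin by (simp add: ennreal_mult_less_top)
  finally have G_fin: "G < \<infinity>" .

  \<comment> \<open>The remainders will enter with the factor \<open>12 * 2 * (3 /
    L\<^sup>2)\<^sup>\<beta>\<^sup>/\<^sup>2\<close>, in which \<open>12\<close> comes from Khinchin's and
    \<open>2\<close> from Jensen's inequality; this choice makes it \<open>1 / 2\<close>.\<close>
  define L where "L = sqrt 3 * 48 powr (1 / \<beta>)"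
  have L: "L > 0" by (simp add: L_def)
  have L_powr: "L powr \<beta> = 3 powr (\<beta> / 2) * 48"
    using \<beta> by (simp add: L_def powr_mult powr_powr powr_half_sqrt[symmetric])
  have "3 powr (\<beta> / 2) \<le> (4 :: real) powr (1 / 2)"
    using \<beta> by (intro order.trans[OF powr_mono powr_mono2]) auto
  then have L_le: "L powr \<beta> \<le> 96" unfolding L_powr by (simp add: powr_half_sqrt)

  have step: "I gs \<le> ennreal (1152 * N) + ennreal (1 / 2) * G" if gs: "gs \<in> \<G>" for gs
  proof -
    define n where "n = length gs"
    define V where "V = sign_vectors n"
    define R where "R es x = signed_sum es (map (\<lambda>g. g x) gs)" for es x
    define T where "T es x = (if cmod (R es x) \<le> L * fo x then R es x else 0)" for es x
    define r where "r es x = R es x - T es x" for es x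
    \<comment> \<open>The square sum of the remainders over all signs is at most \<open>3 * 2\<^sup>n * fo\<^sup>2 /
      L\<^sup>2\<close>.\<close>
    define c where "c = L / (sqrt 3 * sqrt (2 ^ n))"
    have c: "c > 0" "c\<^sup>2 * (3 * 2 ^ n) = L\<^sup>2"
      using L by (auto simp: c_def power_divide power_mult_distrib)
    have int: "integrable D g" if "g \<in> set gs" for g using gs that by (auto simp: \<G>_def)
    have R_int [simp]: "integrable D (R es)" for es
      unfolding R_def[abs_def] by (intro integrable_signed_sum int)
    have [measurable]: "R es \<in> borel_measurable D" "fo \<in> borel_measurable D" for es
      by (rule borel_measurable_integrable[OF R_int], rule borel_measurable_integrable[OF fo(1)])
    have [measurable]: "T es \<in> borel_measurable D" for es
      unfolding T_def[abs_def] by measurable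
    have T_int [simp]: "integrable D (T es)" for es
      by (rule Bochner_Integration.integrable_bound[OF R_int[of es]]) (auto simp: T_def)
    have [measurable]: "FT (T es) \<in> borel_measurable E" for es
      by (rule FT_measurable) (rule T_int)
    have r_int [simp]: "integrable D (r es)" for es
      unfolding r_def[abs_def] by auto
    have FT_R: "FT (R es) \<xi> = signed_sum es (map (\<lambda>g. FT g \<xi>) gs)" for es \<xi>
      unfolding R_def[abs_def] by (rule FT_signed_sum) (rule int)
    have FT_split: "FT (R es) \<xi> = FT (T es) \<xi> + FT (r es) \<xi>" for es \<xi>
      by (simp add: r_def[abs_def] FT_diff)
    define rs where "rs = map (\<lambda>es x. complex_of_real c * r es x) V"
    \<comment> \<open>The remainders form again a family of the same kind.\<close>
    have rs: "rs \<in> \<G>"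
      unfolding \<G>_def
    proof (intro CollectI conjI ballI)
      fix g assume "g \<in> set rs" then show "integrable D g" by (auto simp: rs_def)
    next
      fix x assume x: "x \<in> space D"
      define q where "q = square_sum (map (\<lambda>g. g x) gs)"
      have q: "q \<le> (fo x)\<^sup>2" "q \<ge> 0" using gs x by (auto simp: \<G>_def q_def square_sum_nonneg)
      have "square_sum (map (\<lambda>g. g x) rs) = c\<^sup>2 * square_sum (map (\<lambda>es. r es x) V)"
        by (simp add: rs_def comp_def square_sum_scale)
      also have "\<dots> \<le> (fo x)\<^sup>2"
      proof (cases "fo x = 0")
        case True
        then have "q = 0" using q by simp
        moreover have "signed_sum es zs = 0" if "square_sum zs = 0" for es zs
          using that
        proof (induction es zs rule: signed_sum.induct)
          case (1 e es z zs)
          then show ?case using square_sum_nonneg[of zs] by (simp add: add_nonneg_eq_0_iff)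
        qed auto
        ultimately have "r es x = 0" for es
          by (simp add: r_def T_def R_def q_def)
        then show ?thesis by (simp add: square_sum_def comp_def sum_list_triv)
      next
        case False
        then have f: "fo x > 0" using fo(2)[OF x] by simp
        have "square_sum (map (\<lambda>es. r es x) V) = (\<Sum>es\<leftarrow>V. (cmod (r es x))\<^sup>2)"
          by (simp add: square_sum_def comp_def)
        also have "\<dots> \<le> (\<Sum>es\<leftarrow>V. 1 / (L * fo x)\<^sup>2 * cmod (R es x) ^ 4)"
        proof (rule sum_list_mono)
          fix es
          show "(cmod (r es x))\<^sup>2 \<le> 1 / (L * fo x)\<^sup>2 * cmod (R es x) ^ 4"
          proof (cases "cmod (R es x) \<le> L * fo x")
            case True
            then show ?thesis by (simp add: r_def T_def)
          next
            case False
            then have "(cmod (R es x))\<^sup>2 * (L * fo x)\<^sup>2 \<le> (cmod (R es x))\<^sup>2 * (cmod (R es x))\<^sup>2"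
              using f L by (intro mult_left_mono power_mono) auto
            then show ?thesis using f L False
              by (simp add: r_def T_def field_simps flip: power_add)
          qed
        qed
        also have "\<dots> = 1 / (L * fo x)\<^sup>2 * (\<Sum>es\<leftarrow>V. cmod (R es x) ^ 4)"
          by (rule sum_list_const_mult)
        also have "\<dots> \<le> 1 / (L * fo x)\<^sup>2 * (3 * 2 ^ n * q\<^sup>2)"
          using fourth_moment_signs[of "map (\<lambda>g. g x) gs"]
          by (intro mult_left_mono) (auto simp: V_def n_def R_def q_def)
        also have "\<dots> \<le> 1 / (L * fo x)\<^sup>2 * (3 * 2 ^ n * ((fo x)\<^sup>2)\<^sup>2)"
          using q by (intro mult_left_mono power_mono) auto
        also have "\<dots> = 3 * 2 ^ n * (fo x)\<^sup>2 / L\<^sup>2"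
          using f L by (simp add: field_simps power2_eq_square)
        finally have "c\<^sup>2 * square_sum (map (\<lambda>es. r es x) V) \<le> c\<^sup>2 * (3 * 2 ^ n * (fo x)\<^sup>2 / L\<^sup>2)"
          by (rule mult_left_mono) simp
        also have "\<dots> = (c\<^sup>2 * (3 * 2 ^ n)) * (fo x)\<^sup>2 / L\<^sup>2" by simp
        also have "\<dots> = (fo x)\<^sup>2" unfolding c(2) using L by simp
        finally show ?thesis .
      qed
      finally show "square_sum (map (\<lambda>g. g x) rs) \<le> (fo x)\<^sup>2" .
    qed
    \<comment> \<open>The hypothesis applies to \<open>T / L\<close>, at the cost of the factor \<open>L powr \<beta> \<le> 96\<close>.\<close>
    have T_bound: "(\<integral>\<^sup>+\<xi>. ennreal (cmod (FT (T es) \<xi>) powr \<beta> * w \<xi>) \<partial>E) \<le> ennreal (96 * N)" for es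
    proof -
      have "(\<integral>\<^sup>+\<xi>. ennreal (cmod (FT (\<lambda>x. complex_of_real (1 / L) * T es x) \<xi>) powr \<beta> * w \<xi>) \<partial>E) \<le> ennreal N"
      proof (rule H)
        show "integrable D (\<lambda>x. complex_of_real (1 / L) * T es x)"
          by (rule integrable_mult_right) (rule T_int)
        show "cmod (complex_of_real (1 / L) * T es x) \<le> fo x" if "x \<in> space D" for x
          using L fo(2)[OF that] by (auto simp: T_def norm_divide norm_mult field_simps)
      qed
      then have "ennreal (L powr \<beta>) * (\<integral>\<^sup>+\<xi>. ennreal (cmod (FT (\<lambda>x. complex_of_real (1 / L) * T es x) \<xi>) powr \<beta> * w \<xi>) \<partial>E)
         \<le> ennreal 96 * ennreal N"
        by (intro mult_mono ennreal_leI L_le) auto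
      also have "ennreal (L powr \<beta>) * (\<integral>\<^sup>+\<xi>. ennreal (cmod (FT (\<lambda>x. complex_of_real (1 / L) * T es x) \<xi>) powr \<beta> * w \<xi>) \<partial>E)
        = (\<integral>\<^sup>+\<xi>. ennreal (L powr \<beta>) * ennreal (cmod (FT (\<lambda>x. complex_of_real (1 / L) * T es x) \<xi>) powr \<beta> * w \<xi>) \<partial>E)"
        unfolding FT_scale by (rule nn_integral_cmult[symmetric]) measurable
      also have "\<dots> = (\<integral>\<^sup>+\<xi>. ennreal (cmod (FT (T es) \<xi>) powr \<beta> * w \<xi>) \<partial>E)"
      proof (intro nn_integral_cong)
        fix \<xi>
        have "L powr \<beta> * (cmod (FT (\<lambda>x. complex_of_real (1 / L) * T es x) \<xi>) powr \<beta> * w \<xi>)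
          = cmod (FT (T es) \<xi>) powr \<beta> * w \<xi>"
          using L unfolding FT_scale by (simp add: norm_mult norm_divide powr_divide)
        then show "ennreal (L powr \<beta>) * ennreal (cmod (FT (\<lambda>x. complex_of_real (1 / L) * T es x) \<xi>) powr \<beta> * w \<xi>)
           = ennreal (cmod (FT (T es) \<xi>) powr \<beta> * w \<xi>)"
          using w_nn by (simp flip: ennreal_mult)
      qed
      finally show ?thesis using N by (simp add: ennreal_mult)
    qed
    have lenV: "length V = 2 ^ n" by (simp add: V_def)
    have pointwise: "square_sum (map (\<lambda>g. FT g \<xi>) gs) powr (\<beta> / 2)
       \<le> 12 / 2 ^ n * (\<Sum>es\<leftarrow>V. cmod (FT (T es) \<xi>) powr \<beta>)
         + 1 / 2 * square_sum (map (\<lambda>g. FT g \<xi>) rs) powr (\<beta> / 2)" for \<xi>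
    proof -
      have "2 ^ n * square_sum (map (\<lambda>g. FT g \<xi>) gs) powr (\<beta> / 2)
         \<le> 12 * (\<Sum>es\<leftarrow>V. cmod (FT (R es) \<xi>) powr \<beta>)"
        using khinchin_lower[OF \<beta>, of "map (\<lambda>g. FT g \<xi>) gs"] by (simp add: V_def n_def FT_R)
      also have "(\<Sum>es\<leftarrow>V. cmod (FT (R es) \<xi>) powr \<beta>)
         \<le> (\<Sum>es\<leftarrow>V. cmod (FT (T es) \<xi>) powr \<beta> + cmod (FT (r es) \<xi>) powr \<beta>)"
      proof (rule sum_list_mono)
        fix es
        have "cmod (FT (R es) \<xi>) powr \<beta> \<le> (cmod (FT (T es) \<xi>) + cmod (FT (r es) \<xi>)) powr \<beta>"
          unfolding FT_split using \<beta> by (intro powr_mono2 norm_triangle_ineq) auto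
        also have "\<dots> \<le> cmod (FT (T es) \<xi>) powr \<beta> + cmod (FT (r es) \<xi>) powr \<beta>"
          using \<beta> by (intro powr_add_subadditive) auto
        finally show "cmod (FT (R es) \<xi>) powr \<beta> \<le> cmod (FT (T es) \<xi>) powr \<beta> + cmod (FT (r es) \<xi>) powr \<beta>" .
      qed
      also have "\<dots> = (\<Sum>es\<leftarrow>V. cmod (FT (T es) \<xi>) powr \<beta>) + (\<Sum>es\<leftarrow>V. cmod (FT (r es) \<xi>) powr \<beta>)"
        by (rule sum_list_addf)
      also have "(\<Sum>es\<leftarrow>V. cmod (FT (r es) \<xi>) powr \<beta>)
         \<le> 2 * 2 ^ n * ((\<Sum>es\<leftarrow>V. (cmod (FT (r es) \<xi>))\<^sup>2) / 2 ^ n) powr (\<beta> / 2)"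
      proof -
        have "(\<Sum>x\<leftarrow>map (\<lambda>es. cmod (FT (r es) \<xi>)) V. x powr \<beta>)
          \<le> real (2 * length (map (\<lambda>es. cmod (FT (r es) \<xi>)) V))
             * ((\<Sum>es\<leftarrow>V. (cmod (FT (r es) \<xi>))\<^sup>2) / 2 ^ n) powr (\<beta> / 2)"
          using \<beta> by (intro powr_sum_list_le) (auto simp: comp_def lenV)
        then show ?thesis by (simp add: comp_def lenV)
      qed
      also have "(\<Sum>es\<leftarrow>V. (cmod (FT (r es) \<xi>))\<^sup>2) / 2 ^ n
         = 3 / L\<^sup>2 * square_sum (map (\<lambda>g. FT g \<xi>) rs)"
      proof -
        have "square_sum (map (\<lambda>g. FT g \<xi>) rs) = c\<^sup>2 * (\<Sum>es\<leftarrow>V. (cmod (FT (r es) \<xi>))\<^sup>2)"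
          using square_sum_scale[of c "\<lambda>es. FT (r es) \<xi>" V]
          by (simp add: rs_def comp_def FT_scale square_sum_def)
        then show ?thesis unfolding c(2)[symmetric] using c(1) by (simp add: field_simps)
      qed
      also have "(3 / L\<^sup>2 * square_sum (map (\<lambda>g. FT g \<xi>) rs)) powr (\<beta> / 2)
         = 1 / 48 * square_sum (map (\<lambda>g. FT g \<xi>) rs) powr (\<beta> / 2)"
      proof -
        have "(3 / L\<^sup>2) powr (\<beta> / 2) = 3 powr (\<beta> / 2) / L powr \<beta>"
          using L by (simp add: powr_divide powr_powr flip: powr_numeral)
        then have "(3 / L\<^sup>2) powr (\<beta> / 2) = 1 / 48" by (simp add: L_powr)
        moreover have "(3 / L\<^sup>2 * square_sum (map (\<lambda>g. FT g \<xi>) rs)) powr (\<beta> / 2)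
           = (3 / L\<^sup>2) powr (\<beta> / 2) * square_sum (map (\<lambda>g. FT g \<xi>) rs) powr (\<beta> / 2)"
          by (rule powr_mult)
        ultimately show ?thesis by simp
      qed
      finally have "2 ^ n * square_sum (map (\<lambda>g. FT g \<xi>) gs) powr (\<beta> / 2)
         \<le> 12 * ((\<Sum>es\<leftarrow>V. cmod (FT (T es) \<xi>) powr \<beta>)
             + 2 * 2 ^ n * (1 / 48 * square_sum (map (\<lambda>g. FT g \<xi>) rs) powr (\<beta> / 2)))" by simp
      then show ?thesis by (simp add: field_simps)
    qed
    have [measurable]: "(\<lambda>\<xi>. square_sum (map (\<lambda>g. FT g \<xi>) rs)) \<in> borel_measurable E"
      using rs by (intro square_sum_FT_measurable) (auto simp: \<G>_def)
    have [measurable]: "(\<lambda>\<xi>. \<Sum>es\<leftarrow>V. cmod (FT (T es) \<xi>) powr \<beta> * w \<xi>) \<in> borel_measurable E"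
      unfolding sum_list_sum_nth by simp
    have "I gs \<le> (\<integral>\<^sup>+\<xi>. ennreal (12 / 2 ^ n) * ennreal (\<Sum>es\<leftarrow>V. cmod (FT (T es) \<xi>) powr \<beta> * w \<xi>)
         + ennreal (1 / 2) * ennreal (square_sum (map (\<lambda>g. FT g \<xi>) rs) powr (\<beta> / 2) * w \<xi>) \<partial>E)"
      unfolding I_def
    proof (rule nn_integral_mono)
      fix \<xi>
      have nn: "0 \<le> (\<Sum>es\<leftarrow>V. cmod (FT (T es) \<xi>) powr \<beta> * w \<xi>)"
        using w_nn by (intro sum_list_nonneg) auto
      have "square_sum (map (\<lambda>g. FT g \<xi>) gs) powr (\<beta> / 2) * w \<xi>
        \<le> 12 / 2 ^ n * (\<Sum>es\<leftarrow>V. cmod (FT (T es) \<xi>) powr \<beta> * w \<xi>)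
         + 1 / 2 * (square_sum (map (\<lambda>g. FT g \<xi>) rs) powr (\<beta> / 2) * w \<xi>)"
        using mult_right_mono[OF pointwise[of \<xi>] w_nn[of \<xi>]]
        unfolding sum_list_mult_const by (simp only: distrib_right mult.assoc)
      then show "ennreal (square_sum (map (\<lambda>g. FT g \<xi>) gs) powr (\<beta> / 2) * w \<xi>)
         \<le> ennreal (12 / 2 ^ n) * ennreal (\<Sum>es\<leftarrow>V. cmod (FT (T es) \<xi>) powr \<beta> * w \<xi>)
         + ennreal (1 / 2) * ennreal (square_sum (map (\<lambda>g. FT g \<xi>) rs) powr (\<beta> / 2) * w \<xi>)"
        using w_nn nn by (intro ennreal_le_linear_combination) auto
    qed
    also have "\<dots> = ennreal (12 / 2 ^ n) * (\<integral>\<^sup>+\<xi>. ennreal (\<Sum>es\<leftarrow>V. cmod (FT (T es) \<xi>) powr \<beta> * w \<xi>) \<partial>E)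
         + ennreal (1 / 2) * I rs"
    proof -
      have m [measurable]: "(\<lambda>\<xi>. ennreal (\<Sum>es\<leftarrow>V. cmod (FT (T es) \<xi>) powr \<beta> * w \<xi>)) \<in> borel_measurable E"
        "(\<lambda>\<xi>. ennreal (square_sum (map (\<lambda>g. FT g \<xi>) rs) powr (\<beta> / 2) * w \<xi>)) \<in> borel_measurable E"
        by measurable
      show ?thesis
        unfolding I_def nn_integral_cmult[OF m(1), symmetric] nn_integral_cmult[OF m(2), symmetric]
        by (rule nn_integral_add) measurable
    qed
    also have "\<dots> \<le> ennreal (12 / 2 ^ n) * (of_nat (length V) * ennreal (96 * N)) + ennreal (1 / 2) * G"
    proof (intro add_mono mult_left_mono nn_integral_sum_list_le)
      show "I rs \<le> G" unfolding G_def using rs by (rule SUP_upper)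
    qed (use w_nn T_bound in \<open>auto\<close>)
    also have "ennreal (12 / 2 ^ n) * (of_nat (length V) * ennreal (96 * N)) = ennreal (1152 * N)"
      using N by (simp add: lenV ennreal_of_nat_eq_real_of_nat flip: ennreal_mult)
    finally show ?thesis .
  qed
  have "G \<le> ennreal (1152 * N) + ennreal (1 / 2) * G"
    unfolding G_def[of] by (rule SUP_least) (use step in \<open>simp add: G_def\<close>)
  moreover obtain g where g: "G = ennreal g" "0 \<le> g" using G_fin by (cases G) auto
  ultimately have "ennreal g \<le> ennreal (1152 * N + g / 2)"
    using ennreal_plus[of "1152 * N" "g / 2"] ennreal_mult[of "1 / 2" g] N by simp
  then have "g \<le> 1152 * N + g / 2" using N g by (subst (asm) ennreal_le_iff) auto
  then have "G \<le> ennreal (2304 * N)" unfolding g(1) by (intro ennreal_leI) simp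
  moreover have "I gs0 \<le> G" unfolding G_def using gs0 by (intro SUP_upper) (auto simp: \<G>_def)
  ultimately show ?thesis unfolding I_def by simp
qed

text \<open>
  The envelope may be replaced by the square root of the square sum itself, which is integrable.
\<close>

lemma square_function_bound:
  fixes \<beta> N :: real
  assumes \<beta>: "0 < \<beta>" "\<beta> \<le> 1" and N: "0 \<le> N"
    and w: "w \<in> borel_measurable E" "\<And>\<xi>. 0 \<le> w \<xi>" "(\<integral>\<^sup>+\<xi>. ennreal (w \<xi>) \<partial>E) < \<infinity>"
    and fo: "\<And>x. x \<in> space D \<Longrightarrow> 0 \<le> fo x"
    and H: "\<And>g. integrable D g \<Longrightarrow> (\<And>x. x \<in> space D \<Longrightarrow> cmod (g x) \<le> fo x) \<Longrightarrow>
        (\<integral>\<^sup>+\<xi>. ennreal (cmod (FT g \<xi>) powr \<beta> * w \<xi>) \<partial>E) \<le> ennreal N"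
    and gs: "\<And>g. g \<in> set gs \<Longrightarrow> integrable D g"
      "\<And>x. x \<in> space D \<Longrightarrow> square_sum (map (\<lambda>g. g x) gs) \<le> (fo x)\<^sup>2"
  shows "(\<integral>\<^sup>+\<xi>. ennreal (square_sum (map (\<lambda>g. FT g \<xi>) gs) powr (\<beta> / 2) * w \<xi>) \<partial>E) \<le> ennreal (2304 * N)"
proof -
  let ?fo = "\<lambda>x. sqrt (square_sum (map (\<lambda>g. g x) gs))"
  have int: "integrable D ?fo" using gs(1)
  proof (induction gs)
    case (Cons g gs)
    then have "integrable D (\<lambda>x. cmod (g x) + sqrt (square_sum (map (\<lambda>g. g x) gs)))"
      and [measurable]: "g \<in> borel_measurable D" "(\<lambda>x. square_sum (map (\<lambda>g. g x) gs)) \<in> borel_measurable D"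
      by (auto intro!: square_sum_measurable)
    from this(1) show ?case
    proof (rule Bochner_Integration.integrable_bound)
      show "AE x in D. norm (sqrt (square_sum (map (\<lambda>g. g x) (g # gs)))) \<le> norm (cmod (g x) + sqrt (square_sum (map (\<lambda>g. g x) gs)))"
      proof (rule AE_I2)
        fix x
        show "norm (sqrt (square_sum (map (\<lambda>g. g x) (g # gs)))) \<le> norm (cmod (g x) + sqrt (square_sum (map (\<lambda>g. g x) gs)))"
          using sqrt_add_le_add_sqrt[OF zero_le_power2 square_sum_nonneg, of "cmod (g x)" "map (\<lambda>g. g x) gs"]
          by (simp add: square_sum_nonneg)
      qed
    qed auto
  qed simp
  show ?thesis
  proof (rule square_function_bound_integrable[OF \<beta> N w int])
    fix g assume g: "integrable D g" "\<And>x. x \<in> space D \<Longrightarrow> cmod (g x) \<le> ?fo x"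
    then have "cmod (g x) \<le> fo x" if "x \<in> space D" for x
      using g(2)[OF that] gs(2)[OF that] fo[OF that] by (meson order.trans real_le_lsqrt)
    then show "(\<integral>\<^sup>+\<xi>. ennreal (cmod (FT g \<xi>) powr \<beta> * w \<xi>) \<partial>E) \<le> ennreal N"
      by (intro H g)
  qed (use gs in \<open>auto simp: square_sum_nonneg\<close>)
qed

end

section \<open>Dyadic levels of the decreasing rearrangement\<close>

definition dyad :: "int \<Rightarrow> real" where
  "dyad k = 2 powr real_of_int k"

lemma dyad_pos [simp]: "0 < dyad k" and dyad_nonneg [simp]: "0 \<le> dyad k"
  by (simp_all add: dyad_def)

lemma dyad_add: "dyad (i + j) = dyad i * dyad j"
  by (simp add: dyad_def powr_add)

lemma dyad_diff: "dyad (i - j) = dyad i / dyad j"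
  by (simp add: dyad_def powr_diff)

lemma dyad_minus: "dyad (- i) = inverse (dyad i)"
  by (simp add: dyad_def powr_minus)

lemma dyad_0 [simp]: "dyad 0 = 1" and dyad_1 [simp]: "dyad 1 = 2"
  and dyad_minus_1 [simp]: "dyad (- 1) = 1 / 2"
  by (simp_all add: dyad_def powr_minus)

lemma dyad_le_iff [simp]: "dyad i \<le> dyad j \<longleftrightarrow> i \<le> j"
  by (simp add: dyad_def)

lemma dyad_of_nat: "dyad (int n) = 2 ^ n"
  by (simp add: dyad_def powr_realpow)

lemma dyad_minus_nat: "dyad (- int n) = (1 / 2) ^ n"
  by (simp add: dyad_minus dyad_of_nat power_one_over inverse_eq_divide)

lemma ex_dyad_less: assumes "0 < r" shows "\<exists>n::nat. dyad (- int n) < r"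
  unfolding dyad_minus_nat using real_arch_pow_inv[of r "1 / 2"] assms by simp

lemma ex_dyad_ge: "\<exists>n::nat. r \<le> dyad (int n)"
  unfolding dyad_of_nat using real_arch_pow[of 2 r] by (auto intro: less_imp_le)

lemma decr_rearr_antimono: "s \<le> t \<Longrightarrow> decr_rearr M h t \<le> decr_rearr M h s"
  unfolding decr_rearr_def by (intro Inf_superset_mono) (auto intro: order.trans ennreal_leI)

lemma decr_rearr_le:
  "emeasure M {x \<in> space M. l < ennreal (cmod (h x))} \<le> ennreal t \<Longrightarrow> decr_rearr M h t \<le> l"
  unfolding decr_rearr_def by (intro Inf_lower) simp

lemma decr_rearr_le_of_bounded:
  assumes "\<And>x. x \<in> space M \<Longrightarrow> cmod (h x) \<le> B"
  shows "decr_rearr M h t \<le> ennreal B"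
proof (rule decr_rearr_le)
  have "{x \<in> space M. ennreal B < ennreal (cmod (h x))} = {}"
    using assms by (auto simp: not_less ennreal_leI)
  then show "emeasure M {x \<in> space M. ennreal B < ennreal (cmod (h x))} \<le> ennreal t" by (simp only:) simp
qed

text \<open>
  The infimum that defines the rearrangement is attained, by continuity of the measure from below along the heights
  \<open>d + 1 / (n + 1)\<close>.
\<close>

lemma emeasure_superlevel_decr_rearr:
  assumes [measurable]: "h \<in> borel_measurable M"
  shows "emeasure M {x \<in> space M. decr_rearr M h t < ennreal (cmod (h x))} \<le> ennreal t"
proof (cases "decr_rearr M h t = \<infinity>")
  case False
  then obtain d where d: "decr_rearr M h t = ennreal d" "0 \<le> d"
    by (cases "decr_rearr M h t") auto
  define A where "A n = {x \<in> space M. d + 1 / real (Suc n) < cmod (h x)}" for n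
  have A: "emeasure M (A n) \<le> ennreal t" for n
  proof -
    have "decr_rearr M h t < ennreal (d + 1 / real (Suc n))"
      unfolding d(1) using d(2) by (intro ennreal_lessI add_nonneg_pos) auto
    then obtain l where l: "emeasure M {x \<in> space M. l < ennreal (cmod (h x))} \<le> ennreal t"
      "l < ennreal (d + 1 / real (Suc n))"
      unfolding decr_rearr_def Inf_less_iff by auto
    have "l < ennreal y" if "d + 1 / real (Suc n) < y" for y
      using that by (intro less_le_trans[OF l(2)] ennreal_leI) simp
    then have "A n \<subseteq> {x \<in> space M. l < ennreal (cmod (h x))}" by (auto simp: A_def)
    then have "emeasure M (A n) \<le> emeasure M {x \<in> space M. l < ennreal (cmod (h x))}"
      by (intro emeasure_mono) auto
    then show ?thesis using l(1) by (rule order.trans)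
  qed
  have "{x \<in> space M. decr_rearr M h t < ennreal (cmod (h x))} = (\<Union>n. A n)"
  proof -
    have "\<exists>n. d + 1 / real (Suc n) < y" if "d < y" for y :: real
      using reals_Archimedean[of "y - d"] that by (auto simp: field_simps inverse_eq_divide)
    moreover have "d < y" if "d + 1 / real (Suc n) < y" for y :: real and n
      using that by (rule le_less_trans[rotated]) simp
    ultimately show ?thesis using d(2) unfolding d(1) A_def by (auto simp: ennreal_less_iff)
  qed
  also have "emeasure M \<dots> = (SUP n. emeasure M (A n))"
  proof (rule SUP_emeasure_incseq[symmetric])
    show "incseq A"
    proof (rule incseq_SucI)
      fix n
      have "1 / real (Suc (Suc n)) \<le> 1 / real (Suc n)" by (simp add: field_simps)
      then show "A n \<subseteq> A (Suc n)" unfolding A_def by (auto intro: le_less_trans)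
    qed
  qed (auto simp: A_def)
  also have "\<dots> \<le> ennreal t" by (intro SUP_least A)
  finally show ?thesis .
qed simp

text \<open>
  For a rearrangeable function the superlevel set of index \<open>k\<close> has measure at most
  \<open>2\<^sup>k\<close>, so the layers between consecutive ones behave like dyadic shells.
\<close>

definition level :: "'a measure \<Rightarrow> ('a \<Rightarrow> complex) \<Rightarrow> int \<Rightarrow> real" where
  "level M h k = enn2real (decr_rearr M h (dyad k))"

definition superlevel :: "'a measure \<Rightarrow> ('a \<Rightarrow> complex) \<Rightarrow> int \<Rightarrow> 'a set" where
  "superlevel M h k = {x \<in> space M. level M h k < cmod (h x)}"

lemma level_nonneg [simp]: "0 \<le> level M h k"
  by (simp add: level_def)

lemma ennreal_level: "rearrangeable M h \<Longrightarrow> ennreal (level M h k) = decr_rearr M h (dyad k)"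
  by (simp add: level_def rearrangeable_def)

lemma level_antimono: "rearrangeable M h \<Longrightarrow> j \<le> k \<Longrightarrow> level M h k \<le> level M h j"
  unfolding level_def rearrangeable_def by (intro enn2real_mono decr_rearr_antimono) auto

lemma superlevel_sets [measurable]: "h \<in> borel_measurable M \<Longrightarrow> superlevel M h k \<in> sets M"
  unfolding superlevel_def by measurable

lemma superlevel_mono: "rearrangeable M h \<Longrightarrow> j \<le> k \<Longrightarrow> superlevel M h j \<subseteq> superlevel M h k"
  unfolding superlevel_def by (auto dest: level_antimono intro: le_less_trans)

lemma emeasure_superlevel_le:
  assumes "h \<in> borel_measurable M" "rearrangeable M h"
  shows "emeasure M (superlevel M h k) \<le> ennreal (dyad k)"
proof -
  have "superlevel M h k = {x \<in> space M. decr_rearr M h (dyad k) < ennreal (cmod (h x))}"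
    unfolding superlevel_def ennreal_level[OF assms(2), symmetric]
    by (auto simp: ennreal_less_iff)
  then show ?thesis using emeasure_superlevel_decr_rearr[OF assms(1)] by simp
qed

text \<open>
  Since \<open>\<bar>h\<bar>\<close> is finite, going down in \<open>k\<close> one eventually leaves the superlevel
  sets, outside a set whose measure is below every power of two.
\<close>

lemma AE_not_in_all_superlevels:
  assumes h: "h \<in> borel_measurable M" "rearrangeable M h"
  shows "AE x in M. \<exists>n::nat. x \<notin> superlevel M h (m - int n)"
proof (rule AE_I)
  let ?N = "\<Inter>n::nat. superlevel M h (m - int n)"
  show "{x \<in> space M. \<not> (\<exists>n. x \<notin> superlevel M h (m - int n))} \<subseteq> ?N" by auto
  show N: "?N \<in> sets M" using h by (intro sets.countable_INT) auto
  have "emeasure M ?N \<le> ennreal r" if "0 < r" for r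
  proof -
    from that have "0 < r / dyad m" by simp
    then obtain n :: nat where n: "dyad (- int n) < r / dyad m" using ex_dyad_less by blast
    have "emeasure M ?N \<le> emeasure M (superlevel M h (m - int n))"
      using h by (intro emeasure_mono) auto
    also have "\<dots> \<le> ennreal (dyad (m - int n))" by (rule emeasure_superlevel_le[OF h])
    also have "\<dots> \<le> ennreal r"
      using n dyad_add[of m "- int n"] by (intro ennreal_leI) (simp add: field_simps)
    finally show ?thesis .
  qed
  then show "emeasure M ?N = 0"
    using ennreal_le_epsilon[of 0 "emeasure M ?N"] by simp
qed

text \<open>
  Finiteness of the measures of superlevel sets excludes functions such as the constants on an infinite space; it is
  what makes the levels tend to zero.
\<close>

lemma ex_level_le:
  assumes "0 < l" "emeasure M {x \<in> space M. l < cmod (h x)} < \<infinity>"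
  shows "\<exists>n::nat. \<forall>k\<ge>int n. level M h k \<le> l"
proof -
  obtain r where r: "emeasure M {x \<in> space M. l < cmod (h x)} = ennreal r" "0 \<le> r"
    using assms(2) by (cases "emeasure M {x \<in> space M. l < cmod (h x)}") auto
  obtain n :: nat where n: "r \<le> dyad (int n)" using ex_dyad_ge by blast
  have "level M h k \<le> l" if "int n \<le> k" for k
  proof -
    have "decr_rearr M h (dyad k) \<le> ennreal l"
    proof (rule decr_rearr_le)
      have "{x \<in> space M. ennreal l < ennreal (cmod (h x))} = {x \<in> space M. l < cmod (h x)}"
        using assms(1) by (auto simp: ennreal_less_iff)
      moreover have "r \<le> dyad k" using n that by (meson dyad_le_iff order.trans)
      ultimately show "emeasure M {x \<in> space M. ennreal l < ennreal (cmod (h x))} \<le> ennreal (dyad k)"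
        using r by (simp add: ennreal_leI)
    qed
    then show ?thesis unfolding level_def using assms(1) by (simp add: enn2real_leI)
  qed
  then show ?thesis by blast
qed

lemma ennreal_le_suminf: "f i \<le> (\<Sum>i. f i)" for f :: "nat \<Rightarrow> ennreal"
proof -
  have "sum f {i} \<le> (\<Sum>i. f i)" by (rule sum_le_suminf) auto
  then show ?thesis by simp
qed

text \<open>
  Decompose the set into the layers between consecutive superlevel sets: on the layer inside the set of index \<open>m
  - l\<close> and outside the one of index \<open>m - l - 1\<close> the function is at most the level of index
  \<open>m - l - 1\<close>.
\<close>

lemma nn_integral_superlevel_le:
  assumes f [measurable]: "f \<in> borel_measurable M" and r: "rearrangeable M f"
  shows "(\<integral>\<^sup>+x. ennreal (cmod (f x)) * indicator (superlevel M f m) x \<partial>M)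
    \<le> (\<Sum>l. ennreal (level M f (m - 1 - int l) * dyad (m - int l)))"
proof -
  let ?S = "superlevel M f" and ?a = "level M f"
  have "(\<integral>\<^sup>+x. ennreal (cmod (f x)) * indicator (?S m) x \<partial>M)
     \<le> (\<integral>\<^sup>+x. (\<Sum>l. ennreal (?a (m - 1 - int l)) * indicator (?S (m - int l)) x) \<partial>M)"
  proof (rule nn_integral_mono_AE)
    show "AE x in M. ennreal (cmod (f x)) * indicator (?S m) x
        \<le> (\<Sum>l. ennreal (?a (m - 1 - int l)) * indicator (?S (m - int l)) x)"
      using AE_not_in_all_superlevels[OF f r, of m]
    proof eventually_elim
      case (elim x)
      show ?case
      proof (cases "x \<in> ?S m")
        case True
        define n where "n = (LEAST n::nat. x \<notin> ?S (m - int n))"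
        have n: "x \<notin> ?S (m - int n)" unfolding n_def using elim by (rule LeastI_ex)
        with True obtain l where l: "n = Suc l" by (cases n) auto
        have "x \<in> ?S (m - int l)" using not_less_Least[of l "\<lambda>n. x \<notin> ?S (m - int n)"] l
          by (auto simp: n_def)
        moreover from this have "cmod (f x) \<le> ?a (m - 1 - int l)"
          using n True unfolding l superlevel_def by (simp add: algebra_simps)
        ultimately have "ennreal (cmod (f x)) * indicator (?S m) x
          \<le> ennreal (?a (m - 1 - int l)) * indicator (?S (m - int l)) x"
          using True by (simp add: ennreal_leI)
        also have "\<dots> \<le> (\<Sum>l. ennreal (?a (m - 1 - int l)) * indicator (?S (m - int l)) x)"
          by (rule ennreal_le_suminf)
        finally show ?thesis .
      qed simp
    qed
  qed
  also have "\<dots> = (\<Sum>l. \<integral>\<^sup>+x. ennreal (?a (m - 1 - int l)) * indicator (?S (m - int l)) x \<partial>M)"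
    by (rule nn_integral_suminf) measurable
  also have "\<dots> = (\<Sum>l. ennreal (?a (m - 1 - int l)) * emeasure M (?S (m - int l)))"
    by (simp add: nn_integral_cmult_indicator)
  also have "\<dots> \<le> (\<Sum>l. ennreal (?a (m - 1 - int l) * dyad (m - int l)))"
    by (intro suminf_le) (auto simp: ennreal_mult intro!: mult_left_mono emeasure_superlevel_le[OF f r])
  finally show ?thesis .
qed

text \<open>
  The same decomposition upwards. A point where \<open>f \<noteq> 0\<close> belongs to some superlevel set, because
  the levels tend to zero.
\<close>

lemma nn_integral_sublevel_le:
  assumes f [measurable]: "f \<in> borel_measurable M" and r: "rearrangeable M f"
    and fin: "\<And>l. 0 < l \<Longrightarrow> emeasure M {x \<in> space M. l < cmod (f x)} < \<infinity>"
  shows "(\<integral>\<^sup>+x. ennreal ((cmod (f x))\<^sup>2) * indicator (space M - superlevel M f m) x \<partial>M)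
    \<le> (\<Sum>l. ennreal ((level M f (m + int l))\<^sup>2 * dyad (m + int l + 1)))"
proof -
  let ?S = "superlevel M f" and ?a = "level M f"
  have "(\<integral>\<^sup>+x. ennreal ((cmod (f x))\<^sup>2) * indicator (space M - ?S m) x \<partial>M)
     \<le> (\<integral>\<^sup>+x. (\<Sum>l. ennreal ((?a (m + int l))\<^sup>2) * indicator (?S (m + int l + 1)) x) \<partial>M)"
  proof (rule nn_integral_mono)
    fix x assume x: "x \<in> space M"
    show "ennreal ((cmod (f x))\<^sup>2) * indicator (space M - ?S m) x
        \<le> (\<Sum>l. ennreal ((?a (m + int l))\<^sup>2) * indicator (?S (m + int l + 1)) x)"
    proof (cases "x \<in> ?S m \<or> f x = 0")
      case False
      then have pos: "0 < cmod (f x) / 2" by simp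
      obtain n0 :: nat where "\<forall>k\<ge>int n0. ?a k \<le> cmod (f x) / 2"
        using ex_level_le[OF pos fin[OF pos]] by auto
      then have "?a (m + int (nat (int n0 - m))) \<le> cmod (f x) / 2" by auto
      then have "?a (m + int (nat (int n0 - m))) < cmod (f x)" using pos by linarith
      then have ex: "\<exists>n::nat. x \<in> ?S (m + int n)"
        using x unfolding superlevel_def by blast
      define n where "n = (LEAST n::nat. x \<in> ?S (m + int n))"
      have n: "x \<in> ?S (m + int n)" unfolding n_def using ex by (rule LeastI_ex)
      with False obtain l where l: "n = Suc l" by (cases n) auto
      have "x \<notin> ?S (m + int l)" using not_less_Least[of l "\<lambda>n. x \<in> ?S (m + int n)"] l
        by (auto simp: n_def)
      then have "cmod (f x) \<le> ?a (m + int l)"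
        using x unfolding superlevel_def by simp
      then have "ennreal ((cmod (f x))\<^sup>2) * indicator (space M - ?S m) x
        \<le> ennreal ((?a (m + int l))\<^sup>2) * indicator (?S (m + int l + 1)) x"
        using n False x unfolding l by (auto simp: algebra_simps intro!: ennreal_leI power_mono)
      also have "\<dots> \<le> (\<Sum>l. ennreal ((?a (m + int l))\<^sup>2) * indicator (?S (m + int l + 1)) x)"
          by (rule ennreal_le_suminf)
      finally show ?thesis .
    qed auto
  qed
  also have "\<dots> = (\<Sum>l. \<integral>\<^sup>+x. ennreal ((?a (m + int l))\<^sup>2) * indicator (?S (m + int l + 1)) x \<partial>M)"
    by (rule nn_integral_suminf) measurable
  also have "\<dots> = (\<Sum>l. ennreal ((?a (m + int l))\<^sup>2) * emeasure M (?S (m + int l + 1)))"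
    by (simp add: nn_integral_cmult_indicator)
  also have "\<dots> \<le> (\<Sum>l. ennreal ((?a (m + int l))\<^sup>2 * dyad (m + int l + 1)))"
    by (intro suminf_le) (auto simp: ennreal_mult intro!: mult_left_mono emeasure_superlevel_le[OF f r])
  finally show ?thesis .
qed

lemma decr_rearr_nonpos: "t \<le> 0 \<Longrightarrow> decr_rearr M h t = decr_rearr M h 0"
  by (simp add: decr_rearr_def ennreal_neg)

lemma decr_rearr_measurable:
  assumes "rearrangeable M h"
  shows "(\<lambda>t. enn2real (decr_rearr M h t)) \<in> borel_measurable borel"
proof -
  let ?r = "\<lambda>t. - enn2real (decr_rearr M h t)"
  have "?r \<in> borel_measurable borel"
  \<comment> \<open>At \<open>t \<le> 0\<close> the rearrangement may be infinite, and \<open>enn2real\<close> then breaks the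
    monotonicity.\<close>
  proof (rule borel_measurable_piecewise_mono[of "{{0<..}, {..0}}"])
    show "mono_on c ?r" if "c \<in> {{0<..}, {..0}}" for c
      using that
    proof (elim insertE emptyE)
      assume "c = {0<..}"
      then show ?thesis using assms unfolding rearrangeable_def
        by (auto intro!: mono_onI enn2real_mono decr_rearr_antimono)
    next
      assume "c = {..0}"
      then have const: "?r t = ?r 0" if "t \<in> c" for t
        using that decr_rearr_nonpos[of t M h] by auto
      show ?thesis by (intro mono_onI eq_refl) (simp only: const)
    qed
  qed auto
  then have "(\<lambda>t. - ?r t) \<in> borel_measurable borel"
    by (rule borel_measurable_uminus)
  then show ?thesis by simp
qed

lemma sym_rearr_measurable:
  assumes "rearrangeable M' h" "\<rho> \<in> borel_measurable M"
  shows "(\<lambda>x. enn2real (decr_rearr M' h (\<rho> x))) \<in> borel_measurable M"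
  using measurable_compose[OF assms(2) decr_rearr_measurable[OF assms(1)]] .

text \<open>
  A scale at which the two levels \<open>k\<close> and \<open>k + 1\<close> of every function coincide: the whole
  space is too small (large scales on the torus), or all sets of positive measure are too large (small scales on
  \<open>\<int>\<close>). The layer between these levels is then empty, and no bump has to be provided for it.
\<close>

definition degenerate :: "'a measure \<Rightarrow> int \<Rightarrow> bool" where
  "degenerate M k \<longleftrightarrow> emeasure M (space M) \<le> ennreal (dyad k) \<or>
     (\<forall>S\<in>sets M. emeasure M S \<le> ennreal (dyad (k + 1)) \<longrightarrow> emeasure M S = 0)"

lemma level_eq_of_degenerate:
  assumes [measurable]: "h \<in> borel_measurable M" and "degenerate M k"
  shows "level M h k = level M h (k + 1)"
  using assms(2) unfolding degenerate_def
proof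
  assume *: "emeasure M (space M) \<le> ennreal (dyad k)"
  have "decr_rearr M h (dyad j) = 0" if "k \<le> j" for j
  proof -
    have "decr_rearr M h (dyad j) \<le> 0"
    proof (rule decr_rearr_le)
      have "emeasure M {x \<in> space M. 0 < ennreal (cmod (h x))} \<le> emeasure M (space M)"
        by (rule emeasure_space)
      also note *
      also have "ennreal (dyad k) \<le> ennreal (dyad j)" using that by (simp add: ennreal_leI)
      finally show "emeasure M {x \<in> space M. 0 < ennreal (cmod (h x))} \<le> ennreal (dyad j)" .
    qed
    then show ?thesis by simp
  qed
  then show ?thesis by (simp add: level_def)
next
  assume *: "\<forall>S\<in>sets M. emeasure M S \<le> ennreal (dyad (k + 1)) \<longrightarrow> emeasure M S = 0"
  have "emeasure M {x \<in> space M. l < ennreal (cmod (h x))} \<le> ennreal (dyad k)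
    \<longleftrightarrow> emeasure M {x \<in> space M. l < ennreal (cmod (h x))} \<le> ennreal (dyad (k + 1))" for l
  proof -
    have S: "{x \<in> space M. l < ennreal (cmod (h x))} \<in> sets M" by measurable
    have "ennreal (dyad k) \<le> ennreal (dyad (k + 1))" by (simp add: ennreal_leI)
    from order.trans[OF _ this] show ?thesis using bspec[OF * S] by auto
  qed
  then show ?thesis by (simp add: level_def decr_rearr_def)
qed

lemma degenerate_layer:
  assumes [measurable]: "h \<in> borel_measurable M" and r: "rearrangeable M h" and d: "degenerate M k"
  shows "level M h k = 0 \<or> emeasure M (superlevel M h (k + 1)) = 0"
  using d unfolding degenerate_def
proof
  assume *: "emeasure M (space M) \<le> ennreal (dyad k)"
  have "decr_rearr M h (dyad k) \<le> 0"
    by (rule decr_rearr_le, rule order.trans[OF emeasure_space *])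
  then show ?thesis by (simp add: level_def)
next
  assume "\<forall>S\<in>sets M. emeasure M S \<le> ennreal (dyad (k + 1)) \<longrightarrow> emeasure M S = 0"
  then show ?thesis using emeasure_superlevel_le[OF assms(1,2)] by auto
qed

lemma ennreal_powr_square: "ennreal_powr x (1 / 2) \<le> ennreal r \<Longrightarrow> 0 \<le> r \<Longrightarrow> x \<le> ennreal (r\<^sup>2)"
proof -
  assume *: "ennreal_powr x (1 / 2) \<le> ennreal r" "0 \<le> r"
  then obtain y where y: "x = ennreal y" "0 \<le> y"
    by (cases x) (auto simp: ennreal_powr_def top_unique)
  then have "sqrt y \<le> r" using * by (simp add: ennreal_powr_def powr_half_sqrt)
  then have "y \<le> r\<^sup>2" using y(2) *(2) by (simp add: real_sqrt_le_iff' sqrt_le_D)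
  then show ?thesis by (simp add: y ennreal_leI)
qed

section \<open>Settings and test functions\<close>

lemma sum_int_telescope:
  fixes p :: "int \<Rightarrow> real"
  assumes "lo \<le> hi + 1"
  shows "(\<Sum>k = lo..hi. p k - p (k + 1)) = p lo - p (hi + 1)"
proof -
  have *: "(\<Sum>k = lo..lo + int n - 1. p k - p (k + 1)) = p lo - p (lo + int n)" for n
  proof (induction n)
    case (Suc n)
    have "{lo..lo + int (Suc n) - 1} = insert (lo + int n) {lo..lo + int n - 1}" by auto
    with Suc show ?case by (simp add: algebra_simps)
  qed simp
  from *[of "nat (hi + 1 - lo)"] assms show ?thesis by simp
qed

text \<open>
  The sum telescopes to \<open>p m - p (hi + 1)\<close>, where \<open>m\<close> is the smallest index with
  \<open>\<rho> \<le> dyad m\<close>. This is how superpositions of bumps stay below a radially decreasing function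
  with dyadic values \<open>p\<close>.
\<close>

lemma layer_sum_le:
  fixes p :: "int \<Rightarrow> real"
  assumes mono: "\<And>j k. j \<le> k \<Longrightarrow> p k \<le> p j" and nn: "\<And>k. 0 \<le> p k"
    and y: "0 \<le> y" "\<And>k. \<rho> \<le> dyad k \<Longrightarrow> p k \<le> y"
  shows "(\<Sum>k = lo..hi. (p k - p (k + 1)) * (if \<rho> \<le> dyad k then 1 else 0)) \<le> y"
proof (cases "\<exists>k\<in>{lo..hi}. \<rho> \<le> dyad k")
  case False
  then have "(\<Sum>k = lo..hi. (p k - p (k + 1)) * (if \<rho> \<le> dyad k then 1 else 0)) = 0"
    by (intro sum.neutral) auto
  then show ?thesis using y by simp
next
  case True
  define m where "m = Min {k\<in>{lo..hi}. \<rho> \<le> dyad k}"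
  have fin: "finite {k\<in>{lo..hi}. \<rho> \<le> dyad k}" by (rule finite_subset[of _ "{lo..hi}"]) auto
  have "{k\<in>{lo..hi}. \<rho> \<le> dyad k} \<noteq> {}" using True by auto
  then have m: "m \<in> {lo..hi}" "\<rho> \<le> dyad m" using Min_in[OF fin] by (auto simp: m_def)
  have "\<rho> \<le> dyad k \<longleftrightarrow> m \<le> k" if "k \<in> {lo..hi}" for k
  proof
    assume "\<rho> \<le> dyad k"
    then show "m \<le> k" unfolding m_def using that fin by (intro Min_le) auto
  next
    assume "m \<le> k"
    then show "\<rho> \<le> dyad k" using m(2) by (meson dyad_le_iff order.trans)
  qed
  then have "(\<Sum>k = lo..hi. (p k - p (k + 1)) * (if \<rho> \<le> dyad k then 1 else 0))
     = (\<Sum>k = lo..hi. (if m \<le> k then p k - p (k + 1) else 0))"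
    by (intro sum.cong) auto
  also have "\<dots> = (\<Sum>k = m..hi. p k - p (k + 1))"
    using m(1) by (intro sum.mono_neutral_cong_right) auto
  also have "\<dots> = p m - p (hi + 1)" using m(1) by (intro sum_int_telescope) auto
  also have "\<dots> \<le> y" using y(2)[OF m(2)] nn[of "hi + 1"] by simp
  finally show ?thesis .
qed

lemma square_sum_append: "square_sum (xs @ ys) = square_sum xs + square_sum ys"
  by (simp add: square_sum_def)

lemma square_sum_concat_map:
  "square_sum (map F (concat (map L ps))) = (\<Sum>p\<leftarrow>ps. square_sum (map F (L p)))"
  by (induction ps) (simp_all add: square_sum_append)

lemma square_sum_ge_member: "z \<in> set zs \<Longrightarrow> (cmod z)\<^sup>2 \<le> square_sum zs"
proof (induction zs)
  case (Cons a zs)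
  then show ?case using square_sum_nonneg[of zs] by (auto simp: add_increasing)
qed simp

lemma square_sum_le_length: "(\<And>z. z \<in> set zs \<Longrightarrow> cmod z \<le> b) \<Longrightarrow> square_sum zs \<le> real (length zs) * b\<^sup>2"
proof (induction zs)
  case (Cons a zs)
  have "(cmod a)\<^sup>2 \<le> b\<^sup>2" using Cons.prems[of a] by (intro power_mono) auto
  with Cons show ?case by (simp add: algebra_simps)
qed simp

text \<open>
  The dyadic shells of the radial variable \<open>\<rho>\<close>. The points with \<open>\<rho> = 0\<close> are put
  into the shell of index \<open>0\<close>: on \<open>\<int>\<close> the origin has positive measure and no other
  point lies in that shell.
\<close>

definition shell :: "'b measure \<Rightarrow> ('b \<Rightarrow> real) \<Rightarrow> int \<Rightarrow> 'b set" where
  "shell M \<rho> i = {\<xi> \<in> space M. dyad (- i - 2) < \<rho> \<xi> \<and> \<rho> \<xi> \<le> dyad (- i - 1) \<or> i = 0 \<and> \<rho> \<xi> = 0}"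

lemma shell_space: "\<xi> \<in> shell M \<rho> i \<Longrightarrow> \<xi> \<in> space M"
  by (simp add: shell_def)

lemma shell_le: "\<xi> \<in> shell M \<rho> i \<Longrightarrow> \<rho> \<xi> \<le> dyad (- i - 1)"
  by (auto simp: shell_def)

lemma shell_disjoint:
  assumes "i \<noteq> j" shows "shell M \<rho> i \<inter> shell M \<rho> j = {}"
proof -
  have "False" if "\<xi> \<in> shell M \<rho> i" "\<xi> \<in> shell M \<rho> j" "i < j" for \<xi> i j
  proof -
    have "dyad (- j - 1) \<le> dyad (- i - 2)" using that(3) by simp
    moreover have "0 < dyad (- j - 2)" "0 < dyad (- i - 2)" by simp_all
    ultimately show False using that unfolding shell_def by (auto simp del: dyad_le_iff dyad_pos)
  qed
  from this[of _ i j] this[of _ j i] assms show ?thesis by (cases "i < j") auto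
qed

lemma shell_sets [measurable]:
  assumes [measurable]: "\<rho> \<in> borel_measurable M"
  shows "shell M \<rho> i \<in> sets M"
  unfolding shell_def by measurable

text \<open>
  What the three settings have in common. The radial variables \<open>\<rho>D\<close> and \<open>\<rho>E\<close> are
  normalised so that balls \<open>{\<rho> \<le> t}\<close> have measure comparable to \<open>t\<close> at all scales
  that are not degenerate. Assumption \<open>origin\<close> concerns the only points at which
  \<open>f\<degree>\<close> might be infinite: they form a null set, or else every set of positive measure is larger
  than \<open>1 / 2\<close>, and then \<open>f\<^sup>* 0 = f\<^sup>* (1 / 2)\<close>. Assumption \<open>bump\<close>
  says that the uncertainty principle is attained: there is a function of height at most one on the ball of measure
  \<open>2\<^sup>k\<close> with a nonnegative transform of size \<open>2\<^sup>k\<close> on the dual ball. By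
  \<open>cover\<close>, about \<open>2\<^bsup>j - i\<^esup>\<close> functions on the ball of measure
  \<open>2\<^sup>j\<close> suffice to have large transforms everywhere on the frequency ball of measure
  \<open>2\<^sup>-\<^sup>i\<close>.
\<close>

locale fourier_setting = fourier_kernel D E e
  for D :: "'a measure" and E :: "'b measure" and e :: "'a \<Rightarrow> 'b \<Rightarrow> complex" +
  fixes \<rho>D :: "'a \<Rightarrow> real" and \<rho>E :: "'b \<Rightarrow> real" and c C :: real
  assumes c_pos: "0 < c" and C_pos: "0 < C"
    and \<rho>D_measurable [measurable]: "\<rho>D \<in> borel_measurable D"
    and \<rho>E_measurable [measurable]: "\<rho>E \<in> borel_measurable E"
    and sigma_finite_E: "sigma_finite_measure E"
    and origin: "AE x in D. 0 < \<rho>D x \<or>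
      (\<forall>S\<in>sets D. emeasure D S \<le> ennreal (1 / 2) \<longrightarrow> emeasure D S = 0)"
    and ball_finite: "\<And>r. emeasure E {\<xi> \<in> space E. \<rho>E \<xi> \<le> r} < \<infinity>"
    and shell_large: "\<And>i. \<not> degenerate E (- i - 1) \<Longrightarrow> ennreal (c * dyad (- i)) \<le> emeasure E (shell E \<rho>E i)"
    and bump: "\<And>k. \<not> degenerate D k \<Longrightarrow>
      \<exists>\<psi>. integrable D \<psi> \<and> (\<forall>x\<in>space D. cmod (\<psi> x) \<le> (if \<rho>D x \<le> dyad k then 1 else 0)) \<and>
        (\<forall>\<xi>\<in>space E. 0 \<le> Re (FT \<psi> \<xi>) \<and> (\<rho>E \<xi> \<le> dyad (- k) \<longrightarrow> c * dyad k \<le> Re (FT \<psi> \<xi>)))"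
    and cover: "\<And>i j. \<not> degenerate D j \<Longrightarrow> i \<le> j \<Longrightarrow>
      \<exists>us. real (length us) \<le> C * dyad (j - i) \<and>
        (\<forall>u\<in>set us. integrable D u \<and> (\<forall>x\<in>space D. cmod (u x) \<le> (if \<rho>D x \<le> dyad j then 1 else 0))) \<and>
        (\<forall>\<xi>\<in>space E. \<rho>E \<xi> \<le> dyad (- i) \<longrightarrow> (\<exists>u\<in>set us. c * dyad j \<le> cmod (FT u \<xi>)))"

text \<open>
  A function on either side, with \<open>hyp\<close> as the trace that the bound for the Fourier transform leaves
  after the functionals have been eliminated by duality. That \<open>h\<close> is bounded and supported on a set of
  finite measure can be achieved by truncation.
\<close>

locale rearranged_pair = fourier_setting D E e \<rho>D \<rho>E c C
  for D :: "'a measure" and E :: "'b measure" and e and \<rho>D and \<rho>E and c C :: real +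
  fixes f :: "'a \<Rightarrow> complex" and h :: "'b \<Rightarrow> complex" and \<beta> N :: real
  assumes f_measurable [measurable]: "f \<in> borel_measurable D"
    and f_rearrangeable: "rearrangeable D f"
    and f_finite: "\<And>l. 0 < l \<Longrightarrow> emeasure D {x \<in> space D. l < cmod (f x)} < \<infinity>"
    and h_measurable [measurable]: "h \<in> borel_measurable E"
    and h_bounded: "\<exists>B. \<forall>\<xi>. cmod (h \<xi>) \<le> B"
    and h_support: "emeasure E {\<xi> \<in> space E. h \<xi> \<noteq> 0} < \<infinity>"
    and \<beta>: "0 < \<beta>" "\<beta> \<le> 1" and N_nonneg: "0 \<le> N"
    and hyp: "\<And>g. integrable D g \<Longrightarrow>
      (\<And>x. x \<in> space D \<Longrightarrow> cmod (g x) \<le> enn2real (decr_rearr D f (\<rho>D x))) \<Longrightarrow>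
      (\<integral>\<^sup>+\<xi>. ennreal (cmod (FT g \<xi>) powr \<beta> * enn2real (decr_rearr E h (\<rho>E \<xi>))) \<partial>E) \<le> ennreal N"
begin

text \<open>
  Here \<open>fo = f\<degree>\<close> and \<open>w = h\<degree>\<close>, while \<open>a k = f\<^sup>* (2\<^sup>k)\<close>. The number \<open>wt i = h\<^sup>* (2\<^bsup>-i-1\<^esup>)\<close> has two
  roles: it is a lower bound for \<open>w\<close> on the shell \<open>i\<close>, whose measure is \<open>v i\<close>, and an upper bound for \<open>\<bar>h\<bar>\<close> outside the
  superlevel set of index \<open>-i-1\<close>. The points that are not \<open>good\<close> are those where \<open>f\<degree>\<close> should be infinite and \<open>fo\<close>
  has the default value \<open>0\<close>; test functions are cut off there.
\<close>

definition fo :: "'a \<Rightarrow> real" where "fo x = enn2real (decr_rearr D f (\<rho>D x))"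
definition w :: "'b \<Rightarrow> real" where "w \<xi> = enn2real (decr_rearr E h (\<rho>E \<xi>))"
definition a :: "int \<Rightarrow> real" where "a k = level D f k"
definition wt :: "int \<Rightarrow> real" where "wt i = level E h (- i - 1)"
definition v :: "int \<Rightarrow> real" where "v i = measure E (shell E \<rho>E i)"
definition good :: "'a \<Rightarrow> bool" where "good x \<longleftrightarrow> 0 < \<rho>D x \<or> decr_rearr D f 0 < \<infinity>"

lemma fo_nonneg [simp]: "0 \<le> fo x" and w_nonneg [simp]: "0 \<le> w \<xi>"
  and a_nonneg [simp]: "0 \<le> a k" and wt_nonneg [simp]: "0 \<le> wt i" and v_nonneg [simp]: "0 \<le> v i"
  by (simp_all add: fo_def w_def a_def wt_def v_def)

lemma a_antimono: "j \<le> k \<Longrightarrow> a k \<le> a j"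
  unfolding a_def by (rule level_antimono[OF f_rearrangeable])

lemma a_diff_nonneg: "0 \<le> a k - a (k + 1)"
  using a_antimono[of k "k + 1"] by simp

lemma h_rearr_le: "\<exists>B\<ge>0. \<forall>t. decr_rearr E h t \<le> ennreal B"
proof -
  obtain B where B: "\<And>\<xi>. cmod (h \<xi>) \<le> B" using h_bounded by blast
  then have "0 \<le> B" using norm_ge_zero order.trans by blast
  moreover have "decr_rearr E h t \<le> ennreal B" for t using B by (intro decr_rearr_le_of_bounded)
  ultimately show ?thesis by blast
qed

lemma h_rearr_finite: "decr_rearr E h t < \<infinity>"
  using h_rearr_le by (metis ennreal_less_top infinity_ennreal_def le_less_trans)

lemma h_rearrangeable: "rearrangeable E h"
  unfolding rearrangeable_def using h_rearr_finite by blast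

lemma w_measurable [measurable]: "w \<in> borel_measurable E"
  unfolding w_def[abs_def] by (rule sym_rearr_measurable[OF h_rearrangeable \<rho>E_measurable])

lemma w_integrable: "(\<integral>\<^sup>+\<xi>. ennreal (w \<xi>) \<partial>E) < \<infinity>"
proof -
  obtain B where B: "0 \<le> B" "\<And>t. decr_rearr E h t \<le> ennreal B" using h_rearr_le by blast
  obtain r where r: "emeasure E {\<xi> \<in> space E. h \<xi> \<noteq> 0} = ennreal r" "0 \<le> r"
    using h_support by (cases "emeasure E {\<xi> \<in> space E. h \<xi> \<noteq> 0}") auto
  have "ennreal (w \<xi>) \<le> ennreal B * indicator {\<xi> \<in> space E. \<rho>E \<xi> \<le> r} \<xi>" if "\<xi> \<in> space E" for \<xi>
  proof (cases "\<rho>E \<xi> \<le> r")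
    case True
    then show ?thesis using that B unfolding w_def
      by (simp add: ennreal_leI enn2real_leI)
  next
    case False
    have "decr_rearr E h (\<rho>E \<xi>) \<le> 0"
    proof (rule decr_rearr_le)
      have "{\<xi> \<in> space E. 0 < ennreal (cmod (h \<xi>))} = {\<xi> \<in> space E. h \<xi> \<noteq> 0}" by auto
      then show "emeasure E {\<xi> \<in> space E. 0 < ennreal (cmod (h \<xi>))} \<le> ennreal (\<rho>E \<xi>)"
        using r False by (simp add: ennreal_leI)
    qed
    then show ?thesis by (simp add: w_def)
  qed
  then have "(\<integral>\<^sup>+\<xi>. ennreal (w \<xi>) \<partial>E) \<le> (\<integral>\<^sup>+\<xi>. ennreal B * indicator {\<xi> \<in> space E. \<rho>E \<xi> \<le> r} \<xi> \<partial>E)"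
    by (intro nn_integral_mono)
  also have "\<dots> = ennreal B * emeasure E {\<xi> \<in> space E. \<rho>E \<xi> \<le> r}"
    by (simp add: nn_integral_cmult_indicator)
  also have "\<dots> < \<infinity>" using ball_finite[of r] by (simp add: ennreal_mult_less_top)
  finally show ?thesis .
qed

lemma wt_le_w: "\<xi> \<in> shell E \<rho>E i \<Longrightarrow> wt i \<le> w \<xi>"
  unfolding wt_def level_def w_def
  using h_rearr_finite by (intro enn2real_mono decr_rearr_antimono shell_le) auto

lemma emeasure_shell: "emeasure E (shell E \<rho>E i) = ennreal (v i)"
proof -
  have "emeasure E (shell E \<rho>E i) \<le> emeasure E {\<xi> \<in> space E. \<rho>E \<xi> \<le> dyad (- i - 1)}"
    using shell_le[of _ E \<rho>E i] shell_space[of _ E \<rho>E i] by (intro emeasure_mono) (blast, measurable)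
  also have "\<dots> < \<infinity>" by (rule ball_finite)
  finally show ?thesis unfolding v_def by (intro emeasure_eq_ennreal_measure) auto
qed

lemma shell_sum_le:
  assumes I: "finite I" and q: "\<And>i. i \<in> I \<Longrightarrow> 0 \<le> q i"
    and Q: "\<And>i \<xi>. i \<in> I \<Longrightarrow> \<xi> \<in> shell E \<rho>E i \<Longrightarrow> q i \<le> Q \<xi>" "\<And>\<xi>. 0 \<le> Q \<xi>"
    and M: "(\<integral>\<^sup>+\<xi>. ennreal (Q \<xi> * w \<xi>) \<partial>E) \<le> ennreal M" "0 \<le> M"
  shows "(\<Sum>i\<in>I. wt i * v i * q i) \<le> M"
proof -
  have "ennreal (\<Sum>i\<in>I. wt i * v i * q i) = (\<Sum>i\<in>I. ennreal (wt i * v i * q i))"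
    using q by (intro sum_ennreal[symmetric]) auto
  also have "\<dots> = (\<Sum>i\<in>I. \<integral>\<^sup>+\<xi>. ennreal (wt i * q i) * indicator (shell E \<rho>E i) \<xi> \<partial>E)"
  proof (intro sum.cong refl)
    fix i assume "i \<in> I"
    then have "ennreal (wt i * v i * q i) = ennreal (wt i * q i) * ennreal (v i)"
      using q[of i] by (subst ennreal_mult[symmetric]) (auto simp: mult_ac)
    then show "ennreal (wt i * v i * q i) = (\<integral>\<^sup>+\<xi>. ennreal (wt i * q i) * indicator (shell E \<rho>E i) \<xi> \<partial>E)"
      by (simp add: nn_integral_cmult_indicator emeasure_shell)
  qed
  also have "\<dots> = (\<integral>\<^sup>+\<xi>. (\<Sum>i\<in>I. ennreal (wt i * q i) * indicator (shell E \<rho>E i) \<xi>) \<partial>E)"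
    by (rule nn_integral_sum[symmetric]) measurable
  also have "\<dots> \<le> (\<integral>\<^sup>+\<xi>. ennreal (Q \<xi> * w \<xi>) \<partial>E)"
  proof (rule nn_integral_mono)
    fix \<xi> assume "\<xi> \<in> space E"
    show "(\<Sum>i\<in>I. ennreal (wt i * q i) * indicator (shell E \<rho>E i) \<xi>) \<le> ennreal (Q \<xi> * w \<xi>)"
    proof (cases "\<exists>i\<in>I. \<xi> \<in> shell E \<rho>E i")
      case True
      then obtain i where i: "i \<in> I" "\<xi> \<in> shell E \<rho>E i" by blast
      then have "\<xi> \<notin> shell E \<rho>E j" if "j \<noteq> i" for j using shell_disjoint[OF that, of E \<rho>E] by auto
      then have "(\<Sum>i\<in>I. ennreal (wt i * q i) * indicator (shell E \<rho>E i) \<xi>)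
         = (\<Sum>j\<in>{i}. ennreal (wt j * q j) * indicator (shell E \<rho>E j) \<xi>)"
        using I i by (intro sum.mono_neutral_right) (auto simp: indicator_def)
      also have "\<dots> \<le> ennreal (Q \<xi> * w \<xi>)"
        using i q[OF i(1)] wt_le_w[OF i(2)] Q(1)[OF i] Q(2)[of \<xi>]
        by (auto simp: mult.commute intro!: ennreal_leI mult_mono)
      finally show ?thesis .
    next
      case False
      then have "(\<Sum>i\<in>I. ennreal (wt i * q i) * indicator (shell E \<rho>E i) \<xi>) = 0"
        by (intro sum.neutral) auto
      then show ?thesis by simp
    qed
  qed
  also note M(1)
  finally show ?thesis using M(2) by simp
qed

lemma AE_good: "AE x in D. good x"
  using origin
proof eventually_elim
  case (elim x)
  then show ?case
  proof
    assume *: "\<forall>S\<in>sets D. emeasure D S \<le> ennreal (1 / 2) \<longrightarrow> emeasure D S = 0"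
    have "decr_rearr D f 0 \<le> decr_rearr D f (1 / 2)"
      unfolding decr_rearr_def by (intro Inf_superset_mono) (use * in auto)
    also have "\<dots> < \<infinity>" using f_rearrangeable by (simp add: rearrangeable_def)
    finally show ?thesis by (simp add: good_def)
  qed (simp add: good_def)
qed

lemma good_measurable [measurable]: "Measurable.pred D good"
  unfolding good_def[abs_def] by measurable

lemma good_finite: "good x \<Longrightarrow> decr_rearr D f (\<rho>D x) < \<infinity>"
  using f_rearrangeable decr_rearr_nonpos[of "\<rho>D x" D f]
  by (cases "0 < \<rho>D x") (auto simp: good_def rearrangeable_def)

lemma a_le_fo: "good x \<Longrightarrow> \<rho>D x \<le> dyad k \<Longrightarrow> a k \<le> fo x"
  unfolding a_def fo_def level_def
  using good_finite by (intro enn2real_mono decr_rearr_antimono) auto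

definition cut :: "('a \<Rightarrow> complex) \<Rightarrow> 'a \<Rightarrow> complex" where
  "cut u x = (if good x then u x else 0)"

lemma integrable_cut: "integrable D u \<Longrightarrow> integrable D (cut u)"
  unfolding cut_def[abs_def]
  by (rule Bochner_Integration.integrable_bound[of D u]) auto

lemma FT_cut: assumes "integrable D u" shows "FT (cut u) \<xi> = FT u \<xi>"
proof (rule FT_cong_AE)
  show "AE x in D. cut u x = u x" using AE_good by eventually_elim (simp add: cut_def)
  show "u \<in> borel_measurable D" "cut u \<in> borel_measurable D"
    using assms integrable_cut[OF assms] by auto
qed

text \<open>
  Up to a constant, \<open>\<alpha> k\<close> is the size on the dual ball of the transform of the bump at scale
  \<open>k\<close> with height \<open>a k - a (k + 1)\<close>.
\<close>

definition \<alpha> :: "int \<Rightarrow> real" where "\<alpha> k = (a k - a (k + 1)) * dyad k"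

lemma \<alpha>_nonneg [simp]: "0 \<le> \<alpha> k"
  unfolding \<alpha>_def using a_diff_nonneg by simp

text \<open>
  The test function is the superposition of the bumps at all scales \<open>k\<close> with heights \<open>a k - a (k +
  1)\<close>, which stays below \<open>f\<degree>\<close>. All transforms are nonnegative, so on the shell
  \<open>i\<close> those with \<open>k \<le> i\<close>, whose dual balls contain the shell, add up without
  cancellation.
\<close>

lemma head_bound:
  assumes I: "finite I"
  shows "(\<Sum>i\<in>I. wt i * v i * (c * (\<Sum>l<L. \<alpha> (i - int l))) powr \<beta>) \<le> N"
proof -
  have "\<exists>\<psi>. integrable D \<psi> \<and> (\<forall>x\<in>space D. cmod (\<psi> x) \<le> (if \<rho>D x \<le> dyad k then 1 else 0)) \<and>
      (\<forall>\<xi>\<in>space E. 0 \<le> Re (FT \<psi> \<xi>) \<and>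
        (\<rho>E \<xi> \<le> dyad (- k) \<longrightarrow> (a k - a (k + 1)) * (c * dyad k) \<le> (a k - a (k + 1)) * Re (FT \<psi> \<xi>)))" for k
  proof (cases "degenerate D k")
    case True
    then have "a k = a (k + 1)" unfolding a_def by (intro level_eq_of_degenerate) measurable
    then show ?thesis by (intro exI[of _ "\<lambda>x. 0"]) auto
  next
    case False
    then obtain \<psi> where \<psi>: "integrable D \<psi>" "\<forall>x\<in>space D. cmod (\<psi> x) \<le> (if \<rho>D x \<le> dyad k then 1 else 0)"
      "\<forall>\<xi>\<in>space E. 0 \<le> Re (FT \<psi> \<xi>) \<and> (\<rho>E \<xi> \<le> dyad (- k) \<longrightarrow> c * dyad k \<le> Re (FT \<psi> \<xi>))"
      using bump by blast
    have "(a k - a (k + 1)) * (c * dyad k) \<le> (a k - a (k + 1)) * Re (FT \<psi> \<xi>)"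
      if "\<xi> \<in> space E" "\<rho>E \<xi> \<le> dyad (- k)" for \<xi>
      using \<psi>(3) that a_diff_nonneg by (intro mult_left_mono) auto
    with \<psi> show ?thesis by blast
  qed
  then obtain \<psi> where \<psi>: "\<And>k. integrable D (\<psi> k)"
    "\<And>k x. x \<in> space D \<Longrightarrow> cmod (\<psi> k x) \<le> (if \<rho>D x \<le> dyad k then 1 else 0)"
    "\<And>k \<xi>. \<xi> \<in> space E \<Longrightarrow> 0 \<le> Re (FT (\<psi> k) \<xi>)"
    "\<And>k \<xi>. \<xi> \<in> space E \<Longrightarrow> \<rho>E \<xi> \<le> dyad (- k) \<Longrightarrow>
       (a k - a (k + 1)) * (c * dyad k) \<le> (a k - a (k + 1)) * Re (FT (\<psi> k) \<xi>)"
    by metis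
  obtain n where n: "I \<subseteq> {- int n..int n}"
  proof -
    have fin: "finite (insert 0 (abs ` I))" using I by simp
    have "I \<subseteq> {- int (nat (Max (insert 0 (abs ` I))))..int (nat (Max (insert 0 (abs ` I))))}"
    proof
      fix i assume "i \<in> I"
      then have "\<bar>i\<bar> \<le> Max (insert 0 (abs ` I))" using fin by (intro Max_ge) auto
      then show "i \<in> {- int (nat (Max (insert 0 (abs ` I))))..int (nat (Max (insert 0 (abs ` I))))}" by auto
    qed
    then show ?thesis by (rule that)
  qed
  define K where "K = {- int n - int L..int n}"
  define g where "g x = (\<Sum>k\<in>K. complex_of_real (a k - a (k + 1)) * cut (\<psi> k) x)" for x
  have g_int: "integrable D g" unfolding g_def[abs_def]
    by (intro Bochner_Integration.integrable_sum integrable_mult_right integrable_cut \<psi>)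
  have g_le: "cmod (g x) \<le> fo x" if x: "x \<in> space D" for x
  proof (cases "good x")
    case False
    then show ?thesis by (simp add: g_def cut_def)
  next
    case True
    have "cmod (g x) \<le> (\<Sum>k\<in>K. (a k - a (k + 1)) * (if \<rho>D x \<le> dyad k then 1 else 0))"
      unfolding g_def
    proof (rule order.trans[OF norm_sum], rule sum_mono)
      fix k
      show "cmod (complex_of_real (a k - a (k + 1)) * cut (\<psi> k) x)
         \<le> (a k - a (k + 1)) * (if \<rho>D x \<le> dyad k then 1 else 0)"
        unfolding norm_mult norm_of_real abs_of_nonneg[OF a_diff_nonneg] cut_def if_P[OF True]
        by (intro mult_left_mono \<psi>(2) x a_diff_nonneg)
    qed
    also have "\<dots> \<le> fo x"
      unfolding K_def using a_antimono a_le_fo[OF True] by (intro layer_sum_le) auto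
    finally show ?thesis .
  qed
  show ?thesis
  proof (rule shell_sum_le[OF I, where Q = "\<lambda>\<xi>. cmod (FT g \<xi>) powr \<beta>"])
    show "(\<integral>\<^sup>+\<xi>. ennreal (cmod (FT g \<xi>) powr \<beta> * w \<xi>) \<partial>E) \<le> ennreal N"
      unfolding w_def using g_le by (intro hyp g_int) (simp add: fo_def)
  next
    fix i \<xi> assume i: "i \<in> I" and \<xi>: "\<xi> \<in> shell E \<rho>E i"
    have \<xi>E: "\<xi> \<in> space E" by (rule shell_space[OF \<xi>])
    have "c * (\<Sum>l<L. \<alpha> (i - int l)) = (\<Sum>k\<in>(\<lambda>l. i - int l) ` {..<L}. (a k - a (k + 1)) * (c * dyad k))"
      by (subst sum.reindex) (auto simp: inj_on_def sum_distrib_left \<alpha>_def mult_ac)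
    also have "\<dots> \<le> (\<Sum>k\<in>(\<lambda>l. i - int l) ` {..<L}. (a k - a (k + 1)) * Re (FT (\<psi> k) \<xi>))"
    proof (rule sum_mono)
      fix k assume "k \<in> (\<lambda>l. i - int l) ` {..<L}"
      then have "k \<le> i" by auto
      then show "(a k - a (k + 1)) * (c * dyad k) \<le> (a k - a (k + 1)) * Re (FT (\<psi> k) \<xi>)"
        by (intro \<psi>(4) \<xi>E order.trans[OF shell_le[OF \<xi>]]) simp
    qed
    also have "\<dots> \<le> (\<Sum>k\<in>K. (a k - a (k + 1)) * Re (FT (\<psi> k) \<xi>))"
      using i n \<psi>(3)[OF \<xi>E] a_diff_nonneg by (intro sum_mono2) (auto simp: K_def)
    also have "\<dots> = Re (FT g \<xi>)"
      unfolding g_def[abs_def]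
      by (subst FT_weighted_sum) (auto simp: K_def integrable_cut \<psi> FT_cut simp del: of_real_diff)
    also have "\<dots> \<le> cmod (FT g \<xi>)" by (rule complex_Re_le_cmod)
    finally show "(c * (\<Sum>l<L. \<alpha> (i - int l))) powr \<beta> \<le> cmod (FT g \<xi>) powr \<beta>"
      using c_pos \<beta> by (intro powr_mono2) (auto intro!: mult_nonneg_nonneg sum_nonneg)
  qed (use N_nonneg in auto)
qed

text \<open>
  In sums over \<open>k\<close>, the number \<open>F k\<close> plays the role of the squared \<open>L\<^sup>2\<close>
  norm of \<open>f\<close> on the layer between the levels \<open>k + 1\<close> and \<open>k\<close>; in this form the
  sums telescope against \<open>(f\<degree>)\<^sup>2\<close>.
\<close>

definition F :: "int \<Rightarrow> real" where "F k = ((a k)\<^sup>2 - (a (k + 1))\<^sup>2) * dyad k"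

lemma a_square_antimono: "j \<le> k \<Longrightarrow> (a k)\<^sup>2 \<le> (a j)\<^sup>2"
  by (intro power_mono a_antimono) auto

lemma F_nonneg [simp]: "0 \<le> F k"
  unfolding F_def using a_square_antimono[of k "k + 1"] by simp

text \<open>
  The energy \<open>o' i j\<close> is the share of the spatial scale \<open>j\<close> that is sent to the frequency
  shell \<open>i\<close>. It is spread over the functions that cover the ball around this shell. Their squares sum up
  to at most \<open>(f\<degree>)\<^sup>2\<close>, as the shares of \<open>j\<close> add up to at most \<open>F
  j\<close>; and on the shell \<open>i\<close> one of them has a large transform for every \<open>j\<close>.
\<close>

lemma tail_bound:
  assumes I: "finite I" and o_nn: "\<And>i j. 0 \<le> o' i j" and o_le: "\<And>i j. j < i \<Longrightarrow> o' i j = 0"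
    and o_sum: "\<And>j. j \<in> {lo..hi} \<Longrightarrow> (\<Sum>i\<in>I. o' i j) \<le> F j"
  shows "(\<Sum>i\<in>I. wt i * v i * (c\<^sup>2 / C * dyad i * (\<Sum>j = lo..hi. o' i j)) powr (\<beta> / 2)) \<le> 2304 * N"
proof -
  \<comment> \<open>At degenerate scales the empty list is used; there \<open>F j = 0\<close>, so the share vanishes.\<close>
  define Q where "Q i j us \<longleftrightarrow> real (length us) \<le> C * dyad (j - i) \<and>
      (\<forall>u\<in>set us. integrable D u \<and> (\<forall>x\<in>space D. cmod (u x) \<le> (if \<rho>D x \<le> dyad j then 1 else 0))) \<and>
      (\<not> degenerate D j \<longrightarrow> i \<le> j \<longrightarrow>
        (\<forall>\<xi>\<in>space E. \<rho>E \<xi> \<le> dyad (- i) \<longrightarrow> (\<exists>u\<in>set us. c * dyad j \<le> cmod (FT u \<xi>))))" for i j us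
  have ex: "\<exists>us. Q i j us" for i j
  proof (cases "\<not> degenerate D j \<and> i \<le> j")
    case True
    with cover[of j i] show ?thesis unfolding Q_def by blast
  next
    case False
    then have "Q i j []" using C_pos unfolding Q_def by auto
    then show ?thesis ..
  qed
  define us where "us i j = (SOME us. Q i j us)" for i j
  have Q: "Q i j (us i j)" for i j unfolding us_def by (rule someI_ex[OF ex])
  have us: "\<And>i j. real (length (us i j)) \<le> C * dyad (j - i)"
    "\<And>i j u. u \<in> set (us i j) \<Longrightarrow> integrable D u"
    "\<And>i j u x. u \<in> set (us i j) \<Longrightarrow> x \<in> space D \<Longrightarrow> cmod (u x) \<le> (if \<rho>D x \<le> dyad j then 1 else 0)"
    "\<And>i j \<xi>. \<not> degenerate D j \<Longrightarrow> i \<le> j \<Longrightarrow> \<xi> \<in> space E \<Longrightarrow> \<rho>E \<xi> \<le> dyad (- i) \<Longrightarrow>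
       \<exists>u\<in>set (us i j). c * dyad j \<le> cmod (FT u \<xi>)"
    using Q unfolding Q_def by blast+
  \<comment> \<open>Each of the at most \<open>C * dyad (j - i)\<close> functions has its squared height adjusted so that
    jointly they carry the share over a ball of measure \<open>dyad j\<close>.\<close>
  define r where "r i j = sqrt (o' i j / (dyad j * (C * dyad (j - i))))" for i j
  have r2: "(r i j)\<^sup>2 = o' i j / (dyad j * (C * dyad (j - i)))" for i j
    using o_nn C_pos by (simp add: r_def)
  obtain ps where ps: "set ps = I \<times> {lo..hi}" "distinct ps"
    using finite_distinct_list[of "I \<times> {lo..hi}"] I by auto
  define gs where "gs = concat (map (\<lambda>(i, j). map (\<lambda>u x. complex_of_real (r i j) * cut u x) (us i j)) ps)"
  have gs_int: "integrable D g" if "g \<in> set gs" for g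
    using that by (auto simp: gs_def intro!: integrable_mult_right integrable_cut intro: us(2))
  have gs_sum: "square_sum (map G gs) = (\<Sum>i\<in>I. \<Sum>j = lo..hi. (r i j)\<^sup>2 * square_sum (map G' (us i j)))"
    if G: "\<And>t u. u \<in> (\<Union>i j. set (us i j)) \<Longrightarrow> G (\<lambda>x. complex_of_real t * cut u x) = complex_of_real t * G' u" for G G'
  proof -
    have "square_sum (map G gs) = (\<Sum>p\<leftarrow>ps. case p of (i, j) \<Rightarrow> (r i j)\<^sup>2 * square_sum (map G' (us i j)))"
      unfolding gs_def square_sum_concat_map
    proof (intro arg_cong[where f = sum_list] map_cong refl)
      fix p :: "int \<times> int"
      obtain i j where p: "p = (i, j)" by (cases p)
      have "map (\<lambda>u. G (\<lambda>x. complex_of_real (r i j) * cut u x)) (us i j)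
          = map (\<lambda>u. complex_of_real (r i j) * G' u) (us i j)"
        using G by (intro map_cong) auto
      then have "square_sum (map G (map (\<lambda>u x. complex_of_real (r i j) * cut u x) (us i j)))
          = square_sum (map (\<lambda>u. complex_of_real (r i j) * G' u) (us i j))"
        by (simp only: map_map comp_def)
      then show "square_sum (map G (case p of (i, j) \<Rightarrow> map (\<lambda>u x. complex_of_real (r i j) * cut u x) (us i j)))
          = (case p of (i, j) \<Rightarrow> (r i j)\<^sup>2 * square_sum (map G' (us i j)))"
        by (simp only: p prod.case square_sum_scale)
    qed
    also have "\<dots> = (\<Sum>p\<in>I \<times> {lo..hi}. case p of (i, j) \<Rightarrow> (r i j)\<^sup>2 * square_sum (map G' (us i j)))"
      using ps by (simp add: sum_list_distinct_conv_sum_set)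
    also have "\<dots> = (\<Sum>i\<in>I. \<Sum>j = lo..hi. (r i j)\<^sup>2 * square_sum (map G' (us i j)))"
      by (rule sum.cartesian_product[symmetric])
    finally show ?thesis .
  qed
  have gs_le: "square_sum (map (\<lambda>g. g x) gs) \<le> (fo x)\<^sup>2" if x: "x \<in> space D" for x
  proof (cases "good x")
    case False
    then have "square_sum (map (\<lambda>g. g x) gs) = (\<Sum>i\<in>I. \<Sum>j = lo..hi. (r i j)\<^sup>2 * square_sum (map (\<lambda>u. 0) (us i j)))"
      by (intro gs_sum) (simp add: cut_def)
    also have "\<dots> = 0" by (simp add: square_sum_def comp_def sum_list_triv map_replicate_const sum_list_replicate)
    finally show ?thesis by simp
  next
    case True
    then have "square_sum (map (\<lambda>g. g x) gs) = (\<Sum>i\<in>I. \<Sum>j = lo..hi. (r i j)\<^sup>2 * square_sum (map (\<lambda>u. u x) (us i j)))"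
      by (intro gs_sum) (simp add: cut_def)
    also have "\<dots> \<le> (\<Sum>i\<in>I. \<Sum>j = lo..hi. o' i j * (inverse (dyad j) * (if \<rho>D x \<le> dyad j then 1 else 0)))"
    proof (intro sum_mono)
      fix i j
      have "square_sum (map (\<lambda>u. u x) (us i j))
          \<le> real (length (map (\<lambda>u. u x) (us i j))) * (if \<rho>D x \<le> dyad j then 1 else 0)\<^sup>2"
      proof (rule square_sum_le_length)
        fix z assume "z \<in> set (map (\<lambda>u. u x) (us i j))"
        then obtain u where "u \<in> set (us i j)" "z = u x" by auto
        then show "cmod z \<le> (if \<rho>D x \<le> dyad j then 1 else 0)" using us(3)[OF _ x] by simp
      qed
      also have "\<dots> \<le> (C * dyad (j - i)) * (if \<rho>D x \<le> dyad j then 1 else 0)"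
        using us(1)[of i j] by simp
      finally have "(r i j)\<^sup>2 * square_sum (map (\<lambda>u. u x) (us i j))
        \<le> (r i j)\<^sup>2 * ((C * dyad (j - i)) * (if \<rho>D x \<le> dyad j then 1 else 0))"
        by (rule mult_left_mono) simp
      also have "\<dots> = o' i j * (inverse (dyad j) * (if \<rho>D x \<le> dyad j then 1 else 0))"
        unfolding r2 using C_pos less_imp_neq[OF dyad_pos, of "j - i"] by (simp add: field_simps)
      finally show "(r i j)\<^sup>2 * square_sum (map (\<lambda>u. u x) (us i j))
         \<le> o' i j * (inverse (dyad j) * (if \<rho>D x \<le> dyad j then 1 else 0))" .
    qed
    also have "\<dots> = (\<Sum>j = lo..hi. (\<Sum>i\<in>I. o' i j) * (inverse (dyad j) * (if \<rho>D x \<le> dyad j then 1 else 0)))"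
      by (subst sum.swap) (simp add: sum_distrib_right)
    also have "\<dots> \<le> (\<Sum>j = lo..hi. F j * (inverse (dyad j) * (if \<rho>D x \<le> dyad j then 1 else 0)))"
      by (intro sum_mono mult_right_mono o_sum) auto
    also have "\<dots> = (\<Sum>j = lo..hi. ((a j)\<^sup>2 - (a (j + 1))\<^sup>2) * (if \<rho>D x \<le> dyad j then 1 else 0))"
      using dyad_pos by (intro sum.cong) (auto simp: F_def less_imp_neq[symmetric])
    also have "\<dots> \<le> (fo x)\<^sup>2"
      using a_square_antimono a_le_fo[OF True] by (intro layer_sum_le) (auto intro!: power_mono)
    finally show ?thesis .
  qed
  show ?thesis
  proof (rule shell_sum_le[OF I, where Q = "\<lambda>\<xi>. square_sum (map (\<lambda>g. FT g \<xi>) gs) powr (\<beta> / 2)"])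
    show "(\<integral>\<^sup>+\<xi>. ennreal (square_sum (map (\<lambda>g. FT g \<xi>) gs) powr (\<beta> / 2) * w \<xi>) \<partial>E) \<le> ennreal (2304 * N)"
    proof (rule square_function_bound[OF \<beta> N_nonneg w_measurable w_nonneg w_integrable fo_nonneg _ gs_int gs_le])
      show "(\<integral>\<^sup>+\<xi>. ennreal (cmod (FT g \<xi>) powr \<beta> * w \<xi>) \<partial>E) \<le> ennreal N"
        if "integrable D g" "\<And>x. x \<in> space D \<Longrightarrow> cmod (g x) \<le> fo x" for g
        using that unfolding w_def by (intro hyp) (simp_all add: fo_def)
    qed
  next
    fix i \<xi> assume i: "i \<in> I" and \<xi>: "\<xi> \<in> shell E \<rho>E i"
    have \<xi>E: "\<xi> \<in> space E" by (rule shell_space[OF \<xi>])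
    have \<xi>i: "\<rho>E \<xi> \<le> dyad (- i)"
      using shell_le[OF \<xi>] dyad_le_iff[of "- i - 1" "- i"] by linarith
    have "c\<^sup>2 / C * dyad i * (\<Sum>j = lo..hi. o' i j) = (\<Sum>j = lo..hi. c\<^sup>2 / C * dyad i * o' i j)"
      by (rule sum_distrib_left)
    also have "\<dots> \<le> (\<Sum>j = lo..hi. (r i j)\<^sup>2 * square_sum (map (\<lambda>u. FT u \<xi>) (us i j)))"
    proof (rule sum_mono)
      fix j assume j: "j \<in> {lo..hi}"
      show "c\<^sup>2 / C * dyad i * o' i j \<le> (r i j)\<^sup>2 * square_sum (map (\<lambda>u. FT u \<xi>) (us i j))"
      proof (cases "degenerate D j \<or> j < i")
        case True
        have "o' i j = 0"
        proof (cases "j < i")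
          case False
          with True have "degenerate D j" by simp
          then have "a j = a (j + 1)" unfolding a_def by (intro level_eq_of_degenerate) measurable
          then have "(\<Sum>i\<in>I. o' i j) \<le> 0" using o_sum[OF j] by (simp add: F_def)
          moreover have "o' i j \<le> (\<Sum>i\<in>I. o' i j)" using I i o_nn by (intro member_le_sum) auto
          ultimately show ?thesis using o_nn[of i j] by linarith
        qed (rule o_le)
        then show ?thesis by (simp add: square_sum_nonneg)
      next
        case False
        then obtain u where u: "u \<in> set (us i j)" "c * dyad j \<le> cmod (FT u \<xi>)"
          using us(4)[of j i \<xi>] \<xi>E \<xi>i by (auto simp: not_less)
        have "(c * dyad j)\<^sup>2 \<le> (cmod (FT u \<xi>))\<^sup>2"
          using u c_pos by (intro power_mono) auto
        also have "\<dots> \<le> square_sum (map (\<lambda>u. FT u \<xi>) (us i j))"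
          using u by (intro square_sum_ge_member) auto
        finally have "(r i j)\<^sup>2 * (c * dyad j)\<^sup>2 \<le> (r i j)\<^sup>2 * square_sum (map (\<lambda>u. FT u \<xi>) (us i j))"
          by (rule mult_left_mono) simp
        moreover have "(r i j)\<^sup>2 * (c * dyad j)\<^sup>2 = c\<^sup>2 / C * dyad i * o' i j"
          unfolding r2 dyad_diff using C_pos less_imp_neq[OF dyad_pos, of i] less_imp_neq[OF dyad_pos, of j]
          by (simp add: field_simps power2_eq_square)
        ultimately show ?thesis by simp
      qed
    qed
    also have "\<dots> \<le> (\<Sum>i\<in>I. \<Sum>j = lo..hi. (r i j)\<^sup>2 * square_sum (map (\<lambda>u. FT u \<xi>) (us i j)))"
      using I i by (intro member_le_sum) (auto intro!: sum_nonneg mult_nonneg_nonneg square_sum_nonneg)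
    also have "\<dots> = square_sum (map (\<lambda>g. FT g \<xi>) gs)"
      by (rule gs_sum[symmetric]) (auto simp: FT_scale FT_cut us)
    finally show "(c\<^sup>2 / C * dyad i * (\<Sum>j = lo..hi. o' i j)) powr (\<beta> / 2)
       \<le> square_sum (map (\<lambda>g. FT g \<xi>) gs) powr (\<beta> / 2)"
      using \<beta> C_pos o_nn by (intro powr_mono2) (auto intro!: mult_nonneg_nonneg divide_nonneg_pos sum_nonneg)
  qed (use N_nonneg in auto)
qed

end

section \<open>Absorption and transport of energies\<close>

lemma powr_le_imp_le:
  fixes x y b :: real
  assumes "x powr b \<le> y" "0 < b" "0 \<le> x"
  shows "x \<le> y powr (1 / b)"
proof -
  have "(x powr b) powr (1 / b) \<le> y powr (1 / b)" using assms by (intro powr_mono2) auto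
  then show ?thesis using assms by (simp add: powr_powr)
qed

lemma summable_shift_int:
  fixes p :: "int \<Rightarrow> real"
  assumes "summable (\<lambda>l. p (i + int l))"
  shows "summable (\<lambda>l. p (m + int l))"
proof (cases "i \<le> m")
  case True
  then have "(\<lambda>l. p (m + int l)) = (\<lambda>l. p (i + int (l + nat (m - i))))"
    by (intro ext arg_cong[where f = p]) simp
  then show ?thesis using summable_ignore_initial_segment[OF assms, of "nat (m - i)"] by simp
next
  case False
  then have "(\<lambda>l. p (i + int l)) = (\<lambda>l. p (m + int (l + nat (i - m))))"
    by (intro ext arg_cong[where f = p]) simp
  then have "summable (\<lambda>l. p (m + int (l + nat (i - m))))" using assms by simp
  then show ?thesis by (subst (asm) summable_iff_shift)
qed

lemma sum_int_interval:
  fixes p :: "int \<Rightarrow> real"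
  shows "(\<Sum>j = m..m + int n - 1. p j) = (\<Sum>l<n. p (m + int l))"
proof -
  have "{m..m + int n - 1} = (\<lambda>l. m + int l) ` {..<n}"
  proof (intro equalityI subsetI)
    fix k assume "k \<in> {m..m + int n - 1}"
    then have "k = m + int (nat (k - m))" "nat (k - m) < n" by auto
    then show "k \<in> (\<lambda>l. m + int l) ` {..<n}" by blast
  qed auto
  then show ?thesis by (simp add: sum.reindex inj_on_def)
qed

text \<open>
  Lay the masses \<open>P hi\<close>, \<open>P (hi - 1)\<close>, \<open>\<dots>\<close> end to end from the origin of
  the half-line, and likewise \<open>F J\<close>, \<open>F (J - 1)\<close>, \<open>\<dots>\<close>; then \<open>q i
  j\<close> is the length of the overlap of the interval of \<open>P i\<close> with that of \<open>F j\<close>. The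
  condition on the tails says that the interval of \<open>P i\<close> ends before the one of \<open>F (i - 1)\<close>
  begins, so mass moves only to indices \<open>j \<ge> i\<close>.
\<close>

lemma transport_exists:
  fixes P F :: "int \<Rightarrow> real"
  assumes P: "\<And>i. 0 \<le> P i" and F: "\<And>j. 0 \<le> F j" and le: "lo \<le> hi + 1" "hi \<le> J"
    and tail: "\<And>m. m \<in> {lo..hi} \<Longrightarrow> (\<Sum>i = m..hi. P i) \<le> (\<Sum>j = m..J. F j)"
  shows "\<exists>q. (\<forall>i j. 0 \<le> q i j) \<and> (\<forall>i j. j < i \<longrightarrow> q i j = 0) \<and>
     (\<forall>j\<in>{lo..J}. (\<Sum>i = lo..hi. q i j) \<le> F j) \<and> (\<forall>i\<in>{lo..hi}. (\<Sum>j = lo..J. q i j) = P i)"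
proof -
  define \<Phi> where "\<Phi> m = (\<Sum>i = m..hi. P i)" for m
  define G where "G m = (\<Sum>j = m..J. F j)" for m
  \<comment> \<open>\<open>d x j\<close> is the length of the intersection of \<open>{0..x}\<close> with the interval of
    \<open>F j\<close>.\<close>
  define d where "d x j = min x (G j) - min x (G (j + 1))" for x j
  define q where "q i j = (if i \<in> {lo..hi} \<and> i \<le> j then d (\<Phi> i) j - d (\<Phi> (i + 1)) j else 0)" for i j
  have \<Phi>_nn: "0 \<le> \<Phi> m" for m unfolding \<Phi>_def by (intro sum_nonneg P)
  have G_nn: "0 \<le> G m" for m unfolding G_def by (intro sum_nonneg F)
  have \<Phi>_mono: "\<Phi> j \<le> \<Phi> i" if "i \<le> j" for i j
    unfolding \<Phi>_def using that P by (intro sum_mono2) auto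
  have G_mono: "G j \<le> G i" if "i \<le> j" for i j
    unfolding G_def using that F by (intro sum_mono2) auto
  have d_mono: "d x j \<le> d y j" if "x \<le> y" for x y j
    using that G_mono[of j "j + 1"] unfolding d_def by (auto simp: min_def)
  have \<Phi>_G: "\<Phi> i \<le> G i" if "i \<in> {lo..hi}" for i using tail[OF that] by (simp add: \<Phi>_def G_def)
  have d_0: "d (\<Phi> i) j = 0" if "i \<in> {lo..hi}" "j < i" for i j
  proof -
    have "\<Phi> i \<le> G (j + 1)" using \<Phi>_G[OF that(1)] G_mono[of "j + 1" i] that(2) by simp
    moreover have "G (j + 1) \<le> G j" by (rule G_mono) simp
    ultimately show ?thesis by (simp add: d_def min_def)
  qed
  have d_0': "d (\<Phi> (i + 1)) j = 0" if "i \<in> {lo..hi}" "j < i" for i j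
  proof -
    have "d (\<Phi> (i + 1)) j \<le> 0" using d_mono[OF \<Phi>_mono[of i "i + 1"], of j] d_0[OF that] by simp
    moreover have "0 \<le> d (\<Phi> (i + 1)) j" using G_mono[of j "j + 1"] by (auto simp: d_def min_def)
    ultimately show ?thesis by simp
  qed
  have q_eq: "q i j = d (\<Phi> i) j - d (\<Phi> (i + 1)) j" if "i \<in> {lo..hi}" for i j
    using that d_0[OF that, of j] d_0'[OF that, of j] by (auto simp: q_def)
  have "0 \<le> q i j" for i j
    using d_mono[OF \<Phi>_mono[of i "i + 1"], of j] by (simp add: q_def)
  moreover have "q i j = 0" if "j < i" for i j using that by (simp add: q_def)
  moreover have "(\<Sum>i = lo..hi. q i j) \<le> F j" if j: "j \<in> {lo..J}" for j
  proof -
    have "(\<Sum>i = lo..hi. q i j) = (\<Sum>i = lo..hi. d (\<Phi> i) j - d (\<Phi> (i + 1)) j)"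
      by (intro sum.cong refl q_eq)
    also have "\<dots> = d (\<Phi> lo) j - d (\<Phi> (hi + 1)) j"
      by (rule sum_int_telescope[where p = "\<lambda>i. d (\<Phi> i) j", OF le(1)])
    also have "d (\<Phi> (hi + 1)) j = 0" using G_nn by (simp add: \<Phi>_def d_def min_def)
    also have "d (\<Phi> lo) j - 0 \<le> G j - G (j + 1)"
      using G_mono[of j "j + 1"] by (auto simp: d_def min_def)
    also have "G j - G (j + 1) = F j"
    proof -
      have "{j..J} = insert j {j + 1..J}" using j by auto
      then show ?thesis by (simp add: G_def)
    qed
    finally show ?thesis .
  qed
  moreover have "(\<Sum>j = lo..J. q i j) = P i" if i: "i \<in> {lo..hi}" for i
  proof -
    have lJ: "lo \<le> J + 1" using i le by auto
    have *: "(\<Sum>j = lo..J. d x j) = x" if "0 \<le> x" "x \<le> G lo" for x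
    proof -
      have "(\<Sum>j = lo..J. d x j) = min x (G lo) - min x (G (J + 1))"
        unfolding d_def by (rule sum_int_telescope[OF lJ])
      then show ?thesis using that by (simp add: G_def)
    qed
    have "(\<Sum>j = lo..J. q i j) = (\<Sum>j = lo..J. d (\<Phi> i) j) - (\<Sum>j = lo..J. d (\<Phi> (i + 1)) j)"
      by (simp add: q_eq[OF i] sum_subtractf)
    also have "\<dots> = \<Phi> i - \<Phi> (i + 1)"
    proof -
      have "\<Phi> i \<le> G lo" using \<Phi>_G[OF i] G_mono[of lo i] i by auto
      moreover have "\<Phi> (i + 1) \<le> \<Phi> i" by (rule \<Phi>_mono) simp
      ultimately show ?thesis using \<Phi>_nn by (simp add: *)
    qed
    also have "\<dots> = P i"
    proof -
      have "{i..hi} = insert i {i + 1..hi}" using i by auto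
      then show ?thesis by (simp add: \<Phi>_def)
    qed
    finally show ?thesis .
  qed
  ultimately show ?thesis by (intro exI[of _ q]) blast
qed

context rearranged_pair
begin

text \<open>
  A single shell of positive weight is enough for the hypothesis to force the convergence of the two series below.
\<close>

definition active :: "int \<Rightarrow> bool" where "active i \<longleftrightarrow> 0 < wt i * v i"

text \<open>
  Up to constants, \<open>\<A> m\<close> and \<open>\<Gamma> m\<close> control the \<open>L\<^sup>1\<close> norm of
  the part of \<open>f\<close> above the height \<open>a m\<close> and the squared \<open>L\<^sup>2\<close> norm of
  the part below it; see \<open>large_part_le\<close> and \<open>small_part_le\<close>.
\<close>

definition \<A> :: "int \<Rightarrow> real" where "\<A> m = (\<Sum>l. \<alpha> (m - int l))"
definition \<Gamma> :: "int \<Rightarrow> real" where "\<Gamma> m = (\<Sum>l. F (m + int l))"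

lemma summable_\<alpha>: assumes "active i" shows "summable (\<lambda>l. \<alpha> (m - int l))"
proof -
  define x where "x = (N / (wt i * v i)) powr (1 / \<beta>) / c"
  have "(\<Sum>l<L. \<alpha> (i - int l)) \<le> x" for L
  proof -
    have "wt i * v i * (c * (\<Sum>l<L. \<alpha> (i - int l))) powr \<beta> \<le> N"
      using head_bound[of "{i}" L] by simp
    then have "(c * (\<Sum>l<L. \<alpha> (i - int l))) powr \<beta> \<le> N / (wt i * v i)"
      using assms unfolding active_def by (simp only: pos_le_divide_eq) (simp add: mult.commute)
    then have "c * (\<Sum>l<L. \<alpha> (i - int l)) \<le> (N / (wt i * v i)) powr (1 / \<beta>)"
      using \<beta> c_pos by (intro powr_le_imp_le) (auto intro!: mult_nonneg_nonneg sum_nonneg)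
    then show ?thesis using c_pos by (simp add: x_def field_simps)
  qed
  then have "summable (\<lambda>l. \<alpha> (i - int l))"
    by (intro summableI_nonneg_bounded) auto
  then have "summable (\<lambda>l. (\<lambda>k. \<alpha> (- k)) (- i + int l))" by simp
  from summable_shift_int[OF this, of "- m"] show ?thesis by simp
qed

lemma summable_F: assumes "active i" shows "summable (\<lambda>l. F (m + int l))"
proof -
  define x where "x = (2304 * N / (wt i * v i)) powr (1 / (\<beta> / 2)) / (c\<^sup>2 / C * dyad i)"
  have "(\<Sum>l<L. F (i + int l)) \<le> x" for L
  proof -
    define q where "q i' j = (if i' = i \<and> i \<le> j then F j else 0)" for i' j
    have "(\<Sum>i'\<in>{i}. wt i' * v i' * (c\<^sup>2 / C * dyad i' * (\<Sum>j = i..i + int L - 1. q i' j)) powr (\<beta> / 2)) \<le> 2304 * N"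
      by (rule tail_bound) (auto simp: q_def)
    moreover have "(\<Sum>j = i..i + int L - 1. q i j) = (\<Sum>l<L. F (i + int l))"
      unfolding sum_int_interval by (simp add: q_def)
    ultimately have "wt i * v i * (c\<^sup>2 / C * dyad i * (\<Sum>l<L. F (i + int l))) powr (\<beta> / 2) \<le> 2304 * N"
      by simp
    then have "(c\<^sup>2 / C * dyad i * (\<Sum>l<L. F (i + int l))) powr (\<beta> / 2) \<le> 2304 * N / (wt i * v i)"
      using assms unfolding active_def by (simp only: pos_le_divide_eq) (simp add: mult.commute)
    then have *: "c\<^sup>2 / C * dyad i * (\<Sum>l<L. F (i + int l)) \<le> (2304 * N / (wt i * v i)) powr (1 / (\<beta> / 2))"
      using \<beta> C_pos by (intro powr_le_imp_le) (auto intro!: mult_nonneg_nonneg divide_nonneg_pos sum_nonneg)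
    have "0 < c\<^sup>2 / C * dyad i" using c_pos C_pos by simp
    then show ?thesis using * unfolding x_def by (simp only: pos_le_divide_eq) (simp add: mult.commute)
  qed
  then have "summable (\<lambda>l. F (i + int l))"
    by (intro summableI_nonneg_bounded) auto
  then show ?thesis by (rule summable_shift_int)
qed

lemma head_bound_limit:
  assumes I: "finite I" and act: "active i0"
  shows "(\<Sum>i\<in>I. wt i * v i * (c * \<A> i) powr \<beta>) \<le> N"
proof (rule LIMSEQ_le_const2)
  show "\<exists>n0. \<forall>L\<ge>n0. (\<Sum>i\<in>I. wt i * v i * (c * (\<Sum>l<L. \<alpha> (i - int l))) powr \<beta>) \<le> N"
    using head_bound[OF I] by blast
  show "(\<lambda>L. \<Sum>i\<in>I. wt i * v i * (c * (\<Sum>l<L. \<alpha> (i - int l))) powr \<beta>)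
      \<longlonglongrightarrow> (\<Sum>i\<in>I. wt i * v i * (c * \<A> i) powr \<beta>)"
  proof (intro tendsto_sum tendsto_mult tendsto_const tendsto_powr')
    fix i
    show "(\<lambda>L. \<Sum>l<L. \<alpha> (i - int l)) \<longlonglongrightarrow> \<A> i"
      unfolding \<A>_def by (rule summable_LIMSEQ[OF summable_\<alpha>[OF act]])
    show "c * \<A> i \<noteq> 0 \<or> 0 < \<beta> \<and> (\<forall>\<^sub>F L in sequentially. 0 \<le> c * (\<Sum>l<L. \<alpha> (i - int l)))"
      using \<beta> c_pos by (auto intro!: always_eventually mult_nonneg_nonneg sum_nonneg)
  qed
qed

lemma \<A>_nonneg: "active i \<Longrightarrow> 0 \<le> \<A> m"
  unfolding \<A>_def by (intro suminf_nonneg summable_\<alpha>) auto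

lemma \<Gamma>_nonneg: "active i \<Longrightarrow> 0 \<le> \<Gamma> m"
  unfolding \<Gamma>_def by (intro suminf_nonneg summable_F) auto

lemma \<Gamma>_split: assumes "active i" shows "\<Gamma> m = (\<Sum>l<n. F (m + int l)) + \<Gamma> (m + int n)"
  unfolding \<Gamma>_def using suminf_split_initial_segment[OF summable_F[OF assms, of m], of n]
  by (simp add: add.assoc add.commute[of "int n"])

lemma sum_F_le_\<Gamma>: "active i \<Longrightarrow> (\<Sum>l<n. F (m + int l)) \<le> \<Gamma> m"
  using \<Gamma>_split[of i m n] \<Gamma>_nonneg[of i "m + int n"] by simp

lemma \<Gamma>_antimono: assumes "active i" "m \<le> m'" shows "\<Gamma> m' \<le> \<Gamma> m"
  using \<Gamma>_split[OF assms(1), of m "nat (m' - m)"] assms(2)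
  by (simp add: sum_nonneg)

lemma a_tendsto_0: "(\<lambda>n. a (m + int n)) \<longlonglongrightarrow> 0"
proof (rule LIMSEQ_I)
  fix r :: real assume r: "0 < r"
  then have r2: "0 < r / 2" by simp
  obtain n0 :: nat where n0: "\<And>k. k \<ge> int n0 \<Longrightarrow> a k \<le> r / 2"
    using ex_level_le[OF r2 f_finite[OF r2]] unfolding a_def by blast
  have "norm (a (m + int n) - 0) < r" if "n \<ge> nat (int n0 - m)" for n
  proof -
    have "int n0 \<le> m + int n" using that by linarith
    from n0[OF this] r have "a (m + int n) < r" by linarith
    then show ?thesis by simp
  qed
  then show "\<exists>no. \<forall>n\<ge>no. norm (a (m + int n) - 0) < r" by blast
qed

text \<open>
  Lowering all the dyadic factors in \<open>\<Gamma> m\<close> to \<open>2\<^sup>m\<close> leaves a telescoping sum,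
  and \<open>a\<close> tends to zero.
\<close>

lemma a_square_le_\<Gamma>: assumes "active i" shows "(a m)\<^sup>2 * dyad m \<le> \<Gamma> m"
proof -
  have "(a m)\<^sup>2 * dyad m - (a (m + int n))\<^sup>2 * dyad m \<le> \<Gamma> m" for n
  proof -
    have "(a m)\<^sup>2 - (a (m + int n))\<^sup>2 = (\<Sum>l<n. (a (m + int l))\<^sup>2 - (a (m + int (Suc l)))\<^sup>2)"
      using sum_lessThan_telescope'[of "\<lambda>l. (a (m + int l))\<^sup>2" n] by simp
    then have "(a m)\<^sup>2 * dyad m - (a (m + int n))\<^sup>2 * dyad m
       = (\<Sum>l<n. ((a (m + int l))\<^sup>2 - (a (m + int (Suc l)))\<^sup>2) * dyad m)"
      by (simp add: sum_distrib_right flip: left_diff_distrib)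
    also have "\<dots> \<le> (\<Sum>l<n. F (m + int l))"
    proof (rule sum_mono)
      fix l
      show "((a (m + int l))\<^sup>2 - (a (m + int (Suc l)))\<^sup>2) * dyad m \<le> F (m + int l)"
      proof -
        have i: "m + int (Suc l) = m + int l + 1" by simp
        show ?thesis
          unfolding F_def i using a_square_antimono[of "m + int l" "m + int l + 1"]
          by (intro mult_left_mono) auto
      qed
    qed
    also have "\<dots> \<le> \<Gamma> m" by (rule sum_F_le_\<Gamma>[OF assms])
    finally show ?thesis .
  qed
  moreover have "(\<lambda>n. (a m)\<^sup>2 * dyad m - (a (m + int n))\<^sup>2 * dyad m) \<longlonglongrightarrow> (a m)\<^sup>2 * dyad m - 0\<^sup>2 * dyad m"
    by (intro tendsto_intros a_tendsto_0)
  ultimately show ?thesis using LIMSEQ_le_const2 by fastforce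
qed

text \<open>
  Summation by parts. The boundary term at the lower end has the favourable sign, the one at \<open>m\<close> is kept.
\<close>

lemma large_part_le:
  assumes "active i"
  shows "(\<Sum>l. ennreal (a (m - 1 - int l) * dyad (m - int l))) \<le> ennreal (4 * \<A> m + 2 * a m * dyad m)"
proof (rule suminf_le_const)
  fix n
  have eq: "(\<Sum>l<n. a (m - 1 - int l) * dyad (m - int l)) + 2 * a (m - int n) * dyad (m - int n)
     = 4 * (\<Sum>l<n. \<alpha> (m - 1 - int l)) + 2 * a m * dyad m"
  proof (induction n)
    case (Suc n)
    have d: "dyad (m - int n) = 2 * dyad (m - 1 - int n)"
      using dyad_add[of 1 "m - 1 - int n"] by (simp add: algebra_simps)
    have i: "m - int (Suc n) = m - 1 - int n" "m - 1 - int n + 1 = m - int n" by simp_all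
    show ?case using Suc unfolding sum.lessThan_Suc i \<alpha>_def d by (simp add: algebra_simps)
  qed simp
  have "(\<Sum>l<n. \<alpha> (m - 1 - int l)) \<le> (\<Sum>l<Suc n. \<alpha> (m - int l))"
    by (subst sum.lessThan_Suc_shift) (simp add: algebra_simps)
  also have "\<dots> \<le> \<A> m"
    unfolding \<A>_def by (intro sum_le_suminf summable_\<alpha>[OF assms]) auto
  finally have "(\<Sum>l<n. a (m - 1 - int l) * dyad (m - int l)) \<le> 4 * \<A> m + 2 * a m * dyad m"
    using eq mult_nonneg_nonneg[OF a_nonneg[of "m - int n"] dyad_nonneg[of "m - int n"]] by linarith
  then show "(\<Sum>l<n. ennreal (a (m - 1 - int l) * dyad (m - int l))) \<le> ennreal (4 * \<A> m + 2 * a m * dyad m)"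
    by (subst sum_ennreal) (auto intro!: ennreal_leI)
qed simp

lemma small_part_le:
  assumes "active i"
  shows "(\<Sum>l. ennreal ((a (m + int l))\<^sup>2 * dyad (m + int l + 1))) \<le> ennreal (4 * \<Gamma> m)"
proof (rule suminf_le_const)
  fix n
  have eq: "(\<Sum>l<n. (a (m + int l))\<^sup>2 * dyad (m + int l + 1)) + 2 * (a m)\<^sup>2 * dyad m
     = 4 * (\<Sum>l<n. F (m + int l)) + 2 * (a (m + int n))\<^sup>2 * dyad (m + int n)"
  proof (induction n)
    case (Suc n)
    have d: "dyad (m + int n + 1) = 2 * dyad (m + int n)" by (simp add: dyad_add)
    have i: "m + int (Suc n) = m + int n + 1" by simp
    show ?case using Suc unfolding sum.lessThan_Suc i F_def d by (simp add: algebra_simps)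
  qed simp
  have "2 * (a (m + int n))\<^sup>2 * dyad (m + int n) \<le> 4 * \<Gamma> (m + int n)"
    using a_square_le_\<Gamma>[OF assms, of "m + int n"] \<Gamma>_nonneg[OF assms, of "m + int n"]
    unfolding mult.assoc by linarith
  then have "(\<Sum>l<n. (a (m + int l))\<^sup>2 * dyad (m + int l + 1)) \<le> 4 * \<Gamma> m"
    using eq \<Gamma>_split[OF assms, of m n] mult_nonneg_nonneg[OF zero_le_power2[of "a m"] dyad_nonneg[of m]] by linarith
  then show "(\<Sum>l<n. ennreal ((a (m + int l))\<^sup>2 * dyad (m + int l + 1))) \<le> ennreal (4 * \<Gamma> m)"
    by (subst sum_ennreal) (auto intro!: ennreal_leI)
qed simp

text \<open>
  The comparison of the energies \<open>\<epsilon> i\<close> of an arbitrary function with those that the test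
  functions can produce. An index satisfies \<open>B\<close> when its energy is not dominated by the head sum. At such
  an index \<open>m\<close> the term \<open>2\<^sup>-\<^sup>m (\<A> m)\<^sup>2\<close> of the assumption amounts to at
  most half of the energy at \<open>m\<close> and is absorbed; descending in \<open>m\<close>, the tails of the
  energies with \<open>B\<close> are at most \<open>2 C0 \<Gamma>\<close>. These energies are therefore transported
  from the \<open>F j\<close> and controlled by \<open>tail_bound\<close>, the other ones by
  \<open>head_bound\<close>.
\<close>

lemma tail_sums_bound:
  assumes act: "active i0" and e_nn: "\<And>i. 0 \<le> \<epsilon> i" and C0: "1 \<le> C0"
    and e_tail: "\<And>m. m \<in> {lo..hi} \<Longrightarrow> (\<Sum>i = m..hi. \<epsilon> i) \<le> C0 * (dyad (- m) * (\<A> m)\<^sup>2 + \<Gamma> m)"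
    and lo_hi: "lo \<le> hi"
  shows "(\<Sum>i = lo..hi. wt i * v i * (dyad i * \<epsilon> i) powr (\<beta> / 2))
    \<le> (2 * C0 * (1 + 1 / c) + 2304 * (1 + 4 * C0 * C / c\<^sup>2)) * N"
proof -
  define B where "B i \<longleftrightarrow> 2 * C0 * (dyad (- i) * (\<A> i)\<^sup>2) < \<epsilon> i" for i
  define P where "P i = (if B i then \<epsilon> i else 0)" for i
  have P_nn: "0 \<le> P i" for i using e_nn by (simp add: P_def)
  have P_le: "P i \<le> \<epsilon> i" for i using e_nn by (simp add: P_def)
  have \<Gamma>_nn: "0 \<le> \<Gamma> m" for m by (rule \<Gamma>_nonneg[OF act])
  \<comment> \<open>Absorption: if \<open>B k\<close> holds, half of \<open>\<epsilon> k\<close> swallows the head term, and the tail at \<open>k\<close> starts with \<open>\<epsilon> k\<close>.\<close>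
  have P_tail: "(\<Sum>i = m..hi. P i) \<le> 2 * C0 * \<Gamma> m" if "lo \<le> m" "m \<le> hi + 1" for m
    using that(2,1)
  proof (induction m rule: int_le_induct)
    case base
    then show ?case using C0 \<Gamma>_nn by simp
  next
    case (step m)
    define k where "k = m - 1"
    have k: "lo \<le> k" "k \<le> hi" "m = k + 1" using step by (auto simp: k_def)
    have split: "{k..hi} = insert k {k + 1..hi}" using k by auto
    show ?case unfolding k_def[symmetric]
    proof (cases "B k")
      case False
      then have "(\<Sum>i = k..hi. P i) = (\<Sum>i = k + 1..hi. P i)" unfolding split by (simp add: P_def)
      also have "\<dots> \<le> 2 * C0 * \<Gamma> (k + 1)" using step k by auto
      also have "\<dots> \<le> 2 * C0 * \<Gamma> k" using C0 \<Gamma>_antimono[OF act, of k "k + 1"] by (intro mult_left_mono) auto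
      finally show "(\<Sum>i = k..hi. P i) \<le> 2 * C0 * \<Gamma> k" .
    next
      case True
      have "(\<Sum>i = k..hi. P i) \<le> (\<Sum>i = k..hi. \<epsilon> i)" by (intro sum_mono P_le)
      also have "\<dots> \<le> C0 * (dyad (- k) * (\<A> k)\<^sup>2 + \<Gamma> k)" using k by (intro e_tail) auto
      also have "\<dots> \<le> \<epsilon> k / 2 + C0 * \<Gamma> k" using True by (simp add: B_def algebra_simps)
      finally have "(\<Sum>i = k..hi. P i) \<le> \<epsilon> k / 2 + C0 * \<Gamma> k" .
      moreover have "\<epsilon> k \<le> (\<Sum>i = k..hi. P i)"
        unfolding split using True by (simp add: P_def sum_nonneg P_nn[unfolded P_def])
      ultimately show "(\<Sum>i = k..hi. P i) \<le> 2 * C0 * \<Gamma> k" by linarith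
    qed
  qed
  \<comment> \<open>The test functions involve finitely many scales; cutting the series at \<open>J\<close> loses at most half
    of its value.\<close>
  obtain J where J: "hi \<le> J" "\<And>m. m \<in> {lo..hi} \<Longrightarrow> \<Gamma> m \<le> 2 * (\<Sum>j = m..J. F j)"
  proof -
    have "\<exists>n. \<Gamma> m \<le> 2 * (\<Sum>l<n. F (m + int l))" for m
    proof (cases "\<Gamma> m = 0")
      case False
      then have "\<Gamma> m / 2 < \<Gamma> m" using \<Gamma>_nn[of m] by simp
      moreover have "(\<lambda>n. \<Sum>l<n. F (m + int l)) \<longlonglongrightarrow> \<Gamma> m"
        unfolding \<Gamma>_def by (rule summable_LIMSEQ[OF summable_F[OF act]])
      ultimately have "\<forall>\<^sub>F n in sequentially. \<Gamma> m / 2 < (\<Sum>l<n. F (m + int l))"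
        by (intro order_tendstoD)
      then obtain n where "\<Gamma> m / 2 < (\<Sum>l<n. F (m + int l))"
        by (auto simp: eventually_sequentially)
      then show ?thesis by (intro exI[of _ n]) simp
    qed (auto intro!: sum_nonneg)
    then obtain n where n: "\<And>m. \<Gamma> m \<le> 2 * (\<Sum>l<n m. F (m + int l))" by metis
    define J where "J = Max (insert hi ((\<lambda>m. m + int (n m)) ` {lo..hi}))"
    have "hi \<le> J" unfolding J_def by (intro Max_ge) auto
    moreover have "\<Gamma> m \<le> 2 * (\<Sum>j = m..J. F j)" if "m \<in> {lo..hi}" for m
    proof -
      have "m + int (n m) \<le> J" unfolding J_def using that by (intro Max_ge) auto
      then have "(\<Sum>j = m..m + int (n m) - 1. F j) \<le> (\<Sum>j = m..J. F j)"
        by (intro sum_mono2) auto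
      then show ?thesis using n[of m] unfolding sum_int_interval by simp
    qed
    ultimately show ?thesis by (rule that)
  qed
  have "\<exists>q. (\<forall>i j. 0 \<le> q i j) \<and> (\<forall>i j. j < i \<longrightarrow> q i j = 0) \<and>
     (\<forall>j\<in>{lo..J}. (\<Sum>i = lo..hi. q i j) \<le> F j) \<and> (\<forall>i\<in>{lo..hi}. (\<Sum>j = lo..J. q i j) = P i / (4 * C0))"
  proof (rule transport_exists)
    fix m assume m: "m \<in> {lo..hi}"
    have "(\<Sum>i = m..hi. P i) \<le> 2 * C0 * \<Gamma> m" using m by (intro P_tail) auto
    also have "\<dots> \<le> 2 * C0 * (2 * (\<Sum>j = m..J. F j))" using C0 J(2)[OF m] by (intro mult_left_mono) auto
    finally show "(\<Sum>i = m..hi. P i / (4 * C0)) \<le> (\<Sum>j = m..J. F j)"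
      using C0 by (simp add: field_simps flip: sum_divide_distrib)
  qed (use P_nn C0 J lo_hi in auto)
  then obtain q where q: "\<And>i j. 0 \<le> q i j" "\<And>i j. j < i \<Longrightarrow> q i j = 0"
    "\<And>j. j \<in> {lo..J} \<Longrightarrow> (\<Sum>i = lo..hi. q i j) \<le> F j"
    "\<And>i. i \<in> {lo..hi} \<Longrightarrow> (\<Sum>j = lo..J. q i j) = P i / (4 * C0)"
    by blast
  define R where "R = 4 * C0 * C / c\<^sup>2"
  have R: "0 < R" using C0 C_pos c_pos by (simp add: R_def)
  have powr_le: "x powr b \<le> 1 + x" if "0 < x" "0 < b" "b \<le> 1" for x b :: real
  proof (cases "x \<le> 1")
    case True
    then have "x powr b \<le> 1 powr b" using that by (intro powr_mono2) auto
    then show ?thesis using that by simp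
  next
    case False
    then have "x powr b \<le> x powr 1" using that by (intro powr_mono) auto
    then show ?thesis using that by simp
  qed
  have pw: "(dyad i * \<epsilon> i) powr (\<beta> / 2) \<le> 2 * C0 * (1 + 1 / c) * (c * \<A> i) powr \<beta>
      + (1 + R) * (c\<^sup>2 / C * dyad i * (\<Sum>j = lo..J. q i j)) powr (\<beta> / 2)" if i: "i \<in> {lo..hi}" for i
  proof (cases "B i")
    case True
    have "dyad i * \<epsilon> i = R * (c\<^sup>2 / C * dyad i * (\<Sum>j = lo..J. q i j))"
      using True C0 C_pos c_pos by (simp add: q(4)[OF i] P_def R_def)
    then have "(dyad i * \<epsilon> i) powr (\<beta> / 2) = R powr (\<beta> / 2) * (c\<^sup>2 / C * dyad i * (\<Sum>j = lo..J. q i j)) powr (\<beta> / 2)"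
      by (simp only: powr_mult)
    also have "\<dots> \<le> (1 + R) * (c\<^sup>2 / C * dyad i * (\<Sum>j = lo..J. q i j)) powr (\<beta> / 2)"
      using R \<beta> by (intro mult_right_mono powr_le) auto
    also have "\<dots> \<le> 2 * C0 * (1 + 1 / c) * (c * \<A> i) powr \<beta> + \<dots>"
      using C0 c_pos by simp
    finally show ?thesis .
  next
    case False
    have "dyad i * \<epsilon> i \<le> dyad i * (2 * C0 * (dyad (- i) * (\<A> i)\<^sup>2))"
      using False by (intro mult_left_mono) (auto simp: B_def)
    also have "\<dots> = 2 * C0 * (\<A> i)\<^sup>2"
      using less_imp_neq[OF dyad_pos, of i] by (simp add: dyad_minus field_simps)
    finally have "(dyad i * \<epsilon> i) powr (\<beta> / 2) \<le> (2 * C0 * (\<A> i)\<^sup>2) powr (\<beta> / 2)"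
      using \<beta> e_nn by (intro powr_mono2) auto
    also have "\<dots> = (2 * C0) powr (\<beta> / 2) * ((\<A> i)\<^sup>2) powr (\<beta> / 2)" by (rule powr_mult)
    also have "((\<A> i)\<^sup>2) powr (\<beta> / 2) = (\<A> i) powr \<beta>"
    proof (cases "\<A> i = 0")
      case False
      then have "(\<A> i)\<^sup>2 = \<A> i powr 2" using \<A>_nonneg[OF act, of i] by simp
      then show ?thesis by (simp add: powr_powr)
    qed simp
    also have "(\<A> i) powr \<beta> = (1 / c) powr \<beta> * (c * \<A> i) powr \<beta>"
      using c_pos by (simp add: powr_divide powr_mult)
    also have "(2 * C0) powr (\<beta> / 2) * ((1 / c) powr \<beta> * (c * \<A> i) powr \<beta>)
      \<le> (2 * C0) * ((1 + 1 / c) * (c * \<A> i) powr \<beta>)"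
    proof (intro mult_mono mult_right_mono)
      have "(2 * C0) powr (\<beta> / 2) \<le> (2 * C0) powr 1" using C0 \<beta> by (intro powr_mono) auto
      then show "(2 * C0) powr (\<beta> / 2) \<le> 2 * C0" using C0 by simp
      show "(1 / c) powr \<beta> \<le> 1 + 1 / c" using \<beta> c_pos by (intro powr_le) auto
    qed (use C0 c_pos in auto)
    also have "\<dots> \<le> 2 * C0 * (1 + 1 / c) * (c * \<A> i) powr \<beta>
      + (1 + R) * (c\<^sup>2 / C * dyad i * (\<Sum>j = lo..J. q i j)) powr (\<beta> / 2)"
      using R by simp
    finally show ?thesis .
  qed
  have "(\<Sum>i = lo..hi. wt i * v i * (dyad i * \<epsilon> i) powr (\<beta> / 2))
    \<le> (\<Sum>i = lo..hi. wt i * v i * (2 * C0 * (1 + 1 / c) * (c * \<A> i) powr \<beta>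
      + (1 + R) * (c\<^sup>2 / C * dyad i * (\<Sum>j = lo..J. q i j)) powr (\<beta> / 2)))"
    by (intro sum_mono mult_left_mono pw) auto
  also have "\<dots> = 2 * C0 * (1 + 1 / c) * (\<Sum>i = lo..hi. wt i * v i * (c * \<A> i) powr \<beta>)
     + (1 + R) * (\<Sum>i = lo..hi. wt i * v i * (c\<^sup>2 / C * dyad i * (\<Sum>j = lo..J. q i j)) powr (\<beta> / 2))"
    by (simp add: sum.distrib sum_distrib_left algebra_simps)
  also have "\<dots> \<le> 2 * C0 * (1 + 1 / c) * N + (1 + R) * (2304 * N)"
    using C0 c_pos R q by (intro add_mono mult_left_mono head_bound_limit[OF _ act] tail_bound) auto
  finally show ?thesis by (simp add: R_def algebra_simps)
qed

end

section \<open>Operators of joint strong type\<close>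

text \<open>
  Fatou's lemma for an eventual pointwise majorisation.
\<close>

lemma nn_integral_le_of_eventually:
  fixes u :: "'a \<Rightarrow> ennreal"
  assumes [measurable]: "\<And>n::nat. U n \<in> borel_measurable M"
    and le: "\<And>n. (\<integral>\<^sup>+x. U n x \<partial>M) \<le> B"
    and ev: "AE x in M. \<forall>\<^sub>F n in sequentially. u x \<le> U n x"
  shows "(\<integral>\<^sup>+x. u x \<partial>M) \<le> B"
proof -
  have "(\<integral>\<^sup>+x. u x \<partial>M) \<le> (\<integral>\<^sup>+x. liminf (\<lambda>n. U n x) \<partial>M)"
  proof (rule nn_integral_mono_AE)
    show "AE x in M. u x \<le> liminf (\<lambda>n. U n x)"
      using ev by eventually_elim (rule Liminf_bounded)
  qed
  also have "\<dots> \<le> liminf (\<lambda>n. \<integral>\<^sup>+x. U n x \<partial>M)" by (rule nn_integral_liminf) simp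
  also have "\<dots> \<le> liminf (\<lambda>n. B)" by (rule Liminf_mono) (simp add: le)
  also have "\<dots> = B" by (simp add: Liminf_const)
  finally show ?thesis .
qed

lemma ennreal_linear_combination:
  assumes "0 \<le> x" "0 \<le> y" "0 \<le> z" "0 \<le> t"
  shows "ennreal x * ennreal y + ennreal z * ennreal t = ennreal (x * y + z * t)"
  using assms by (simp add: ennreal_plus ennreal_mult)

text \<open>
  Hoelder's inequality on a set of finite measure, up to the factor \<open>2\<close>, by interpolation at the height
  of the root mean square.
\<close>

lemma nn_integral_powr_le_energy:
  fixes \<phi> :: "'b \<Rightarrow> real"
  assumes \<phi> [measurable]: "\<phi> \<in> borel_measurable M" and nn: "\<And>x. 0 \<le> \<phi> x"
    and Q [measurable]: "Q \<in> sets M" and Q_le: "emeasure M Q \<le> ennreal q" and q: "0 < q"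
    and energy: "(\<integral>\<^sup>+x. ennreal ((\<phi> x)\<^sup>2) * indicator Q x \<partial>M) = ennreal \<epsilon>" "0 \<le> \<epsilon>"
    and \<beta>: "0 < \<beta>" "\<beta> \<le> 2"
  shows "(\<integral>\<^sup>+x. ennreal (\<phi> x powr \<beta>) * indicator Q x \<partial>M) \<le> ennreal (2 * q * (\<epsilon> / q) powr (\<beta> / 2))"
proof (cases "\<epsilon> = 0")
  case True
  then have "(\<integral>\<^sup>+x. ennreal ((\<phi> x)\<^sup>2) * indicator Q x \<partial>M) = 0" using energy by simp
  then have "AE x in M. ennreal ((\<phi> x)\<^sup>2) * indicator Q x = 0"
    by (subst (asm) nn_integral_0_iff_AE) auto
  then have "AE x in M. ennreal (\<phi> x powr \<beta>) * indicator Q x = 0"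
    by eventually_elim (auto simp: ennreal_eq_0_iff indicator_def split: if_splits)
  then have "(\<integral>\<^sup>+x. ennreal (\<phi> x powr \<beta>) * indicator Q x \<partial>M) = 0"
    by (subst nn_integral_0_iff_AE) auto
  then show ?thesis by simp
next
  case False
  then have \<epsilon>: "0 < \<epsilon>" using energy by simp
  define l where "l = sqrt (\<epsilon> / q)"
  have l: "0 < l" "l\<^sup>2 = \<epsilon> / q" using \<epsilon> q by (auto simp: l_def)
  have "(\<integral>\<^sup>+x. ennreal (\<phi> x powr \<beta>) * indicator Q x \<partial>M)
     \<le> (\<integral>\<^sup>+x. ennreal (l powr \<beta>) * indicator Q x + ennreal (l powr (\<beta> - 2)) * (ennreal ((\<phi> x)\<^sup>2) * indicator Q x) \<partial>M)"
  proof (rule nn_integral_mono)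
    fix x
    have "ennreal (\<phi> x powr \<beta>) \<le> ennreal (l powr \<beta> + l powr (\<beta> - 2) * (\<phi> x)\<^sup>2)"
      using nn l \<beta> by (intro ennreal_leI powr_le_interpolate) auto
    then show "ennreal (\<phi> x powr \<beta>) * indicator Q x
       \<le> ennreal (l powr \<beta>) * indicator Q x + ennreal (l powr (\<beta> - 2)) * (ennreal ((\<phi> x)\<^sup>2) * indicator Q x)"
      by (auto simp: ennreal_plus ennreal_mult indicator_def)
  qed
  also have "\<dots> = ennreal (l powr \<beta>) * emeasure M Q + ennreal (l powr (\<beta> - 2)) * ennreal \<epsilon>"
    unfolding energy(1)[symmetric] by (simp add: nn_integral_add nn_integral_cmult)
  also have "\<dots> \<le> ennreal (l powr \<beta>) * ennreal q + ennreal (l powr (\<beta> - 2)) * ennreal \<epsilon>"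
    by (intro add_mono mult_left_mono Q_le) auto
  also have "\<dots> = ennreal (l powr \<beta> * q + l powr (\<beta> - 2) * \<epsilon>)"
    using q \<epsilon> by (simp add: ennreal_plus ennreal_mult)
  also have "l powr (\<beta> - 2) * \<epsilon> = l powr \<beta> * q"
  proof -
    have "l powr (\<beta> - 2) * \<epsilon> = l powr (\<beta> - 2) * l powr 2 * q" using l q by simp
    then show ?thesis by (simp only: powr_add[symmetric]) simp
  qed
  also have "l powr \<beta> = (\<epsilon> / q) powr (\<beta> / 2)"
    using \<epsilon> q by (simp add: l_def powr_half_sqrt[symmetric] powr_powr)
  finally show ?thesis by (simp add: algebra_simps)
qed

context rearranged_pair
begin

text \<open>The indices are reversed so that \<open>S i\<close> has measure at most \<open>2\<^sup>-\<^sup>i\<close>, matching the shell of index \<open>i\<close>.\<close>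

definition S :: "int \<Rightarrow> 'b set" where "S i = superlevel E h (- i)"

lemma S_sets [measurable]: "S i \<in> sets E" unfolding S_def by measurable

lemma S_le: "emeasure E (S i) \<le> ennreal (dyad (- i))"
  unfolding S_def by (rule emeasure_superlevel_le[OF h_measurable h_rearrangeable])

lemma S_antimono: "i \<le> j \<Longrightarrow> S j \<subseteq> S i"
  unfolding S_def by (intro superlevel_mono[OF h_rearrangeable]) simp

lemma cmod_h_le: "\<xi> \<in> space E \<Longrightarrow> \<xi> \<notin> S (i + 1) \<Longrightarrow> cmod (h \<xi>) \<le> wt i"
proof -
  have "- (i + 1) = - i - 1" by simp
  then show "\<xi> \<in> space E \<Longrightarrow> \<xi> \<notin> S (i + 1) \<Longrightarrow> cmod (h \<xi>) \<le> wt i"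
    unfolding S_def superlevel_def wt_def by (simp only:) simp
qed

lemma h_le_layers:
  assumes \<xi>: "\<xi> \<in> S (- int n)" "\<xi> \<notin> S (int n)"
  shows "\<exists>i\<in>{- int n..int n - 1}. \<xi> \<in> S i - S (i + 1) \<and> cmod (h \<xi>) \<le> wt i"
proof -
  define K where "K = {i \<in> {- int n..int n}. \<xi> \<in> S i}"
  have K: "finite K" by (rule finite_subset[of _ "{- int n..int n}"]) (auto simp: K_def)
  have "K \<noteq> {}" using \<xi>(1) by (auto simp: K_def)
  then have m: "Max K \<in> K" using K by (rule Max_in[rotated])
  have mn: "Max K < int n" using m \<xi>(2) by (auto simp: K_def order.order_iff_strict)
  have "Max K + 1 \<notin> K" using Max_ge[OF K, of "Max K + 1"] by auto
  then have "\<xi> \<notin> S (Max K + 1)" using m mn by (auto simp: K_def)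
  moreover have "\<xi> \<in> space E" using \<xi>(1) by (auto simp: S_def superlevel_def)
  ultimately show ?thesis using m mn cmod_h_le by (intro bexI[of _ "Max K"]) (auto simp: K_def)
qed

lemma AE_layers: "AE \<xi> in E. \<forall>\<^sub>F n in sequentially. h \<xi> = 0 \<or> \<xi> \<in> S (- int n) \<and> \<xi> \<notin> S (int n)"
  using AE_not_in_all_superlevels[OF h_measurable h_rearrangeable, of 0] AE_space
proof eventually_elim
  case (elim \<xi>)
  show ?case
  proof (cases "h \<xi> = 0")
    case False
    then have pos: "0 < cmod (h \<xi>) / 2" by simp
    have "emeasure E {x \<in> space E. cmod (h \<xi>) / 2 < cmod (h x)} \<le> emeasure E {x \<in> space E. h x \<noteq> 0}"
      using pos by (intro emeasure_mono) auto
    then have "emeasure E {x \<in> space E. cmod (h \<xi>) / 2 < cmod (h x)} < \<infinity>"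
      using h_support by (rule le_less_trans)
    from ex_level_le[OF pos this] obtain n0 where n0: "\<And>k. int n0 \<le> k \<Longrightarrow> level E h k \<le> cmod (h \<xi>) / 2" by blast
    obtain n1 :: nat where n1: "\<xi> \<notin> S (int n1)" using elim by (auto simp: S_def)
    have "\<xi> \<in> S (- int n) \<and> \<xi> \<notin> S (int n)" if "n \<ge> max n0 n1" for n
    proof
      have "level E h (int n) \<le> cmod (h \<xi>) / 2" using n0 that by simp
      then have "level E h (int n) < cmod (h \<xi>)" using pos by linarith
      then show "\<xi> \<in> S (- int n)" using elim by (simp add: S_def superlevel_def)
      show "\<xi> \<notin> S (int n)" using n1 S_antimono[of "int n1" "int n"] that by auto
    qed
    then show ?thesis unfolding eventually_sequentially by blast
  qed simp
qed

text \<open>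
  On the layer \<open>S i - S (i + 1)\<close> the weight is at most \<open>wt i\<close>, and Hoelder's inequality
  bounds the power integral by the energy of \<open>\<phi>\<close> on the layer. As \<open>wt i\<close> is also a
  lower bound for \<open>h\<degree>\<close> on a shell of comparable measure, the resulting sum is the one in
  \<open>tail_sums_bound\<close>.
\<close>

lemma power_integral_bound:
  fixes \<phi> :: "'b \<Rightarrow> real"
  assumes \<phi> [measurable]: "\<phi> \<in> borel_measurable E" and nn: "\<And>\<xi>. 0 \<le> \<phi> \<xi>" and C0: "1 \<le> C0"
    and energy: "\<And>i0 m. active i0 \<Longrightarrow>
      (\<integral>\<^sup>+\<xi>. ennreal ((\<phi> \<xi>)\<^sup>2) * indicator (S m) \<xi> \<partial>E) \<le> ennreal (C0 * (dyad (- m) * (\<A> m)\<^sup>2 + \<Gamma> m))"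
  shows "(\<integral>\<^sup>+\<xi>. ennreal (\<phi> \<xi> powr \<beta> * cmod (h \<xi>)) \<partial>E)
    \<le> ennreal (2 / c * ((2 * C0 * (1 + 1 / c) + 2304 * (1 + 4 * C0 * C / c\<^sup>2)) * N))"
proof -
  define Q where "Q i = S i - S (i + 1)" for i
  have Q_sets [measurable]: "Q i \<in> sets E" for i unfolding Q_def by measurable
  define \<epsilon> where "\<epsilon> i = enn2real (\<integral>\<^sup>+\<xi>. ennreal ((\<phi> \<xi>)\<^sup>2) * indicator (Q i) \<xi> \<partial>E)" for i
  define p where "p i = 2 / c * (wt i * v i * (dyad i * \<epsilon> i) powr (\<beta> / 2))" for i
  have p_nn: "0 \<le> p i" for i using c_pos by (simp add: p_def)
  have \<epsilon>_eq: "(\<integral>\<^sup>+\<xi>. ennreal ((\<phi> \<xi>)\<^sup>2) * indicator (Q i) \<xi> \<partial>E) = ennreal (\<epsilon> i)" if act: "active i0" for i i0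
  proof -
    have "(\<integral>\<^sup>+\<xi>. ennreal ((\<phi> \<xi>)\<^sup>2) * indicator (Q i) \<xi> \<partial>E) \<le> (\<integral>\<^sup>+\<xi>. ennreal ((\<phi> \<xi>)\<^sup>2) * indicator (S i) \<xi> \<partial>E)"
      by (intro nn_integral_mono) (auto simp: Q_def indicator_def)
    also have "\<dots> < \<infinity>" using energy[OF act, of i] by (rule le_less_trans) simp
    finally show ?thesis by (simp add: \<epsilon>_def)
  qed
  have layer: "ennreal (wt i) * (\<integral>\<^sup>+\<xi>. ennreal (\<phi> \<xi> powr \<beta>) * indicator (Q i) \<xi> \<partial>E) \<le> ennreal (p i)" for i
  proof (cases "wt i = 0 \<or> emeasure E (S i) = 0")
    case True
    then show ?thesis
    proof
      assume "emeasure E (S i) = 0"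
      then have "S i \<in> null_sets E" by auto
      then have "AE \<xi> in E. \<xi> \<notin> S i" by (rule AE_not_in)
      then have "AE \<xi> in E. ennreal (\<phi> \<xi> powr \<beta>) * indicator (Q i) \<xi> = 0"
        by eventually_elim (simp add: Q_def)
      then have "(\<integral>\<^sup>+\<xi>. ennreal (\<phi> \<xi> powr \<beta>) * indicator (Q i) \<xi> \<partial>E) = 0"
        by (subst nn_integral_0_iff_AE) auto
      then show ?thesis by simp
    qed simp
  next
    case False
    then have "\<not> degenerate E (- i - 1)"
      using degenerate_layer[OF h_measurable h_rearrangeable, of "- i - 1"] by (auto simp: wt_def S_def)
    from shell_large[OF this] have v: "c * dyad (- i) \<le> v i"
      unfolding emeasure_shell by simp
    have "0 < c * dyad (- i)" using c_pos by simp
    then have "0 < v i" using v by linarith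
    moreover have "0 < wt i" using False wt_nonneg[of i] by linarith
    ultimately have act: "active i" unfolding active_def by simp
    have "(\<integral>\<^sup>+\<xi>. ennreal (\<phi> \<xi> powr \<beta>) * indicator (Q i) \<xi> \<partial>E)
       \<le> ennreal (2 * dyad (- i) * (\<epsilon> i / dyad (- i)) powr (\<beta> / 2))"
    proof (rule nn_integral_powr_le_energy)
      show "emeasure E (Q i) \<le> ennreal (dyad (- i))"
        by (rule order.trans[OF emeasure_mono S_le]) (auto simp: Q_def)
    qed (use nn \<beta> \<epsilon>_eq[OF act] in \<open>auto simp: \<epsilon>_def\<close>)
    then have "ennreal (wt i) * (\<integral>\<^sup>+\<xi>. ennreal (\<phi> \<xi> powr \<beta>) * indicator (Q i) \<xi> \<partial>E)
      \<le> ennreal (wt i) * ennreal (2 * dyad (- i) * (\<epsilon> i / dyad (- i)) powr (\<beta> / 2))"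
      by (rule mult_left_mono) simp
    also have "\<dots> = ennreal (wt i * (2 * dyad (- i) * (\<epsilon> i / dyad (- i)) powr (\<beta> / 2)))"
      by (rule ennreal_mult[symmetric]) auto
    also have "\<dots> \<le> ennreal (p i)"
    proof (rule ennreal_leI)
      have "\<epsilon> i / dyad (- i) = dyad i * \<epsilon> i" by (simp add: dyad_minus field_simps)
      moreover have "dyad (- i) \<le> v i / c" using v c_pos by (simp add: field_simps)
      then have "wt i * (2 * dyad (- i) * (dyad i * \<epsilon> i) powr (\<beta> / 2))
         \<le> wt i * (2 * (v i / c) * (dyad i * \<epsilon> i) powr (\<beta> / 2))"
        by (intro mult_left_mono mult_right_mono) auto
      ultimately have "wt i * (2 * dyad (- i) * (\<epsilon> i / dyad (- i)) powr (\<beta> / 2))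
         \<le> wt i * (2 * (v i / c) * (dyad i * \<epsilon> i) powr (\<beta> / 2))"
        by (simp only:)
      then show "wt i * (2 * dyad (- i) * (\<epsilon> i / dyad (- i)) powr (\<beta> / 2)) \<le> p i"
        by (simp add: p_def field_simps)
    qed
    finally show ?thesis .
  qed
  have p_sum: "(\<Sum>i = - int n..int n - 1. p i)
     \<le> 2 / c * ((2 * C0 * (1 + 1 / c) + 2304 * (1 + 4 * C0 * C / c\<^sup>2)) * N)" for n
  proof (cases "(\<exists>i. active i) \<and> 0 < n")
    case True
    then obtain i0 where act: "active i0" by blast
    have "(\<Sum>i = - int n..int n - 1. wt i * v i * (dyad i * \<epsilon> i) powr (\<beta> / 2))
       \<le> (2 * C0 * (1 + 1 / c) + 2304 * (1 + 4 * C0 * C / c\<^sup>2)) * N"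
    proof (rule tail_sums_bound[OF act _ C0])
      fix m
      have disj: "disjoint_family_on Q {m..int n - 1}"
      proof -
        have "Q i \<inter> Q j = {}" if "i < j" for i j
          using S_antimono[of "i + 1" j] that by (auto simp: Q_def)
        then show ?thesis unfolding disjoint_family_on_def
          by (metis Int_commute linorder_neq_iff)
      qed
      have "ennreal (\<Sum>i = m..int n - 1. \<epsilon> i) = (\<Sum>i = m..int n - 1. ennreal (\<epsilon> i))"
        by (rule sum_ennreal[symmetric]) (simp add: \<epsilon>_def)
      also have "\<dots> = (\<integral>\<^sup>+\<xi>. (\<Sum>i = m..int n - 1. ennreal ((\<phi> \<xi>)\<^sup>2) * indicator (Q i) \<xi>) \<partial>E)"
        unfolding \<epsilon>_eq[OF act, symmetric] by (rule nn_integral_sum[symmetric]) measurable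
      also have "\<dots> \<le> (\<integral>\<^sup>+\<xi>. ennreal ((\<phi> \<xi>)\<^sup>2) * indicator (S m) \<xi> \<partial>E)"
      proof (rule nn_integral_mono)
        fix \<xi>
        have "(\<Sum>i = m..int n - 1. ennreal ((\<phi> \<xi>)\<^sup>2) * indicator (Q i) \<xi>)
           = ennreal ((\<phi> \<xi>)\<^sup>2) * indicator (\<Union>i\<in>{m..int n - 1}. Q i) \<xi>"
          by (subst indicator_UN_disjoint[OF _ disj]) (simp_all add: sum_distrib_left)
        also have "\<dots> \<le> ennreal ((\<phi> \<xi>)\<^sup>2) * indicator (S m) \<xi>"
        proof -
          have "(\<Union>i\<in>{m..int n - 1}. Q i) \<subseteq> S m" using S_antimono[of m] by (fastforce simp: Q_def)
          then show ?thesis by (intro mult_left_mono) (auto simp: indicator_def)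
        qed
        finally show "(\<Sum>i = m..int n - 1. ennreal ((\<phi> \<xi>)\<^sup>2) * indicator (Q i) \<xi>)
           \<le> ennreal ((\<phi> \<xi>)\<^sup>2) * indicator (S m) \<xi>" .
      qed
      also note energy[OF act]
      finally show "(\<Sum>i = m..int n - 1. \<epsilon> i) \<le> C0 * (dyad (- m) * (\<A> m)\<^sup>2 + \<Gamma> m)"
        using C0 \<Gamma>_nonneg[OF act, of m] by (subst (asm) ennreal_le_iff) auto
    qed (use True in \<open>auto simp: \<epsilon>_def\<close>)
    then show ?thesis unfolding p_def sum_distrib_left[symmetric] using c_pos by (intro mult_left_mono) auto
  next
    case False
    have "p i = 0" if "\<not> active i" for i
    proof -
      have "wt i * v i = 0" using that mult_nonneg_nonneg[OF wt_nonneg v_nonneg, of i i] unfolding active_def by linarith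
      then show ?thesis by (simp add: p_def)
    qed
    then have "(\<Sum>i = - int n..int n - 1. p i) = 0" using False by (intro sum.neutral) auto
    moreover have "0 \<le> 2 / c * ((2 * C0 * (1 + 1 / c) + 2304 * (1 + 4 * C0 * C / c\<^sup>2)) * N)"
      using c_pos C_pos C0 N_nonneg by (intro mult_nonneg_nonneg add_nonneg_nonneg divide_nonneg_nonneg) auto
    ultimately show ?thesis by simp
  qed
  show ?thesis
  proof (rule nn_integral_le_of_eventually[where U = "\<lambda>n \<xi>. \<Sum>i = - int n..int n - 1.
        ennreal (wt i) * (ennreal (\<phi> \<xi> powr \<beta>) * indicator (Q i) \<xi>)"])
    fix n
    have "(\<integral>\<^sup>+\<xi>. (\<Sum>i = - int n..int n - 1. ennreal (wt i) * (ennreal (\<phi> \<xi> powr \<beta>) * indicator (Q i) \<xi>)) \<partial>E)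
      = (\<Sum>i = - int n..int n - 1. ennreal (wt i) * (\<integral>\<^sup>+\<xi>. ennreal (\<phi> \<xi> powr \<beta>) * indicator (Q i) \<xi> \<partial>E))"
      by (subst nn_integral_sum) (auto simp: nn_integral_cmult)
    also have "\<dots> \<le> (\<Sum>i = - int n..int n - 1. ennreal (p i))" by (intro sum_mono layer)
    also have "\<dots> = ennreal (\<Sum>i = - int n..int n - 1. p i)" using p_nn by (rule sum_ennreal)
    also have "\<dots> \<le> ennreal (2 / c * ((2 * C0 * (1 + 1 / c) + 2304 * (1 + 4 * C0 * C / c\<^sup>2)) * N))"
      by (intro ennreal_leI p_sum)
    finally show "(\<integral>\<^sup>+\<xi>. (\<Sum>i = - int n..int n - 1. ennreal (wt i) * (ennreal (\<phi> \<xi> powr \<beta>) * indicator (Q i) \<xi>)) \<partial>E)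
      \<le> ennreal (2 / c * ((2 * C0 * (1 + 1 / c) + 2304 * (1 + 4 * C0 * C / c\<^sup>2)) * N))" .
  next
    show "AE \<xi> in E. \<forall>\<^sub>F n in sequentially. ennreal (\<phi> \<xi> powr \<beta> * cmod (h \<xi>))
       \<le> (\<Sum>i = - int n..int n - 1. ennreal (wt i) * (ennreal (\<phi> \<xi> powr \<beta>) * indicator (Q i) \<xi>))"
      using AE_layers
    proof eventually_elim
      case (elim \<xi>)
      then show ?case
      proof eventually_elim
        case (elim n)
        show ?case
        proof (cases "h \<xi> = 0")
          case False
          then obtain i where i: "i \<in> {- int n..int n - 1}" "\<xi> \<in> Q i" "cmod (h \<xi>) \<le> wt i"
            using h_le_layers[of \<xi> n] elim by (auto simp: Q_def)
          have "ennreal (\<phi> \<xi> powr \<beta> * cmod (h \<xi>)) \<le> ennreal (wt i * \<phi> \<xi> powr \<beta>)"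
            using i(3) by (intro ennreal_leI) (simp add: mult.commute mult_right_mono)
          also have "\<dots> = ennreal (wt i) * (ennreal (\<phi> \<xi> powr \<beta>) * indicator (Q i) \<xi>)"
            using i(2) by (simp add: ennreal_mult)
          also have "\<dots> \<le> (\<Sum>i = - int n..int n - 1. ennreal (wt i) * (ennreal (\<phi> \<xi> powr \<beta>) * indicator (Q i) \<xi>))"
            using i(1) by (intro member_le_sum) auto
          finally show ?thesis .
        qed simp
      qed
    qed
  qed measurable
qed

end

lemma ennreal_powr_1 [simp]: "ennreal_powr x 1 = x"
  by (cases x) (auto simp: ennreal_powr_def)

lemma Lp_norm_1: "Lp_norm M 1 f = (\<integral>\<^sup>+x. ennreal (cmod (f x)) \<partial>M)"
  by (simp add: Lp_norm_def)

lemma Lp_norm_2: "Lp_norm M 2 f = ennreal_powr (\<integral>\<^sup>+x. ennreal ((cmod (f x))\<^sup>2) \<partial>M) (1 / 2)"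
proof -
  have "cmod (f x) powr 2 = (cmod (f x))\<^sup>2" for x by (cases "f x = 0") auto
  then show ?thesis by (simp add: Lp_norm_def)
qed

lemma ennreal_powr_half_le:
  assumes "x \<le> ennreal (r\<^sup>2)" "0 \<le> r"
  shows "ennreal_powr x (1 / 2) \<le> ennreal r"
proof -
  obtain y where y: "x = ennreal y" "0 \<le> y" using assms(1) by (cases x) (auto simp: top_unique)
  then have "y \<le> r\<^sup>2" using assms by simp
  then have "sqrt y \<le> r" using assms(2) by (rule real_le_lsqrt[rotated])
  then show ?thesis using y by (simp add: ennreal_powr_def powr_half_sqrt ennreal_leI)
qed

lemma zero_in_Lp_space: "(\<lambda>x. 0) \<in> Lp_space M p"
  by (simp add: Lp_space_def Lp_norm_def ennreal_powr_def)

lemma L1_in_L1_plus_L2: "f \<in> Lp_space M 1 \<Longrightarrow> f \<in> L1_plus_L2 M"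
  unfolding L1_plus_L2_def using zero_in_Lp_space[of M 2] by force

lemma L2_in_L1_plus_L2: "f \<in> Lp_space M 2 \<Longrightarrow> f \<in> L1_plus_L2 M"
  unfolding L1_plus_L2_def using zero_in_Lp_space[of M 1] by force

lemma Lp_space_1_iff: "f \<in> Lp_space M 1 \<longleftrightarrow> integrable M f"
  by (auto simp: Lp_space_def Lp_norm_1 integrable_iff_bounded)

lemma Lp_space_2_integrable_square:
  assumes "g \<in> Lp_space M 2"
  shows "integrable M (\<lambda>x. (cmod (g x))\<^sup>2)"
proof (rule integrableI_bounded)
  show "(\<lambda>x. (cmod (g x))\<^sup>2) \<in> borel_measurable M"
    using assms by (auto simp: Lp_space_def)
  show "(\<integral>\<^sup>+x. ennreal (norm ((cmod (g x))\<^sup>2)) \<partial>M) < \<infinity>"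
    using assms by (cases "(\<integral>\<^sup>+x. ennreal ((cmod (g x))\<^sup>2) \<partial>M) = \<infinity>")
      (auto simp: Lp_space_def Lp_norm_2 ennreal_powr_def less_top)
qed

lemma Lp_space_2_integrable_on_finite:
  assumes g: "g \<in> Lp_space M 2" and B: "B \<in> sets M" "emeasure M B < \<infinity>"
  shows "integrable M (\<lambda>x. indicator B x * g x)"
proof (rule Bochner_Integration.integrable_bound)
  show "integrable M (\<lambda>x. indicator B x + (cmod (g x))\<^sup>2)"
    by (intro Bochner_Integration.integrable_add integrable_real_indicator B Lp_space_2_integrable_square g)
  have "g \<in> borel_measurable M" using g by (simp add: Lp_space_def)
  with B(1) show "(\<lambda>x. indicator B x * g x) \<in> borel_measurable M" by measurable
  have y: "y \<le> 1 + y\<^sup>2" for y :: real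
    using zero_le_power2[of "y - 1 / 2"] by (simp add: power2_eq_square algebra_simps)
  have "norm (indicator B x * g x) \<le> norm (indicator B x + (cmod (g x))\<^sup>2)" for x
    using y[of "cmod (g x)"] by (auto simp: norm_mult indicator_def)
  then show "AE x in M. norm (indicator B x * g x) \<le> norm (indicator B x + (cmod (g x))\<^sup>2)"
    by (intro AE_I2)
qed

text \<open>
  The constant of \<open>power_integral_bound\<close> for \<open>C0 = 64 K\<^sup>2\<close>, the factor in
  \<open>operator_energy\<close>.
\<close>

definition (in fourier_setting) extremal_const :: "real \<Rightarrow> real" where
  "extremal_const K = 2 / c * (2 * (64 * K\<^sup>2) * (1 + 1 / c) + 2304 * (1 + 4 * (64 * K\<^sup>2) * C / c\<^sup>2))"

context rearranged_pair
begin

text \<open>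
  The large part of \<open>f\<close> is mapped to a bounded function, whose energy on \<open>S m\<close> is limited by
  the measure of this set; the small part is mapped to \<open>L\<^sup>2\<close>.
\<close>

lemma operator_energy:
  assumes K: "1 \<le> K" and T: "sublinear_operator D E T" "joint_strong_type D E K T" and act: "active i"
  shows "(\<integral>\<^sup>+\<xi>. ennreal ((cmod (T f \<xi>))\<^sup>2) * indicator (S m) \<xi> \<partial>E)
    \<le> ennreal (64 * K\<^sup>2 * (dyad (- m) * (\<A> m)\<^sup>2 + \<Gamma> m))"
proof -
  let ?L = "superlevel D f m"
  define f1 where "f1 x = (if x \<in> ?L then f x else 0)" for x
  define f2 where "f2 x = (if x \<in> ?L then 0 else f x)" for x
  have L [measurable]: "?L \<in> sets D" by measurable
  have [measurable]: "f1 \<in> borel_measurable D" "f2 \<in> borel_measurable D"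
    unfolding f1_def[abs_def] f2_def[abs_def] by measurable
  have split: "f = (\<lambda>x. f1 x + f2 x)" by (auto simp: f1_def f2_def)
  define R where "R = 4 * \<A> m + 2 * a m * dyad m"
  have R_nn: "0 \<le> R" unfolding R_def using \<A>_nonneg[OF act, of m] by simp
  have \<Gamma>_nn: "0 \<le> \<Gamma> m" by (rule \<Gamma>_nonneg[OF act])
  have "(\<integral>\<^sup>+x. ennreal (cmod (f1 x)) \<partial>D) = (\<integral>\<^sup>+x. ennreal (cmod (f x)) * indicator ?L x \<partial>D)"
    by (intro nn_integral_cong) (simp add: f1_def)
  also have "\<dots> \<le> (\<Sum>l. ennreal (level D f (m - 1 - int l) * dyad (m - int l)))"
    by (rule nn_integral_superlevel_le[OF f_measurable f_rearrangeable])
  also have "\<dots> \<le> ennreal R" using large_part_le[OF act, of m] by (simp add: a_def R_def)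
  finally have f1_norm: "Lp_norm D 1 f1 \<le> ennreal R" by (simp add: Lp_norm_1)
  then have f1: "f1 \<in> Lp_space D 1" by (auto simp: Lp_space_def intro: le_less_trans)
  have "(\<integral>\<^sup>+x. ennreal ((cmod (f2 x))\<^sup>2) \<partial>D) = (\<integral>\<^sup>+x. ennreal ((cmod (f x))\<^sup>2) * indicator (space D - ?L) x \<partial>D)"
    by (intro nn_integral_cong) (simp add: f2_def)
  also have "\<dots> \<le> (\<Sum>l. ennreal ((level D f (m + int l))\<^sup>2 * dyad (m + int l + 1)))"
    by (rule nn_integral_sublevel_le[OF f_measurable f_rearrangeable f_finite])
  also have "\<dots> \<le> ennreal (4 * \<Gamma> m)" using small_part_le[OF act, of m] by (simp add: a_def)
  also have "4 * \<Gamma> m = (2 * sqrt (\<Gamma> m))\<^sup>2" using \<Gamma>_nn by (simp add: power_mult_distrib)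
  finally have f2_norm: "Lp_norm D 2 f2 \<le> ennreal (2 * sqrt (\<Gamma> m))"
    unfolding Lp_norm_2 using \<Gamma>_nn by (intro ennreal_powr_half_le) auto
  then have f2: "f2 \<in> Lp_space D 2" by (auto simp: Lp_space_def intro: le_less_trans)
  note mem = L1_in_L1_plus_L2[OF f1] L2_in_L1_plus_L2[OF f2]
  have [measurable]: "T f1 \<in> borel_measurable E" "T f2 \<in> borel_measurable E"
    using T(1) mem by (auto simp: sublinear_operator_def)
  have "Linf_norm E (T f1) \<le> ennreal K * Lp_norm D 1 f1" using T(2) f1 by (simp add: joint_strong_type_def)
  also have "\<dots> \<le> ennreal K * ennreal R" by (intro mult_left_mono f1_norm) simp
  also have "\<dots> = ennreal (K * R)" using K R_nn by (simp add: ennreal_mult)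
  finally have Linf: "Linf_norm E (T f1) \<le> ennreal (K * R)" .
  have T1: "AE \<xi> in E. cmod (T f1 \<xi>) \<le> K * R"
    using esssup_AE[where M = E and f = "\<lambda>\<xi>. ennreal (cmod (T f1 \<xi>))"]
  proof eventually_elim
    case (elim \<xi>)
    then have "ennreal (cmod (T f1 \<xi>)) \<le> ennreal (K * R)" using Linf unfolding Linf_norm_def by (rule order.trans)
    then show ?case using K R_nn by (subst (asm) ennreal_le_iff) auto
  qed
  have "Lp_norm E 2 (T f2) \<le> ennreal K * Lp_norm D 2 f2" using T(2) f2 by (simp add: joint_strong_type_def)
  also have "\<dots> \<le> ennreal K * ennreal (2 * sqrt (\<Gamma> m))" by (intro mult_left_mono f2_norm) simp
  also have "\<dots> = ennreal (K * (2 * sqrt (\<Gamma> m)))" using K \<Gamma>_nn by (simp add: ennreal_mult)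
  finally have "(\<integral>\<^sup>+\<xi>. ennreal ((cmod (T f2 \<xi>))\<^sup>2) \<partial>E) \<le> ennreal ((K * (2 * sqrt (\<Gamma> m)))\<^sup>2)"
    unfolding Lp_norm_2 using K \<Gamma>_nn by (intro ennreal_powr_square) auto
  also have "(K * (2 * sqrt (\<Gamma> m)))\<^sup>2 = 4 * K\<^sup>2 * \<Gamma> m" using \<Gamma>_nn by (simp add: power_mult_distrib)
  finally have T2: "(\<integral>\<^sup>+\<xi>. ennreal ((cmod (T f2 \<xi>))\<^sup>2) \<partial>E) \<le> ennreal (4 * K\<^sup>2 * \<Gamma> m)" .
  have sub: "AE \<xi> in E. cmod (T f \<xi>) \<le> cmod (T f1 \<xi>) + cmod (T f2 \<xi>)"
    unfolding split using T(1) mem by (simp add: sublinear_operator_def)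
  have "(\<integral>\<^sup>+\<xi>. ennreal ((cmod (T f \<xi>))\<^sup>2) * indicator (S m) \<xi> \<partial>E)
     \<le> (\<integral>\<^sup>+\<xi>. ennreal (2 * (K * R)\<^sup>2) * indicator (S m) \<xi> + ennreal 2 * ennreal ((cmod (T f2 \<xi>))\<^sup>2) \<partial>E)"
  proof (rule nn_integral_mono_AE)
    show "AE \<xi> in E. ennreal ((cmod (T f \<xi>))\<^sup>2) * indicator (S m) \<xi>
       \<le> ennreal (2 * (K * R)\<^sup>2) * indicator (S m) \<xi> + ennreal 2 * ennreal ((cmod (T f2 \<xi>))\<^sup>2)"
      using T1 sub
    proof eventually_elim
      case (elim \<xi>)
      have "(cmod (T f \<xi>))\<^sup>2 \<le> (K * R + cmod (T f2 \<xi>))\<^sup>2" using elim by (intro power_mono) auto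
      also have "\<dots> \<le> 2 * (K * R)\<^sup>2 + 2 * (cmod (T f2 \<xi>))\<^sup>2"
        using zero_le_power2[of "K * R - cmod (T f2 \<xi>)"] by (simp add: power2_eq_square algebra_simps)
      finally have "ennreal ((cmod (T f \<xi>))\<^sup>2) \<le> ennreal (2 * (K * R)\<^sup>2 + 2 * (cmod (T f2 \<xi>))\<^sup>2)"
        by (rule ennreal_leI)
      also have "\<dots> = ennreal (2 * (K * R)\<^sup>2) + ennreal 2 * ennreal ((cmod (T f2 \<xi>))\<^sup>2)"
        by (subst ennreal_mult[symmetric]) (auto simp: ennreal_plus)
      finally show ?case by (auto simp: indicator_def)
    qed
  qed
  also have "\<dots> = ennreal (2 * (K * R)\<^sup>2) * emeasure E (S m) + ennreal 2 * (\<integral>\<^sup>+\<xi>. ennreal ((cmod (T f2 \<xi>))\<^sup>2) \<partial>E)"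
    by (subst nn_integral_add) (auto simp: nn_integral_cmult nn_integral_cmult_indicator)
  also have "\<dots> \<le> ennreal (2 * (K * R)\<^sup>2) * ennreal (dyad (- m)) + ennreal 2 * ennreal (4 * K\<^sup>2 * \<Gamma> m)"
    by (intro add_mono mult_left_mono S_le T2) auto
  also have "\<dots> = ennreal (2 * (K * R)\<^sup>2 * dyad (- m) + 2 * (4 * K\<^sup>2 * \<Gamma> m))"
    using \<Gamma>_nn by (intro ennreal_linear_combination) auto
  also have "\<dots> \<le> ennreal (64 * K\<^sup>2 * (dyad (- m) * (\<A> m)\<^sup>2 + \<Gamma> m))"
  proof (rule ennreal_leI)
    have "R\<^sup>2 \<le> 2 * (4 * \<A> m)\<^sup>2 + 2 * (2 * a m * dyad m)\<^sup>2"
      using zero_le_power2[of "4 * \<A> m - 2 * a m * dyad m"] unfolding R_def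
      by (simp add: power2_eq_square algebra_simps)
    then have "R\<^sup>2 * dyad (- m) \<le> (2 * (4 * \<A> m)\<^sup>2 + 2 * (2 * a m * dyad m)\<^sup>2) * dyad (- m)"
      by (rule mult_right_mono) simp
    also have "\<dots> = 32 * (dyad (- m) * (\<A> m)\<^sup>2) + 8 * ((a m)\<^sup>2 * dyad m)"
      using less_imp_neq[OF dyad_pos, of m] by (simp add: dyad_minus field_simps power2_eq_square)
    also have "\<dots> \<le> 32 * (dyad (- m) * (\<A> m)\<^sup>2) + 8 * \<Gamma> m"
      using a_square_le_\<Gamma>[OF act, of m] by simp
    finally have "K\<^sup>2 * (R\<^sup>2 * dyad (- m)) \<le> K\<^sup>2 * (32 * (dyad (- m) * (\<A> m)\<^sup>2) + 8 * \<Gamma> m)"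
      by (rule mult_left_mono) simp
    then show "2 * (K * R)\<^sup>2 * dyad (- m) + 2 * (4 * K\<^sup>2 * \<Gamma> m) \<le> 64 * K\<^sup>2 * (dyad (- m) * (\<A> m)\<^sup>2 + \<Gamma> m)"
      using mult_nonneg_nonneg[OF zero_le_power2[of K] \<Gamma>_nn] by (simp add: power_mult_distrib algebra_simps)
  qed
  finally show ?thesis .
qed

theorem operator_power_integral:
  assumes K: "1 \<le> K" and T: "sublinear_operator D E T" "joint_strong_type D E K T" and f: "f \<in> L1_plus_L2 D"
  shows "(\<integral>\<^sup>+\<xi>. ennreal (cmod (T f \<xi>) powr \<beta> * cmod (h \<xi>)) \<partial>E) \<le> ennreal (extremal_const K * N)"
proof -
  have "T f \<in> borel_measurable E" using T(1) f by (simp add: sublinear_operator_def)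
  then have "(\<integral>\<^sup>+\<xi>. ennreal (cmod (T f \<xi>) powr \<beta> * cmod (h \<xi>)) \<partial>E)
    \<le> ennreal (2 / c * ((2 * (64 * K\<^sup>2) * (1 + 1 / c) + 2304 * (1 + 4 * (64 * K\<^sup>2) * C / c\<^sup>2)) * N))"
  proof (intro power_integral_bound)
    have "1 \<le> K\<^sup>2" using K by simp
    then show "1 \<le> 64 * K\<^sup>2" by linarith
  qed (use operator_energy[OF K T] in auto)
  then show ?thesis unfolding extremal_const_def by (simp only: mult.assoc)
qed

end

section \<open>Duality with admissible functionals\<close>

text \<open>
  Chebyshev's inequality for each summand at half the height.
\<close>

lemma L1_plus_L2_superlevel:
  assumes f: "f \<in> L1_plus_L2 M"
  shows "f \<in> borel_measurable M"
    and "\<exists>A B. 0 \<le> A \<and> 0 \<le> B \<and> (\<forall>l>0. emeasure M {x \<in> space M. l < cmod (f x)} \<le> ennreal (A / l + B / l\<^sup>2))"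
proof -
  obtain g h where gh: "f = (\<lambda>x. g x + h x)" "g \<in> Lp_space M 1" "h \<in> Lp_space M 2"
    using f by (auto simp: L1_plus_L2_def)
  have [measurable]: "g \<in> borel_measurable M" "h \<in> borel_measurable M" using gh by (auto simp: Lp_space_def)
  show "f \<in> borel_measurable M" unfolding gh(1) by measurable
  obtain A where A: "(\<integral>\<^sup>+x. ennreal (cmod (g x)) \<partial>M) = ennreal A" "0 \<le> A"
    using gh(2) by (cases "\<integral>\<^sup>+x. ennreal (cmod (g x)) \<partial>M") (auto simp: Lp_space_def Lp_norm_1)
  obtain B where B: "(\<integral>\<^sup>+x. ennreal ((cmod (h x))\<^sup>2) \<partial>M) = ennreal B" "0 \<le> B"
    using gh(3) by (cases "\<integral>\<^sup>+x. ennreal ((cmod (h x))\<^sup>2) \<partial>M") (auto simp: Lp_space_def Lp_norm_2 ennreal_powr_def)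
  have "emeasure M {x \<in> space M. l < cmod (f x)} \<le> ennreal (2 * A / l + 4 * B / l\<^sup>2)" if l: "0 < l" for l
  proof -
    have "emeasure M {x \<in> space M. l < cmod (f x)} = (\<integral>\<^sup>+x. indicator {x \<in> space M. l < cmod (f x)} x \<partial>M)"
      unfolding gh(1) by (intro nn_integral_indicator[symmetric]) measurable
    also have "\<dots> \<le> (\<integral>\<^sup>+x. ennreal (2 / l) * ennreal (cmod (g x)) + ennreal (4 / l\<^sup>2) * ennreal ((cmod (h x))\<^sup>2) \<partial>M)"
    proof (rule nn_integral_mono)
      fix x
      show "indicator {x \<in> space M. l < cmod (f x)} x
        \<le> ennreal (2 / l) * ennreal (cmod (g x)) + ennreal (4 / l\<^sup>2) * ennreal ((cmod (h x))\<^sup>2)"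
      proof (cases "l < cmod (f x)")
        case True
        have "1 \<le> 2 / l * cmod (g x) + 4 / l\<^sup>2 * (cmod (h x))\<^sup>2"
        proof (cases "l / 2 \<le> cmod (g x)")
          case True
          then have "1 \<le> 2 / l * cmod (g x)" using l by (simp add: field_simps)
          then show ?thesis by (simp add: add_increasing2)
        next
          case False
          then have "l / 2 \<le> cmod (h x)"
            using \<open>l < cmod (f x)\<close> norm_triangle_ineq[of "g x" "h x"] by (simp add: gh(1))
          then have "(l / 2)\<^sup>2 \<le> (cmod (h x))\<^sup>2" using l by (intro power_mono) auto
          then have "1 \<le> 4 / l\<^sup>2 * (cmod (h x))\<^sup>2" using l by (simp add: field_simps power2_eq_square)
          then show ?thesis using l by (simp add: add_increasing)
        qed
        then have "ennreal 1 \<le> ennreal (2 / l * cmod (g x) + 4 / l\<^sup>2 * (cmod (h x))\<^sup>2)" by (rule ennreal_leI)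
        also have "\<dots> = ennreal (2 / l) * ennreal (cmod (g x)) + ennreal (4 / l\<^sup>2) * ennreal ((cmod (h x))\<^sup>2)"
          using l by (intro ennreal_linear_combination[symmetric]) auto
        finally show ?thesis by (auto simp: indicator_def)
      qed simp
    qed
    also have "\<dots> = ennreal (2 / l) * ennreal A + ennreal (4 / l\<^sup>2) * ennreal B"
      unfolding A(1)[symmetric] B(1)[symmetric] by (subst nn_integral_add) (auto simp: nn_integral_cmult)
    also have "\<dots> = ennreal (2 / l * A + 4 / l\<^sup>2 * B)"
      using l A B by (intro ennreal_linear_combination) auto
    finally show ?thesis by simp
  qed
  then show "\<exists>A B. 0 \<le> A \<and> 0 \<le> B \<and> (\<forall>l>0. emeasure M {x \<in> space M. l < cmod (f x)} \<le> ennreal (A / l + B / l\<^sup>2))"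
    using A(2) B(2) by (intro exI[of _ "2 * A"] exI[of _ "4 * B"]) auto
qed

lemma L1_plus_L2_finite:
  assumes f: "f \<in> L1_plus_L2 M" and l: "0 < l"
  shows "emeasure M {x \<in> space M. l < cmod (f x)} < \<infinity>"
proof -
  obtain A B where "emeasure M {x \<in> space M. l < cmod (f x)} \<le> ennreal (A / l + B / l\<^sup>2)"
    using L1_plus_L2_superlevel(2)[OF f] l by blast
  then show ?thesis by (rule le_less_trans) simp
qed

lemma L1_plus_L2_rearrangeable:
  assumes f: "f \<in> L1_plus_L2 M"
  shows "rearrangeable M f"
  unfolding rearrangeable_def
proof (intro allI impI)
  fix t :: real assume t: "0 < t"
  obtain A B where AB: "0 \<le> A" "0 \<le> B"
    "\<And>l. 0 < l \<Longrightarrow> emeasure M {x \<in> space M. l < cmod (f x)} \<le> ennreal (A / l + B / l\<^sup>2)"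
    using L1_plus_L2_superlevel(2)[OF f] by blast
  define l where "l = 1 + (A + B) / t"
  have l: "1 \<le> l" using AB t by (simp add: l_def)
  have "B / l\<^sup>2 \<le> B / l" using l AB by (intro divide_left_mono) (auto simp: power2_eq_square)
  then have "A / l + B / l\<^sup>2 \<le> (A + B) / l" by (simp add: add_divide_distrib)
  also have "\<dots> \<le> t" using l t by (simp add: l_def field_simps)
  finally have "emeasure M {x \<in> space M. l < cmod (f x)} \<le> ennreal t"
    using AB(3)[of l] l by (meson ennreal_leI less_le_trans order.trans zero_less_one)
  moreover have "{x \<in> space M. ennreal l < ennreal (cmod (f x))} = {x \<in> space M. l < cmod (f x)}"
    using l by (auto simp: ennreal_less_iff)
  ultimately have "decr_rearr M f t \<le> ennreal l" by (intro decr_rearr_le) simp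
  then show "decr_rearr M f t < \<infinity>" by (rule le_less_trans) simp
qed

text \<open>
  The functional \<open>X\<close> need not be homogeneous, so the function is normalised inside \<open>X\<close>.
\<close>

lemma nn_integral_le_associate:
  assumes [measurable]: "F \<in> borel_measurable M" and P: "0 < P"
    and X: "X (\<lambda>y. complex_of_real (cmod (complex_of_real (1 / P) * F y) powr \<beta>)) \<le> 1"
    and [measurable]: "h \<in> borel_measurable M"
  shows "(\<integral>\<^sup>+y. ennreal (cmod (F y) powr \<beta> * cmod (h y)) \<partial>M) \<le> ennreal (P powr \<beta>) * associate M X h"
proof -
  let ?g = "\<lambda>y. complex_of_real (cmod (complex_of_real (1 / P) * F y) powr \<beta>)"
  have "(\<integral>\<^sup>+y. ennreal (cmod (F y) powr \<beta> * cmod (h y)) \<partial>M)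
     = (\<integral>\<^sup>+y. ennreal (P powr \<beta>) * ennreal (cmod (h y * ?g y)) \<partial>M)"
    using P by (intro nn_integral_cong, subst ennreal_mult[symmetric])
      (auto simp: norm_mult norm_divide powr_divide mult_ac)
  also have "\<dots> = ennreal (P powr \<beta>) * (\<integral>\<^sup>+y. ennreal (cmod (h y * ?g y)) \<partial>M)"
    by (rule nn_integral_cmult) measurable
  also have "\<dots> \<le> ennreal (P powr \<beta>) * associate M X h"
    unfolding associate_def using X by (intro mult_left_mono SUP_upper) auto
  finally show ?thesis .
qed

lemma power_norm_le_1:
  assumes "power_norm X \<beta> F \<le> 1" "0 < \<beta>"
  shows "X (\<lambda>y. complex_of_real (cmod (F y) powr \<beta>)) \<le> 1"
proof -
  define x where "x = X (\<lambda>y. complex_of_real (cmod (F y) powr \<beta>))"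
  have *: "ennreal_powr x (1 / \<beta>) \<le> 1" using assms by (simp add: power_norm_def x_def)
  then obtain r where r: "x = ennreal r" "0 \<le> r"
    by (cases x) (auto simp: ennreal_powr_def top_unique)
  then have "r powr (1 / \<beta>) \<le> 1" using * by (simp add: ennreal_powr_def)
  then have "(r powr (1 / \<beta>)) powr \<beta> \<le> 1 powr \<beta>" using assms by (intro powr_mono2) auto
  then show ?thesis using r assms by (simp add: x_def[symmetric] powr_powr)
qed

lemma associate_mono:
  assumes "\<And>y. y \<in> space M \<Longrightarrow> cmod (h y) \<le> cmod (k y)"
  shows "associate M X h \<le> associate M X k"
  unfolding associate_def
proof (rule SUP_mono)
  fix g assume g: "g \<in> {g \<in> borel_measurable M. X g \<le> 1}"
  show "\<exists>g'\<in>{g \<in> borel_measurable M. X g \<le> 1}.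
     (\<integral>\<^sup>+y. ennreal (cmod (h y * g y)) \<partial>M) \<le> (\<integral>\<^sup>+y. ennreal (cmod (k y * g' y)) \<partial>M)"
    using g assms by (intro bexI[of _ g] nn_integral_mono) (auto simp: norm_mult intro!: ennreal_leI mult_right_mono)
qed

text \<open>
  Condition (i) of left-admissibility turns a bound for all pairings with the unit ball of the associate space into a
  bound for \<open>X\<close>.
\<close>

lemma power_norm_le_of_dual:
  assumes X: "left_admissible M \<rho> X" and [measurable]: "F \<in> borel_measurable M" and \<beta>: "0 < \<beta>"
    and P: "0 \<le> P"
    and dual: "\<And>h. h \<in> borel_measurable M \<Longrightarrow> associate M X h \<le> 1 \<Longrightarrow>
      (\<integral>\<^sup>+y. ennreal (cmod (F y) powr \<beta> * cmod (h y)) \<partial>M) \<le> ennreal (P powr \<beta>)"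
  shows "power_norm X \<beta> F \<le> ennreal P"
proof -
  let ?F = "\<lambda>y. complex_of_real (cmod (F y) powr \<beta>)"
  have le: "associate M (associate M X) ?F \<le> ennreal (P powr \<beta>)"
    unfolding associate_def[of M "associate M X"]
    using dual by (intro SUP_least) (auto simp: norm_mult)
  then have "associate M (associate M X) ?F < \<infinity>" by (rule le_less_trans) simp
  moreover have "?F \<in> borel_measurable M" by measurable
  ultimately have "X ?F = associate M (associate M X) ?F"
    using X unfolding left_admissible_def by blast
  then have "X ?F \<le> ennreal (P powr \<beta>)" using le by simp
  then obtain r where r: "X ?F = ennreal r" "0 \<le> r" by (cases "X ?F") (auto simp: top_unique)
  then have "r \<le> P powr \<beta>" using \<open>X ?F \<le> _\<close> by simp
  then have "r powr (1 / \<beta>) \<le> (P powr \<beta>) powr (1 / \<beta>)" using r \<beta> by (intro powr_mono2) auto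
  then show ?thesis using r \<beta> P by (simp add: power_norm_def ennreal_powr_def powr_powr ennreal_leI)
qed

text \<open>
  Scalars and bounded factors act on \<open>Y\<close> as multipliers; this replaces homogeneity.
\<close>

lemma right_admissible_mult_le:
  assumes Y: "right_admissible M \<rho> Y" and G: "G \<in> borel_measurable M" "Y G < \<infinity>"
    and m: "m \<in> borel_measurable M" "\<And>x. x \<in> space M \<Longrightarrow> cmod (m x) \<le> s" and s: "0 \<le> s"
  shows "Y (\<lambda>x. m x * G x) \<le> Y G * ennreal s"
proof -
  have *: "Linf_norm M m \<le> ennreal s"
    unfolding Linf_norm_def using m by (intro esssup_I) (auto intro!: AE_I2 ennreal_leI)
  then have "Linf_norm M m < \<infinity>" by (rule le_less_trans) simp
  with Y G m(1) have "Y (\<lambda>x. m x * G x) \<le> Y G * Linf_norm M m"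
    unfolding right_admissible_def by blast
  also have "\<dots> \<le> Y G * ennreal s" by (intro mult_left_mono *) simp
  finally show ?thesis .
qed

lemma ennreal_mult_inverse_le_1:
  assumes "y \<le> ennreal P" "0 < P" shows "y * ennreal (1 / P) \<le> 1"
proof -
  have "y * ennreal (1 / P) \<le> ennreal P * ennreal (1 / P)" by (intro mult_right_mono assms) simp
  also have "\<dots> = 1" using assms(2) by (simp add: ennreal_mult[symmetric])
  finally show ?thesis .
qed

text \<open>
  Estimates by \<open>C\<^sub>1 * y\<close> are proved for finite positive upper bounds \<open>P\<close> of this
  product, which can serve as divisors. The product may also be zero, whence the passage to the limit, or infinite.
\<close>

lemma le_ennreal_mult_of_finite_bounds:
  assumes C1: "0 < C\<^sub>1" and c: "0 < c"
    and le: "\<And>P. 0 < P \<Longrightarrow> C\<^sub>1 * y \<le> ennreal P \<Longrightarrow> y < \<infinity> \<Longrightarrow> z \<le> ennreal (c * P)"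
  shows "z \<le> ennreal c * C\<^sub>1 * y"
proof (cases "C\<^sub>1 * y = \<infinity>")
  case True
  then show ?thesis using c by (simp add: mult.assoc ennreal_mult_top)
next
  case False
  then have y: "y < \<infinity>" using C1 by (cases "y = \<infinity>") (auto simp: ennreal_mult_top less_top zero_less_iff_neq_zero)
  obtain p where p: "C\<^sub>1 * y = ennreal p" "0 \<le> p" using False by (cases "C\<^sub>1 * y") auto
  have "z \<le> ennreal (c * p)"
  proof (rule ennreal_le_epsilon)
    fix e :: real assume e: "0 < e"
    have "z \<le> ennreal (c * (p + e / c))" using p e c y by (intro le) (auto intro!: ennreal_leI add_nonneg_pos)
    also have "c * (p + e / c) = c * p + e" using c by (simp add: field_simps)
    also have "ennreal (c * p + e) = ennreal (c * p) + ennreal e" using c p e by (intro ennreal_plus) auto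
    finally show "z \<le> ennreal (c * p) + ennreal e" .
  qed
  then show ?thesis using p c by (simp add: mult.assoc ennreal_mult)
qed

context fourier_setting
begin

text \<open>
  A function below \<open>f\<degree>\<close> is a multiplier of modulus at most one times \<open>f\<degree>\<close>,
  so right-admissibility bounds \<open>Y\<close> at this function by \<open>Y f\<close>. The bound for its transform
  is then paired with \<open>h\<close>.
\<close>

lemma fourier_bound_pairing:
  assumes X: "left_admissible E \<rho>E X" and Y: "right_admissible D \<rho>D Y"
    and \<beta>: "0 < \<beta>" and FB: "fourier_bound D FT X Y \<beta> C\<^sub>1"
    and f: "f \<in> borel_measurable D" "rearrangeable D f" "Y f < \<infinity>"
    and P: "0 < P" "C\<^sub>1 * Y f \<le> ennreal P"
    and h [measurable]: "h \<in> borel_measurable E"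
    and g: "integrable D g" "\<And>x. x \<in> space D \<Longrightarrow> cmod (g x) \<le> enn2real (decr_rearr D f (\<rho>D x))"
  shows "(\<integral>\<^sup>+\<xi>. ennreal (cmod (FT g \<xi>) powr \<beta> * cmod (h \<xi>)) \<partial>E) \<le> ennreal (P powr \<beta>) * associate E X h"
proof -
  define fo where "fo x = enn2real (decr_rearr D f (\<rho>D x))" for x
  have [measurable]: "fo \<in> borel_measurable D"
    unfolding fo_def[abs_def] by (rule sym_rearr_measurable[OF f(2) \<rho>D_measurable])
  have [measurable]: "g \<in> borel_measurable D" using g(1) by auto
  have sym: "sym_rearr D \<rho>D f = (\<lambda>x. complex_of_real (fo x))"
    by (simp add: sym_rearr_def[abs_def] fo_def)
  have "Y (sym_rearr D \<rho>D f) \<le> Y f" using Y f unfolding right_admissible_def by blast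
  then have Yfo: "Y (\<lambda>x. complex_of_real (fo x)) \<le> Y f" unfolding sym .
  \<comment> \<open>\<open>Y\<close> may depend on values outside the space. Setting the function to zero there makes it exactly equal to the
    product of \<open>f\<degree>\<close> with a multiplier.\<close>
  define G where "G x = (if x \<in> space D then complex_of_real (1 / P) * g x else 0)" for x
  define m where "m x = G x / complex_of_real (fo x)" for x
  have fo_nn: "0 \<le> fo x" for x by (simp add: fo_def)
  have G_meas [measurable]: "G \<in> borel_measurable D"
    by (subst measurable_cong[of D _ "\<lambda>x. complex_of_real (1 / P) * g x"]) (auto simp: G_def)
  have m_meas: "m \<in> borel_measurable D" unfolding m_def[abs_def] by measurable
  have m_le: "cmod (m x) \<le> 1 / P" if x: "x \<in> space D" for x
    using g(2)[OF x] fo_nn[of x] P x unfolding fo_def[symmetric] m_def G_def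
    by (cases "fo x = 0") (auto simp: norm_divide norm_mult field_simps)
  have g_0: "g x = 0" if "x \<in> space D" "fo x = 0" for x
    using g(2)[OF that(1)] that(2) by (simp add: fo_def)
  have G_eq: "G = (\<lambda>x. m x * complex_of_real (fo x))"
    using g_0 by (auto simp: m_def G_def fun_eq_iff)
  have "Y G \<le> Y (\<lambda>x. complex_of_real (fo x)) * ennreal (1 / P)"
    unfolding G_eq
  proof (rule right_admissible_mult_le[OF Y])
    show "Y (\<lambda>x. complex_of_real (fo x)) < \<infinity>" using Yfo f(3) by (rule le_less_trans)
  qed (use m_meas m_le P in auto)
  also have "\<dots> \<le> Y f * ennreal (1 / P)" by (intro mult_right_mono Yfo) simp
  finally have YG: "Y G \<le> Y f * ennreal (1 / P)" .
  have G_int: "integrable D G"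
    by (subst Bochner_Integration.integrable_cong[of D D _ "\<lambda>x. complex_of_real (1 / P) * g x"])
      (use g(1) in \<open>auto simp: G_def\<close>)
  have FT_G: "FT G = (\<lambda>\<xi>. complex_of_real (1 / P) * FT g \<xi>)"
  proof
    fix \<xi>
    have "FT G \<xi> = FT (\<lambda>x. complex_of_real (1 / P) * g x) \<xi>"
      unfolding FT_def by (intro Bochner_Integration.integral_cong) (auto simp: G_def)
    then show "FT G \<xi> = complex_of_real (1 / P) * FT g \<xi>" by (simp only: FT_scale)
  qed
  have "power_norm X \<beta> (FT G) \<le> C\<^sub>1 * Y G"
    using FB G_int by (simp add: fourier_bound_def Lp_space_1_iff)
  also have "\<dots> \<le> C\<^sub>1 * (Y f * ennreal (1 / P))" by (intro mult_left_mono YG) simp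
  also have "\<dots> = (C\<^sub>1 * Y f) * ennreal (1 / P)" by (simp only: mult.assoc)
  also have "\<dots> \<le> 1" by (rule ennreal_mult_inverse_le_1[OF P(2,1)])
  finally have "power_norm X \<beta> (FT G) \<le> 1" .
  from power_norm_le_1[OF this \<beta>] show ?thesis
    unfolding FT_G by (intro nn_integral_le_associate[OF _ P(1)] FT_measurable g(1)) auto
qed

text \<open>
  By duality it suffices to pair \<open>\<bar>T f\<bar>\<^sup>\<beta>\<close> with \<open>h\<close> in the unit ball
  of the associate space. The truncations \<open>hn\<close> and their symmetric rearrangements stay in this ball, by
  condition (ii) of left-admissibility, so each \<open>hn\<close> forms with \<open>f\<close> a pair to which
  \<open>operator_power_integral\<close> applies.
\<close>

theorem operator_bound_of_fourier_bound:
  assumes X: "left_admissible E \<rho>E X" and Y: "right_admissible D \<rho>D Y"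
    and \<beta>: "0 < \<beta>" "\<beta> \<le> 1" and K: "1 \<le> K" and C1: "0 < C\<^sub>1" and FB: "fourier_bound D FT X Y \<beta> C\<^sub>1"
  shows "operator_bound D E K X Y \<beta> (ennreal (extremal_const K powr (1 / \<beta>)) * C\<^sub>1)"
  unfolding operator_bound_def
proof (intro ballI allI impI)
  fix f T assume f: "f \<in> L1_plus_L2 D" and T: "sublinear_operator D E T" "joint_strong_type D E K T"
  have f_meas: "f \<in> borel_measurable D" by (rule L1_plus_L2_superlevel(1)[OF f])
  have Tf [measurable]: "T f \<in> borel_measurable E" using T(1) f by (simp add: sublinear_operator_def)
  have const: "0 < extremal_const K"
  proof -
    define p q where "p = 2 * (64 * K\<^sup>2) * (1 + 1 / c)" and "q = 4 * (64 * K\<^sup>2) * C / c\<^sup>2"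
    have "0 \<le> p" "0 \<le> q"
      using c_pos C_pos by (auto simp: p_def q_def intro!: mult_nonneg_nonneg divide_nonneg_nonneg)
    then have "0 < p + 2304 * (1 + q)" by (simp add: add_nonneg_pos add_pos_nonneg)
    then show ?thesis unfolding extremal_const_def p_def[symmetric] q_def[symmetric] using c_pos by simp
  qed
  show "power_norm X \<beta> (T f) \<le> ennreal (extremal_const K powr (1 / \<beta>)) * C\<^sub>1 * Y f"
  proof (rule le_ennreal_mult_of_finite_bounds[OF C1])
    fix P assume P: "0 < P" "C\<^sub>1 * Y f \<le> ennreal P" and Yf: "Y f < \<infinity>"
    show "power_norm X \<beta> (T f) \<le> ennreal (extremal_const K powr (1 / \<beta>) * P)"
    proof (rule power_norm_le_of_dual[OF X Tf \<beta>(1)])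
      fix h assume h [measurable]: "h \<in> borel_measurable E" and h1: "associate E X h \<le> 1"
      obtain A :: "nat \<Rightarrow> 'b set" where A: "range A \<subseteq> sets E" "(\<Union>i. A i) = space E"
        "\<And>i. emeasure E (A i) \<noteq> \<infinity>" "incseq A"
        using sigma_finite_measure.sigma_finite_incseq[OF sigma_finite_E] by metis
      have [measurable]: "A n \<in> sets E" for n using A(1) by auto
      define hn where "hn n y = complex_of_real (min (cmod (h y)) (real n)) * indicator (A n) y" for n y
      have hn_meas [measurable]: "hn n \<in> borel_measurable E" for n
        unfolding hn_def[abs_def] by measurable
      have bound: "(\<integral>\<^sup>+\<xi>. ennreal (cmod (T f \<xi>) powr \<beta> * cmod (hn n \<xi>)) \<partial>E) \<le> ennreal (extremal_const K * P powr \<beta>)" for n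
      proof -
        have assoc: "associate E X (hn n) \<le> 1"
          by (rule order.trans[OF associate_mono h1]) (auto simp: hn_def norm_mult indicator_def)
        have hn_B: "\<forall>\<xi>. cmod (hn n \<xi>) \<le> real n"
          by (auto simp: hn_def norm_mult indicator_def)
        have hn_le: "decr_rearr E (hn n) t \<le> ennreal (real n)" for t
          using hn_B by (intro decr_rearr_le_of_bounded) blast
        have hn_r: "rearrangeable E (hn n)"
          unfolding rearrangeable_def by (intro allI impI, rule le_less_trans[OF hn_le]) simp
        have "associate E X (hn n) < \<infinity>" using assoc by (rule le_less_trans) simp
        then have "associate E X (sym_rearr E \<rho>E (hn n)) \<le> associate E X (hn n)"
          using X hn_r hn_meas unfolding left_admissible_def by blast
        then have assoc': "associate E X (sym_rearr E \<rho>E (hn n)) \<le> 1" using assoc by (rule order.trans)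
        have sym_meas: "sym_rearr E \<rho>E (hn n) \<in> borel_measurable E"
          unfolding sym_rearr_def[abs_def]
          using sym_rearr_measurable[OF hn_r \<rho>E_measurable] by measurable
        interpret rearranged_pair D E e \<rho>D \<rho>E c C f "hn n" \<beta> "P powr \<beta>"
        proof unfold_locales
          show "f \<in> borel_measurable D" by fact
          show "rearrangeable D f" by (rule L1_plus_L2_rearrangeable[OF f])
          show "emeasure D {x \<in> space D. l < cmod (f x)} < \<infinity>" if "0 < l" for l
            by (rule L1_plus_L2_finite[OF f that])
          show "hn n \<in> borel_measurable E" by fact
          show "\<exists>B. \<forall>\<xi>. cmod (hn n \<xi>) \<le> B" using hn_B by blast
          have "emeasure E {\<xi> \<in> space E. hn n \<xi> \<noteq> 0} \<le> emeasure E (A n)"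
            by (intro emeasure_mono) (auto simp: hn_def indicator_def split: if_splits)
          also have "\<dots> < \<infinity>" using A(3)[of n] by (simp add: less_top)
          finally show "emeasure E {\<xi> \<in> space E. hn n \<xi> \<noteq> 0} < \<infinity>" .
          show "0 < \<beta>" "\<beta> \<le> 1" "0 \<le> P powr \<beta>" using \<beta> by auto
          fix g assume g: "integrable D g" "\<And>x. x \<in> space D \<Longrightarrow> cmod (g x) \<le> enn2real (decr_rearr D f (\<rho>D x))"
          have "(\<integral>\<^sup>+\<xi>. ennreal (cmod (FT g \<xi>) powr \<beta> * cmod (sym_rearr E \<rho>E (hn n) \<xi>)) \<partial>E)
             \<le> ennreal (P powr \<beta>) * associate E X (sym_rearr E \<rho>E (hn n))"
            by (rule fourier_bound_pairing[OF X Y \<beta>(1) FB f_meas L1_plus_L2_rearrangeable[OF f] Yf P sym_meas g])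
          also have "\<dots> \<le> ennreal (P powr \<beta>) * 1" by (intro mult_left_mono assoc') simp
          finally show "(\<integral>\<^sup>+\<xi>. ennreal (cmod (FT g \<xi>) powr \<beta> * enn2real (decr_rearr E (hn n) (\<rho>E \<xi>))) \<partial>E) \<le> ennreal (P powr \<beta>)"
            by (simp add: sym_rearr_def)
        qed
        show ?thesis using operator_power_integral[OF K T f] by simp
      qed
      have "(\<integral>\<^sup>+y. ennreal (cmod (T f y) powr \<beta> * cmod (h y)) \<partial>E) \<le> ennreal (extremal_const K * P powr \<beta>)"
      proof (rule nn_integral_le_of_eventually[OF _ bound])
        show "AE y in E. \<forall>\<^sub>F n in sequentially. ennreal (cmod (T f y) powr \<beta> * cmod (h y)) \<le> ennreal (cmod (T f y) powr \<beta> * cmod (hn n y))"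
        proof (rule AE_I2)
          fix y assume "y \<in> space E"
          then obtain n0 where n0: "y \<in> A n0" using A(2) by auto
          obtain n1 :: nat where n1: "cmod (h y) \<le> real n1" using real_arch_simple by blast
          have "cmod (hn n y) = cmod (h y)" if "n \<ge> max n0 n1" for n
          proof -
            have "y \<in> A n" using n0 incseqD[OF A(4), of n0 n] that by auto
            moreover have "cmod (h y) \<le> real n" using n1 that by (meson max.boundedE of_nat_le_iff order.trans)
            ultimately show ?thesis by (simp add: hn_def norm_mult)
          qed
          then show "\<forall>\<^sub>F n in sequentially. ennreal (cmod (T f y) powr \<beta> * cmod (h y)) \<le> ennreal (cmod (T f y) powr \<beta> * cmod (hn n y))"
            unfolding eventually_sequentially by (metis order.refl)
        qed
      qed measurable
      also have "extremal_const K * P powr \<beta> = (extremal_const K powr (1 / \<beta>) * P) powr \<beta>"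
        using const P \<beta> by (simp add: powr_mult powr_powr)
      finally show "(\<integral>\<^sup>+y. ennreal (cmod (T f y) powr \<beta> * cmod (h y)) \<partial>E) \<le> ennreal ((extremal_const K powr (1 / \<beta>) * P) powr \<beta>)" .
    qed (use P in auto)
  qed (use const in auto)
qed

text \<open>
  The operators \<open>T n\<close> must be defined on all of \<open>L\<^sup>1 + L\<^sup>2\<close> and have joint
  strong type with constant one. The factor \<open>\<kappa>\<close> leaves room for scaling them down to this
  constant, and for passing from a limit to an eventual inequality.
\<close>

definition approximable :: "real \<Rightarrow> bool" where
  "approximable \<kappa> \<longleftrightarrow> (\<forall>f. integrable D f \<longrightarrow> (\<exists>T :: nat \<Rightarrow> ('a \<Rightarrow> complex) \<Rightarrow> 'b \<Rightarrow> complex.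
     (\<forall>n. sublinear_operator D E (T n) \<and> joint_strong_type D E 1 (T n)) \<and>
     (AE \<xi> in E. \<forall>\<^sub>F n in sequentially. \<kappa> * cmod (FT f \<xi>) \<le> cmod (T n f \<xi>))))"

lemma joint_strong_type_mono:
  assumes "joint_strong_type D E 1 T" "1 \<le> K" shows "joint_strong_type D E K T"
proof -
  have "ennreal 1 * x \<le> ennreal K * x" for x using assms(2) by (intro mult_right_mono ennreal_leI) auto
  then show ?thesis using assms(1) unfolding joint_strong_type_def by (meson order.trans)
qed

text \<open>
  The dual bounds hold for \<open>T n\<close>, and Fatou's lemma transfers them to the transform. Since the
  functionals are not homogeneous, the bounds are applied to \<open>f / P\<close>, and the homogeneity of \<open>T
  n\<close> removes the factor.
\<close>

theorem fourier_bound_of_operator_bound: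
  assumes X: "left_admissible E \<rho>E X" and Y: "right_admissible D \<rho>D Y"
    and \<beta>: "0 < \<beta>" and K: "1 \<le> K" and C2: "0 < C\<^sub>2" and OB: "operator_bound D E K X Y \<beta> C\<^sub>2"
    and \<kappa>: "0 < \<kappa>" "approximable \<kappa>"
  shows "fourier_bound D FT X Y \<beta> (ennreal (1 / \<kappa>) * C\<^sub>2)"
  unfolding fourier_bound_def
proof
  fix f assume "f \<in> Lp_space D 1"
  then have f: "integrable D f" and f12: "f \<in> L1_plus_L2 D" by (auto simp: Lp_space_1_iff L1_in_L1_plus_L2)
  have f_meas [measurable]: "f \<in> borel_measurable D" using f by auto
  obtain T where T: "\<And>n. sublinear_operator D E (T n)" "\<And>n. joint_strong_type D E K (T n)"
    "AE \<xi> in E. \<forall>\<^sub>F n in sequentially. \<kappa> * cmod (FT f \<xi>) \<le> cmod (T n f \<xi>)"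
    using \<kappa>(2) f joint_strong_type_mono[OF _ K] unfolding approximable_def by meson
  show "power_norm X \<beta> (FT f) \<le> ennreal (1 / \<kappa>) * C\<^sub>2 * Y f"
  proof (rule le_ennreal_mult_of_finite_bounds[OF C2])
    fix P assume P: "0 < P" "C\<^sub>2 * Y f \<le> ennreal P" and Yf: "Y f < \<infinity>"
    show "power_norm X \<beta> (FT f) \<le> ennreal (1 / \<kappa> * P)"
    proof (rule power_norm_le_of_dual[OF X FT_measurable[OF f] \<beta>])
      fix h assume h [measurable]: "h \<in> borel_measurable E" and h1: "associate E X h \<le> 1"
      let ?s = "complex_of_real (1 / P)"
      have sf: "(\<lambda>x. ?s * f x) \<in> L1_plus_L2 D"
        using f by (intro L1_in_L1_plus_L2) (simp add: Lp_space_1_iff)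
      have meas: "T n (\<lambda>x. ?s * f x) \<in> borel_measurable E" "T n f \<in> borel_measurable E" for n
        using T(1)[of n] sf f12 by (auto simp: sublinear_operator_def)
      note [measurable] = meas
      have bound: "(\<integral>\<^sup>+\<xi>. ennreal (1 / (\<kappa> powr \<beta>)) * ennreal (cmod (T n f \<xi>) powr \<beta> * cmod (h \<xi>)) \<partial>E) \<le> ennreal ((1 / \<kappa> * P) powr \<beta>)" for n
      proof -
        have "power_norm X \<beta> (T n (\<lambda>x. ?s * f x)) \<le> C\<^sub>2 * Y (\<lambda>x. ?s * f x)"
          using OB sf T unfolding operator_bound_def by blast
        also have "\<dots> \<le> C\<^sub>2 * (Y f * ennreal (1 / P))"
          using P Yf by (intro mult_left_mono right_admissible_mult_le[OF Y]) (auto simp: norm_divide)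
        also have "\<dots> = (C\<^sub>2 * Y f) * ennreal (1 / P)" by (simp only: mult.assoc)
        also have "\<dots> \<le> 1" by (rule ennreal_mult_inverse_le_1[OF P(2,1)])
        finally have "power_norm X \<beta> (T n (\<lambda>x. ?s * f x)) \<le> 1" .
        from power_norm_le_1[OF this \<beta>]
        have X1: "X (\<lambda>y. complex_of_real (cmod (complex_of_real (1 / 1) * T n (\<lambda>x. ?s * f x) y) powr \<beta>)) \<le> 1" by simp
        have hom: "AE \<xi> in E. cmod (T n (\<lambda>x. ?s * f x) \<xi>) = cmod ?s * cmod (T n f \<xi>)"
          using T(1)[of n] f12 unfolding sublinear_operator_def by blast
        have "(\<integral>\<^sup>+\<xi>. ennreal (1 / (\<kappa> powr \<beta>)) * ennreal (cmod (T n f \<xi>) powr \<beta> * cmod (h \<xi>)) \<partial>E)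
          = (\<integral>\<^sup>+\<xi>. ennreal (P powr \<beta> / (\<kappa> powr \<beta>)) * ennreal (cmod (T n (\<lambda>x. ?s * f x) \<xi>) powr \<beta> * cmod (h \<xi>)) \<partial>E)"
        proof (rule nn_integral_cong_AE)
          show "AE \<xi> in E. ennreal (1 / (\<kappa> powr \<beta>)) * ennreal (cmod (T n f \<xi>) powr \<beta> * cmod (h \<xi>))
            = ennreal (P powr \<beta> / (\<kappa> powr \<beta>)) * ennreal (cmod (T n (\<lambda>x. ?s * f x) \<xi>) powr \<beta> * cmod (h \<xi>))"
            using hom
          proof eventually_elim
            case (elim \<xi>)
            have "1 / (\<kappa> powr \<beta>) * (cmod (T n f \<xi>) powr \<beta> * cmod (h \<xi>))
               = P powr \<beta> / (\<kappa> powr \<beta>) * (cmod (T n (\<lambda>x. ?s * f x) \<xi>) powr \<beta> * cmod (h \<xi>))"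
              unfolding elim using P by (simp add: norm_divide powr_divide powr_mult)
            then show ?case by (subst (1 2) ennreal_mult[symmetric]) auto
          qed
        qed
        also have "\<dots> = ennreal (P powr \<beta> / (\<kappa> powr \<beta>)) * (\<integral>\<^sup>+\<xi>. ennreal (cmod (T n (\<lambda>x. ?s * f x) \<xi>) powr \<beta> * cmod (h \<xi>)) \<partial>E)"
          by (rule nn_integral_cmult) measurable
        also have "\<dots> \<le> ennreal (P powr \<beta> / (\<kappa> powr \<beta>)) * (ennreal (1 powr \<beta>) * associate E X h)"
          by (intro mult_left_mono nn_integral_le_associate X1 meas h) auto
        also have "\<dots> \<le> ennreal (P powr \<beta> / (\<kappa> powr \<beta>)) * 1"
          using h1 by (intro mult_left_mono) auto
        also have "\<dots> = ennreal ((1 / \<kappa> * P) powr \<beta>)" using \<kappa>(1) P by (simp add: powr_mult powr_divide)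
        finally show ?thesis .
      qed
      show "(\<integral>\<^sup>+y. ennreal (cmod (FT f y) powr \<beta> * cmod (h y)) \<partial>E) \<le> ennreal ((1 / \<kappa> * P) powr \<beta>)"
      proof (rule nn_integral_le_of_eventually[OF _ bound])
        show "AE y in E. \<forall>\<^sub>F n in sequentially. ennreal (cmod (FT f y) powr \<beta> * cmod (h y))
           \<le> ennreal (1 / (\<kappa> powr \<beta>)) * ennreal (cmod (T n f y) powr \<beta> * cmod (h y))"
          using T(3)
        proof eventually_elim
          case (elim y)
          then show ?case
          proof eventually_elim
            case (elim n)
            then have "(\<kappa> * cmod (FT f y)) powr \<beta> \<le> cmod (T n f y) powr \<beta>"
              using \<kappa>(1) \<beta> by (intro powr_mono2) auto
            then have "cmod (FT f y) powr \<beta> \<le> 1 / (\<kappa> powr \<beta>) * cmod (T n f y) powr \<beta>"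
              using \<kappa>(1) by (simp add: powr_mult field_simps)
            then have "cmod (FT f y) powr \<beta> * cmod (h y) \<le> 1 / (\<kappa> powr \<beta>) * cmod (T n f y) powr \<beta> * cmod (h y)"
              by (rule mult_right_mono) simp
            then have "ennreal (cmod (FT f y) powr \<beta> * cmod (h y)) \<le> ennreal (1 / (\<kappa> powr \<beta>) * (cmod (T n f y) powr \<beta> * cmod (h y)))"
              by (intro ennreal_leI) (simp only: mult.assoc)
            then show ?case by (subst ennreal_mult[symmetric]) auto
          qed
        qed
      qed measurable
    qed (use P \<kappa> in auto)
  qed (use \<kappa> in auto)
qed

lemma fourier_bound_mono: "fourier_bound D \<F> X Y \<beta> C\<^sub>1 \<Longrightarrow> C\<^sub>1 \<le> C\<^sub>2 \<Longrightarrow> fourier_bound D \<F> X Y \<beta> C\<^sub>2"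
  unfolding fourier_bound_def by (meson mult_right_mono order.trans zero_le)

lemma operator_bound_mono: "operator_bound D E K X Y \<beta> C\<^sub>1 \<Longrightarrow> C\<^sub>1 \<le> C\<^sub>2 \<Longrightarrow> operator_bound D E K X Y \<beta> C\<^sub>2"
  unfolding operator_bound_def by (meson mult_right_mono order.trans zero_le)

end

text \<open>
  The bounds imply each other for positive constants only, so the infimum is approached from above.
\<close>

lemma Inf_le_mult_Inf:
  fixes S1 S2 :: "ennreal set"
  assumes mono: "\<And>x y. x \<in> S2 \<Longrightarrow> x \<le> y \<Longrightarrow> y \<in> S2"
    and c: "0 < c" and imp: "\<And>x. x \<in> S2 \<Longrightarrow> 0 < x \<Longrightarrow> ennreal c * x \<in> S1"
  shows "Inf S1 \<le> ennreal c * Inf S2"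
proof -
  have "Inf S1 / ennreal c \<le> Inf S2"
  proof (rule Inf_greatest)
    fix x assume x: "x \<in> S2"
    have "Inf S1 / ennreal c \<le> x + ennreal \<epsilon>" if \<epsilon>: "0 < \<epsilon>" for \<epsilon>
    proof -
      have "x + ennreal \<epsilon> \<in> S2" using mono[OF x] by simp
      then have "ennreal c * (x + ennreal \<epsilon>) \<in> S1" using \<epsilon> by (intro imp add_nonneg_pos) auto
      then have "Inf S1 \<le> ennreal c * (x + ennreal \<epsilon>)" by (rule Inf_lower)
      then have "Inf S1 / ennreal c \<le> (ennreal c * (x + ennreal \<epsilon>)) / ennreal c"
        by (rule divide_right_mono_ennreal)
      also have "\<dots> = x + ennreal \<epsilon>"
        using c by (simp add: ennreal_divide_times[symmetric] mult.commute[of "ennreal c"] mult_divide_eq_ennreal)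
      finally show ?thesis .
    qed
    then show "Inf S1 / ennreal c \<le> x" by (rule ennreal_le_epsilon)
  qed
  then have "ennreal c * (Inf S1 / ennreal c) \<le> ennreal c * Inf S2" by (rule mult_left_mono) simp
  moreover have "ennreal c * (Inf S1 / ennreal c) = Inf S1"
    using c by (simp add: ennreal_times_divide mult.commute[of "ennreal c"] mult_divide_eq_ennreal)
  ultimately show ?thesis by simp
qed

context fourier_setting
begin

theorem fourier_transform_extremal:
  assumes \<beta>: "0 < \<beta>" "\<beta> \<le> 1" and K: "1 \<le> K" and \<kappa>: "0 < \<kappa>" "approximable \<kappa>"
    and \<F>: "\<And>f. integrable D f \<Longrightarrow> \<F> f = FT f"
  shows "\<exists>c::real. 0 < c \<and>
    (\<forall>X Y. left_admissible E \<rho>E X \<longrightarrow> right_admissible D \<rho>D Y \<longrightarrow>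
      ((\<exists>C\<^sub>1<\<infinity>. fourier_bound D \<F> X Y \<beta> C\<^sub>1) \<longleftrightarrow> (\<exists>C\<^sub>2<\<infinity>. operator_bound D E K X Y \<beta> C\<^sub>2)) \<and>
      Inf {C\<^sub>1. fourier_bound D \<F> X Y \<beta> C\<^sub>1} \<le> ennreal c * Inf {C\<^sub>2. operator_bound D E K X Y \<beta> C\<^sub>2} \<and>
      Inf {C\<^sub>2. operator_bound D E K X Y \<beta> C\<^sub>2} \<le> ennreal c * Inf {C\<^sub>1. fourier_bound D \<F> X Y \<beta> C\<^sub>1})"
proof -
  define b where "b = max (extremal_const K powr (1 / \<beta>)) (1 / \<kappa>)"
  have b: "0 < b" using \<kappa> by (simp add: b_def less_max_iff_disj)
  have FB_eq: "fourier_bound D \<F> X Y \<beta> C' \<longleftrightarrow> fourier_bound D FT X Y \<beta> C'" for X Y C'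
    using \<F> by (simp add: fourier_bound_def Lp_space_1_iff)
  have up: "operator_bound D E K X Y \<beta> (ennreal b * C')"
    if "left_admissible E \<rho>E X" "right_admissible D \<rho>D Y" "fourier_bound D \<F> X Y \<beta> C'" "0 < C'" for X Y C'
    using that \<beta> K by (intro operator_bound_mono[OF operator_bound_of_fourier_bound[of X Y \<beta> K C']])
      (auto simp: FB_eq b_def intro!: mult_right_mono ennreal_leI)
  have down: "fourier_bound D \<F> X Y \<beta> (ennreal b * C')"
    if "left_admissible E \<rho>E X" "right_admissible D \<rho>D Y" "operator_bound D E K X Y \<beta> C'" "0 < C'" for X Y C'
    unfolding FB_eq
    using that \<beta> K \<kappa> by (intro fourier_bound_mono[OF fourier_bound_of_operator_bound[of X Y \<beta> K C' \<kappa>]])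
      (auto simp: b_def intro!: mult_right_mono ennreal_leI)
  show ?thesis
  proof (intro exI[of _ b] conjI b allI impI)
    fix X Y assume XY: "left_admissible E \<rho>E X" "right_admissible D \<rho>D Y"
    have fin: "ennreal b * (C' + 1) < \<infinity>" if "C' < \<infinity>" for C'
      using that by (simp add: ennreal_mult_less_top)
    show "(\<exists>C\<^sub>1<\<infinity>. fourier_bound D \<F> X Y \<beta> C\<^sub>1) \<longleftrightarrow> (\<exists>C\<^sub>2<\<infinity>. operator_bound D E K X Y \<beta> C\<^sub>2)"
    proof
      assume "\<exists>C\<^sub>1<\<infinity>. fourier_bound D \<F> X Y \<beta> C\<^sub>1"
      then obtain C' where C': "C' < \<infinity>" "fourier_bound D \<F> X Y \<beta> C'" by blast
      have "fourier_bound D \<F> X Y \<beta> (C' + 1)" using C'(2) by (rule fourier_bound_mono) simp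
      then have "operator_bound D E K X Y \<beta> (ennreal b * (C' + 1))" by (intro up XY add_nonneg_pos) auto
      with fin[OF C'(1)] show "\<exists>C\<^sub>2<\<infinity>. operator_bound D E K X Y \<beta> C\<^sub>2" by blast
    next
      assume "\<exists>C\<^sub>2<\<infinity>. operator_bound D E K X Y \<beta> C\<^sub>2"
      then obtain C' where C': "C' < \<infinity>" "operator_bound D E K X Y \<beta> C'" by blast
      have "operator_bound D E K X Y \<beta> (C' + 1)" using C'(2) by (rule operator_bound_mono) simp
      then have "fourier_bound D \<F> X Y \<beta> (ennreal b * (C' + 1))" by (intro down XY add_nonneg_pos) auto
      with fin[OF C'(1)] show "\<exists>C\<^sub>1<\<infinity>. fourier_bound D \<F> X Y \<beta> C\<^sub>1" by blast
    qed
    show "Inf {C\<^sub>1. fourier_bound D \<F> X Y \<beta> C\<^sub>1} \<le> ennreal b * Inf {C\<^sub>2. operator_bound D E K X Y \<beta> C\<^sub>2}"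
      using operator_bound_mono down[OF XY] by (intro Inf_le_mult_Inf b) auto
    show "Inf {C\<^sub>2. operator_bound D E K X Y \<beta> C\<^sub>2} \<le> ennreal b * Inf {C\<^sub>1. fourier_bound D \<F> X Y \<beta> C\<^sub>1}"
      using fourier_bound_mono up[OF XY] by (intro Inf_le_mult_Inf b) auto
  qed
qed

end

section \<open>Transforms with a continuous kernel\<close>

lemma cis_measurable: "cis \<in> borel_measurable borel"
  by (intro borel_measurable_continuous_onI continuous_on_cis continuous_on_id)

lemma cnj_measurable: "cnj \<in> borel_measurable borel"
  by (intro borel_measurable_continuous_onI continuous_on_cnj continuous_on_id)

lemma half_le_cos: "\<bar>x\<bar> \<le> pi / 3 \<Longrightarrow> 1 / 2 \<le> cos x"
  using cos_monotone_0_pi_le[of "\<bar>x\<bar>" "pi / 3"] by (simp add: cos_60)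

lemma transform_continuous:
  fixes e :: "'a \<Rightarrow> 'b::metric_space \<Rightarrow> complex" and f :: "'a \<Rightarrow> complex"
  assumes f: "integrable M f" and meas: "\<And>\<xi>. (\<lambda>x. e x \<xi>) \<in> borel_measurable M"
    and uni: "\<And>x \<xi>. cmod (e x \<xi>) = 1" and cont: "\<And>x. continuous_on UNIV (e x)"
  shows "continuous_on UNIV (\<lambda>\<xi>. \<integral>x. f x * e x \<xi> \<partial>M)"
  unfolding continuous_on_eq_continuous_within
proof
  fix a :: 'b
  have "((\<lambda>n. \<integral>x. f x * e x (u n) \<partial>M) \<longlonglongrightarrow> (\<integral>x. f x * e x a \<partial>M))" if u: "u \<longlonglongrightarrow> a" for u
  proof (rule integral_dominated_convergence)
    show "integrable M (\<lambda>x. cmod (f x))" using f by (rule integrable_norm)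
    show "AE x in M. (\<lambda>n. f x * e x (u n)) \<longlonglongrightarrow> f x * e x a"
    proof (rule AE_I2)
      fix x
      have "isCont (e x) a" using cont[of x] by (simp add: continuous_on_eq_continuous_at)
      then have "(\<lambda>n. e x (u n)) \<longlonglongrightarrow> e x a" using u by (rule isCont_tendsto_compose)
      then show "(\<lambda>n. f x * e x (u n)) \<longlonglongrightarrow> f x * e x a" by (intro tendsto_mult tendsto_const)
    qed
  qed (use f meas in \<open>auto simp: norm_mult uni\<close>)
  then show "isCont (\<lambda>\<xi>. \<integral>x. f x * e x \<xi> \<partial>M) a"
    unfolding continuous_at_sequentially by (simp add: comp_def)
qed

section \<open>Autocorrelations\<close>

lemma lborel_distr_reflect: "distr lborel borel (\<lambda>x. y - x) = (lborel :: 'a::euclidean_space measure)"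
proof -
  have *: "(\<lambda>x. y - x) = (\<lambda>x. y + (- 1) *\<^sub>R x)" by auto
  have "(lborel :: 'a measure) = density (distr lborel borel (\<lambda>x. y + (- 1) *\<^sub>R x)) (\<lambda>_. ennreal (\<bar>- 1 :: real\<bar> ^ DIM('a)))"
    by (rule lborel_affine) simp
  then show ?thesis unfolding * by (simp add: density_1)
qed

lemma lborel_integral_reflect:
  fixes F :: "'a::euclidean_space \<Rightarrow> 'b::{banach, second_countable_topology}"
  assumes "F \<in> borel_measurable borel"
  shows "(\<integral>x. F (y - x) \<partial>lborel) = (\<integral>x. F x \<partial>lborel)"
proof -
  have "(\<integral>x. F x \<partial>lborel) = (\<integral>x. F x \<partial>distr lborel borel (\<lambda>x. y - x))"
    by (simp only: lborel_distr_reflect)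
  also have "\<dots> = (\<integral>x. F (y - x) \<partial>lborel)"
    using assms by (subst integral_distr) auto
  finally show ?thesis ..
qed

text \<open>
  The correlation of the indicator of \<open>B\<close> with itself: its transform is the squared modulus of the
  transform of the indicator, hence nonnegative, and for bounded \<open>B\<close> the support is bounded.
\<close>

definition autocorr :: "'a::euclidean_space set \<Rightarrow> 'a \<Rightarrow> real" where
  "autocorr B x = (\<integral>y. indicator B y * indicator B (y - x) \<partial>lborel)"

lemma autocorr_measurable [measurable]:
  assumes [measurable]: "B \<in> sets borel"
  shows "autocorr B \<in> borel_measurable borel"
  unfolding autocorr_def[abs_def] by (rule lborel.borel_measurable_lebesgue_integral) measurable

lemma autocorr_bounds:
  assumes [measurable]: "B \<in> sets borel" and fin: "emeasure lborel B < \<infinity>"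
  shows "0 \<le> autocorr B x" "autocorr B x \<le> measure lborel B"
proof -
  show "0 \<le> autocorr B x" unfolding autocorr_def by (rule integral_nonneg_AE) simp
  have i: "integrable lborel (indicator B :: 'a \<Rightarrow> real)" using fin by simp
  have "autocorr B x \<le> (\<integral>y. indicator B y \<partial>lborel)"
    unfolding autocorr_def
  proof (rule integral_mono)
    show "integrable lborel (\<lambda>y. indicator B y * indicator B (y - x) :: real)"
      by (rule Bochner_Integration.integrable_bound[OF i]) (auto simp: indicator_def)
    show "integrable lborel (\<lambda>y. indicator B y :: real)" by (rule i)
  qed (simp add: indicator_def)
  also have "\<dots> = measure lborel B" by simp
  finally show "autocorr B x \<le> measure lborel B" .
qed

lemma autocorr_support: "2 * r \<le> norm x \<Longrightarrow> autocorr (ball 0 r) x = 0"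
proof -
  assume x: "2 * r \<le> norm x"
  have "(\<lambda>y. indicator (ball 0 r) y * indicator (ball 0 r) (y - x)) = (\<lambda>y. 0 :: real)"
  proof
    fix y
    show "indicator (ball 0 r) y * indicator (ball 0 r) (y - x) = (0 :: real)"
      using norm_triangle_ineq4[of y "y - x"] x by (auto simp: indicator_def)
  qed
  then show ?thesis unfolding autocorr_def by (simp only:) simp
qed

text \<open>
  Fubini's theorem, with the reflection \<open>z = y - x\<close> in the inner integral.
\<close>

lemma autocorr_transform:
  fixes t :: "'a::euclidean_space"
  assumes B [measurable]: "B \<in> sets borel" and fin: "emeasure lborel B < \<infinity>"
  shows "integrable lborel (autocorr B)"
    and "(\<integral>x. complex_of_real (autocorr B x) * cis (t \<bullet> x) \<partial>lborel)
      = complex_of_real ((cmod (\<integral>y. indicator B y * cis (t \<bullet> y) \<partial>lborel))\<^sup>2)"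
proof -
  note [measurable] = cis_measurable
  let ?k = "\<lambda>x y. indicator B y * indicator B (y - x) * cis (t \<bullet> x) :: complex"
  have i: "integrable lborel (indicator B :: 'a \<Rightarrow> real)" using fin by simp
  have ic: "integrable lborel (\<lambda>y. indicator B y * c :: complex)" for c
    using integrable_mult_left[OF integrable_of_real[OF i, where 'a = complex], of c]
    by (simp add: of_real_indicator)
  have norm_k: "norm (?k x y) = indicator B y * indicator B (y - x)" for x y
    by (simp add: norm_mult indicator_def)
  have shift: "(\<integral>x. indicator B (y - x) \<partial>lborel) = measure lborel B" for y :: 'a
    using lborel_integral_reflect[of "indicator B :: 'a \<Rightarrow> real" y] by simp
  have shift_i: "integrable lborel (\<lambda>x. indicator B (y - x) :: real)" for y :: 'a
  proof -
    have "integrable (distr lborel borel (\<lambda>x. y - x)) (indicator B :: 'a \<Rightarrow> real)"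
      unfolding lborel_distr_reflect by (rule i)
    then show ?thesis by (subst (asm) integrable_distr_eq) auto
  qed
  have int: "integrable (lborel \<Otimes>\<^sub>M lborel) (\<lambda>(y, x). ?k x y)"
  proof (rule lborel_pair.Fubini_integrable)
    show "(\<lambda>(y, x). ?k x y) \<in> borel_measurable (lborel \<Otimes>\<^sub>M lborel)" by measurable
    have "(\<lambda>y. \<integral>x. norm (case (y, x) of (y, x) \<Rightarrow> ?k x y) \<partial>lborel) = (\<lambda>y. indicator B y * measure lborel B)"
      by (simp add: norm_k shift)
    then show "integrable lborel (\<lambda>y. \<integral>x. norm (case (y, x) of (y, x) \<Rightarrow> ?k x y) \<partial>lborel)"
      using i by simp
    show "AE y in lborel. integrable lborel (\<lambda>x. case (y, x) of (y, x) \<Rightarrow> ?k x y)"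
    proof (rule AE_I2, unfold prod.case)
      fix y :: 'a
      show "integrable lborel (\<lambda>x. ?k x y)"
        by (rule Bochner_Integration.integrable_bound[OF shift_i[of y]]) (auto simp: norm_mult indicator_def)
    qed
  qed
  have swap: "integrable (lborel \<Otimes>\<^sub>M lborel) (\<lambda>(x, y). ?k x y)"
    using lborel_pair.integrable_product_swap[OF int] by (simp add: case_prod_unfold)
  have inner: "(\<integral>y. ?k x y \<partial>lborel) = complex_of_real (autocorr B x) * cis (t \<bullet> x)" for x
  proof -
    have "(\<integral>y. ?k x y \<partial>lborel) = (\<integral>y. complex_of_real (indicator B y * indicator B (y - x)) * cis (t \<bullet> x) \<partial>lborel)"
      by (intro Bochner_Integration.integral_cong) (auto simp: indicator_def)
    also have "\<dots> = (\<integral>y. complex_of_real (indicator B y * indicator B (y - x)) \<partial>lborel) * cis (t \<bullet> x)"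
      by (rule integral_mult_left_zero)
    also have "(\<integral>y. complex_of_real (indicator B y * indicator B (y - x)) \<partial>lborel) = complex_of_real (autocorr B x)"
      unfolding autocorr_def
      by (rule integral_of_real, rule Bochner_Integration.integrable_bound[OF i]) (auto simp: indicator_def)
    finally show ?thesis .
  qed
  define I where "I = (\<integral>y. indicator B y * cis (t \<bullet> y) \<partial>lborel)"
  have inner': "(\<integral>x. ?k x y \<partial>lborel) = (indicator B y * cis (t \<bullet> y)) * cnj I" for y
  proof -
    have "(\<integral>x. ?k x y \<partial>lborel) = (\<integral>x. (\<lambda>z. indicator B y * (indicator B z * cis (t \<bullet> (y - z)))) (y - x) \<partial>lborel)"
      by (intro Bochner_Integration.integral_cong) (auto simp: mult.assoc)
    also have "\<dots> = (\<integral>z. indicator B y * (indicator B z * cis (t \<bullet> (y - z))) \<partial>lborel)"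
      by (rule lborel_integral_reflect) measurable
    also have "\<dots> = (\<integral>z. (indicator B y * cis (t \<bullet> y)) * cnj (indicator B z * cis (t \<bullet> z)) \<partial>lborel)"
      by (intro Bochner_Integration.integral_cong)
        (auto simp: inner_diff_right indicator_def cis_divide[symmetric] cis_cnj divide_inverse)
    also have "\<dots> = (indicator B y * cis (t \<bullet> y)) * cnj I"
      unfolding I_def by (simp del: complex_cnj_mult)
    finally show ?thesis .
  qed
  have "integrable lborel (\<lambda>x. \<integral>y. norm (?k x y) \<partial>lborel)"
    using lborel_pair.integrable_fst'[OF integrable_norm[OF swap]] by simp
  then show "integrable lborel (autocorr B)"
    by (simp add: norm_k autocorr_def[abs_def])
  have "(\<integral>x. complex_of_real (autocorr B x) * cis (t \<bullet> x) \<partial>lborel) = (\<integral>x. (\<integral>y. ?k x y \<partial>lborel) \<partial>lborel)"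
    by (simp only: inner)
  also have "\<dots> = (\<integral>y. (\<integral>x. ?k x y \<partial>lborel) \<partial>lborel)"
    using lborel_pair.Fubini_integral[OF int] by simp
  also have "\<dots> = I * cnj I"
    unfolding inner' by (subst integral_mult_left_zero) (simp add: I_def)
  also have "\<dots> = complex_of_real ((cmod I)\<^sup>2)" by (rule complex_norm_square[symmetric])
  finally show "(\<integral>x. complex_of_real (autocorr B x) * cis (t \<bullet> x) \<partial>lborel)
      = complex_of_real ((cmod (\<integral>y. indicator B y * cis (t \<bullet> y) \<partial>lborel))\<^sup>2)"
    by (simp only: I_def)
qed

text \<open>
  All phases stay within \<open>pi / 3\<close> of zero, where the cosine is at least \<open>1 / 2\<close>.
\<close>

lemma transform_indicator_lower:
  fixes t :: "'a::euclidean_space"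
  assumes B [measurable]: "B \<in> sets borel" and fin: "emeasure lborel B < \<infinity>"
    and small: "\<And>y. y \<in> B \<Longrightarrow> \<bar>t \<bullet> y\<bar> \<le> pi / 3"
  shows "measure lborel B / 2 \<le> cmod (\<integral>y. indicator B y * cis (t \<bullet> y) \<partial>lborel)"
proof -
  note [measurable] = cis_measurable
  have i: "integrable lborel (indicator B :: 'a \<Rightarrow> real)" using fin by simp
  have ik: "integrable lborel (\<lambda>y. indicator B y * cis (t \<bullet> y))"
    by (rule Bochner_Integration.integrable_bound[OF i]) (auto simp: norm_mult indicator_def)
  have "measure lborel B / 2 = (\<integral>y. indicator B y / 2 \<partial>lborel)" by simp
  also have "\<dots> \<le> (\<integral>y. Re (indicator B y * cis (t \<bullet> y)) \<partial>lborel)"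
  proof (rule integral_mono)
    show "integrable lborel (\<lambda>y. indicator B y / 2 :: real)" using i by simp
    show "integrable lborel (\<lambda>y. Re (indicator B y * cis (t \<bullet> y)))" using ik by (rule integrable_Re)
    fix y
    show "indicator B y / 2 \<le> Re (indicator B y * cis (t \<bullet> y))"
    proof (cases "y \<in> B")
      case True
      then show ?thesis using half_le_cos[OF small[OF True]] by simp
    qed simp
  qed
  also have "\<dots> = Re (\<integral>y. indicator B y * cis (t \<bullet> y) \<partial>lborel)"
    by (rule integral_Re[OF ik])
  also have "\<dots> \<le> cmod (\<integral>y. indicator B y * cis (t \<bullet> y) \<partial>lborel)" by (rule complex_Re_le_cmod)
  finally show ?thesis .
qed

text \<open>Modulation translates the transform, so one bump covers a ball by translates.\<close>

lemma (in fourier_kernel) cover_by_modulation: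
  assumes \<psi>: "integrable D \<psi>" "\<And>x. x \<in> space D \<Longrightarrow> cmod (\<psi> x) \<le> B x"
    and low: "\<And>\<xi>. \<rho> \<xi> \<le> r \<Longrightarrow> s \<le> Re (FT \<psi> \<xi>)"
    and sub: "\<And>x \<xi> \<eta>. e x \<xi> * cnj (e x \<eta>) = e x (sub \<xi> \<eta>)"
    and H: "finite H" "real (card H) \<le> n"
    and net: "\<And>\<xi>. \<xi> \<in> space E \<Longrightarrow> \<rho> \<xi> \<le> R \<Longrightarrow> \<exists>\<eta>\<in>H. \<rho> (sub \<xi> \<eta>) \<le> r"
  shows "\<exists>us. real (length us) \<le> n \<and>
      (\<forall>u\<in>set us. integrable D u \<and> (\<forall>x\<in>space D. cmod (u x) \<le> B x)) \<and>
      (\<forall>\<xi>\<in>space E. \<rho> \<xi> \<le> R \<longrightarrow> (\<exists>u\<in>set us. s \<le> cmod (FT u \<xi>)))"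
proof -
  obtain hs where hs: "set hs = H" "distinct hs" using finite_distinct_list[OF H(1)] by blast
  define u where "u \<eta> x = \<psi> x * cnj (e x \<eta>)" for \<eta> x
  have [measurable]: "(\<lambda>x. cnj (e x \<eta>)) \<in> borel_measurable D" for \<eta>
    by (rule measurable_compose[OF kernel_measurable cnj_measurable])
  have [measurable]: "\<psi> \<in> borel_measurable D" using \<psi>(1) by auto
  have u_int: "integrable D (u \<eta>)" for \<eta>
    unfolding u_def[abs_def]
    by (rule Bochner_Integration.integrable_bound[OF \<psi>(1)]) (auto simp: norm_mult kernel_unimodular)
  have FT_u: "FT (u \<eta>) \<xi> = FT \<psi> (sub \<xi> \<eta>)" for \<xi> \<eta>
    unfolding FT_def u_def by (simp add: mult.assoc sub[symmetric] mult.commute[of "cnj _"])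
  show ?thesis
  proof (intro exI[of _ "map u hs"] conjI ballI impI)
    show "real (length (map u hs)) \<le> n" using hs H(2) distinct_card[OF hs(2)] by simp
  next
    fix v assume "v \<in> set (map u hs)"
    then obtain \<eta> where v: "v = u \<eta>" by auto
    show "integrable D v" unfolding v by (rule u_int)
    show "cmod (v x) \<le> B x" if "x \<in> space D" for x
      using \<psi>(2)[OF that] by (simp add: v u_def norm_mult kernel_unimodular)
  next
    fix \<xi> assume "\<xi> \<in> space E" "\<rho> \<xi> \<le> R"
    then obtain \<eta> where \<eta>: "\<eta> \<in> H" "\<rho> (sub \<xi> \<eta>) \<le> r" using net by blast
    have "s \<le> cmod (FT (u \<eta>) \<xi>)"
      unfolding FT_u using low[OF \<eta>(2)] complex_Re_le_cmod order.trans by blast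
    then show "\<exists>v\<in>set (map u hs). s \<le> cmod (FT v \<xi>)" using \<eta>(1) hs by auto
  qed
qed

section \<open>The integers\<close>

lemma int_rank_nonneg: "0 \<le> int_rank n"
  by (simp add: int_rank_def)

lemma int_rank_le: "int_rank n \<le> 2 * \<bar>real_of_int n\<bar>" and int_rank_ge: "2 * \<bar>real_of_int n\<bar> - 1 \<le> int_rank n"
  by (auto simp: int_rank_def)

lemma emeasure_int_eq_0: "emeasure int_measure S \<le> ennreal (1 / 2) \<Longrightarrow> emeasure int_measure S = 0"
proof (rule ccontr)
  assume *: "emeasure int_measure S \<le> ennreal (1 / 2)" "emeasure int_measure S \<noteq> 0"
  then have "S \<noteq> {}" by (cases "S = {}") auto
  then obtain x where "x \<in> S" by blast
  then have "emeasure int_measure {x} \<le> emeasure int_measure S" by (intro emeasure_mono) auto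
  then have "1 \<le> ennreal (1 / 2)" using *(1) by (auto intro: order.trans)
  then have "ennreal 1 \<le> ennreal (1 / 2)" by simp
  then show False by (subst (asm) ennreal_le_iff) auto
qed

lemma degenerate_int: "k < - 1 \<Longrightarrow> degenerate int_measure k"
proof -
  assume "k < - 1"
  then have "dyad (k + 1) \<le> dyad (- 1)" by (simp del: dyad_minus_1)
  then have "ennreal (dyad (k + 1)) \<le> ennreal (1 / 2)" unfolding dyad_minus_1 by (rule ennreal_leI)
  then show ?thesis unfolding degenerate_def using emeasure_int_eq_0 order.trans by blast
qed

lemma finite_int_ball: "finite {n \<in> space int_measure. int_rank n \<le> r}"
proof (rule finite_subset)
  show "{n \<in> space int_measure. int_rank n \<le> r} \<subseteq> {- \<lceil>r + 1\<rceil>..\<lceil>r + 1\<rceil>}"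
  proof
    fix n assume "n \<in> {n \<in> space int_measure. int_rank n \<le> r}"
    then have "2 * \<bar>real_of_int n\<bar> - 1 \<le> r" using int_rank_ge[of n] by auto
    then have "\<bar>real_of_int n\<bar> \<le> r + 1" by linarith
    then show "n \<in> {- \<lceil>r + 1\<rceil>..\<lceil>r + 1\<rceil>}" by (simp add: abs_le_iff) linarith
  qed
qed simp

lemma int_ball_finite: "emeasure int_measure {n \<in> space int_measure. int_rank n \<le> r} < \<infinity>"
  using finite_int_ball[of r] by (simp add: emeasure_count_space_finite ennreal_of_nat_eq_real_of_nat)

lemma int_shell_large:
  assumes "\<not> degenerate int_measure (- i - 1)"
  shows "ennreal (1 / 8 * dyad (- i)) \<le> emeasure int_measure (shell int_measure int_rank i)"
proof -
  have i: "i \<le> 0" using assms degenerate_int[of "- i - 1"] by (cases "i \<le> 0") auto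
  have fin: "finite (shell int_measure int_rank i)"
    by (rule finite_subset[OF _ finite_int_ball[of "dyad (- i - 1)"]]) (auto dest: shell_le)
  have "1 / 8 * dyad (- i) \<le> real (card (shell int_measure int_rank i))"
  \<comment> \<open>The shells of index \<open>0\<close> and \<open>- 1\<close> are \<open>{0}\<close> and \<open>{1}\<close>;
    the others contain the negative integers \<open>- m\<close>, of rank \<open>2 m\<close>, with
    \<open>m\<close> in the upper half of the range up to \<open>2\<^bsup>-i-2\<^esup>\<close>.\<close>
  proof (cases "i \<ge> - 1")
    case True
    with i consider "i = 0" | "i = - 1" by linarith
    then have "card (shell int_measure int_rank i) \<noteq> 0"
    proof cases
      case 1
      then have "0 \<in> shell int_measure int_rank i" by (simp add: shell_def int_rank_def)
      then show ?thesis using fin by auto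
    next
      case 2
      then have "1 \<in> shell int_measure int_rank i" by (simp add: shell_def int_rank_def)
      then show ?thesis using fin by auto
    qed
    then have "1 \<le> real (card (shell int_measure int_rank i))" by linarith
    moreover have "dyad (- i) \<le> dyad 1" using True by (simp del: dyad_1)
    ultimately show ?thesis unfolding dyad_1 by linarith
  next
    case False
    define k where "k = nat (- i - 2)"
    have k: "i = - int k - 2" using False by (simp add: k_def)
    have d: "dyad (- i - 2) = 2 ^ k" "dyad (- i - 1) = 2 * 2 ^ k" "dyad (- i) = 4 * 2 ^ k"
      using dyad_of_nat[of k] dyad_add[of "int k" 1] dyad_add[of "int k + 1" 1] by (simp_all add: k add.commute)
    define M :: int where "M = 2 ^ k"
    have M: "1 \<le> M" by (simp add: M_def)
    have rM: "real_of_int M = 2 ^ k" by (simp add: M_def)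
    have "uminus ` {M div 2 + 1..M} \<subseteq> shell int_measure int_rank i"
    proof
      fix n assume "n \<in> uminus ` {M div 2 + 1..M}"
      then obtain m where "m \<in> {M div 2 + 1..M}" and m: "n = - m" by blast
      from this(1) have "M < 2 * m" "2 * m \<le> 2 * M" "0 < m" using M by auto
      then have "real_of_int M < 2 * real_of_int m" "2 * real_of_int m \<le> 2 * real_of_int M" by linarith+
      then show "n \<in> shell int_measure int_rank i"
        using \<open>0 < m\<close> by (simp add: shell_def int_rank_def d m(1) rM)
    qed
    then have "card (uminus ` {M div 2 + 1..M}) \<le> card (shell int_measure int_rank i)"
      by (rule card_mono[OF fin])
    moreover have "card (uminus ` {M div 2 + 1..M}) = nat (M - M div 2)"
      by (subst card_image) (auto simp: inj_on_def)
    moreover have "real_of_int M / 2 \<le> real (nat (M - M div 2))" using M by linarith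
    ultimately have "real_of_int M / 2 \<le> real (card (shell int_measure int_rank i))" by linarith
    then show ?thesis by (simp add: d rM)
  qed
  then show ?thesis using fin by (simp add: emeasure_count_space_finite ennreal_of_nat_eq_real_of_nat ennreal_leI)
qed

section \<open>The torus\<close>

lemma space_torus [simp]: "space torus_measure = {- (1 / 2)..1 / 2}"
  by (simp add: torus_measure_def)

lemma torus_measure_alt: "torus_measure = restrict_space lebesgue {- (1 / 2)..1 / 2}"
  by (simp add: torus_measure_def)

lemma borel_torus: "F \<in> borel_measurable borel \<Longrightarrow> F \<in> borel_measurable torus_measure"
  unfolding torus_measure_alt by (intro measurable_restrict_space1 measurable_completion) simp

lemma torus_radius_measurable [measurable]: "torus_radius \<in> borel_measurable torus_measure"
  by (rule borel_torus) (simp add: torus_radius_def[abs_def])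

lemma sets_torusI: "S \<in> sets borel \<Longrightarrow> S \<subseteq> {- (1 / 2)..1 / 2} \<Longrightarrow> S \<in> sets torus_measure"
  unfolding torus_measure_alt by (subst sets_restrict_space_iff) auto

lemma emeasure_torus: "S \<in> sets borel \<Longrightarrow> S \<subseteq> {- (1 / 2)..1 / 2} \<Longrightarrow> emeasure torus_measure S = emeasure lborel S"
  unfolding torus_measure_alt by (subst emeasure_restrict_space) (auto simp: emeasure_completion)

lemma emeasure_space_torus [simp]: "emeasure torus_measure {- (1 / 2)..1 / 2} = 1"
  by (subst emeasure_torus) auto

lemma finite_measure_torus: "finite_measure torus_measure"
  by (rule finite_measureI) simp

interpretation torus: finite_measure torus_measure by (rule finite_measure_torus)

lemma torus_integral_eq:
  fixes F :: "real \<Rightarrow> complex"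
  assumes F: "F \<in> borel_measurable borel" and z: "\<And>x. x \<notin> {- (1 / 2)..1 / 2} \<Longrightarrow> F x = 0"
  shows "(\<integral>x. F x \<partial>torus_measure) = (\<integral>x. F x \<partial>lborel)"
    and "integrable torus_measure F \<longleftrightarrow> integrable lborel F"
proof -
  have *: "(\<lambda>x. indicator {- (1 / 2)..1 / 2} x *\<^sub>R F x) = F"
    using z by (auto simp: fun_eq_iff indicator_def)
  show "(\<integral>x. F x \<partial>torus_measure) = (\<integral>x. F x \<partial>lborel)"
    unfolding torus_measure_alt using F
    by (subst integral_restrict_space) (auto simp: * integral_completion)
  show "integrable torus_measure F \<longleftrightarrow> integrable lborel F"
    unfolding torus_measure_alt using F
    by (subst integrable_restrict_space) (auto simp: * integrable_completion)
qed

lemma degenerate_torus: "0 \<le> k \<Longrightarrow> degenerate torus_measure k"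
proof -
  assume "0 \<le> k"
  then have "dyad 0 \<le> dyad k" by (simp only: dyad_le_iff)
  then have "ennreal 1 \<le> ennreal (dyad k)" by (intro ennreal_leI) simp
  then show ?thesis by (simp add: degenerate_def)
qed

lemma torus_shell_large:
  assumes "\<not> degenerate torus_measure (- i - 1)"
  shows "ennreal (1 / 8 * dyad (- i)) \<le> emeasure torus_measure (shell torus_measure torus_radius i)"
proof -
  have i: "0 \<le> i" using assms degenerate_torus[of "- i - 1"] by (cases "0 \<le> i") auto
  have d: "dyad (- i - 1) = dyad (- i) / 2" "dyad (- i - 2) = dyad (- i) / 4"
    using dyad_diff[of "- i" 1] dyad_diff[of "- i" 2] by (simp_all add: dyad_def)
  have "dyad (- i) \<le> dyad 0" using i by (simp only: dyad_le_iff)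
  then have d1: "dyad (- i) \<le> 1" by simp
  let ?S = "{dyad (- i) / 8<..dyad (- i) / 4}"
  have "ennreal (1 / 8 * dyad (- i)) = emeasure lborel ?S"
    by simp
  also have "\<dots> = emeasure torus_measure ?S"
    using d1 dyad_pos[of "- i"] by (intro emeasure_torus[symmetric]) auto
  also have "\<dots> \<le> emeasure torus_measure (shell torus_measure torus_radius i)"
  proof (rule emeasure_mono)
    show "?S \<subseteq> shell torus_measure torus_radius i"
    proof
      fix x assume x: "x \<in> ?S"
      then have "0 < x" using dyad_pos[of "- i"] by (auto intro: less_trans[rotated])
      then show "x \<in> shell torus_measure torus_radius i"
        using x d1 by (auto simp: shell_def torus_radius_def d)
    qed
  qed measurable
  finally show ?thesis .
qed

lemma torus_integral_cis: "(\<integral>x. cis (2 * pi * real_of_int k * x) \<partial>torus_measure) = (if k = 0 then 1 else 0)"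
proof (cases "k = 0")
  case True
  then show ?thesis by (simp add: measure_def)
next
  case False
  define z where "z = 2 * complex_of_real pi * of_int k * \<i>"
  have z: "z \<noteq> 0" using False by (simp add: z_def)
  have cis_z: "cis (2 * pi * real_of_int k * x) = exp (z * complex_of_real x)" for x
    by (simp add: cis_conv_exp z_def mult_ac)
  have cont: "continuous_on {- (1 / 2)..1 / 2} (\<lambda>x. cis (2 * pi * real_of_int k * x))"
    by (intro continuous_intros)
  have "((\<lambda>x. exp (z * complex_of_real x)) has_integral
      (exp (z * complex_of_real (1 / 2)) / z - exp (z * complex_of_real (- (1 / 2))) / z)) {- (1 / 2)..1 / 2}"
  proof (rule fundamental_theorem_of_calculus)
    fix x :: real
    have "((\<lambda>x. exp (z * x) / z) has_field_derivative exp (z * complex_of_real x)) (at (complex_of_real x))"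
      using z by (auto intro!: derivative_eq_intros)
    then show "((\<lambda>x. exp (z * complex_of_real x) / z) has_vector_derivative exp (z * complex_of_real x)) (at x within {- (1 / 2)..1 / 2})"
      by (rule has_vector_derivative_real_field)
  qed simp
  moreover have "exp (z * complex_of_real (1 / 2)) = exp (z * complex_of_real (- (1 / 2)))"
  proof -
    have "z * complex_of_real (1 / 2) = z * complex_of_real (- 1 / 2) + z" by (simp add: field_simps)
    moreover have "exp z = 1"
      unfolding z_def using exp_two_pi_i exp_integer_2pi[of "of_int k"] by (simp add: mult_ac)
    ultimately show ?thesis by (simp only: exp_add) simp
  qed
  ultimately have "((\<lambda>x. cis (2 * pi * real_of_int k * x)) has_integral 0) {- (1 / 2)..1 / 2}"
    by (simp add: cis_z)
  moreover have "integrable torus_measure (\<lambda>x. cis (2 * pi * real_of_int k * x))"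
    unfolding torus_measure_alt by (rule continuous_imp_integrable_real[OF cont])
  ultimately show ?thesis
    unfolding torus_measure_alt using False
    by (subst lebesgue_integral_eq_integral) (auto simp: integral_unique)
qed

lemma character_measurable [measurable]:
  "(\<lambda>x. cis (2 * pi * real_of_int k * x)) \<in> borel_measurable torus_measure"
  by (rule borel_torus) (intro borel_measurable_continuous_onI continuous_intros)

lemma integrable_torus_bounded:
  fixes F :: "real \<Rightarrow> complex"
  assumes "F \<in> borel_measurable torus_measure" "\<And>x. cmod (F x) \<le> B"
  shows "integrable torus_measure F"
  by (rule torus.integrable_const_bound[where B = B]) (use assms in auto)

lemma parseval_trig_polynomial:
  assumes A: "finite A"
  shows "(\<integral>\<^sup>+x. ennreal ((cmod (\<Sum>m\<in>A. z m * cis (2 * pi * real_of_int m * x)))\<^sup>2) \<partial>torus_measure)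
    = (\<Sum>m\<in>A. ennreal ((cmod (z m))\<^sup>2))"
proof -
  let ?p = "\<lambda>x. \<Sum>m\<in>A. z m * cis (2 * pi * real_of_int m * x)"
  have i: "integrable torus_measure (\<lambda>x. cis (2 * pi * real_of_int k * x))" for k
    by (rule integrable_torus_bounded[where B = 1]) auto
  have sq: "complex_of_real ((cmod (?p x))\<^sup>2)
     = (\<Sum>m\<in>A. \<Sum>m'\<in>A. z m * cnj (z m') * cis (2 * pi * real_of_int (m - m') * x))" for x
  proof -
    have "complex_of_real ((cmod (?p x))\<^sup>2) = ?p x * cnj (?p x)" by (rule complex_norm_square)
    also have "\<dots> = (\<Sum>m\<in>A. \<Sum>m'\<in>A. (z m * cis (2 * pi * real_of_int m * x)) * cnj (z m' * cis (2 * pi * real_of_int m' * x)))"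
      by (simp only: cnj_sum sum_product)
    also have "\<dots> = (\<Sum>m\<in>A. \<Sum>m'\<in>A. z m * cnj (z m') * cis (2 * pi * real_of_int (m - m') * x))"
      by (intro sum.cong refl) (simp add: cis_cnj cis_mult algebra_simps)
    finally show ?thesis .
  qed
  have ip: "integrable torus_measure (\<lambda>x. complex_of_real ((cmod (?p x))\<^sup>2))"
    unfolding sq by (intro Bochner_Integration.integrable_sum integrable_mult_right i)
  then have ir: "integrable torus_measure (\<lambda>x. (cmod (?p x))\<^sup>2)"
    using integrable_Re[OF ip] by simp
  have "complex_of_real (\<integral>x. (cmod (?p x))\<^sup>2 \<partial>torus_measure) = (\<integral>x. complex_of_real ((cmod (?p x))\<^sup>2) \<partial>torus_measure)"
    by (rule integral_of_real[OF ir, symmetric])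
  also have "\<dots> = (\<Sum>m\<in>A. \<Sum>m'\<in>A. z m * cnj (z m') * (if m - m' = 0 then 1 else 0))"
    unfolding sq by (simp add: Bochner_Integration.integral_sum i torus_integral_cis del: of_int_diff)
  also have "\<dots> = (\<Sum>m\<in>A. z m * cnj (z m))"
    using A by (intro sum.cong refl) (simp add: sum.delta' if_distrib[of "\<lambda>t. _ * t"] cong: if_cong)
  also have "\<dots> = complex_of_real (\<Sum>m\<in>A. (cmod (z m))\<^sup>2)"
    by (simp only: of_real_sum complex_norm_square)
  finally have "(\<integral>x. (cmod (?p x))\<^sup>2 \<partial>torus_measure) = (\<Sum>m\<in>A. (cmod (z m))\<^sup>2)"
    by (simp only: of_real_eq_iff)
  then show ?thesis
    using ir by (subst nn_integral_eq_integral) (auto simp: sum_ennreal)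
qed

lemma cis_diff_mult: "cis a * cnj (cis b) = cis (a - b)"
  by (simp add: cis_cnj cis_mult)

lemma round_close: "\<bar>x - real_of_int (round x)\<bar> \<le> 1 / 2"
  using of_int_round_abs_le[of x] by (simp add: abs_minus_commute)

lemma card_image_Icc_int_le: "1 \<le> Q \<Longrightarrow> real (card (f ` {- Q..Q :: int})) \<le> 3 * real_of_int Q"
proof -
  assume Q: "1 \<le> Q"
  have "card (f ` {- Q..Q}) \<le> card {- Q..Q}" by (rule card_image_le) simp
  also have "\<dots> = nat (2 * Q + 1)" by simp
  finally have "real (card (f ` {- Q..Q})) \<le> real (nat (2 * Q + 1))" by linarith
  also have "\<dots> \<le> 3 * real_of_int Q" using Q by linarith
  finally show ?thesis .
qed

lemma ennreal_powr_mono: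
  assumes "x \<le> y" "0 \<le> p" shows "ennreal_powr x p \<le> ennreal_powr y p"
proof (cases "y = \<infinity>")
  case False
  then obtain a b where "x = ennreal a" "0 \<le> a" "y = ennreal b" "0 \<le> b"
    using assms by (cases x; cases y) (auto simp: top_unique)
  then show ?thesis using assms by (auto simp: ennreal_powr_def intro!: ennreal_leI powr_mono2)
qed (simp add: ennreal_powr_def)

section \<open>Sequences\<close>

lemma integral_int_measure_finite:
  fixes F :: "int \<Rightarrow> complex"
  assumes A: "finite A" and z: "\<And>n. n \<notin> A \<Longrightarrow> F n = 0"
  shows "(\<integral>n. F n \<partial>int_measure) = (\<Sum>n\<in>A. F n)"
proof -
  have sub: "{n \<in> UNIV. F n \<noteq> 0} \<subseteq> A" using z by auto
  have "(\<integral>n. F n \<partial>int_measure) = (\<Sum>n | n \<in> UNIV \<and> F n \<noteq> 0. F n)"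
    by (rule lebesgue_integral_count_space_finite_support[OF finite_subset[OF sub A]])
  also have "\<dots> = (\<Sum>n\<in>A. F n)" using A sub by (intro sum.mono_neutral_left) auto
  finally show ?thesis .
qed

definition int_kernel :: "int \<Rightarrow> real \<Rightarrow> complex" where
  "int_kernel n x = cis (2 * pi * real_of_int n * x)"

lemma fourier_kernel_int: "fourier_kernel int_measure torus_measure int_kernel"
proof
  show "cmod (int_kernel n x) = 1" for n x by (simp add: int_kernel_def)
  fix f :: "int \<Rightarrow> complex" assume f: "integrable int_measure f"
  show "(\<lambda>x. \<integral>n. f n * int_kernel n x \<partial>int_measure) \<in> borel_measurable torus_measure"
    by (intro borel_torus borel_measurable_continuous_onI transform_continuous[OF f])
      (auto simp: int_kernel_def[abs_def] intro!: continuous_intros)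
qed simp

interpretation seq: fourier_kernel int_measure torus_measure int_kernel
  by (rule fourier_kernel_int)

text \<open>
  A Fejer kernel: \<open>\<psi>\<close> is the autocorrelation of \<open>{0..<N}\<close>, divided by \<open>N\<close>,
  so that its transform is the squared modulus of a geometric sum.
\<close>

lemma seq_bump:
  "\<exists>\<psi>. integrable int_measure \<psi> \<and>
     (\<forall>n\<in>space int_measure. cmod (\<psi> n) \<le> (if int_rank n \<le> dyad k then 1 else 0)) \<and>
     (\<forall>\<xi>. 0 \<le> Re (seq.FT \<psi> \<xi>) \<and> (torus_radius \<xi> \<le> dyad (- k) \<longrightarrow> 1 / 24 * dyad k \<le> Re (seq.FT \<psi> \<xi>)))"
proof -
  \<comment> \<open>Differences of elements of \<open>{0..<N}\<close> are at most \<open>N - 1 \<le> dyad k / 6\<close>, which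
    keeps the support inside the ball and all phases within \<open>pi / 3\<close> on the dual ball; adding one
    keeps \<open>N\<close> positive at small scales.\<close>
  define N where "N = nat \<lfloor>dyad k / 6\<rfloor> + 1"
  have fl: "real (nat \<lfloor>dyad k / 6\<rfloor>) = of_int \<lfloor>dyad k / 6\<rfloor>"
    using dyad_pos[of k] by (intro of_nat_nat) simp
  have N: "real N - 1 \<le> dyad k / 6" "dyad k / 6 \<le> real N" "1 \<le> N"
    unfolding N_def using fl of_int_floor_le[of "dyad k / 6"] floor_correct[of "dyad k / 6"] by (auto simp: algebra_simps)
  define A where "A = {0..<int N}"
  have A: "finite A" "card A = N" by (simp_all add: A_def)
  define p where "p ab n = (indicator {fst ab - snd ab} n :: complex)" for ab :: "int \<times> int" and n
  define \<psi> where "\<psi> n = (\<Sum>ab\<in>A \<times> A. complex_of_real (1 / real N) * p ab n)" for n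
  have p_int: "integrable int_measure (p ab)" for ab
  proof -
    have "integrable int_measure (indicator {fst ab - snd ab} :: int \<Rightarrow> real)"
      by (rule integrable_real_indicator) auto
    from integrable_of_real[OF this, where 'a = complex] show ?thesis
      by (simp add: p_def[abs_def] of_real_indicator)
  qed
  have \<psi>_int: "integrable int_measure \<psi>"
    unfolding \<psi>_def[abs_def] by (intro Bochner_Integration.integrable_sum integrable_mult_right p_int)
  have FT_p: "seq.FT (p ab) \<xi> = int_kernel (fst ab - snd ab) \<xi>" for ab \<xi>
  proof -
    have "seq.FT (p ab) \<xi> = (\<Sum>n\<in>{fst ab - snd ab}. p ab n * int_kernel n \<xi>)"
      unfolding seq.FT_def by (rule integral_int_measure_finite) (auto simp: p_def)
    then show ?thesis by (simp add: p_def)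
  qed
  have FT_\<psi>: "seq.FT \<psi> \<xi> = complex_of_real (1 / real N * (cmod (\<Sum>a\<in>A. int_kernel a \<xi>))\<^sup>2)" for \<xi>
  proof -
    have "seq.FT \<psi> \<xi> = (\<Sum>ab\<in>A \<times> A. complex_of_real (1 / real N) * int_kernel (fst ab - snd ab) \<xi>)"
      unfolding \<psi>_def[abs_def] using A p_int by (subst seq.FT_weighted_sum) (auto simp: FT_p)
    also have "\<dots> = complex_of_real (1 / real N) * (\<Sum>ab\<in>A \<times> A. int_kernel (fst ab) \<xi> * cnj (int_kernel (snd ab) \<xi>))"
      unfolding sum_distrib_left
      by (intro sum.cong refl) (simp add: int_kernel_def cis_diff_mult algebra_simps)
    also have "(\<Sum>ab\<in>A \<times> A. int_kernel (fst ab) \<xi> * cnj (int_kernel (snd ab) \<xi>))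
       = (\<Sum>a\<in>A. int_kernel a \<xi>) * cnj (\<Sum>a\<in>A. int_kernel a \<xi>)"
      unfolding cnj_sum sum_product sum.cartesian_product by (simp add: case_prod_unfold)
    also have "\<dots> = complex_of_real ((cmod (\<Sum>a\<in>A. int_kernel a \<xi>))\<^sup>2)"
      by (rule complex_norm_square[symmetric])
    finally show ?thesis by simp
  qed
  have \<psi>_le: "cmod (\<psi> n) \<le> (if int_rank n \<le> dyad k then 1 else 0)" for n
  proof (cases "int_rank n \<le> dyad k")
    case True
    have "cmod (\<psi> n) \<le> (\<Sum>ab\<in>A \<times> A. 1 / real N * indicator {fst ab - snd ab} n)"
      unfolding \<psi>_def p_def
      by (intro order.trans[OF norm_sum] sum_mono) (auto simp: norm_mult norm_divide indicator_def)
    also have "\<dots> = (\<Sum>a\<in>A. \<Sum>b\<in>A. 1 / real N * indicator {a - b} n)"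
      by (simp add: sum.cartesian_product case_prod_unfold)
    also have "\<dots> \<le> (\<Sum>a\<in>A. 1 / real N)"
    proof (rule sum_mono)
      fix a
      have "(\<Sum>b\<in>A. 1 / real N * indicator {a - b} n) = (\<Sum>b\<in>A. if b = a - n then 1 / real N else 0)"
        by (intro sum.cong refl) (auto simp: indicator_def)
      also have "\<dots> \<le> 1 / real N" using A by (simp add: sum.delta)
      finally show "(\<Sum>b\<in>A. 1 / real N * indicator {a - b} n) \<le> 1 / real N" .
    qed
    also have "\<dots> = 1" using A N by simp
    finally show ?thesis using True by simp
  next
    case False
    have "p ab n = 0" if "ab \<in> A \<times> A" for ab
    proof (rule ccontr)
      assume "p ab n \<noteq> 0"
      then have "n = fst ab - snd ab" by (auto simp: p_def indicator_def split: if_splits)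
      then have "\<bar>n\<bar> \<le> int N - 1" using that by (auto simp: A_def)
      then have "\<bar>real_of_int n\<bar> \<le> real N - 1" by linarith
      then have "int_rank n \<le> dyad k" using int_rank_le[of n] N(1) dyad_pos[of k] by linarith
      then show False using False by simp
    qed
    then have "\<psi> n = 0" unfolding \<psi>_def by (intro sum.neutral) auto
    then show ?thesis by simp
  qed
  have low: "1 / 24 * dyad k \<le> Re (seq.FT \<psi> \<xi>)" if \<xi>: "torus_radius \<xi> \<le> dyad (- k)" for \<xi>
  proof -
    have "real N / 2 = (\<Sum>a\<in>A. 1 / 2)" using A by simp
    also have "\<dots> \<le> (\<Sum>a\<in>A. Re (int_kernel a \<xi>))"
    proof (rule sum_mono)
      fix a assume a: "a \<in> A"
      have "\<bar>real_of_int a\<bar> \<le> dyad k / 6" using a N(1) by (auto simp: A_def)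
      moreover have "2 * \<bar>\<xi>\<bar> \<le> inverse (dyad k)" using \<xi> by (simp add: torus_radius_def dyad_minus)
      ultimately have "\<bar>real_of_int a\<bar> * (2 * \<bar>\<xi>\<bar>) \<le> dyad k / 6 * inverse (dyad k)"
        by (intro mult_mono) auto
      also have "\<dots> = 1 / 6" using less_imp_neq[OF dyad_pos, of k] by simp
      finally have "pi * (\<bar>real_of_int a\<bar> * (2 * \<bar>\<xi>\<bar>)) \<le> pi * (1 / 6)" by (rule mult_left_mono) simp
      then have "\<bar>2 * pi * real_of_int a * \<xi>\<bar> \<le> pi / 3" using pi_gt_zero by (simp add: abs_mult mult_ac)
      then have "1 / 2 \<le> cos (2 * pi * real_of_int a * \<xi>)" by (rule half_le_cos)
      then show "1 / 2 \<le> Re (int_kernel a \<xi>)" by (simp add: int_kernel_def)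
    qed
    also have "\<dots> = Re (\<Sum>a\<in>A. int_kernel a \<xi>)" by (simp add: Re_sum)
    also have "\<dots> \<le> cmod (\<Sum>a\<in>A. int_kernel a \<xi>)" by (rule complex_Re_le_cmod)
    finally have "(real N / 2)\<^sup>2 \<le> (cmod (\<Sum>a\<in>A. int_kernel a \<xi>))\<^sup>2" by (rule power_mono) simp
    then have "1 / real N * (real N / 2)\<^sup>2 \<le> Re (seq.FT \<psi> \<xi>)"
      unfolding FT_\<psi> Re_complex_of_real by (rule mult_left_mono) simp
    moreover have "1 / real N * (real N / 2)\<^sup>2 = real N / 4" using N(3) by (simp add: power2_eq_square)
    ultimately show ?thesis using N(2) by simp
  qed
  have "0 \<le> Re (seq.FT \<psi> \<xi>)" for \<xi> unfolding FT_\<psi> by simp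
  then show ?thesis using \<psi>_int \<psi>_le low by (intro exI[of _ \<psi>]) auto
qed

lemma dyad_int_power: "0 \<le> k \<Longrightarrow> dyad k = real_of_int (2 ^ nat k)"
  using dyad_of_nat[of "nat k"] by simp

lemma fourier_setting_seq: "fourier_setting int_measure torus_measure int_kernel int_rank torus_radius (1 / 24) 3"
proof (rule fourier_setting.intro[OF fourier_kernel_int], rule fourier_setting_axioms.intro, goal_cases)
  case 5
  show ?case by (rule torus.sigma_finite_measure_axioms)
next
  case 6
  show ?case using emeasure_int_eq_0 by auto
next
  case (7 r)
  show ?case using torus.emeasure_finite by (simp add: less_top[symmetric])
next
  case (8 i)
  have "ennreal (1 / 24 * dyad (- i)) \<le> ennreal (1 / 8 * dyad (- i))" by (intro ennreal_leI mult_right_mono) auto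
  also note torus_shell_large[OF 8]
  finally show ?case .
next
  case (9 k)
  show ?case using seq_bump[of k] by blast
next
  case (10 i j)
  obtain \<psi> where \<psi>: "integrable int_measure \<psi>"
     "\<And>n. n \<in> space int_measure \<Longrightarrow> cmod (\<psi> n) \<le> (if int_rank n \<le> dyad j then 1 else 0)"
     "\<And>\<xi>. torus_radius \<xi> \<le> dyad (- j) \<Longrightarrow> 1 / 24 * dyad j \<le> Re (seq.FT \<psi> \<xi>)"
    using seq_bump[of j] by blast
  \<comment> \<open>The transform of the bump is translated by multiples of \<open>2\<^sup>-\<^sup>j\<close>; rounding finds
    the nearest one.\<close>
  define Q :: int where "Q = 2 ^ nat (j - i)"
  have Q: "1 \<le> Q" "dyad (j - i) = real_of_int Q" using 10 by (simp_all add: Q_def dyad_int_power)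
  have d: "dyad (- i) = dyad (- j) * Q" using dyad_add[of "- j" "j - i"] by (simp add: Q(2))
  show ?case
  proof (rule seq.cover_by_modulation[OF \<psi>(1,2,3)])
    show "int_kernel n \<xi> * cnj (int_kernel n \<eta>) = int_kernel n (\<xi> - \<eta>)" for n \<xi> \<eta>
      by (simp add: int_kernel_def cis_diff_mult algebra_simps)
    show "real (card ((\<lambda>q. dyad (- j) * real_of_int q) ` {- Q..Q})) \<le> 3 * dyad (j - i)"
      unfolding Q(2) by (rule card_image_Icc_int_le[OF Q(1)])
    fix \<xi> assume \<xi>: "torus_radius \<xi> \<le> dyad (- i)"
    define x where "x = \<xi> / dyad (- j)"
    have \<xi>_eq: "\<xi> = dyad (- j) * x" using less_imp_neq[OF dyad_pos, of "- j"] by (simp add: x_def)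
    have "\<bar>x\<bar> \<le> Q / 2"
      using \<xi> unfolding torus_radius_def d \<xi>_eq abs_mult by simp
    then have "\<bar>real_of_int (round x)\<bar> \<le> Q / 2 + 1 / 2" using round_close[of x] by linarith
    then have "round x \<in> {- Q..Q}" using Q(1) by (auto simp: abs_le_iff)
    moreover have "torus_radius (\<xi> - dyad (- j) * real_of_int (round x)) \<le> dyad (- j)"
      using round_close[of x] by (simp add: torus_radius_def \<xi>_eq abs_mult flip: right_diff_distrib)
    ultimately show "\<exists>\<eta>\<in>(\<lambda>q. dyad (- j) * real_of_int q) ` {- Q..Q}. torus_radius (\<xi> - \<eta>) \<le> dyad (- j)"
      by blast
  qed (assumption | intro finite_imageI finite_atLeastAtMost_int)+
qed auto

lemma int_fourier_eq: assumes "integrable int_measure f" shows "int_fourier f = seq.FT f"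
proof
  fix x
  have "Infinite_Set_Sum.abs_summable_on (\<lambda>n. f n * int_kernel n x) UNIV"
    unfolding Infinite_Set_Sum.abs_summable_on_def by (rule seq.integrable_mult_kernel[OF assms])
  then have "infsetsum (\<lambda>n. f n * int_kernel n x) UNIV = infsum (\<lambda>n. f n * int_kernel n x) UNIV"
    by (rule infsetsum_infsum)
  then show "int_fourier f x = seq.FT f x"
    by (simp add: int_fourier_def seq.FT_def infsetsum_def int_kernel_def)
qed

lemma sum_le_nn_integral_count: "finite A \<Longrightarrow> (\<Sum>n\<in>A. g n) \<le> (\<integral>\<^sup>+n. g n \<partial>int_measure)" for g :: "int \<Rightarrow> ennreal"
proof -
  assume A: "finite A"
  have "(\<Sum>n\<in>A. g n) = (\<integral>\<^sup>+n. g n \<partial>count_space A)" using A by (simp add: nn_integral_count_space_finite)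
  also have "\<dots> = (\<integral>\<^sup>+n. g n * indicator A n \<partial>int_measure)" by (simp add: nn_integral_count_space_indicator)
  also have "\<dots> \<le> (\<integral>\<^sup>+n. g n \<partial>int_measure)" by (intro nn_integral_mono) (auto simp: indicator_def)
  finally show ?thesis .
qed

lemma tendsto_imp_eventually_half:
  fixes u :: "nat \<Rightarrow> complex"
  assumes "u \<longlonglongrightarrow> z" shows "\<forall>\<^sub>F n in sequentially. 1 / 2 * cmod z \<le> cmod (u n)"
proof (cases "z = 0")
  case False
  then have "1 / 2 * cmod z < cmod z" by simp
  moreover have "(\<lambda>n. cmod (u n)) \<longlonglongrightarrow> cmod z" using assms by (rule tendsto_norm)
  ultimately have "\<forall>\<^sub>F n in sequentially. 1 / 2 * cmod z < cmod (u n)" by (intro order_tendstoD)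
  then show ?thesis by (rule eventually_mono) simp
qed simp

text \<open>
  The approximating operators are the symmetric partial sums of the Fourier series. Their \<open>L\<^sup>2\<close>
  bound is Parseval's identity for trigonometric polynomials.
\<close>

lemma seq_approximable:
  "fourier_setting.approximable int_measure torus_measure int_kernel (1 / 2)"
proof -
  interpret fourier_setting int_measure torus_measure int_kernel int_rank torus_radius "1 / 24" 3
    by (rule fourier_setting_seq)
  define T where "T n g x = (\<Sum>m\<in>{- int n..int n}. g m * cis (2 * pi * real_of_int m * x))" for n :: nat and g x
  have [measurable]: "T n g \<in> borel_measurable torus_measure" for n g
    unfolding T_def[abs_def] by measurable
  have sub: "sublinear_operator int_measure torus_measure (T n)" for n
    unfolding sublinear_operator_def
    by (auto simp: T_def distrib_right sum.distrib mult.assoc norm_mult norm_triangle_ineq simp flip: sum_distrib_left)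
  have strong: "joint_strong_type int_measure torus_measure 1 (T n)" for n
    unfolding joint_strong_type_def
  proof (intro conjI ballI)
    fix g :: "int \<Rightarrow> complex"
    have "ennreal (cmod (T n g x)) \<le> Lp_norm int_measure 1 g" for x
    proof -
      have "ennreal (cmod (T n g x)) \<le> ennreal (\<Sum>m\<in>{- int n..int n}. cmod (g m))"
        unfolding T_def by (intro ennreal_leI order.trans[OF norm_sum]) (simp add: norm_mult)
      also have "\<dots> = (\<Sum>m\<in>{- int n..int n}. ennreal (cmod (g m)))" by (simp add: sum_ennreal)
      also have "\<dots> \<le> Lp_norm int_measure 1 g" unfolding Lp_norm_1 by (rule sum_le_nn_integral_count) simp
      finally show ?thesis .
    qed
    then show "Linf_norm torus_measure (T n g) \<le> ennreal 1 * Lp_norm int_measure 1 g"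
      unfolding Linf_norm_def by (intro esssup_I) auto
    have "(\<integral>\<^sup>+x. ennreal ((cmod (T n g x))\<^sup>2) \<partial>torus_measure) = (\<Sum>m\<in>{- int n..int n}. ennreal ((cmod (g m))\<^sup>2))"
      unfolding T_def by (rule parseval_trig_polynomial) simp
    also have "\<dots> \<le> (\<integral>\<^sup>+m. ennreal ((cmod (g m))\<^sup>2) \<partial>int_measure)" by (rule sum_le_nn_integral_count) simp
    finally show "Lp_norm torus_measure 2 (T n g) \<le> ennreal 1 * Lp_norm int_measure 2 g"
      unfolding Lp_norm_2 by (simp add: ennreal_powr_mono)
  qed
  show ?thesis
    unfolding approximable_def
  proof (intro allI impI exI[of _ T] conjI sub strong AE_I2)
    fix f :: "int \<Rightarrow> complex" and \<xi> assume f: "integrable int_measure f"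
    have "(\<lambda>n. T n f \<xi>) \<longlonglongrightarrow> seq.FT f \<xi>"
    proof -
      have "(\<lambda>n. \<integral>m. (if m \<in> {- int n..int n} then f m * int_kernel m \<xi> else 0) \<partial>int_measure) \<longlonglongrightarrow> seq.FT f \<xi>"
        unfolding seq.FT_def
      proof (rule integral_dominated_convergence)
        show "integrable int_measure (\<lambda>m. cmod (f m))" using f by (rule integrable_norm)
        show "AE m in int_measure. (\<lambda>n. if m \<in> {- int n..int n} then f m * int_kernel m \<xi> else 0) \<longlonglongrightarrow> f m * int_kernel m \<xi>"
        proof (rule AE_I2)
          fix m
          have "\<forall>\<^sub>F n in sequentially. m \<in> {- int n..int n}"
            using eventually_ge_at_top[of "nat \<bar>m\<bar>"] by eventually_elim auto
          then have "\<forall>\<^sub>F n in sequentially. (if m \<in> {- int n..int n} then f m * int_kernel m \<xi> else 0) = f m * int_kernel m \<xi>"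
            by eventually_elim simp
          then show "(\<lambda>n. if m \<in> {- int n..int n} then f m * int_kernel m \<xi> else 0) \<longlonglongrightarrow> f m * int_kernel m \<xi>"
            by (rule tendsto_eventually)
        qed
        show "AE m in int_measure. norm (if m \<in> {- int n..int n} then f m * int_kernel m \<xi> else 0) \<le> cmod (f m)" for n
          by (auto simp: norm_mult seq.kernel_unimodular)
      qed auto
      moreover have "(\<integral>m. (if m \<in> {- int n..int n} then f m * int_kernel m \<xi> else 0) \<partial>int_measure) = T n f \<xi>" for n
      proof -
        have "(\<integral>m. (if m \<in> {- int n..int n} then f m * int_kernel m \<xi> else 0) \<partial>int_measure)
          = (\<Sum>m\<in>{- int n..int n}. if m \<in> {- int n..int n} then f m * int_kernel m \<xi> else 0)"
          by (rule integral_int_measure_finite) auto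
        then show ?thesis by (simp add: T_def int_kernel_def)
      qed
      ultimately show ?thesis by simp
    qed
    then show "\<forall>\<^sub>F n in sequentially. 1 / 2 * cmod (seq.FT f \<xi>) \<le> cmod (T n f \<xi>)"
      by (rule tendsto_imp_eventually_half)
  qed
qed

section \<open>Functions on the torus\<close>

definition torus_kernel :: "real \<Rightarrow> int \<Rightarrow> complex" where
  "torus_kernel x n = cis (- 2 * pi * real_of_int n * x)"

lemma torus_kernel_borel: "(\<lambda>x. torus_kernel x n) \<in> borel_measurable borel"
  unfolding torus_kernel_def by (intro borel_measurable_continuous_onI continuous_intros)

lemma fourier_kernel_torus: "fourier_kernel torus_measure int_measure torus_kernel"
proof
  show "cmod (torus_kernel x n) = 1" for n x by (simp add: torus_kernel_def)
  show "(\<lambda>x. torus_kernel x n) \<in> borel_measurable torus_measure" for n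
    by (rule borel_torus[OF torus_kernel_borel])
qed simp

interpretation per: fourier_kernel torus_measure int_measure torus_kernel
  by (rule fourier_kernel_torus)

lemma torus_fourier_eq: "torus_fourier f = per.FT f"
  by (simp add: torus_fourier_def[abs_def] per.FT_def[abs_def] torus_kernel_def)

lemma measure_real_ball: "0 \<le> r \<Longrightarrow> measure lborel (ball (0::real) r) = 2 * r"
  by (simp add: ball_eq_greaterThanLessThan)

lemma emeasure_ball_finite: "emeasure lborel (ball (0::'a::euclidean_space) r) < \<infinity>"
  using emeasure_lborel_ball_finite by (simp add: less_top[symmetric])

text \<open>
  The normalised autocorrelation of the interval of radius \<open>dyad k / 6\<close>: this radius keeps the phases
  within \<open>pi / 3\<close> for all \<open>n\<close> in the dual ball, where \<open>\<bar>n\<bar> \<le> dyad (-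
  k)\<close> because \<open>k \<le> 0\<close>.
\<close>

lemma per_bump:
  assumes k: "k \<le> 0"
  shows "\<exists>\<psi>. integrable torus_measure \<psi> \<and>
     (\<forall>x\<in>space torus_measure. cmod (\<psi> x) \<le> (if torus_radius x \<le> dyad k then 1 else 0)) \<and>
     (\<forall>n. 0 \<le> Re (per.FT \<psi> n) \<and> (int_rank n \<le> dyad (- k) \<longrightarrow> 1 / 24 * dyad k \<le> Re (per.FT \<psi> n)))"
proof -
  define r where "r = dyad k / 6"
  have r: "0 < r" by (simp add: r_def)
  have "dyad k \<le> dyad 0" using k by (simp only: dyad_le_iff)
  then have d1: "dyad k \<le> 1" by simp
  define B where "B = ball (0::real) r"
  have B [measurable]: "B \<in> sets borel" by (simp add: B_def)
  have B_fin: "emeasure lborel B < \<infinity>" unfolding B_def by (rule emeasure_ball_finite)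
  have B_m: "measure lborel B = 2 * r" unfolding B_def using r by (intro measure_real_ball) simp
  define \<psi> where "\<psi> x = complex_of_real (1 / (2 * r)) * complex_of_real (autocorr B x)" for x
  have supp: "\<psi> x = 0" if "2 * r \<le> \<bar>x\<bar>" for x
    using autocorr_support[of r x] that by (simp add: \<psi>_def B_def)
  have out: "\<psi> x = 0" if "x \<notin> {- (1 / 2)..1 / 2}" for x
    using that d1 by (intro supp) (auto simp: r_def abs_if)
  have [measurable]: "\<psi> \<in> borel_measurable borel" unfolding \<psi>_def[abs_def] by measurable
  note [measurable] = torus_kernel_borel
  have "integrable lborel \<psi>" unfolding \<psi>_def[abs_def]
    by (intro integrable_mult_right) (rule integrable_of_real[OF autocorr_transform(1)[OF B B_fin]])
  then have \<psi>_int: "integrable torus_measure \<psi>" by (subst torus_integral_eq(2)) (auto simp: out)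
  have FT_\<psi>: "per.FT \<psi> n = complex_of_real (1 / (2 * r) * (cmod (\<integral>y. indicator B y * cis ((- 2 * pi * real_of_int n) \<bullet> y) \<partial>lborel))\<^sup>2)" for n
  proof -
    have "per.FT \<psi> n = (\<integral>x. \<psi> x * torus_kernel x n \<partial>lborel)"
      unfolding per.FT_def by (rule torus_integral_eq(1)) (auto simp: out)
    also have "\<dots> = (\<integral>x. complex_of_real (1 / (2 * r)) * (complex_of_real (autocorr B x) * cis ((- 2 * pi * real_of_int n) \<bullet> x)) \<partial>lborel)"
      by (simp add: \<psi>_def torus_kernel_def mult.assoc)
    also have "\<dots> = complex_of_real (1 / (2 * r)) * (\<integral>x. complex_of_real (autocorr B x) * cis ((- 2 * pi * real_of_int n) \<bullet> x) \<partial>lborel)"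
      by (rule integral_mult_right_zero)
    finally show ?thesis unfolding autocorr_transform(2)[OF B B_fin] by simp
  qed
  have \<psi>_le: "cmod (\<psi> x) \<le> (if torus_radius x \<le> dyad k then 1 else 0)" for x
  proof (cases "torus_radius x \<le> dyad k")
    case True
    have "cmod (\<psi> x) = 1 / (2 * r) * autocorr B x"
      using r autocorr_bounds(1)[OF B B_fin, of x] by (simp add: \<psi>_def norm_mult norm_divide)
    also have "\<dots> \<le> 1 / (2 * r) * (2 * r)"
      using r autocorr_bounds(2)[OF B B_fin, of x] unfolding B_m by (intro mult_left_mono) auto
    finally show ?thesis using True r by simp
  next
    case False
    have "\<psi> x = 0" using False r by (intro supp) (simp add: torus_radius_def r_def)
    then show ?thesis by simp
  qed
  have low: "1 / 24 * dyad k \<le> Re (per.FT \<psi> n)" if n: "int_rank n \<le> dyad (- k)" for n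
  proof -
    have "dyad 0 \<le> dyad (- k)" using k by (simp only: dyad_le_iff)
    then have "1 \<le> dyad (- k)" by simp
    then have n': "\<bar>real_of_int n\<bar> \<le> dyad (- k)" using n int_rank_ge[of n] by linarith
    have "\<bar>(- 2 * pi * real_of_int n) \<bullet> y\<bar> \<le> pi / 3" if "y \<in> B" for y
    proof -
      have "\<bar>real_of_int n\<bar> * \<bar>y\<bar> \<le> dyad (- k) * r"
        using n' that by (intro mult_mono) (auto simp: B_def)
      also have "\<dots> = 1 / 6" using less_imp_neq[OF dyad_pos, of k] by (simp add: r_def dyad_minus)
      finally have "2 * pi * (\<bar>real_of_int n\<bar> * \<bar>y\<bar>) \<le> 2 * pi * (1 / 6)" by (rule mult_left_mono) simp
      then show ?thesis by (simp add: abs_mult mult.assoc)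
    qed
    from transform_indicator_lower[OF B B_fin this]
    have "r \<le> cmod (\<integral>y. indicator B y * cis ((- 2 * pi * real_of_int n) \<bullet> y) \<partial>lborel)" unfolding B_m by simp
    then have "r\<^sup>2 \<le> (cmod (\<integral>y. indicator B y * cis ((- 2 * pi * real_of_int n) \<bullet> y) \<partial>lborel))\<^sup>2"
      using r by (intro power_mono) auto
    then have "1 / (2 * r) * r\<^sup>2 \<le> Re (per.FT \<psi> n)"
      unfolding FT_\<psi> Re_complex_of_real using r by (intro mult_left_mono) auto
    moreover have "1 / (2 * r) * r\<^sup>2 = dyad k / 12" using r by (simp add: r_def power2_eq_square)
    ultimately show ?thesis using dyad_pos[of k] by linarith
  qed
  have "0 \<le> Re (per.FT \<psi> n)" for n unfolding FT_\<psi> Re_complex_of_real using r by simp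
  then show ?thesis using \<psi>_int \<psi>_le low by (intro exI[of _ \<psi>]) auto
qed

lemma fourier_setting_per: "fourier_setting torus_measure int_measure torus_kernel torus_radius int_rank (1 / 24) 3"
proof (rule fourier_setting.intro[OF fourier_kernel_torus], rule fourier_setting_axioms.intro, goal_cases)
  case 5
  show ?case by (rule sigma_finite_measure_count_space)
next
  case 6
  have "emeasure torus_measure {0} = 0" by (subst emeasure_torus) auto
  moreover have "{0} \<in> sets torus_measure" by (rule sets_torusI) auto
  ultimately have "AE x in torus_measure. x \<notin> {0}" by (intro AE_not_in) auto
  then show ?case by eventually_elim (auto simp: torus_radius_def)
next
  case (7 r)
  show ?case by (rule int_ball_finite)
next
  case (8 i)
  have "ennreal (1 / 24 * dyad (- i)) \<le> ennreal (1 / 8 * dyad (- i))" by (intro ennreal_leI mult_right_mono) auto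
  also note int_shell_large[OF 8]
  finally show ?case .
next
  case (9 k)
  then have "k \<le> 0" using degenerate_torus[of k] by linarith
  from per_bump[OF this] show ?case by blast
next
  case (10 i j)
  then have j: "j < 0" using degenerate_torus[of j] by linarith
  then have j0: "j \<le> 0" by simp
  obtain \<psi> where \<psi>: "integrable torus_measure \<psi>"
     "\<And>x. x \<in> space torus_measure \<Longrightarrow> cmod (\<psi> x) \<le> (if torus_radius x \<le> dyad j then 1 else 0)"
     "\<And>n. int_rank n \<le> dyad (- j) \<Longrightarrow> 1 / 24 * dyad j \<le> Re (per.FT \<psi> n)"
    using per_bump[OF j0] by blast
  \<comment> \<open>The transform of the bump is translated by multiples of \<open>s = 2\<^sup>-\<^sup>j\<close>, an integer
    because \<open>j < 0\<close> at scales that are not degenerate.\<close>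
  define Q s :: int where "Q = 2 ^ nat (j - i)" and "s = 2 ^ nat (- j)"
  have Q: "1 \<le> Q" "dyad (j - i) = real_of_int Q" using 10 by (simp_all add: Q_def dyad_int_power)
  have s: "1 \<le> s" "dyad (- j) = real_of_int s" using j by (simp_all add: s_def dyad_int_power)
  have d: "dyad (- i) = real_of_int s * Q" using dyad_add[of "- j" "j - i"] by (simp add: Q(2) s(2))
  show ?case
  proof (rule per.cover_by_modulation[OF \<psi>(1,2,3)])
    show "torus_kernel x n * cnj (torus_kernel x m) = torus_kernel x (n - m)" for x n m
      by (simp add: torus_kernel_def cis_diff_mult algebra_simps)
    show "real (card ((\<lambda>q. s * q) ` {- Q..Q})) \<le> 3 * dyad (j - i)"
      unfolding Q(2) by (rule card_image_Icc_int_le[OF Q(1)])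
    fix n assume n: "int_rank n \<le> dyad (- i)"
    define x where "x = real_of_int n / s"
    have n_eq: "real_of_int n = s * x" using s(1) by (simp add: x_def)
    have "1 \<le> s * Q" using mult_mono[OF s(1) Q(1)] s(1) by simp
    then have "1 \<le> real_of_int s * Q" by (metis of_int_1_le_iff of_int_mult)
    then have "\<bar>real_of_int n\<bar> \<le> real_of_int s * Q" using n int_rank_ge[of n] unfolding d by linarith
    then have "\<bar>x\<bar> \<le> Q" using s(1) unfolding n_eq abs_mult by simp
    then have "\<bar>real_of_int (round x)\<bar> \<le> Q + 1 / 2" using round_close[of x] by linarith
    then have "round x \<in> {- Q..Q}" by (auto simp: abs_le_iff)
    moreover have "int_rank (n - s * round x) \<le> dyad (- j)"
    proof -
      have "int_rank (n - s * round x) \<le> 2 * \<bar>real_of_int (n - s * round x)\<bar>" by (rule int_rank_le)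
      also have "\<dots> = 2 * (s * \<bar>x - real_of_int (round x)\<bar>)"
        using s(1) by (simp add: n_eq abs_mult flip: right_diff_distrib)
      also have "\<dots> \<le> 2 * (s * (1 / 2))" using s(1) by (intro mult_left_mono round_close) auto
      finally show ?thesis by (simp add: s(2))
    qed
    ultimately show "\<exists>\<eta>\<in>(\<lambda>q. s * q) ` {- Q..Q}. int_rank (n - \<eta>) \<le> dyad (- j)" by blast
  qed (assumption | intro finite_imageI finite_atLeastAtMost_int)+
qed (auto simp: torus_radius_measurable)

lemma Lp_space_2_torus_integrable:
  assumes "g \<in> Lp_space torus_measure 2"
  shows "integrable torus_measure g"
proof -
  have "integrable torus_measure (\<lambda>x. indicator (space torus_measure) x * g x)"
    by (rule Lp_space_2_integrable_on_finite[OF assms sets.top]) simp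
  then show ?thesis
    by (subst (asm) Bochner_Integration.integrable_cong[of torus_measure torus_measure _ g]) auto
qed

lemma L1_plus_L2_torus: "f \<in> L1_plus_L2 torus_measure \<Longrightarrow> integrable torus_measure f"
  by (auto simp: L1_plus_L2_def Lp_space_1_iff Lp_space_2_torus_integrable)

text \<open>
  Expand the squared norm of the difference of \<open>g\<close> and its partial sum \<open>p\<close>.
\<close>

lemma bessel_torus:
  assumes g: "g \<in> Lp_space torus_measure 2" and A: "finite A"
  shows "(\<Sum>n\<in>A. (cmod (per.FT g n))\<^sup>2) \<le> (\<integral>x. (cmod (g x))\<^sup>2 \<partial>torus_measure)"
proof -
  note gi = Lp_space_2_torus_integrable[OF g] Lp_space_2_integrable_square[OF g]
  define c where "c n = per.FT g n" for n
  define p where "p x = (\<Sum>n\<in>A. c n * cnj (torus_kernel x n))" for x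
  define S where "S = (\<Sum>n\<in>A. (cmod (c n))\<^sup>2)"
  have conj: "cnj (torus_kernel x n) = cis (2 * pi * real_of_int n * x)" for x n
    by (simp add: torus_kernel_def cis_cnj)
  have p_eq: "p x = (\<Sum>n\<in>A. c n * cis (2 * pi * real_of_int n * x))" for x by (simp add: p_def conj)
  have [measurable]: "p \<in> borel_measurable torus_measure" unfolding p_eq[abs_def] by measurable
  have p_bd: "cmod (p x) \<le> (\<Sum>n\<in>A. cmod (c n))" for x
    unfolding p_eq by (rule order.trans[OF norm_sum]) (simp add: norm_mult)
  have pp_i: "integrable torus_measure (\<lambda>x. (cmod (p x))\<^sup>2)"
    by (rule torus.integrable_const_bound[where B = "(\<Sum>n\<in>A. cmod (c n))\<^sup>2"])
      (auto intro!: power_mono p_bd AE_I2)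
  have "(\<integral>\<^sup>+x. ennreal ((cmod (p x))\<^sup>2) \<partial>torus_measure) = (\<Sum>n\<in>A. ennreal ((cmod (c n))\<^sup>2))"
    unfolding p_eq by (rule parseval_trig_polynomial[OF A])
  then have "ennreal (\<integral>x. (cmod (p x))\<^sup>2 \<partial>torus_measure) = ennreal S"
    using pp_i by (simp add: nn_integral_eq_integral sum_ennreal S_def)
  moreover have "0 \<le> (\<integral>x. (cmod (p x))\<^sup>2 \<partial>torus_measure)" by (rule integral_nonneg_AE) simp
  moreover have S0: "0 \<le> S" unfolding S_def by (intro sum_nonneg) auto
  ultimately have pp: "(\<integral>x. (cmod (p x))\<^sup>2 \<partial>torus_measure) = S" by simp
  have gp_i: "integrable torus_measure (\<lambda>x. g x * torus_kernel x n)" for n by (rule per.integrable_mult_kernel[OF gi(1)])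
  have gp_eq: "g x * cnj (p x) = (\<Sum>n\<in>A. cnj (c n) * (g x * torus_kernel x n))" for x
    by (simp add: p_def cnj_sum sum_distrib_left mult_ac)
  have gpi: "integrable torus_measure (\<lambda>x. g x * cnj (p x))"
    unfolding gp_eq by (intro Bochner_Integration.integrable_sum integrable_mult_right gp_i)
  have "(\<integral>x. g x * cnj (p x) \<partial>torus_measure) = (\<Sum>n\<in>A. cnj (c n) * (\<integral>x. g x * torus_kernel x n \<partial>torus_measure))"
    unfolding gp_eq by (subst Bochner_Integration.integral_sum) (auto intro: integrable_mult_right gp_i)
  also have "\<dots> = (\<Sum>n\<in>A. c n * cnj (c n))" by (simp add: c_def per.FT_def mult.commute)
  also have "\<dots> = complex_of_real S" unfolding S_def of_real_sum complex_norm_square ..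
  finally have gp: "(\<integral>x. g x * cnj (p x) \<partial>torus_measure) = complex_of_real S" .
  define u where "u x = Re (g x * cnj (p x))" for x
  have u_i: "integrable torus_measure u" unfolding u_def[abs_def] by (rule integrable_Re[OF gpi])
  have u: "(\<integral>x. u x \<partial>torus_measure) = S"
    unfolding u_def integral_Re[OF gpi] gp by simp
  have "0 \<le> (\<integral>x. (cmod (g x - p x))\<^sup>2 \<partial>torus_measure)" by (rule integral_nonneg_AE) simp
  also have "\<dots> = (\<integral>x. (cmod (g x))\<^sup>2 - 2 * u x + (cmod (p x))\<^sup>2 \<partial>torus_measure)"
    by (intro Bochner_Integration.integral_cong refl)
      (simp only: cmod_power2 u_def, simp add: power2_eq_square algebra_simps)
  also have "\<dots> = (\<integral>x. (cmod (g x))\<^sup>2 \<partial>torus_measure) - 2 * S + S"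
    using gi(2) pp_i u_i u pp by simp
  finally show ?thesis by (simp add: S_def c_def)
qed

text \<open>
  On a space of finite measure \<open>L\<^sup>1 + L\<^sup>2\<close> is \<open>L\<^sup>1\<close>, so the Fourier
  transform is itself an operator of joint strong type.
\<close>

lemma per_approximable: "fourier_setting.approximable torus_measure int_measure torus_kernel 1"
proof -
  interpret fourier_setting torus_measure int_measure torus_kernel torus_radius int_rank "1 / 24" 3
    by (rule fourier_setting_per)
  have sub: "sublinear_operator torus_measure int_measure per.FT"
    unfolding sublinear_operator_def
    by (auto simp: per.FT_add per.FT_scale L1_plus_L2_torus norm_mult norm_triangle_ineq)
  have strong: "joint_strong_type torus_measure int_measure 1 per.FT"
    unfolding joint_strong_type_def
  proof (intro conjI ballI)
    fix g assume "g \<in> Lp_space torus_measure 1"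
    then have g: "integrable torus_measure g" by (simp add: Lp_space_1_iff)
    have "ennreal (cmod (per.FT g n)) \<le> Lp_norm torus_measure 1 g" for n
      unfolding Lp_norm_1 using per.cmod_FT_le[of g n] g
      by (subst nn_integral_eq_integral) (auto intro: ennreal_leI)
    then show "Linf_norm int_measure (per.FT g) \<le> ennreal 1 * Lp_norm torus_measure 1 g"
      unfolding Linf_norm_def by (intro esssup_I) auto
  next
    fix g assume g: "g \<in> Lp_space torus_measure 2"
    have "(\<integral>\<^sup>+n. ennreal ((cmod (per.FT g n))\<^sup>2) \<partial>int_measure) \<le> (\<integral>\<^sup>+x. ennreal ((cmod (g x))\<^sup>2) \<partial>torus_measure)"
    proof (rule nn_integral_le_of_eventually[where U = "\<lambda>m n. ennreal ((cmod (per.FT g n))\<^sup>2) * indicator {- int m..int m} n"])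
      fix m :: nat
      have "(\<integral>\<^sup>+n. ennreal ((cmod (per.FT g n))\<^sup>2) * indicator {- int m..int m} n \<partial>int_measure)
         = (\<integral>\<^sup>+n. ennreal ((cmod (per.FT g n))\<^sup>2) \<partial>count_space {- int m..int m})"
        by (simp add: nn_integral_count_space_indicator)
      also have "\<dots> = (\<Sum>n\<in>{- int m..int m}. ennreal ((cmod (per.FT g n))\<^sup>2))" by (simp add: nn_integral_count_space_finite)
      also have "\<dots> = ennreal (\<Sum>n\<in>{- int m..int m}. (cmod (per.FT g n))\<^sup>2)" by (simp add: sum_ennreal)
      also have "\<dots> \<le> ennreal (\<integral>x. (cmod (g x))\<^sup>2 \<partial>torus_measure)" by (intro ennreal_leI bessel_torus g) simp
      also have "\<dots> = (\<integral>\<^sup>+x. ennreal ((cmod (g x))\<^sup>2) \<partial>torus_measure)"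
        by (rule nn_integral_eq_integral[symmetric, OF Lp_space_2_integrable_square[OF g]]) auto
      finally show "(\<integral>\<^sup>+n. ennreal ((cmod (per.FT g n))\<^sup>2) * indicator {- int m..int m} n \<partial>int_measure)
         \<le> (\<integral>\<^sup>+x. ennreal ((cmod (g x))\<^sup>2) \<partial>torus_measure)" .
    next
      have "\<forall>\<^sub>F m in sequentially. ennreal ((cmod (per.FT g n))\<^sup>2)
          \<le> ennreal ((cmod (per.FT g n))\<^sup>2) * indicator {- int m..int m} n" for n :: int
        using eventually_ge_at_top[of "nat \<bar>n\<bar>"] by eventually_elim (auto simp: indicator_def)
      then show "AE n in int_measure. \<forall>\<^sub>F m in sequentially.
          ennreal ((cmod (per.FT g n))\<^sup>2) \<le> ennreal ((cmod (per.FT g n))\<^sup>2) * indicator {- int m..int m} n"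
        by (intro AE_I2)
    qed simp
    then show "Lp_norm int_measure 2 (per.FT g) \<le> ennreal 1 * Lp_norm torus_measure 2 g"
      unfolding Lp_norm_2 by (simp add: ennreal_powr_mono)
  qed
  show ?thesis
    unfolding approximable_def
    by (intro allI impI exI[of _ "\<lambda>_. per.FT"] conjI sub strong) simp
qed

section \<open>Gaussian weights\<close>

text \<open>
  Lebesgue measure is the image of the product of the measures on the coordinate axes.
\<close>

lemma lborel_product_integral:
  fixes f :: "'a::euclidean_space \<Rightarrow> real \<Rightarrow> complex"
  assumes f: "\<And>b. b \<in> Basis \<Longrightarrow> integrable lborel (f b)"
  shows "integrable lborel (\<lambda>x::'a. \<Prod>b\<in>Basis. f b (x \<bullet> b))"
    and "(\<integral>x. (\<Prod>b\<in>(Basis::'a set). f b (x \<bullet> b)) \<partial>lborel) = (\<Prod>b\<in>Basis. \<integral>s. f b s \<partial>lborel)"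
proof -
  interpret product_sigma_finite "\<lambda>_::'a. lborel :: real measure" by standard
  have [measurable]: "f b \<in> borel_measurable borel" if "b \<in> Basis" for b
    using f[OF that] by auto
  have meas: "(\<lambda>x::'a. \<Prod>b\<in>Basis. f b (x \<bullet> b)) \<in> borel_measurable borel"
    by (intro borel_measurable_prod) measurable
  have sum_meas: "(\<lambda>t. \<Sum>b\<in>Basis. t b *\<^sub>R b :: 'a) \<in> measurable (\<Pi>\<^sub>M b\<in>Basis. lborel) borel"
    by measurable
  have coord: "(\<Prod>b\<in>Basis. f b ((\<Sum>b'\<in>Basis. t b' *\<^sub>R b') \<bullet> b)) = (\<Prod>b\<in>Basis. f b (t b))" for t
    by (intro prod.cong refl) (simp add: inner_sum_left inner_Basis if_distrib[of "\<lambda>x. _ * x"] cong: if_cong)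
  have int: "integrable (\<Pi>\<^sub>M b\<in>Basis. lborel) (\<lambda>t. \<Prod>b\<in>(Basis::'a set). f b (t b))"
    by (rule product_integrable_prod[OF finite_Basis f])
  show "integrable lborel (\<lambda>x::'a. \<Prod>b\<in>Basis. f b (x \<bullet> b))"
    unfolding lborel_eq[where 'a = 'a] using int
    by (subst integrable_distr_eq[OF sum_meas meas]) (simp only: coord)
  have "(\<integral>x. (\<Prod>b\<in>(Basis::'a set). f b (x \<bullet> b)) \<partial>lborel) = (\<integral>t. (\<Prod>b\<in>Basis. f b (t b)) \<partial>(\<Pi>\<^sub>M b\<in>(Basis::'a set). lborel))"
    unfolding lborel_eq[where 'a = 'a] by (subst integral_distr[OF sum_meas meas]) (simp only: coord)
  also have "\<dots> = (\<Prod>b\<in>Basis. \<integral>s. f b s \<partial>lborel)"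
    by (rule product_integral_prod[OF finite_Basis f])
  finally show "(\<integral>x. (\<Prod>b\<in>(Basis::'a set). f b (x \<bullet> b)) \<partial>lborel) = (\<Prod>b\<in>Basis. \<integral>s. f b s \<partial>lborel)" .
qed

definition gauss1 :: "real \<Rightarrow> real \<Rightarrow> real" where
  "gauss1 n s = exp (- (s / n)\<^sup>2 / 2)"

definition gauss1_hat :: "real \<Rightarrow> real \<Rightarrow> real" where
  "gauss1_hat n z = n * sqrt (2 * pi) * exp (- (n * z)\<^sup>2 / 2)"

lemma gauss1_transform:
  assumes n: "0 < n"
  shows "integrable lborel (\<lambda>s. complex_of_real (gauss1 n s) * cis (z * s))"
    and "(\<integral>s. complex_of_real (gauss1 n s) * cis (z * s) \<partial>lborel) = complex_of_real (gauss1_hat n z)"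
proof -
  have [measurable]: "(\<lambda>s. cis (z * s)) \<in> borel_measurable borel" for z
    by (intro borel_measurable_continuous_onI continuous_intros)
  have eq: "complex_of_real (gauss1 n (0 + n * s)) * cis (z * (0 + n * s))
     = complex_of_real (sqrt (2 * pi)) * (complex_of_real (std_normal_density s) * cis (z * n * s))" for s
    using n by (simp add: gauss1_def std_normal_density_def mult_ac)
  have int: "integrable lborel (\<lambda>s. complex_of_real (std_normal_density s) * cis (z * n * s))"
    by (rule Bochner_Integration.integrable_bound[of lborel "normal_density 0 1"]) (auto simp: norm_mult)
  have "integrable lborel (\<lambda>s. complex_of_real (gauss1 n (0 + n * s)) * cis (z * (0 + n * s)))"
    unfolding eq by (intro integrable_mult_right int)
  then show "integrable lborel (\<lambda>s. complex_of_real (gauss1 n s) * cis (z * s))"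
    using n lborel_integrable_real_affine_iff[of n "\<lambda>s. complex_of_real (gauss1 n s) * cis (z * s)" 0] by simp
  have "(\<integral>s. complex_of_real (gauss1 n s) * cis (z * s) \<partial>lborel)
     = n *\<^sub>R (\<integral>s. complex_of_real (gauss1 n (0 + n * s)) * cis (z * (0 + n * s)) \<partial>lborel)"
    using lborel_integral_real_affine[of n "\<lambda>s. complex_of_real (gauss1 n s) * cis (z * s)" 0] n by simp
  also have "\<dots> = n *\<^sub>R (complex_of_real (sqrt (2 * pi)) * (\<integral>s. complex_of_real (std_normal_density s) * cis (z * n * s) \<partial>lborel))"
    unfolding eq by (simp only: integral_mult_right_zero)
  also have "(\<integral>s. complex_of_real (std_normal_density s) * cis (z * n * s) \<partial>lborel) = char std_normal_distribution (z * n)"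
    unfolding char_def by (subst integral_density) (auto simp: cis_conv_exp scaleR_conv_of_real)
  also have "\<dots> = complex_of_real (exp (- (z * n)\<^sup>2 / 2))"
    by (simp add: char_std_normal_distribution)
  finally show "(\<integral>s. complex_of_real (gauss1 n s) * cis (z * s) \<partial>lborel) = complex_of_real (gauss1_hat n z)"
    by (simp add: gauss1_hat_def scaleR_conv_of_real mult_ac)
qed

text \<open>
  The transform of a Gaussian weight of height one is a probability density in the variable \<open>s\<close>.
\<close>

lemma gauss1_hat_density:
  assumes n: "0 < n"
  shows "gauss1_hat n (2 * pi * s) = normal_density 0 (1 / (2 * pi * n)) s"
proof -
  have "sqrt (2 * pi * (1 / (2 * pi * n))\<^sup>2) = sqrt (2 * pi) / (2 * pi * n)"
    using n by (simp add: real_sqrt_mult real_sqrt_divide)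
  moreover have "n * sqrt (2 * pi) = 1 / (sqrt (2 * pi) / (2 * pi * n))"
  proof -
    have "sqrt (2 * pi) * sqrt (2 * pi) = 2 * pi" by simp
    then have "n * sqrt (2 * pi) * sqrt (2 * pi) = 2 * pi * n" by (simp only: mult.assoc mult.commute mult.left_commute)
    then show ?thesis using n by (simp add: field_simps)
  qed
  moreover have "- (n * (2 * pi * s))\<^sup>2 / 2 = - (s - 0)\<^sup>2 / (2 * (1 / (2 * pi * n))\<^sup>2)"
    using n by (simp add: field_simps power2_eq_square)
  ultimately show ?thesis unfolding gauss1_hat_def normal_density_def by simp
qed

definition gauss :: "real \<Rightarrow> 'a::euclidean_space \<Rightarrow> real" where
  "gauss n \<xi> = (\<Prod>b\<in>Basis. gauss1 n (\<xi> \<bullet> b))"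

definition gauss_hat :: "real \<Rightarrow> 'a::euclidean_space \<Rightarrow> real" where
  "gauss_hat n z = (\<Prod>b\<in>Basis. gauss1_hat n (z \<bullet> b))"

lemma gauss_nonneg: "0 \<le> gauss n \<xi>" and gauss_le_1: "gauss n \<xi> \<le> 1"
  unfolding gauss_def by (auto intro!: prod_nonneg prod_le_1 simp: gauss1_def)

lemma gauss_hat_nonneg: "0 < n \<Longrightarrow> 0 \<le> gauss_hat n z"
  unfolding gauss_hat_def by (auto intro!: prod_nonneg simp: gauss1_hat_def)

lemma gauss_hat_minus: "gauss_hat n (- z) = gauss_hat n z"
  by (simp add: gauss_hat_def gauss1_hat_def)

lemma gauss_measurable [measurable]: "gauss n \<in> borel_measurable borel"
  unfolding gauss_def[abs_def] gauss1_def by measurable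

lemma gauss_hat_measurable [measurable]: "gauss_hat n \<in> borel_measurable borel"
  unfolding gauss_hat_def[abs_def] gauss1_hat_def by measurable

lemma gauss_transform:
  fixes z :: "'a::euclidean_space"
  assumes n: "0 < n"
  shows "integrable lborel (\<lambda>\<xi>. complex_of_real (gauss n \<xi>) * cis (z \<bullet> \<xi>))"
    and "(\<integral>\<xi>. complex_of_real (gauss n \<xi>) * cis (z \<bullet> \<xi>) \<partial>lborel) = complex_of_real (gauss_hat n z)"
proof -
  have eq: "complex_of_real (gauss n \<xi>) * cis (z \<bullet> \<xi>)
     = (\<Prod>b\<in>Basis. complex_of_real (gauss1 n (\<xi> \<bullet> b)) * cis ((z \<bullet> b) * (\<xi> \<bullet> b)))" for \<xi>
  proof -
    have "cis (z \<bullet> \<xi>) = (\<Prod>b\<in>Basis. cis ((z \<bullet> b) * (\<xi> \<bullet> b)))"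
      by (simp add: euclidean_inner[of z \<xi>] cis_conv_exp sum_distrib_left exp_sum)
    then show ?thesis by (simp add: gauss_def prod.distrib)
  qed
  show "integrable lborel (\<lambda>\<xi>. complex_of_real (gauss n \<xi>) * cis (z \<bullet> \<xi>))"
    unfolding eq by (rule lborel_product_integral(1)) (rule gauss1_transform(1)[OF n])
  show "(\<integral>\<xi>. complex_of_real (gauss n \<xi>) * cis (z \<bullet> \<xi>) \<partial>lborel) = complex_of_real (gauss_hat n z)"
    unfolding eq
    by (subst lborel_product_integral(2)[OF gauss1_transform(1)[OF n]])
      (simp add: gauss1_transform(2)[OF n] gauss_hat_def)
qed

lemma gauss_integrable: "0 < n \<Longrightarrow> integrable lborel (gauss n :: 'a::euclidean_space \<Rightarrow> real)"
  using integrable_Re[OF gauss_transform(1)[of n 0]] by simp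

lemma nn_integral_gauss_hat:
  fixes y :: "'a::euclidean_space"
  assumes n: "0 < n"
  shows "(\<integral>\<^sup>+x. ennreal (gauss_hat n ((2 * pi) *\<^sub>R (y - x))) \<partial>lborel) = 1"
proof -
  have dens: "integrable lborel (\<lambda>s. complex_of_real (gauss1_hat n (2 * pi * s)))"
    "(\<integral>s. complex_of_real (gauss1_hat n (2 * pi * s)) \<partial>lborel) = 1"
    unfolding gauss1_hat_density[OF n] using n
    by (auto intro!: integrable_of_real simp: integral_of_real)
  have eq: "complex_of_real (gauss_hat n ((2 * pi) *\<^sub>R x)) = (\<Prod>b\<in>Basis. complex_of_real (gauss1_hat n (2 * pi * (x \<bullet> b))))" for x :: 'a
    by (simp add: gauss_hat_def)
  have int: "integrable lborel (\<lambda>x::'a. complex_of_real (gauss_hat n ((2 * pi) *\<^sub>R x)))"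
    unfolding eq by (rule lborel_product_integral(1)) (rule dens(1))
  then have int': "integrable lborel (\<lambda>x::'a. gauss_hat n ((2 * pi) *\<^sub>R x))"
    using integrable_Re[OF int] by simp
  have "complex_of_real (\<integral>x. gauss_hat n ((2 * pi) *\<^sub>R (x::'a)) \<partial>lborel)
     = (\<integral>x. complex_of_real (gauss_hat n ((2 * pi) *\<^sub>R (x::'a))) \<partial>lborel)"
    by (rule integral_of_real[OF int', symmetric])
  also have "\<dots> = 1" unfolding eq by (subst lborel_product_integral(2)[OF dens(1)]) (simp only: dens(2) prod.neutral_const)
  finally have one: "(\<integral>x. gauss_hat n ((2 * pi) *\<^sub>R (x::'a)) \<partial>lborel) = 1" by simp
  have "(\<integral>\<^sup>+x. ennreal (gauss_hat n ((2 * pi) *\<^sub>R (y - x))) \<partial>lborel)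
     = (\<integral>\<^sup>+x. ennreal (gauss_hat n ((2 * pi) *\<^sub>R x)) \<partial>distr lborel borel (\<lambda>x. y - x))"
    by (subst nn_integral_distr) auto
  also have "\<dots> = ennreal 1"
    unfolding lborel_distr_reflect one[symmetric]
    using n by (intro nn_integral_eq_integral int') (auto simp: gauss_hat_nonneg)
  finally show ?thesis by simp
qed

section \<open>A Plancherel inequality\<close>

lemma Fubini_bounded_kernel:
  fixes p :: "'a::euclidean_space \<Rightarrow> complex" and q :: "'b::euclidean_space \<Rightarrow> complex"
  assumes p: "integrable lborel p" and q: "integrable lborel q"
    and k [measurable]: "(\<lambda>(x, y). k x y) \<in> borel_measurable (lborel \<Otimes>\<^sub>M lborel)" and k1: "\<And>x y. cmod (k x y) \<le> 1"
  shows "(\<integral>x. p x * (\<integral>y. q y * k x y \<partial>lborel) \<partial>lborel) = (\<integral>y. q y * (\<integral>x. p x * k x y \<partial>lborel) \<partial>lborel)"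
proof -
  have [measurable]: "p \<in> borel_measurable borel" "q \<in> borel_measurable borel" using p q by auto
  have int: "integrable (lborel \<Otimes>\<^sub>M lborel) (\<lambda>(x, y). p x * q y * k x y)"
  proof (rule Bochner_Integration.integrable_bound)
    show "integrable (lborel \<Otimes>\<^sub>M lborel) (\<lambda>(x, y). p x * q y)"
    proof (rule lborel_pair.Fubini_integrable)
      show "(\<lambda>(x, y). p x * q y) \<in> borel_measurable (lborel \<Otimes>\<^sub>M lborel)" by measurable
      show "integrable lborel (\<lambda>x. \<integral>y. norm (case (x, y) of (x, y) \<Rightarrow> p x * q y) \<partial>lborel)"
        using p by (simp add: norm_mult)
      show "AE x in lborel. integrable lborel (\<lambda>y. case (x, y) of (x, y) \<Rightarrow> p x * q y)"
        using q by simp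
    qed
    show "(\<lambda>(x, y). p x * q y * k x y) \<in> borel_measurable (lborel \<Otimes>\<^sub>M lborel)"
      unfolding case_prod_unfold using k by (intro borel_measurable_times) (auto simp: case_prod_unfold)
    show "AE z in lborel \<Otimes>\<^sub>M lborel. norm (case z of (x, y) \<Rightarrow> p x * q y * k x y) \<le> norm (case z of (x, y) \<Rightarrow> p x * q y)"
    proof (rule AE_I2)
      fix z :: "'a \<times> 'b"
      obtain x y where z: "z = (x, y)" by (cases z)
      have "cmod (p x * q y) * cmod (k x y) \<le> cmod (p x * q y)" using k1[of x y] by (intro mult_left_le) auto
      then show "norm (case z of (x, y) \<Rightarrow> p x * q y * k x y) \<le> norm (case z of (x, y) \<Rightarrow> p x * q y)"
        by (simp add: z norm_mult)
    qed
  qed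
  have "(\<integral>x. p x * (\<integral>y. q y * k x y \<partial>lborel) \<partial>lborel) = (\<integral>x. (\<integral>y. p x * q y * k x y \<partial>lborel) \<partial>lborel)"
    by (simp add: mult.assoc)
  also have "\<dots> = (\<integral>y. (\<integral>x. p x * q y * k x y \<partial>lborel) \<partial>lborel)"
    by (rule lborel_pair.Fubini_integral[OF int, symmetric])
  also have "\<dots> = (\<integral>y. (\<integral>x. q y * (p x * k x y) \<partial>lborel) \<partial>lborel)"
    by (simp add: mult_ac)
  also have "\<dots> = (\<integral>y. q y * (\<integral>x. p x * k x y \<partial>lborel) \<partial>lborel)"
    by simp
  finally show ?thesis .
qed

lemma cmod_integral_le_nn_integral:
  fixes F :: "'a \<Rightarrow> complex"
  shows "ennreal (cmod (\<integral>x. F x \<partial>M)) \<le> (\<integral>\<^sup>+x. ennreal (cmod (F x)) \<partial>M)"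
proof (cases "integrable M F")
  case True
  then show ?thesis by (rule integral_norm_bound_ennreal)
qed (simp add: not_integrable_integral_eq)

text \<open>
  By Fubini's theorem the left-hand side is \<open>\<integral>\<integral> u(x) cnj (u(y)) \<gamma>(y - x)\<close> with
  a probability density \<open>\<gamma>\<close>, the transform of the weight. Schur's test, in the form \<open>2
  \<bar>u(x)\<bar> \<bar>u(y)\<bar> \<le> \<bar>u(x)\<bar>\<^sup>2 + \<bar>u(y)\<bar>\<^sup>2\<close>, concludes. The
  weight makes all integrals converge absolutely.
\<close>

lemma plancherel_gauss:
  fixes u :: "'a::euclidean_space \<Rightarrow> complex"
  assumes u: "integrable lborel u" and n: "0 < n"
  shows "(\<integral>\<^sup>+\<xi>. ennreal ((cmod (\<integral>x. u x * cis (- 2 * pi * (x \<bullet> \<xi>)) \<partial>lborel))\<^sup>2 * gauss n \<xi>) \<partial>lborel)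
    \<le> (\<integral>\<^sup>+x. ennreal ((cmod (u x))\<^sup>2) \<partial>lborel)"
proof -
  have [measurable]: "u \<in> borel_measurable borel" using u by auto
  note [measurable] = cis_measurable cnj_measurable
  define ek where "ek x \<xi> = cis (- 2 * pi * (x \<bullet> \<xi>))" for x \<xi> :: 'a
  have ek_meas [measurable]: "(\<lambda>(x, \<xi>). ek x \<xi>) \<in> borel_measurable (lborel \<Otimes>\<^sub>M lborel)"
    unfolding ek_def by measurable
  have ek_meas2 [measurable]: "(\<lambda>(\<xi>, x). ek x \<xi>) \<in> borel_measurable (lborel \<Otimes>\<^sub>M lborel)"
    unfolding ek_def by measurable
  have ek_meas3 [measurable]: "(\<lambda>(\<xi>, x). cnj (ek x \<xi>)) \<in> borel_measurable (lborel \<Otimes>\<^sub>M lborel)"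
    unfolding ek_def by measurable
  have ek1: "cmod (ek x \<xi>) = 1" for x \<xi> by (simp add: ek_def)
  define U where "U \<xi> = (\<integral>x. u x * ek x \<xi> \<partial>lborel)" for \<xi>
  have [measurable]: "U \<in> borel_measurable borel"
    unfolding U_def[abs_def] ek_def by (rule lborel.borel_measurable_lebesgue_integral) measurable
  define B where "B = (\<integral>x. cmod (u x) \<partial>lborel)"
  have U_le: "cmod (U \<xi>) \<le> B" for \<xi>
    unfolding U_def B_def using integral_norm_bound[of lborel "\<lambda>x. u x * ek x \<xi>"] by (simp add: norm_mult ek1)
  have g_int: "integrable lborel (\<lambda>\<xi>. complex_of_real (gauss n \<xi>))"
    by (intro integrable_of_real gauss_integrable n)
  have gU_int: "integrable lborel (\<lambda>\<xi>. complex_of_real (gauss n \<xi>) * cnj (U \<xi>))"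
    by (rule Bochner_Integration.integrable_bound[OF integrable_mult_left[OF g_int, of "complex_of_real B"]])
      (use U_le in \<open>auto simp: norm_mult gauss_nonneg intro!: mult_left_mono order.trans[OF U_le]\<close>)
  have gUU_int: "integrable lborel (\<lambda>\<xi>. (cmod (U \<xi>))\<^sup>2 * gauss n \<xi>)"
    by (rule Bochner_Integration.integrable_bound[OF integrable_mult_right[OF gauss_integrable[OF n], of "B\<^sup>2"]])
      (use U_le in \<open>auto simp: abs_mult gauss_nonneg intro!: mult_right_mono power_mono\<close>)
  have inner: "(\<integral>\<xi>. complex_of_real (gauss n \<xi>) * cnj (U \<xi>) * ek x \<xi> \<partial>lborel)
     = (\<integral>y. cnj (u y) * complex_of_real (gauss_hat n ((2 * pi) *\<^sub>R (y - x))) \<partial>lborel)" for x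
  proof -
    have "(\<integral>\<xi>. complex_of_real (gauss n \<xi>) * cnj (U \<xi>) * ek x \<xi> \<partial>lborel)
       = (\<integral>\<xi>. (complex_of_real (gauss n \<xi>) * ek x \<xi>) * (\<integral>y. cnj (u y) * cnj (ek y \<xi>) \<partial>lborel) \<partial>lborel)"
    proof (intro Bochner_Integration.integral_cong refl)
      fix \<xi>
      have "cnj (U \<xi>) = (\<integral>y. cnj (u y * ek y \<xi>) \<partial>lborel)" unfolding U_def by (simp del: complex_cnj_mult)
      then show "complex_of_real (gauss n \<xi>) * cnj (U \<xi>) * ek x \<xi>
         = (complex_of_real (gauss n \<xi>) * ek x \<xi>) * (\<integral>y. cnj (u y) * cnj (ek y \<xi>) \<partial>lborel)"
        by (simp add: mult_ac)
    qed
    also have "\<dots> = (\<integral>y. cnj (u y) * (\<integral>\<xi>. (complex_of_real (gauss n \<xi>) * ek x \<xi>) * cnj (ek y \<xi>) \<partial>lborel) \<partial>lborel)"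
    proof (rule Fubini_bounded_kernel)
      have [measurable]: "(\<lambda>\<xi>. ek x \<xi>) \<in> borel_measurable borel" unfolding ek_def by measurable
      show "integrable lborel (\<lambda>\<xi>. complex_of_real (gauss n \<xi>) * ek x \<xi>)"
        by (rule Bochner_Integration.integrable_bound[OF g_int]) (auto simp: norm_mult ek1)
      show "integrable lborel (\<lambda>y. cnj (u y))" using u by (rule integrable_cnj)
    qed (auto simp: ek1)
    also have "\<dots> = (\<integral>y. cnj (u y) * complex_of_real (gauss_hat n ((2 * pi) *\<^sub>R (y - x))) \<partial>lborel)"
    proof (intro Bochner_Integration.integral_cong refl arg_cong2[where f = "(*)"])
      fix y
      have "(\<integral>\<xi>. (complex_of_real (gauss n \<xi>) * ek x \<xi>) * cnj (ek y \<xi>) \<partial>lborel)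
         = (\<integral>\<xi>. complex_of_real (gauss n \<xi>) * cis (((2 * pi) *\<^sub>R (y - x)) \<bullet> \<xi>) \<partial>lborel)"
        by (intro Bochner_Integration.integral_cong refl)
          (simp add: ek_def mult.assoc cis_diff_mult inner_diff_left algebra_simps)
      then show "(\<integral>\<xi>. (complex_of_real (gauss n \<xi>) * ek x \<xi>) * cnj (ek y \<xi>) \<partial>lborel)
         = complex_of_real (gauss_hat n ((2 * pi) *\<^sub>R (y - x)))"
        by (rule trans[OF _ gauss_transform(2)[OF n]])
    qed
    finally show ?thesis .
  qed
  have "complex_of_real (\<integral>\<xi>. (cmod (U \<xi>))\<^sup>2 * gauss n \<xi> \<partial>lborel)
     = (\<integral>\<xi>. complex_of_real ((cmod (U \<xi>))\<^sup>2 * gauss n \<xi>) \<partial>lborel)"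
    by (rule integral_of_real[OF gUU_int, symmetric])
  also have "\<dots> = (\<integral>\<xi>. (complex_of_real (gauss n \<xi>) * cnj (U \<xi>)) * (\<integral>x. u x * ek x \<xi> \<partial>lborel) \<partial>lborel)"
    by (intro Bochner_Integration.integral_cong refl)
      (simp only: of_real_mult complex_norm_square U_def[symmetric] mult_ac)
  also have "\<dots> = (\<integral>x. u x * (\<integral>\<xi>. complex_of_real (gauss n \<xi>) * cnj (U \<xi>) * ek x \<xi> \<partial>lborel) \<partial>lborel)"
    by (rule Fubini_bounded_kernel[OF gU_int u]) (auto simp: ek1)
  finally have eq: "complex_of_real (\<integral>\<xi>. (cmod (U \<xi>))\<^sup>2 * gauss n \<xi> \<partial>lborel)
     = (\<integral>x. u x * (\<integral>y. cnj (u y) * complex_of_real (gauss_hat n ((2 * pi) *\<^sub>R (y - x))) \<partial>lborel) \<partial>lborel)"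
    by (simp only: inner)
  let ?G = "\<lambda>x y :: 'a. ennreal (gauss_hat n ((2 * pi) *\<^sub>R (y - x)))"
  have "(\<integral>\<^sup>+\<xi>. ennreal ((cmod (U \<xi>))\<^sup>2 * gauss n \<xi>) \<partial>lborel) = ennreal (\<integral>\<xi>. (cmod (U \<xi>))\<^sup>2 * gauss n \<xi> \<partial>lborel)"
    by (rule nn_integral_eq_integral[OF gUU_int]) (auto simp: gauss_nonneg)
  also have "\<dots> = ennreal (cmod (complex_of_real (\<integral>\<xi>. (cmod (U \<xi>))\<^sup>2 * gauss n \<xi> \<partial>lborel)))"
    by (subst norm_of_real, subst abs_of_nonneg) (auto intro!: integral_nonneg_AE simp: gauss_nonneg)
  also have "\<dots> \<le> (\<integral>\<^sup>+x. ennreal (cmod (u x * (\<integral>y. cnj (u y) * complex_of_real (gauss_hat n ((2 * pi) *\<^sub>R (y - x))) \<partial>lborel))) \<partial>lborel)"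
    unfolding eq by (rule cmod_integral_le_nn_integral)
  also have "\<dots> \<le> (\<integral>\<^sup>+x. (\<integral>\<^sup>+y. ennreal (1 / 2) * (ennreal ((cmod (u x))\<^sup>2) * ?G x y + ennreal ((cmod (u y))\<^sup>2) * ?G x y) \<partial>lborel) \<partial>lborel)"
  proof (rule nn_integral_mono)
    fix x
    have "ennreal (cmod (u x * (\<integral>y. cnj (u y) * complex_of_real (gauss_hat n ((2 * pi) *\<^sub>R (y - x))) \<partial>lborel)))
       = ennreal (cmod (u x)) * ennreal (cmod (\<integral>y. cnj (u y) * complex_of_real (gauss_hat n ((2 * pi) *\<^sub>R (y - x))) \<partial>lborel))"
      by (simp add: norm_mult ennreal_mult)
    also have "\<dots> \<le> ennreal (cmod (u x)) * (\<integral>\<^sup>+y. ennreal (cmod (cnj (u y) * complex_of_real (gauss_hat n ((2 * pi) *\<^sub>R (y - x))))) \<partial>lborel)"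
      by (intro mult_left_mono cmod_integral_le_nn_integral) simp
    also have "\<dots> = (\<integral>\<^sup>+y. ennreal (cmod (u x)) * ennreal (cmod (cnj (u y) * complex_of_real (gauss_hat n ((2 * pi) *\<^sub>R (y - x))))) \<partial>lborel)"
      by (rule nn_integral_cmult[symmetric]) measurable
    also have "\<dots> \<le> (\<integral>\<^sup>+y. ennreal (1 / 2) * (ennreal ((cmod (u x))\<^sup>2) * ?G x y + ennreal ((cmod (u y))\<^sup>2) * ?G x y) \<partial>lborel)"
    proof (rule nn_integral_mono)
      fix y
      define g where "g = gauss_hat n ((2 * pi) *\<^sub>R (y - x))"
      have g: "0 \<le> g" unfolding g_def by (rule gauss_hat_nonneg[OF n])
      have "cmod (u x) * (cmod (u y) * g) \<le> 1 / 2 * ((cmod (u x))\<^sup>2 * g + (cmod (u y))\<^sup>2 * g)"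
      proof -
        have "cmod (u x) * cmod (u y) \<le> 1 / 2 * ((cmod (u x))\<^sup>2 + (cmod (u y))\<^sup>2)"
          using zero_le_power2[of "cmod (u x) - cmod (u y)"] by (simp add: power2_eq_square algebra_simps)
        from mult_right_mono[OF this g] show ?thesis by (simp add: algebra_simps)
      qed
      then have "ennreal (cmod (u x) * (cmod (u y) * g)) \<le> ennreal (1 / 2 * ((cmod (u x))\<^sup>2 * g + (cmod (u y))\<^sup>2 * g))"
        by (rule ennreal_leI)
      also have "\<dots> = ennreal (1 / 2) * ennreal ((cmod (u x))\<^sup>2 * g + (cmod (u y))\<^sup>2 * g)"
        using g by (intro ennreal_mult) auto
      also have "ennreal ((cmod (u x))\<^sup>2 * g + (cmod (u y))\<^sup>2 * g) = ennreal ((cmod (u x))\<^sup>2) * ennreal g + ennreal ((cmod (u y))\<^sup>2) * ennreal g"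
        using g by (intro ennreal_linear_combination[symmetric]) auto
      finally show "ennreal (cmod (u x)) * ennreal (cmod (cnj (u y) * complex_of_real (gauss_hat n ((2 * pi) *\<^sub>R (y - x)))))
        \<le> ennreal (1 / 2) * (ennreal ((cmod (u x))\<^sup>2) * ?G x y + ennreal ((cmod (u y))\<^sup>2) * ?G x y)"
        using g unfolding g_def[symmetric] by (simp add: norm_mult ennreal_mult)
    qed
    finally show "ennreal (cmod (u x * (\<integral>y. cnj (u y) * complex_of_real (gauss_hat n ((2 * pi) *\<^sub>R (y - x))) \<partial>lborel)))
      \<le> (\<integral>\<^sup>+y. ennreal (1 / 2) * (ennreal ((cmod (u x))\<^sup>2) * ?G x y + ennreal ((cmod (u y))\<^sup>2) * ?G x y) \<partial>lborel)" .
  qed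
  also have "\<dots> = ennreal (1 / 2) * ((\<integral>\<^sup>+x. (\<integral>\<^sup>+y. ennreal ((cmod (u x))\<^sup>2) * ?G x y \<partial>lborel) \<partial>lborel)
      + (\<integral>\<^sup>+x. (\<integral>\<^sup>+y. ennreal ((cmod (u y))\<^sup>2) * ?G x y \<partial>lborel) \<partial>lborel))"
    by (subst nn_integral_cmult, measurable, subst nn_integral_cmult, measurable, subst nn_integral_add, measurable, subst nn_integral_add, measurable)
  also have "(\<integral>\<^sup>+x. (\<integral>\<^sup>+y. ennreal ((cmod (u x))\<^sup>2) * ?G x y \<partial>lborel) \<partial>lborel) = (\<integral>\<^sup>+x. ennreal ((cmod (u x))\<^sup>2) \<partial>lborel)"
  proof (intro nn_integral_cong)
    fix x :: 'a
    have "(\<integral>\<^sup>+y. ?G x y \<partial>lborel) = (\<integral>\<^sup>+y. ennreal (gauss_hat n ((2 * pi) *\<^sub>R (x - y))) \<partial>lborel)"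
    proof (intro nn_integral_cong arg_cong[where f = ennreal])
      fix y
      have "(2 * pi) *\<^sub>R (y - x) = - ((2 * pi) *\<^sub>R (x - y))" by (simp add: algebra_simps)
      then show "gauss_hat n ((2 * pi) *\<^sub>R (y - x)) = gauss_hat n ((2 * pi) *\<^sub>R (x - y))"
        by (simp only: gauss_hat_minus)
    qed
    also have "\<dots> = 1" by (rule nn_integral_gauss_hat[OF n])
    finally show "(\<integral>\<^sup>+y. ennreal ((cmod (u x))\<^sup>2) * ?G x y \<partial>lborel) = ennreal ((cmod (u x))\<^sup>2)"
      by (subst nn_integral_cmult) auto
  qed
  also have "(\<integral>\<^sup>+x. (\<integral>\<^sup>+y. ennreal ((cmod (u y))\<^sup>2) * ?G x y \<partial>lborel) \<partial>lborel) = (\<integral>\<^sup>+y. ennreal ((cmod (u y))\<^sup>2) \<partial>lborel)"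
  proof -
    have "(\<integral>\<^sup>+x. (\<integral>\<^sup>+y. ennreal ((cmod (u y))\<^sup>2) * ?G x y \<partial>lborel) \<partial>lborel)
       = (\<integral>\<^sup>+y. (\<integral>\<^sup>+x. ennreal ((cmod (u y))\<^sup>2) * ?G x y \<partial>lborel) \<partial>lborel)"
      by (rule lborel_pair.Fubini') measurable
    also have "\<dots> = (\<integral>\<^sup>+y. ennreal ((cmod (u y))\<^sup>2) \<partial>lborel)"
    proof (intro nn_integral_cong)
      fix y :: 'a
      show "(\<integral>\<^sup>+x. ennreal ((cmod (u y))\<^sup>2) * ?G x y \<partial>lborel) = ennreal ((cmod (u y))\<^sup>2)"
        by (subst nn_integral_cmult) (auto simp: nn_integral_gauss_hat[OF n])
    qed
    finally show ?thesis .
  qed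
  also have "ennreal (1 / 2) * ((\<integral>\<^sup>+x. ennreal ((cmod (u x))\<^sup>2) \<partial>lborel) + (\<integral>\<^sup>+x. ennreal ((cmod (u x))\<^sup>2) \<partial>lborel))
     = (\<integral>\<^sup>+x. ennreal ((cmod (u x))\<^sup>2) \<partial>lborel)"
  proof -
    have "ennreal (1 / 2) * (a + a) = a" for a :: ennreal
    proof (cases a)
      case (real r)
      have "ennreal (1 / 2) * (ennreal r + ennreal r) = ennreal (1 / 2) * ennreal (r + r)"
        using real by (simp only: ennreal_plus)
      also have "\<dots> = ennreal (1 / 2 * (r + r))" using real by (intro ennreal_mult[symmetric]) auto
      finally show ?thesis using real by simp
    qed (simp add: ennreal_mult_top)
    then show ?thesis .
  qed
  finally show ?thesis by (simp only: U_def ek_def)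
qed

section \<open>Euclidean space\<close>

text \<open>
  The Euclidean radius of a ball of normalised measure \<open>2\<^sup>k\<close> in dimension \<open>d\<close>.
\<close>

definition dyad_root :: "nat \<Rightarrow> int \<Rightarrow> real" where
  "dyad_root d k = root d (dyad k)"

lemma dyad_root_pos: "0 < d \<Longrightarrow> 0 < dyad_root d k"
  by (simp add: dyad_root_def)

lemma dyad_root_power: "0 < d \<Longrightarrow> dyad_root d k ^ d = dyad k"
  by (simp add: dyad_root_def)

lemma dyad_root_add: "dyad_root d (i + j) = dyad_root d i * dyad_root d j"
  by (simp add: dyad_root_def dyad_add real_root_mult)

lemma dyad_root_minus: "0 < d \<Longrightarrow> dyad_root d (- k) * dyad_root d k = 1"
  using dyad_root_add[of d "- k" k] by (simp add: dyad_root_def)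

lemma Rd_radius_le_iff: "Rd_radius (x::'a::euclidean_space) \<le> dyad k \<longleftrightarrow> norm x \<le> dyad_root DIM('a) k"
proof -
  have "Rd_radius x \<le> dyad k \<longleftrightarrow> norm x ^ DIM('a) \<le> dyad_root DIM('a) k ^ DIM('a)"
    by (simp add: Rd_radius_def dyad_root_power)
  also have "\<dots> \<longleftrightarrow> norm x \<le> dyad_root DIM('a) k"
    using dyad_root_pos[of "DIM('a)" k] by (intro power_mono_iff) auto
  finally show ?thesis .
qed

lemma unit_ball_vol_neq_0: "unit_ball_vol (real d) \<noteq> 0"
  by (rule less_imp_neq[symmetric], rule unit_ball_vol_pos) simp

text \<open>
  The density with respect to Lebesgue measure of the measure in which the unit ball has measure one.
\<close>

definition Rd_const :: "'a::euclidean_space itself \<Rightarrow> real" where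
  "Rd_const _ = 1 / unit_ball_vol (real DIM('a))"

lemma Rd_const_pos: "0 < Rd_const TYPE('a::euclidean_space)"
  by (simp add: Rd_const_def)

lemma Rd_measure_eq: "Rd_measure = scale_measure (ennreal (Rd_const TYPE('a))) (lebesgue :: 'a::euclidean_space measure)"
proof -
  have "emeasure lebesgue (ball (0::'a) 1) = ennreal (unit_ball_vol (real DIM('a)))"
    using emeasure_ball[of 1 "0::'a"] by (simp add: emeasure_completion)
  then have "inverse (emeasure lebesgue (ball (0::'a) 1)) = ennreal (Rd_const TYPE('a))"
    by (simp add: inverse_ennreal Rd_const_def inverse_eq_divide)
  then show ?thesis by (simp add: Rd_measure_def)
qed

lemma space_Rd [simp]: "space (Rd_measure :: 'a::euclidean_space measure) = UNIV"
  by (simp add: Rd_measure_eq space_scale_measure)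

lemma sets_Rd [simp]: "sets (Rd_measure :: 'a::euclidean_space measure) = sets lebesgue"
  by (simp add: Rd_measure_eq)

lemma borel_measurable_Rd_iff: "F \<in> borel_measurable (Rd_measure :: 'a::euclidean_space measure) \<longleftrightarrow> F \<in> borel_measurable lebesgue"
  by (rule arg_cong[where f = "\<lambda>S. F \<in> S"], rule measurable_cong_sets) simp_all

lemma borel_Rd: "F \<in> borel_measurable borel \<Longrightarrow> F \<in> borel_measurable (Rd_measure :: 'a::euclidean_space measure)"
  unfolding borel_measurable_Rd_iff by (intro measurable_completion) simp

lemma nn_integral_Rd:
  "F \<in> borel_measurable Rd_measure \<Longrightarrow>
    (\<integral>\<^sup>+x. F x \<partial>(Rd_measure :: 'a::euclidean_space measure)) = ennreal (Rd_const TYPE('a)) * (\<integral>\<^sup>+x. F x \<partial>lborel)"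
  unfolding borel_measurable_Rd_iff unfolding Rd_measure_eq
  by (subst nn_integral_scale_measure) (auto simp: nn_integral_completion)

lemma Rd_measure_density:
  "Rd_measure = density (lebesgue :: 'a::euclidean_space measure) (\<lambda>_. ennreal (Rd_const TYPE('a)))"
  by (rule measure_eqI) (auto simp: Rd_measure_eq emeasure_density_const)

lemma integrable_scaleR_iff:
  fixes F :: "'b \<Rightarrow> complex"
  assumes "0 < r" shows "integrable M (\<lambda>x. r *\<^sub>R F x) \<longleftrightarrow> integrable M F"
proof
  assume "integrable M (\<lambda>x. r *\<^sub>R F x)"
  then have "integrable M (\<lambda>x. inverse r *\<^sub>R (r *\<^sub>R F x))" by (rule integrable_scaleR_right)
  then show "integrable M F" using assms by simp
qed (rule integrable_scaleR_right)

lemma integral_Rd: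
  fixes F :: "'a::euclidean_space \<Rightarrow> complex"
  assumes F: "F \<in> borel_measurable borel"
  shows "(\<integral>x. F x \<partial>Rd_measure) = complex_of_real (Rd_const TYPE('a)) * (\<integral>x. F x \<partial>lborel)"
    and "integrable Rd_measure F \<longleftrightarrow> integrable lborel F"
proof -
  have [measurable]: "F \<in> borel_measurable lebesgue" using F by (intro measurable_completion) simp
  note pos = Rd_const_pos[where 'a = 'a]
  show "(\<integral>x. F x \<partial>Rd_measure) = complex_of_real (Rd_const TYPE('a)) * (\<integral>x. F x \<partial>lborel)"
    unfolding Rd_measure_density using pos F
    by (subst integral_density) (auto simp: integral_completion scaleR_conv_of_real)
  show "integrable Rd_measure F \<longleftrightarrow> integrable lborel F"
    unfolding Rd_measure_density using pos F
    by (subst integrable_density)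
      (auto simp: integrable_completion integrable_scaleR_iff)
qed

lemma emeasure_Rd: "S \<in> sets borel \<Longrightarrow>
    emeasure (Rd_measure :: 'a::euclidean_space measure) S = ennreal (Rd_const TYPE('a)) * emeasure lborel S"
  by (simp add: Rd_measure_eq emeasure_completion)

lemma emeasure_Rd_cball:
  "0 \<le> s \<Longrightarrow> emeasure (Rd_measure :: 'a::euclidean_space measure) (cball 0 s) = ennreal (s ^ DIM('a))"
  using unit_ball_vol_neq_0[of "DIM('a)"]
  by (subst emeasure_Rd) (auto simp: emeasure_cball Rd_const_def simp flip: ennreal_mult)

lemma emeasure_Rd_radius:
  "emeasure (Rd_measure :: 'a::euclidean_space measure) {x. Rd_radius x \<le> dyad k} = ennreal (dyad k)"
proof -
  have "{x::'a. Rd_radius x \<le> dyad k} = cball 0 (dyad_root DIM('a) k)"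
    unfolding Rd_radius_le_iff by auto
  then show ?thesis
    using dyad_root_pos[of "DIM('a)" k] by (simp add: emeasure_Rd_cball dyad_root_power)
qed

lemma Rd_radius_borel: "(Rd_radius :: 'a::euclidean_space \<Rightarrow> real) \<in> borel_measurable borel"
  unfolding Rd_radius_def[abs_def] by measurable

lemma Rd_shell_large:
  "ennreal (1 / 4 * dyad (- i)) \<le> emeasure (Rd_measure :: 'a::euclidean_space measure) (shell Rd_measure Rd_radius i)"
proof -
  let ?A = "\<lambda>k. {x::'a. Rd_radius x \<le> dyad k}"
  note [measurable] = Rd_radius_borel
  have A: "?A k \<in> sets (Rd_measure :: 'a measure)" for k
  proof -
    have "?A k \<in> sets borel" by measurable
    then show ?thesis by (simp add: sets_completionI_sets)
  qed
  have d: "dyad (- i - 1) - dyad (- i - 2) = 1 / 4 * dyad (- i)"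
    using dyad_diff[of "- i" 1] dyad_diff[of "- i" 2] by (simp add: dyad_def)
  have "ennreal (1 / 4 * dyad (- i)) = ennreal (dyad (- i - 1)) - ennreal (dyad (- i - 2))"
    unfolding d[symmetric] by (rule ennreal_minus[symmetric]) simp
  also have "\<dots> = emeasure (Rd_measure :: 'a measure) (?A (- i - 1) - ?A (- i - 2))"
    unfolding emeasure_Rd_radius[where 'a = 'a, symmetric]
    using A by (intro emeasure_Diff[symmetric])
      (auto simp: emeasure_Rd_radius intro: order.trans[where b = "dyad (- i - 2)"])
  also have "\<dots> \<le> emeasure (Rd_measure :: 'a measure) (shell Rd_measure Rd_radius i)"
    by (intro emeasure_mono shell_sets borel_Rd Rd_radius_borel) (auto simp: shell_def)
  finally show ?thesis .
qed

definition Rd_kernel :: "'a::euclidean_space \<Rightarrow> 'a \<Rightarrow> complex" where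
  "Rd_kernel x \<xi> = cis (- 2 * pi * (x \<bullet> \<xi>))"

lemma Rd_kernel_continuous: "continuous_on UNIV (Rd_kernel x)" "continuous_on UNIV (\<lambda>x. Rd_kernel x \<xi>)"
  unfolding Rd_kernel_def[abs_def] by (intro continuous_intros)+

lemma Rd_kernel_borel: "(\<lambda>x. Rd_kernel x \<xi>) \<in> borel_measurable borel"
  by (intro borel_measurable_continuous_onI Rd_kernel_continuous)

lemma fourier_kernel_Rd: "fourier_kernel (Rd_measure :: 'a::euclidean_space measure) Rd_measure Rd_kernel"
proof
  show "(\<lambda>x. Rd_kernel x \<xi>) \<in> borel_measurable (Rd_measure :: 'a measure)" for \<xi> :: 'a
    by (intro borel_Rd Rd_kernel_borel)
  show "cmod (Rd_kernel x \<xi>) = 1" for x \<xi> :: 'a by (simp add: Rd_kernel_def)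
  fix f :: "'a \<Rightarrow> complex" assume f: "integrable Rd_measure f"
  show "(\<lambda>\<xi>. \<integral>x. f x * Rd_kernel x \<xi> \<partial>Rd_measure) \<in> borel_measurable (Rd_measure :: 'a measure)"
    by (intro borel_Rd borel_measurable_continuous_onI transform_continuous[OF f] Rd_kernel_continuous Rd_kernel_borel)
      (simp add: Rd_kernel_def)
qed

interpretation Rd: fourier_kernel Rd_measure Rd_measure Rd_kernel
  by (rule fourier_kernel_Rd)

lemma Rd_fourier_eq: "Rd_fourier f = Rd.FT f"
  by (simp add: Rd_fourier_def[abs_def] Rd.FT_def[abs_def] Rd_kernel_def)

definition Rd_bump_const :: "'a::euclidean_space itself \<Rightarrow> real" where
  "Rd_bump_const _ = 1 / (4 * 6 ^ DIM('a))"

text \<open>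
  The normalised autocorrelation of a ball whose radius is a sixth of the radius at scale \<open>k\<close>. By the
  Cauchy-Schwarz inequality all phases on the dual ball are at most \<open>2 pi / 6\<close>.
\<close>

lemma Rd_bump:
  "\<exists>\<psi>. integrable (Rd_measure :: 'a::euclidean_space measure) \<psi> \<and>
     (\<forall>x\<in>space Rd_measure. cmod (\<psi> x) \<le> (if Rd_radius x \<le> dyad k then 1 else 0)) \<and>
     (\<forall>\<xi>. 0 \<le> Re (Rd.FT \<psi> \<xi>) \<and> (Rd_radius \<xi> \<le> dyad (- k) \<longrightarrow> Rd_bump_const TYPE('a) * dyad k \<le> Re (Rd.FT \<psi> \<xi>)))"
proof -
  let ?d = "DIM('a)"
  define \<kappa> where "\<kappa> = Rd_const TYPE('a)"
  define r where "r = dyad_root ?d k / 6"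
  have r: "0 < r" using dyad_root_pos[of ?d k] by (simp add: r_def)
  define B where "B = ball (0::'a) r"
  have B [measurable]: "B \<in> sets borel" by (simp add: B_def)
  have B_fin: "emeasure lborel B < \<infinity>" unfolding B_def by (rule emeasure_ball_finite)
  define b where "b = measure lborel B"
  have b_eq: "b = unit_ball_vol (real ?d) * r ^ ?d"
    unfolding b_def B_def measure_def using r by (subst emeasure_ball) (auto simp: enn2real_ennreal)
  have b: "0 < b" unfolding b_eq using r by simp
  have \<kappa>b: "\<kappa> * b = r ^ ?d"
    using unit_ball_vol_neq_0[of "DIM('a)"] unfolding b_eq \<kappa>_def Rd_const_def by simp
  have \<kappa>: "0 < \<kappa>" unfolding \<kappa>_def by (rule Rd_const_pos)
  define \<psi> where "\<psi> x = complex_of_real (1 / b) * complex_of_real (autocorr B x)" for x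
  have supp: "\<psi> x = 0" if "2 * r \<le> norm x" for x
    using autocorr_support[of r x] that by (simp add: \<psi>_def B_def)
  have [measurable]: "\<psi> \<in> borel_measurable borel" unfolding \<psi>_def[abs_def] by measurable
  note [measurable] = Rd_kernel_borel
  have "integrable lborel \<psi>" unfolding \<psi>_def[abs_def]
    by (intro integrable_mult_right) (rule integrable_of_real[OF autocorr_transform(1)[OF B B_fin]])
  then have \<psi>_int: "integrable Rd_measure \<psi>" by (subst integral_Rd(2)) auto
  define I where "I \<xi> = (\<integral>y. indicator B y * cis (((- 2 * pi) *\<^sub>R \<xi>) \<bullet> y) \<partial>lborel)" for \<xi>
  have FT_\<psi>: "Rd.FT \<psi> \<xi> = complex_of_real (\<kappa> / b * (cmod (I \<xi>))\<^sup>2)" for \<xi>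
  proof -
    have "Rd.FT \<psi> \<xi> = complex_of_real \<kappa> * (\<integral>x. \<psi> x * Rd_kernel x \<xi> \<partial>lborel)"
      unfolding Rd.FT_def \<kappa>_def by (rule integral_Rd(1)) measurable
    also have "(\<integral>x. \<psi> x * Rd_kernel x \<xi> \<partial>lborel)
       = (\<integral>x. complex_of_real (1 / b) * (complex_of_real (autocorr B x) * cis (((- 2 * pi) *\<^sub>R \<xi>) \<bullet> x)) \<partial>lborel)"
      by (simp add: \<psi>_def Rd_kernel_def mult.assoc inner_commute)
    also have "\<dots> = complex_of_real (1 / b) * (\<integral>x. complex_of_real (autocorr B x) * cis (((- 2 * pi) *\<^sub>R \<xi>) \<bullet> x) \<partial>lborel)"
      by (rule integral_mult_right_zero)
    finally show ?thesis unfolding autocorr_transform(2)[OF B B_fin] I_def by simp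
  qed
  have \<psi>_le: "cmod (\<psi> x) \<le> (if Rd_radius x \<le> dyad k then 1 else 0)" for x
  proof (cases "Rd_radius x \<le> dyad k")
    case True
    have "cmod (\<psi> x) = 1 / b * autocorr B x"
      using b autocorr_bounds(1)[OF B B_fin, of x] by (simp add: \<psi>_def norm_mult norm_divide)
    also have "\<dots> \<le> 1 / b * b"
      using b autocorr_bounds(2)[OF B B_fin, of x] unfolding b_def[symmetric] by (intro mult_left_mono) auto
    finally show ?thesis using True b by simp
  next
    case False
    have "\<psi> x = 0" using False r unfolding Rd_radius_le_iff by (intro supp) (simp add: r_def)
    then show ?thesis by simp
  qed
  have low: "Rd_bump_const TYPE('a) * dyad k \<le> Re (Rd.FT \<psi> \<xi>)" if \<xi>: "Rd_radius \<xi> \<le> dyad (- k)" for \<xi>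
  proof -
    have small: "\<bar>((- 2 * pi) *\<^sub>R \<xi>) \<bullet> y\<bar> \<le> pi / 3" if "y \<in> B" for y
    proof -
      have "\<bar>\<xi> \<bullet> y\<bar> \<le> norm \<xi> * norm y" by (rule Cauchy_Schwarz_ineq2)
      also have "\<dots> \<le> dyad_root ?d (- k) * r"
        using \<xi> that dyad_root_pos[of ?d "- k"] unfolding Rd_radius_le_iff by (intro mult_mono) (auto simp: B_def)
      also have "\<dots> = 1 / 6" using dyad_root_minus[of ?d k] by (simp add: r_def)
      finally have "2 * pi * \<bar>\<xi> \<bullet> y\<bar> \<le> 2 * pi * (1 / 6)" by (rule mult_left_mono) simp
      then show ?thesis by (simp add: abs_mult)
    qed
    have "b / 2 \<le> cmod (I \<xi>)"
      unfolding b_def I_def by (rule transform_indicator_lower[OF B B_fin small])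
    then have "(b / 2)\<^sup>2 \<le> (cmod (I \<xi>))\<^sup>2"
      using b by (intro power_mono) auto
    then have "\<kappa> / b * (b / 2)\<^sup>2 \<le> Re (Rd.FT \<psi> \<xi>)"
      unfolding FT_\<psi> Re_complex_of_real using b \<kappa> by (intro mult_left_mono) auto
    moreover have "\<kappa> / b * (b / 2)\<^sup>2 = \<kappa> * b / 4" using b by (simp add: power2_eq_square)
    moreover have "\<kappa> * b / 4 = Rd_bump_const TYPE('a) * dyad k"
      unfolding \<kappa>b by (simp add: r_def power_divide dyad_root_power Rd_bump_const_def)
    ultimately show ?thesis by simp
  qed
  have "0 \<le> Re (Rd.FT \<psi> \<xi>)" for \<xi> unfolding FT_\<psi> Re_complex_of_real using b \<kappa> by simp
  then show ?thesis using \<psi>_int \<psi>_le low by (intro exI[of _ \<psi>]) auto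
qed

definition Rd_cover_const :: "'a::euclidean_space itself \<Rightarrow> real" where
  "Rd_cover_const _ = (2 * real DIM('a) + 3) ^ DIM('a)"

text \<open>
  A cubical grid of mesh \<open>s\<close>, the small radius divided by the dimension, so that the
  \<open>\<ell>\<^sup>1\<close> distance to the nearest grid point is at most the small radius.
\<close>

lemma Rd_net:
  assumes ij: "i \<le> j"
  shows "\<exists>H::'a::euclidean_space set. finite H \<and> real (card H) \<le> Rd_cover_const TYPE('a) * dyad (j - i) \<and>
     (\<forall>\<xi>. Rd_radius \<xi> \<le> dyad (- i) \<longrightarrow> (\<exists>\<eta>\<in>H. Rd_radius (\<xi> - \<eta>) \<le> dyad (- j)))"
proof -
  let ?d = "DIM('a)"
  define R where "R = dyad_root ?d (j - i)"
  have R: "1 \<le> R"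
  proof -
    have "dyad 0 \<le> dyad (j - i)" using ij by (simp only: dyad_le_iff)
    then show ?thesis unfolding R_def dyad_root_def by simp
  qed
  have R_pow: "R ^ ?d = dyad (j - i)" unfolding R_def by (rule dyad_root_power) simp
  define s where "s = dyad_root ?d (- j) / ?d"
  have s: "0 < s" using dyad_root_pos[of ?d "- j"] by (simp add: s_def)
  have ds: "dyad_root ?d (- j) = ?d * s" by (simp add: s_def)
  have big: "dyad_root ?d (- i) = ?d * s * R"
    using dyad_root_add[of ?d "- j" "j - i"] by (simp add: R_def ds)
  define Q where "Q = \<lfloor>(real ?d + 1) * R\<rfloor>"
  have dR: "0 \<le> (real ?d + 1) * R" using R by simp
  then have Q0: "0 \<le> Q" by (simp add: Q_def)
  have Q_le: "real_of_int Q \<le> (real ?d + 1) * R" unfolding Q_def by (rule of_int_floor_le)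
  define P where "P = (\<Pi>\<^sub>E b\<in>(Basis::'a set). {- Q..Q})"
  have P: "finite P" unfolding P_def by (intro finite_PiE) auto
  define pt where "pt q = (\<Sum>b\<in>Basis. (s * real_of_int (q b)) *\<^sub>R b)" for q :: "'a \<Rightarrow> int"
  have "real (card (pt ` P)) \<le> real (card P)" using card_image_le[OF P] by simp
  also have "card P = nat (2 * Q + 1) ^ ?d"
    unfolding P_def by (subst card_PiE) (simp_all add: add.commute)
  also have "real (nat (2 * Q + 1) ^ ?d) \<le> ((2 * real ?d + 3) * R) ^ ?d"
  proof -
    have "real (nat (2 * Q + 1)) \<le> (2 * real ?d + 3) * R"
      using Q0 Q_le R by (simp add: algebra_simps)
    then show ?thesis unfolding of_nat_power by (rule power_mono) simp
  qed
  also have "\<dots> = Rd_cover_const TYPE('a) * dyad (j - i)"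
    by (simp add: power_mult_distrib R_pow Rd_cover_const_def)
  finally have card: "real (card (pt ` P)) \<le> Rd_cover_const TYPE('a) * dyad (j - i)" .
  have net: "\<exists>\<eta>\<in>pt ` P. Rd_radius (\<xi> - \<eta>) \<le> dyad (- j)" if \<xi>: "Rd_radius \<xi> \<le> dyad (- i)" for \<xi> :: 'a
  proof -
    define q where "q = (\<lambda>b\<in>Basis. round ((\<xi> \<bullet> b) / s))"
    have "q b \<in> {- Q..Q}" if b: "b \<in> Basis" for b
    proof -
      have "\<bar>\<xi> \<bullet> b\<bar> \<le> ?d * s * R"
        using Basis_le_norm[OF b, of \<xi>] \<xi> unfolding Rd_radius_le_iff big by linarith
      then have "\<bar>(\<xi> \<bullet> b) / s\<bar> \<le> ?d * R" using s by (simp add: abs_divide field_simps)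
      then have "\<bar>real_of_int (q b)\<bar> \<le> ?d * R + 1 / 2"
      proof -
        have "q b = round ((\<xi> \<bullet> b) / s)" using b by (simp add: q_def)
        then show ?thesis using round_close[of "(\<xi> \<bullet> b) / s"] \<open>\<bar>(\<xi> \<bullet> b) / s\<bar> \<le> ?d * R\<close> by linarith
      qed
      also have "\<dots> \<le> (real ?d + 1) * R" using R by (simp add: algebra_simps)
      finally have "real_of_int \<bar>q b\<bar> \<le> (real ?d + 1) * R" by simp
      then have "\<bar>q b\<bar> \<le> Q" unfolding Q_def by (simp only: le_floor_iff)
      then show ?thesis by (auto simp: abs_le_iff)
    qed
    then have q: "q \<in> P" unfolding P_def by (auto simp: q_def)
    have "norm (\<xi> - pt q) \<le> (\<Sum>b\<in>Basis. \<bar>(\<xi> - pt q) \<bullet> b\<bar>)" by (rule norm_le_l1)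
    also have "\<dots> \<le> (\<Sum>b\<in>(Basis::'a set). s)"
    proof (rule sum_mono)
      fix b :: 'a assume b: "b \<in> Basis"
      have "pt q \<bullet> b = s * real_of_int (q b)"
        unfolding pt_def using b by (simp add: inner_sum_left inner_Basis if_distrib[of "\<lambda>x. _ * x"] cong: if_cong)
      then have "(\<xi> - pt q) \<bullet> b = s * ((\<xi> \<bullet> b) / s - real_of_int (q b))"
        using s by (simp add: inner_diff_left field_simps)
      then have "\<bar>(\<xi> - pt q) \<bullet> b\<bar> = s * \<bar>(\<xi> \<bullet> b) / s - real_of_int (q b)\<bar>"
        using s by (simp add: abs_mult)
      also have "\<dots> \<le> s * 1"
        using round_close[of "(\<xi> \<bullet> b) / s"] b s by (intro mult_left_mono) (auto simp: q_def)
      finally show "\<bar>(\<xi> - pt q) \<bullet> b\<bar> \<le> s" by simp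
    qed
    also have "\<dots> = dyad_root ?d (- j)" by (simp add: ds)
    finally have "Rd_radius (\<xi> - pt q) \<le> dyad (- j)" unfolding Rd_radius_le_iff .
    then show ?thesis using q by blast
  qed
  show ?thesis using P card net by (intro exI[of _ "pt ` P"]) auto
qed

lemma sigma_finite_Rd: "sigma_finite_measure (Rd_measure :: 'a::euclidean_space measure)"
proof
  show "\<exists>A. countable A \<and> A \<subseteq> sets (Rd_measure :: 'a measure) \<and> \<Union> A = space Rd_measure \<and> (\<forall>a\<in>A. emeasure Rd_measure a \<noteq> \<infinity>)"
  proof (intro exI[of _ "range (\<lambda>n::nat. cball (0::'a) (real n))"] conjI)
    show "(\<Union>n::nat. cball (0::'a) (real n)) = space Rd_measure"
      using real_arch_simple by auto
  qed (auto simp: emeasure_Rd_cball)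
qed

lemma fourier_setting_Rd:
  "fourier_setting (Rd_measure :: 'a::euclidean_space measure) Rd_measure Rd_kernel Rd_radius Rd_radius
     (Rd_bump_const TYPE('a)) (Rd_cover_const TYPE('a))"
proof (rule fourier_setting.intro[OF fourier_kernel_Rd], rule fourier_setting_axioms.intro, goal_cases)
  case 1
  show ?case by (simp add: Rd_bump_const_def)
next
  case 2
  show ?case by (simp add: Rd_cover_const_def)
next
  case 3
  show ?case by (intro borel_Rd Rd_radius_borel)
next
  case 4
  show ?case by (intro borel_Rd Rd_radius_borel)
next
  case 5
  show ?case by (rule sigma_finite_Rd)
next
  case 6
  have "emeasure (Rd_measure :: 'a measure) {0} = 0" by (subst emeasure_Rd) auto
  then have "AE x in (Rd_measure :: 'a measure). x \<notin> {0}" by (intro AE_not_in) auto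
  then show ?case by eventually_elim (auto simp: Rd_radius_def)
next
  case (7 r)
  obtain n :: nat where n: "r \<le> dyad (int n)" using ex_dyad_ge by blast
  note [measurable] = Rd_radius_borel
  have "{x::'a. Rd_radius x \<le> dyad (int n)} \<in> sets borel" by measurable
  then have "emeasure (Rd_measure :: 'a measure) {\<xi> \<in> space Rd_measure. Rd_radius \<xi> \<le> r}
     \<le> emeasure (Rd_measure :: 'a measure) {x. Rd_radius x \<le> dyad (int n)}"
    using n by (intro emeasure_mono) (auto simp: sets_completionI_sets)
  also have "\<dots> < \<infinity>" by (simp add: emeasure_Rd_radius)
  finally show ?case .
next
  case (8 i)
  have "(6::real) ^ 0 \<le> 6 ^ DIM('a)" by (rule power_increasing) auto
  then have "Rd_bump_const TYPE('a) \<le> 1 / 4" by (simp add: Rd_bump_const_def field_simps)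
  then have "ennreal (Rd_bump_const TYPE('a) * dyad (- i)) \<le> ennreal (1 / 4 * dyad (- i))" by (intro ennreal_leI mult_right_mono) auto
  also note Rd_shell_large
  finally show ?case .
next
  case (9 k)
  show ?case using Rd_bump[of k] by blast
next
  case (10 i j)
  obtain \<psi> :: "'a \<Rightarrow> complex" where \<psi>: "integrable Rd_measure \<psi>"
     "\<And>x. x \<in> space Rd_measure \<Longrightarrow> cmod (\<psi> x) \<le> (if Rd_radius x \<le> dyad j then 1 else 0)"
     "\<And>\<xi>. Rd_radius \<xi> \<le> dyad (- j) \<Longrightarrow> Rd_bump_const TYPE('a) * dyad j \<le> Re (Rd.FT \<psi> \<xi>)"
    using Rd_bump[of j] by blast
  obtain H :: "'a set" where H: "finite H" "real (card H) \<le> Rd_cover_const TYPE('a) * dyad (j - i)"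
     "\<And>\<xi>. Rd_radius \<xi> \<le> dyad (- i) \<Longrightarrow> \<exists>\<eta>\<in>H. Rd_radius (\<xi> - \<eta>) \<le> dyad (- j)"
    using Rd_net[OF 10(2)] by blast
  show ?case
  proof (rule Rd.cover_by_modulation[OF \<psi>(1,2,3)])
    show "Rd_kernel x \<xi> * cnj (Rd_kernel x \<eta>) = Rd_kernel x (\<xi> - \<eta>)" for x \<xi> \<eta> :: 'a
      by (simp add: Rd_kernel_def cis_diff_mult inner_diff_right algebra_simps)
    show "finite H" "real (card H) \<le> Rd_cover_const TYPE('a) * dyad (j - i)" by fact+
    show "\<exists>\<eta>\<in>H. Rd_radius (\<xi> - \<eta>) \<le> dyad (- j)" if "Rd_radius \<xi> \<le> dyad (- i)" for \<xi>
      using that by (rule H(3))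
  qed
qed

section \<open>The truncated Fourier operators on Euclidean space\<close>

text \<open>
  Fubini's theorem is applied to Borel representatives of Lebesgue measurable functions.
\<close>

lemma ex_borel_AE_eq:
  fixes u :: "'a::euclidean_space \<Rightarrow> complex"
  assumes "u \<in> borel_measurable Rd_measure"
  shows "\<exists>u'\<in>borel_measurable borel. AE x in lebesgue. u x = u' x"
proof -
  have [measurable]: "u \<in> borel_measurable lebesgue" using assms by (simp add: borel_measurable_Rd_iff)
  have "(\<lambda>x. Re (u x)) \<in> borel_measurable (completion lborel)" "(\<lambda>x. Im (u x)) \<in> borel_measurable (completion lborel)"
    by measurable
  then obtain p q where pq [measurable]: "p \<in> borel_measurable lborel" "q \<in> borel_measurable lborel"
    and ae: "AE x in lborel. Re (u x) = p x" "AE x in lborel. Im (u x) = q x"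
    using completion_ex_borel_measurable_real by metis
  have "(\<lambda>x. Complex (p x) (q x)) \<in> borel_measurable borel"
    unfolding Complex_eq using pq by measurable
  moreover have "AE x in lborel. u x = Complex (p x) (q x)"
    using ae by eventually_elim (simp add: complex_eq_iff)
  then have "AE x in lebesgue. u x = Complex (p x) (q x)" by (rule AE_completion)
  ultimately show ?thesis by (intro bexI[of _ "\<lambda>x. Complex (p x) (q x)"])
qed

lemma AE_Rd_of_lebesgue: "(AE x in (lebesgue :: 'a::euclidean_space measure). P x) \<Longrightarrow> AE x in Rd_measure. P x"
  unfolding Rd_measure_density by (subst AE_density) auto

lemma plancherel_Rd:
  fixes u :: "'a::euclidean_space \<Rightarrow> complex"
  assumes u: "integrable Rd_measure u" and n: "0 < n"
  shows "(\<integral>\<^sup>+\<xi>. ennreal ((cmod (Rd.FT u \<xi>))\<^sup>2 * gauss n \<xi>) \<partial>Rd_measure)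
    \<le> ennreal ((Rd_const TYPE('a))\<^sup>2) * (\<integral>\<^sup>+x. ennreal ((cmod (u x))\<^sup>2) \<partial>Rd_measure)"
proof -
  define \<kappa> where "\<kappa> = Rd_const TYPE('a)"
  have \<kappa>: "0 < \<kappa>" unfolding \<kappa>_def by (rule Rd_const_pos)
  have u_meas: "u \<in> borel_measurable Rd_measure" using u by auto
  obtain u' where u' [measurable]: "u' \<in> borel_measurable borel" and ae: "AE x in lebesgue. u x = u' x"
    using ex_borel_AE_eq[OF u_meas] by blast
  have ae': "AE x in Rd_measure. u x = u' x" by (rule AE_Rd_of_lebesgue[OF ae])
  have "integrable Rd_measure u'"
    using u u_meas borel_Rd[OF u'] ae' by (subst (asm) integrable_cong_AE) auto
  then have u'_int: "integrable lborel u'" using integral_Rd(2)[OF u'] by simp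
  define U where "U \<xi> = (\<integral>x. u' x * cis (- 2 * pi * (x \<bullet> \<xi>)) \<partial>lborel)" for \<xi>
  have FT_u: "Rd.FT u \<xi> = complex_of_real \<kappa> * U \<xi>" for \<xi>
  proof -
    have "Rd.FT u \<xi> = Rd.FT u' \<xi>" by (rule Rd.FT_cong_AE[OF ae' u_meas borel_Rd[OF u']])
    also have "\<dots> = complex_of_real \<kappa> * (\<integral>x. u' x * Rd_kernel x \<xi> \<partial>lborel)"
      unfolding Rd.FT_def \<kappa>_def using Rd_kernel_borel[of \<xi>] by (intro integral_Rd(1) borel_measurable_times u')
    finally show ?thesis by (simp only: U_def Rd_kernel_def)
  qed
  have FT_meas: "Rd.FT u \<in> borel_measurable Rd_measure" by (rule Rd.FT_measurable[OF u])
  have gm: "gauss n \<in> borel_measurable (Rd_measure :: 'a measure)" by (rule borel_Rd) measurable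
  have "(\<lambda>\<xi>. (cmod (Rd.FT u \<xi>))\<^sup>2 * gauss n \<xi>) \<in> borel_measurable Rd_measure"
    using FT_meas gm by measurable
  then have m: "(\<lambda>\<xi>. ennreal ((cmod (Rd.FT u \<xi>))\<^sup>2 * gauss n \<xi>)) \<in> borel_measurable Rd_measure"
    by measurable
  have U_cont: "continuous_on UNIV U"
    unfolding U_def Rd_kernel_def[symmetric]
    by (intro transform_continuous[OF u'_int] Rd_kernel_continuous Rd.kernel_unimodular)
      (simp add: Rd_kernel_borel)
  have [measurable]: "U \<in> borel_measurable borel" by (rule borel_measurable_continuous_onI[OF U_cont])
  have "(\<integral>\<^sup>+\<xi>. ennreal ((cmod (Rd.FT u \<xi>))\<^sup>2 * gauss n \<xi>) \<partial>Rd_measure)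
     = ennreal \<kappa> * (\<integral>\<^sup>+\<xi>. ennreal ((cmod (Rd.FT u \<xi>))\<^sup>2 * gauss n \<xi>) \<partial>lborel)"
    unfolding \<kappa>_def by (rule nn_integral_Rd[OF m])
  also have "(\<integral>\<^sup>+\<xi>. ennreal ((cmod (Rd.FT u \<xi>))\<^sup>2 * gauss n \<xi>) \<partial>lborel)
     = (\<integral>\<^sup>+\<xi>. ennreal (\<kappa>\<^sup>2) * ennreal ((cmod (U \<xi>))\<^sup>2 * gauss n \<xi>) \<partial>lborel)"
    unfolding FT_u using \<kappa>
    by (intro nn_integral_cong, subst ennreal_mult[symmetric])
      (auto simp: norm_mult power_mult_distrib gauss_nonneg mult.assoc)
  also have "\<dots> = ennreal (\<kappa>\<^sup>2) * (\<integral>\<^sup>+\<xi>. ennreal ((cmod (U \<xi>))\<^sup>2 * gauss n \<xi>) \<partial>lborel)"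
    by (rule nn_integral_cmult) measurable
  also have "ennreal \<kappa> * (ennreal (\<kappa>\<^sup>2) * (\<integral>\<^sup>+\<xi>. ennreal ((cmod (U \<xi>))\<^sup>2 * gauss n \<xi>) \<partial>lborel))
     \<le> ennreal \<kappa> * (ennreal (\<kappa>\<^sup>2) * (\<integral>\<^sup>+x. ennreal ((cmod (u' x))\<^sup>2) \<partial>lborel))"
    unfolding U_def by (intro mult_left_mono plancherel_gauss[OF u'_int n]) auto
  also have "\<dots> = ennreal (\<kappa>\<^sup>2) * (ennreal \<kappa> * (\<integral>\<^sup>+x. ennreal ((cmod (u' x))\<^sup>2) \<partial>lborel))"
    by (simp only: mult_ac)
  also have "ennreal \<kappa> * (\<integral>\<^sup>+x. ennreal ((cmod (u' x))\<^sup>2) \<partial>lborel) = (\<integral>\<^sup>+x. ennreal ((cmod (u' x))\<^sup>2) \<partial>Rd_measure)"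
    unfolding \<kappa>_def by (rule nn_integral_Rd[symmetric], rule borel_Rd) measurable
  also have "\<dots> = (\<integral>\<^sup>+x. ennreal ((cmod (u x))\<^sup>2) \<partial>Rd_measure)"
    using ae' by (intro nn_integral_cong_AE) (auto elim!: eventually_mono)
  finally show ?thesis by (simp only: \<kappa>_def)
qed

lemma gauss_tendsto_1:
  fixes \<xi> :: "'a::euclidean_space"
  shows "(\<lambda>n. gauss (real (Suc n)) \<xi>) \<longlonglongrightarrow> 1"
proof -
  have "(\<lambda>n. gauss1 (real (Suc n)) s) \<longlonglongrightarrow> exp (- (0\<^sup>2) / 2)" for s
    unfolding gauss1_def
    by (intro tendsto_intros tendsto_divide_0[OF tendsto_const] filterlim_compose[OF tendsto_of_nat filterlim_Suc]) simp
  note lim = this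
  have "(\<lambda>n. gauss (real (Suc n)) \<xi>) \<longlonglongrightarrow> (\<Prod>b\<in>(Basis :: 'a set). exp (- (0\<^sup>2) / 2))"
    unfolding gauss_def by (intro tendsto_prod lim)
  then show ?thesis by simp
qed

lemma L1_plus_L2_integrable_on_ball:
  fixes g :: "'a::euclidean_space \<Rightarrow> complex"
  assumes "g \<in> L1_plus_L2 Rd_measure"
  shows "integrable Rd_measure (\<lambda>x. indicator (cball 0 r) x * g x)"
proof -
  obtain g1 g2 where g: "g = (\<lambda>x. g1 x + g2 x)" "g1 \<in> Lp_space Rd_measure 1" "g2 \<in> Lp_space Rd_measure 2"
    using assms by (auto simp: L1_plus_L2_def)
  have B: "cball (0::'a) r \<in> sets Rd_measure" by (simp add: sets_completionI_sets)
  note [measurable] = B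
  have B_fin: "emeasure Rd_measure (cball (0::'a) r) < \<infinity>"
    by (cases "0 \<le> r") (auto simp: emeasure_Rd_cball)
  have [measurable]: "g1 \<in> borel_measurable Rd_measure" "g2 \<in> borel_measurable Rd_measure"
    using g by (auto simp: Lp_space_def)
  have g1: "integrable Rd_measure g1" using g by (simp add: Lp_space_1_iff)
  have i1: "integrable Rd_measure (\<lambda>x. indicator (cball 0 r) x * g1 x)"
  proof (rule Bochner_Integration.integrable_bound[OF g1])
    show "(\<lambda>x. indicator (cball 0 r) x * g1 x) \<in> borel_measurable Rd_measure" by measurable
  qed (auto simp: norm_mult indicator_def)
  have i2: "integrable Rd_measure (\<lambda>x. indicator (cball 0 r) x * g2 x)"
    by (rule Lp_space_2_integrable_on_finite[OF g(3) B B_fin])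
  show ?thesis unfolding g(1) using Bochner_Integration.integrable_add[OF i1 i2] by (simp add: distrib_left)
qed

text \<open>
  The approximating operators restrict \<open>f\<close> to a ball, which makes it integrable, and multiply the
  transform by the root of a Gaussian weight tending to one, which gives the \<open>L\<^sup>2\<close> bound.
\<close>

lemma Rd_approximable:
  "\<exists>\<kappa>>0. fourier_setting.approximable (Rd_measure :: 'a::euclidean_space measure) Rd_measure Rd_kernel \<kappa>"
proof -
  interpret fourier_setting "Rd_measure :: 'a measure" Rd_measure Rd_kernel Rd_radius Rd_radius
    "Rd_bump_const TYPE('a)" "Rd_cover_const TYPE('a)"
    by (rule fourier_setting_Rd)
  define \<kappa> where "\<kappa> = Rd_const TYPE('a)"
  have \<kappa>: "0 < \<kappa>" unfolding \<kappa>_def by (rule Rd_const_pos)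
  \<comment> \<open>With the normalised measure on both sides the transform is \<open>\<kappa>\<close> times an isometry of
    \<open>L\<^sup>2\<close>; the factor \<open>q\<close> compensates for this.\<close>
  define q where "q = min 1 (1 / \<kappa>)"
  have q: "0 < q" "q \<le> 1" "q * \<kappa> \<le> 1" using \<kappa> by (auto simp: q_def min_def field_simps)
  define cutoff where "cutoff n g x = indicator (cball 0 (real n)) x * g x" for n and g :: "'a \<Rightarrow> complex" and x
  define G where "G n \<xi> = q * sqrt (gauss (real (Suc n)) \<xi>)" for n and \<xi> :: 'a
  define T where "T n g \<xi> = complex_of_real (G n \<xi>) * Rd.FT (cutoff n g) \<xi>" for n g \<xi>
  have G: "0 \<le> G n \<xi>" "G n \<xi> \<le> 1" "(G n \<xi>)\<^sup>2 = q\<^sup>2 * gauss (real (Suc n)) \<xi>" for n \<xi>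
    using q gauss_nonneg[of "real (Suc n)" \<xi>] gauss_le_1[of "real (Suc n)" \<xi>]
    by (auto simp: G_def power_mult_distrib intro!: mult_le_one)
  have G_meas: "G n \<in> borel_measurable Rd_measure" for n
    unfolding G_def[abs_def] by (rule borel_Rd) measurable
  have cut_int: "integrable Rd_measure (cutoff n g)" if "g \<in> L1_plus_L2 Rd_measure" for n g
    unfolding cutoff_def[abs_def] by (rule L1_plus_L2_integrable_on_ball[OF that])
  have T_meas: "T n g \<in> borel_measurable Rd_measure" if "g \<in> L1_plus_L2 Rd_measure" for n g
    unfolding T_def[abs_def]
    by (intro borel_measurable_times measurable_compose[OF G_meas borel_measurable_of_real] Rd.FT_measurable cut_int that)
  have cut_add: "cutoff n (\<lambda>x. g x + h x) = (\<lambda>x. cutoff n g x + cutoff n h x)" for n g h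
    by (simp add: cutoff_def[abs_def] distrib_left)
  have cut_scale: "cutoff n (\<lambda>x. c * g x) = (\<lambda>x. c * cutoff n g x)" for n c g
    by (simp add: cutoff_def[abs_def] mult_ac)
  have cut_le: "cmod (cutoff n g x) \<le> cmod (g x)" for n g x
    by (auto simp: cutoff_def norm_mult indicator_def)
  have sub: "sublinear_operator Rd_measure Rd_measure (T n)" for n
    unfolding sublinear_operator_def
  proof (intro conjI ballI allI AE_I2)
    fix g h :: "'a \<Rightarrow> complex" and \<xi> assume gh: "g \<in> L1_plus_L2 Rd_measure" "h \<in> L1_plus_L2 Rd_measure"
    have "T n (\<lambda>x. g x + h x) \<xi> = T n g \<xi> + T n h \<xi>"
      unfolding T_def cut_add by (simp add: Rd.FT_add cut_int gh distrib_left)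
    then show "cmod (T n (\<lambda>x. g x + h x) \<xi>) \<le> cmod (T n g \<xi>) + cmod (T n h \<xi>)"
      by (simp add: norm_triangle_ineq)
  next
    fix g :: "'a \<Rightarrow> complex" and c \<xi>
    show "cmod (T n (\<lambda>x. c * g x) \<xi>) = cmod c * cmod (T n g \<xi>)"
      unfolding T_def cut_scale by (simp add: Rd.FT_scale norm_mult)
  qed (rule T_meas)
  have strong: "joint_strong_type Rd_measure Rd_measure 1 (T n)" for n
    unfolding joint_strong_type_def
  proof (intro conjI ballI)
    fix g :: "'a \<Rightarrow> complex" assume g: "g \<in> Lp_space Rd_measure 1"
    then have gi: "integrable Rd_measure g" by (simp add: Lp_space_1_iff)
    have "ennreal (cmod (T n g \<xi>)) \<le> Lp_norm Rd_measure 1 g" for \<xi>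
    proof -
      have "cmod (T n g \<xi>) \<le> 1 * cmod (Rd.FT (cutoff n g) \<xi>)"
        using G(1,2) by (simp add: T_def norm_mult mult_right_le_one_le mult_left_le_one_le)
      also have "\<dots> \<le> (\<integral>x. cmod (cutoff n g x) \<partial>Rd_measure)" using Rd.cmod_FT_le by simp
      also have "\<dots> \<le> (\<integral>x. cmod (g x) \<partial>Rd_measure)"
        using gi cut_int[OF L1_in_L1_plus_L2[OF g]] cut_le by (intro integral_mono) auto
      finally have "ennreal (cmod (T n g \<xi>)) \<le> ennreal (\<integral>x. cmod (g x) \<partial>Rd_measure)" by (rule ennreal_leI)
      also have "\<dots> = Lp_norm Rd_measure 1 g"
        unfolding Lp_norm_1 using gi by (intro nn_integral_eq_integral[symmetric]) auto
      finally show ?thesis .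
    qed
    moreover have "(\<lambda>\<xi>. ennreal (cmod (T n g \<xi>))) \<in> borel_measurable Rd_measure"
      using T_meas[OF L1_in_L1_plus_L2[OF g], of n] by measurable
    ultimately show "Linf_norm Rd_measure (T n g) \<le> ennreal 1 * Lp_norm Rd_measure 1 g"
      unfolding Linf_norm_def by (intro esssup_I) auto
  next
    fix g :: "'a \<Rightarrow> complex" assume g: "g \<in> Lp_space Rd_measure 2"
    have ci: "integrable Rd_measure (cutoff n g)" by (rule cut_int[OF L2_in_L1_plus_L2[OF g]])
    have "(\<integral>\<^sup>+\<xi>. ennreal ((cmod (T n g \<xi>))\<^sup>2) \<partial>Rd_measure)
       = (\<integral>\<^sup>+\<xi>. ennreal (q\<^sup>2) * ennreal ((cmod (Rd.FT (cutoff n g) \<xi>))\<^sup>2 * gauss (real (Suc n)) \<xi>) \<partial>Rd_measure)"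
      by (intro nn_integral_cong, subst ennreal_mult[symmetric])
        (auto simp: T_def norm_mult power_mult_distrib G(3) gauss_nonneg mult_ac simp del: of_nat_Suc)
    also have "\<dots> = ennreal (q\<^sup>2) * (\<integral>\<^sup>+\<xi>. ennreal ((cmod (Rd.FT (cutoff n g) \<xi>))\<^sup>2 * gauss (real (Suc n)) \<xi>) \<partial>Rd_measure)"
    proof (rule nn_integral_cmult)
      have "gauss (real (Suc n)) \<in> borel_measurable (Rd_measure :: 'a measure)" by (rule borel_Rd) measurable
      then show "(\<lambda>\<xi>. ennreal ((cmod (Rd.FT (cutoff n g) \<xi>))\<^sup>2 * gauss (real (Suc n)) \<xi>)) \<in> borel_measurable Rd_measure"
        using Rd.FT_measurable[OF ci] by measurable
    qed
    also have "\<dots> \<le> ennreal (q\<^sup>2) * (ennreal (\<kappa>\<^sup>2) * (\<integral>\<^sup>+x. ennreal ((cmod (cutoff n g x))\<^sup>2) \<partial>Rd_measure))"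
      unfolding \<kappa>_def by (intro mult_left_mono plancherel_Rd[OF ci]) auto
    also have "\<dots> = ennreal ((q * \<kappa>)\<^sup>2) * (\<integral>\<^sup>+x. ennreal ((cmod (cutoff n g x))\<^sup>2) \<partial>Rd_measure)"
      by (simp add: ennreal_mult power_mult_distrib mult.assoc)
    also have "\<dots> \<le> ennreal 1 * (\<integral>\<^sup>+x. ennreal ((cmod (g x))\<^sup>2) \<partial>Rd_measure)"
    proof (intro mult_mono nn_integral_mono ennreal_leI)
      show "(q * \<kappa>)\<^sup>2 \<le> 1" using q \<kappa> by (intro power_le_one) auto
    qed (auto intro!: power_mono cut_le)
    finally show "Lp_norm Rd_measure 2 (T n g) \<le> ennreal 1 * Lp_norm Rd_measure 2 g"
      unfolding Lp_norm_2 by (simp add: ennreal_powr_mono)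
  qed
  have "approximable (q / 2)"
    unfolding approximable_def
  proof (intro allI impI exI[of _ T] conjI sub strong AE_I2)
    fix f :: "'a \<Rightarrow> complex" and \<xi> assume f: "integrable Rd_measure f"
    have "(\<lambda>n. Rd.FT (cutoff n f) \<xi>) \<longlonglongrightarrow> Rd.FT f \<xi>"
      unfolding Rd.FT_def
    proof (rule integral_dominated_convergence)
      show "integrable Rd_measure (\<lambda>x. cmod (f x))" using f by (rule integrable_norm)
      show "(\<lambda>x. f x * Rd_kernel x \<xi>) \<in> borel_measurable Rd_measure"
        by (rule borel_measurable_integrable[OF Rd.integrable_mult_kernel[OF f]])
      have "integrable Rd_measure (cutoff n f)" for n
        using f by (intro cut_int L1_in_L1_plus_L2) (simp add: Lp_space_1_iff)
      then show "(\<lambda>x. cutoff n f x * Rd_kernel x \<xi>) \<in> borel_measurable Rd_measure" for n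
        by (intro borel_measurable_integrable Rd.integrable_mult_kernel)
      show "AE x in Rd_measure. norm (cutoff n f x * Rd_kernel x \<xi>) \<le> cmod (f x)" for n
        using cut_le by (auto simp: norm_mult Rd.kernel_unimodular)
      show "AE x in Rd_measure. (\<lambda>n. cutoff n f x * Rd_kernel x \<xi>) \<longlonglongrightarrow> f x * Rd_kernel x \<xi>"
      proof (rule AE_I2)
        fix x :: 'a
        obtain n0 :: nat where n0: "norm x \<le> real n0" using real_arch_simple by blast
        have "\<forall>\<^sub>F n in sequentially. cutoff n f x * Rd_kernel x \<xi> = f x * Rd_kernel x \<xi>"
          using eventually_ge_at_top[of n0] by eventually_elim (use n0 in \<open>auto simp: cutoff_def\<close>)
        then show "(\<lambda>n. cutoff n f x * Rd_kernel x \<xi>) \<longlonglongrightarrow> f x * Rd_kernel x \<xi>" by (rule tendsto_eventually)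
      qed
    qed
    moreover have "(\<lambda>n. complex_of_real (G n \<xi>)) \<longlonglongrightarrow> complex_of_real (q * sqrt 1)"
      unfolding G_def by (intro tendsto_intros gauss_tendsto_1)
    ultimately have "(\<lambda>n. T n f \<xi>) \<longlonglongrightarrow> complex_of_real (q * sqrt 1) * Rd.FT f \<xi>"
      unfolding T_def by (intro tendsto_mult)
    from tendsto_imp_eventually_half[OF this]
    show "\<forall>\<^sub>F n in sequentially. q / 2 * cmod (Rd.FT f \<xi>) \<le> cmod (T n f \<xi>)"
      using q by (simp add: norm_mult)
  qed
  then show ?thesis using q by (intro exI[of _ "q / 2"]) auto
qed

section \<open>The Fourier transform is extremal\<close>

theorem theorem1p5:
  fixes K \<beta> :: real
  assumes "1 \<le> K" and "0 < \<beta>" and "\<beta> \<le> 1"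
  shows
    "(\<exists>c::real. 0 < c \<and>
       (\<forall>(X :: ('a::euclidean_space \<Rightarrow> complex) \<Rightarrow> ennreal) (Y :: ('a \<Rightarrow> complex) \<Rightarrow> ennreal).
          left_admissible Rd_measure Rd_radius X \<longrightarrow> right_admissible Rd_measure Rd_radius Y \<longrightarrow>
            ((\<exists>C\<^sub>1<\<infinity>. fourier_bound Rd_measure Rd_fourier X Y \<beta> C\<^sub>1) \<longleftrightarrow>
             (\<exists>C\<^sub>2<\<infinity>. operator_bound Rd_measure Rd_measure K X Y \<beta> C\<^sub>2)) \<and>
            Inf {C\<^sub>1. fourier_bound Rd_measure Rd_fourier X Y \<beta> C\<^sub>1}
              \<le> ennreal c * Inf {C\<^sub>2. operator_bound Rd_measure Rd_measure K X Y \<beta> C\<^sub>2} \<and>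
            Inf {C\<^sub>2. operator_bound Rd_measure Rd_measure K X Y \<beta> C\<^sub>2}
              \<le> ennreal c * Inf {C\<^sub>1. fourier_bound Rd_measure Rd_fourier X Y \<beta> C\<^sub>1})) \<and>
     (\<exists>c::real. 0 < c \<and>
       (\<forall>X Y.
          left_admissible torus_measure torus_radius X \<longrightarrow> right_admissible int_measure int_rank Y \<longrightarrow>
            ((\<exists>C\<^sub>1<\<infinity>. fourier_bound int_measure int_fourier X Y \<beta> C\<^sub>1) \<longleftrightarrow>
             (\<exists>C\<^sub>2<\<infinity>. operator_bound int_measure torus_measure K X Y \<beta> C\<^sub>2)) \<and>
            Inf {C\<^sub>1. fourier_bound int_measure int_fourier X Y \<beta> C\<^sub>1}
              \<le> ennreal c * Inf {C\<^sub>2. operator_bound int_measure torus_measure K X Y \<beta> C\<^sub>2} \<and>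
            Inf {C\<^sub>2. operator_bound int_measure torus_measure K X Y \<beta> C\<^sub>2}
              \<le> ennreal c * Inf {C\<^sub>1. fourier_bound int_measure int_fourier X Y \<beta> C\<^sub>1})) \<and>
     (\<exists>c::real. 0 < c \<and>
       (\<forall>X Y.
          left_admissible int_measure int_rank X \<longrightarrow> right_admissible torus_measure torus_radius Y \<longrightarrow>
            ((\<exists>C\<^sub>1<\<infinity>. fourier_bound torus_measure torus_fourier X Y \<beta> C\<^sub>1) \<longleftrightarrow>
             (\<exists>C\<^sub>2<\<infinity>. operator_bound torus_measure int_measure K X Y \<beta> C\<^sub>2)) \<and>
            Inf {C\<^sub>1. fourier_bound torus_measure torus_fourier X Y \<beta> C\<^sub>1}
              \<le> ennreal c * Inf {C\<^sub>2. operator_bound torus_measure int_measure K X Y \<beta> C\<^sub>2} \<and>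
            Inf {C\<^sub>2. operator_bound torus_measure int_measure K X Y \<beta> C\<^sub>2}
              \<le> ennreal c * Inf {C\<^sub>1. fourier_bound torus_measure torus_fourier X Y \<beta> C\<^sub>1}))"
proof -
  obtain \<kappa> where \<kappa>: "0 < \<kappa>"
    "fourier_setting.approximable (Rd_measure :: 'a measure) Rd_measure Rd_kernel \<kappa>"
    using Rd_approximable by blast
  show ?thesis
    by (intro conjI) (rule fourier_setting.fourier_transform_extremal[OF fourier_setting_Rd assms(2,3,1) \<kappa> Rd_fourier_eq]
      fourier_setting.fourier_transform_extremal[OF fourier_setting_seq assms(2,3,1) _ seq_approximable int_fourier_eq]
      fourier_setting.fourier_transform_extremal[OF fourier_setting_per assms(2,3,1) _ per_approximable torus_fourier_eq]; simp)+
qed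

end
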